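(* Let $\mathbb{H}=\{(z,w)\in\mathbb{C}^2 : \operatorname{Im}(w)=|z|^2\}$. Every topological type of knot in $\mathbb{H}$ $(\cong\mathbb{R}^3)$ which is either bounded or unbounded of finite count may be assumed precisely as the set of complex tangents to some embedding $\mathbb{H}\hookrightarrow\mathbb{C}^3$; in fact, the embedding can be taken to be a polynomial embedding and the corresponding knot algebraic.
   Context: Complex tangents: for a real $3$-manifold $M$ embedded in $\mathbb{C}^3$, a point $x\in M$ is complex tangent if $T_xM\cap J(T_xM)\ne\{0\}$, where $J$ is multiplication by $i$; equivalently, $T_xM$ contains a complex line. The set of complex tangents of an embedding of $\mathbb{H}$ is regarded as a subset of $\mathbb{H}$. A polynomial embedding of $\mathbb{H}$ is one of the form $(z,w)\mapsto(z,w,f(z,w))$ with $f$ a complex polynomial in $z,\overline z,w,\overline w$. A knot in $\mathbb{H}$ is algebraic if it equals $\{p=0\}\cap\mathbb{H}$ for some complex polynomial $p$ in $z,\overline z,w,\overline w$ (equivalently, it is cut out in $\mathbb{H}$ by two real polynomial equations). $\mathbb{H}$ is identified with $\mathbb{R}^3$ via the diffeomorphism $(z,w)\mapsto(z,\operatorname{Re}w)\in\mathbb{C}\times\mathbb{R}$. Let $S^3=\{|z|^2+|w|^2=1\}\subset\mathbb{C}^2$ and let $\varphi:\mathbb{H}\to S^3\setminus\{(0,1)\}$, $\varphi(z,w)=\left(\frac{2z}{w+i},\frac{w-i}{w+i}\right)$, which plays the role of inverse stereographic projection. Knots in $S^3$ are smooth (at least continuous) simple embeddings of the circle. Two smooth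 (continuous) knots $K_1,K_2\subset S^3$ are of the same topological type if there is a diffeomorphism (homeomorphism) $h:S^3\to S^3$ with $h(K_1)=K_2$. A knot in $\mathbb{H}\cong\mathbb{R}^3$ is bounded if it is a simple closed curve. It is unbounded if it is a curve that does geometrically knot but has two rays to infinity. An unbounded knot $K$ is of finite count if there is $R>0$ such that outside the ball $B_R(0)$ of radius $R$ about the origin the knot consists precisely of two "unknotted" rays going to infinity, i.e. $K\cap(\mathbb{R}^3\setminus B_R(0))$ is topologically equivalent to $\{(0,0,t):t\ge1\}\cup\{(0,0,t):t\le-1\}$. Types in $\mathbb{H}$: for a topological type $\lambda$ of knots in $S^3$, a bounded knot $K\subset\mathbb{H}$ is of bounded type $\lambda$ if $\varphi(K)\subset S^3$ is of type $\lambda$; an unbounded knot $K\subset\mathbb{H}$ is of unbounded type $\lambda$ if $\varphi(K)\cup\{(0,1)\}$ is a (well-defined, continuous) knot in $S^3$ of type $\lambda$.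
   Formalization: Knots in H are taken to be smooth (regularly parametrized) curves, so only types with a smooth representative are covered; for merely continuous (wild) knots the claim fails, since algebraic knots are tame. *)

theory Defs
  imports "HOL-Analysis.Analysis"
begin

section \<open>Smooth maps\<close>

text \<open>
  For open \<open>S\<close>, \<open>Ck k S f\<close> says that \<open>f\<close> is of class $C^k$ on \<open>S\<close>. The recursion runs through
  the directional derivatives, so that the type of \<open>f\<close> is the same in every step.
\<close>

primrec Ck :: "nat \<Rightarrow> 'a::real_normed_vector set \<Rightarrow> ('a \<Rightarrow> 'b::real_normed_vector) \<Rightarrow> bool" where
  "Ck 0 S f \<longleftrightarrow> continuous_on S f"
| "Ck (Suc k) S f \<longleftrightarrow>
     (\<forall>x\<in>S. f differentiable (at x)) \<and> (\<forall>v. Ck k S (\<lambda>x. frechet_derivative f (at x) v))"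

text \<open>Smoothness on an arbitrary subset means having a smooth extension to a neighbourhood.\<close>

definition smooth_map_on ::
  "'a::real_normed_vector set \<Rightarrow> ('a \<Rightarrow> 'b::real_normed_vector) \<Rightarrow> bool" where
  "smooth_map_on A f \<longleftrightarrow>
     (\<exists>U g. open U \<and> A \<subseteq> U \<and> (\<forall>k. Ck k U g) \<and> (\<forall>x\<in>A. g x = f x))"


section \<open>Knots in the 3-sphere and their types\<close>

definition S3 :: "(complex \<times> complex) set" where
  "S3 = {(z, w). (cmod z)\<^sup>2 + (cmod w)\<^sup>2 = 1}"

text \<open>Immersivity on the circle is expressed in the angular coordinate.\<close>

definition smooth_simple_closed_curve :: "(complex \<times> complex) set \<Rightarrow> bool" where
  "smooth_simple_closed_curve K \<longleftrightarrow>
     (\<exists>\<gamma> :: complex \<Rightarrow> complex \<times> complex.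
        smooth_map_on (sphere 0 1) \<gamma> \<and> inj_on \<gamma> (sphere 0 1) \<and>
        (\<forall>t. vector_derivative (\<lambda>s. \<gamma> (cis s)) (at t) \<noteq> 0) \<and>
        K = \<gamma> ` sphere 0 1)"

definition smooth_knot :: "(complex \<times> complex) set \<Rightarrow> bool" where
  "smooth_knot K \<longleftrightarrow> K \<subseteq> S3 \<and> smooth_simple_closed_curve K"

definition continuous_knot :: "(complex \<times> complex) set \<Rightarrow> bool" where
  "continuous_knot K \<longleftrightarrow> K \<subseteq> S3 \<and>
     (\<exists>\<gamma> :: complex \<Rightarrow> complex \<times> complex.
        continuous_on (sphere 0 1) \<gamma> \<and> inj_on \<gamma> (sphere 0 1) \<and> K = \<gamma> ` sphere 0 1)"

definition diffeo_equivalent :: "(complex \<times> complex) set \<Rightarrow> (complex \<times> complex) set \<Rightarrow> bool" where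
  "diffeo_equivalent K\<^sub>1 K\<^sub>2 \<longleftrightarrow>
     (\<exists>h g. homeomorphism S3 S3 h g \<and> smooth_map_on S3 h \<and> smooth_map_on S3 g \<and> h ` K\<^sub>1 = K\<^sub>2)"

definition homeo_equivalent :: "(complex \<times> complex) set \<Rightarrow> (complex \<times> complex) set \<Rightarrow> bool" where
  "homeo_equivalent K\<^sub>1 K\<^sub>2 \<longleftrightarrow> (\<exists>h g. homeomorphism S3 S3 h g \<and> h ` K\<^sub>1 = K\<^sub>2)"

text \<open>
  A topological type is an equivalence class of knots: of smooth knots under diffeomorphisms, or of
  continuous knots under homeomorphisms.
\<close>

definition smooth_knot_type :: "(complex \<times> complex) set set \<Rightarrow> bool" where
  "smooth_knot_type \<tau> \<longleftrightarrow>
     (\<exists>K. smooth_knot K \<and> \<tau> = {K'. smooth_knot K' \<and> diffeo_equivalent K K'})"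

definition continuous_knot_type :: "(complex \<times> complex) set set \<Rightarrow> bool" where
  "continuous_knot_type \<tau> \<longleftrightarrow>
     (\<exists>K. continuous_knot K \<and> \<tau> = {K'. continuous_knot K' \<and> homeo_equivalent K K'})"


section \<open>The Heisenberg group and its knots\<close>

definition heis :: "(complex \<times> complex) set" where
  "heis = {(z, w). Im w = (cmod z)\<^sup>2}"

text \<open>The diffeomorphism onto $\mathbf{C} \times \mathbf{R} = \mathbf{R}^3$ and its inverse.\<close>

definition heis_chart :: "complex \<times> complex \<Rightarrow> complex \<times> real" where
  "heis_chart = (\<lambda>(z, w). (z, Re w))"

definition heis_param :: "complex \<times> real \<Rightarrow> complex \<times> complex" where
  "heis_param = (\<lambda>(z, t). (z, Complex t ((cmod z)\<^sup>2)))"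

lemma homeomorphism_heis_chart: "homeomorphism heis UNIV heis_chart heis_param"
  by (rule homeomorphismI)
     (auto simp: heis_def heis_chart_def heis_param_def case_prod_unfold complex_eq_iff
        Complex_eq intro!: continuous_intros)

definition phi :: "complex \<times> complex \<Rightarrow> complex \<times> complex" where
  "phi = (\<lambda>(z, w). (2 * z / (w + \<i>), (w - \<i>) / (w + \<i>)))"

definition bounded_knot :: "(complex \<times> complex) set \<Rightarrow> bool" where
  "bounded_knot K \<longleftrightarrow> K \<subseteq> heis \<and> smooth_simple_closed_curve K"

definition unbounded_knot :: "(complex \<times> complex) set \<Rightarrow> bool" where
  "unbounded_knot K \<longleftrightarrow> K \<subseteq> heis \<and>
     (\<exists>\<gamma> :: real \<Rightarrow> complex \<times> complex.
        smooth_map_on UNIV \<gamma> \<and> inj \<gamma> \<and> (\<forall>t. vector_derivative \<gamma> (at t) \<noteq> 0) \<and>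
        filterlim \<gamma> at_infinity at_top \<and> filterlim \<gamma> at_infinity at_bot \<and>
        K = range \<gamma>)"

text \<open>
  Outside some ball, the knot is two unknotted rays: the pair formed by the complement of the open
  ball and the part of the knot in it is homeomorphic to the complement of the unit ball with the
  two vertical rays.
\<close>

definition finite_count_knot :: "(complex \<times> complex) set \<Rightarrow> bool" where
  "finite_count_knot K \<longleftrightarrow> unbounded_knot K \<and>
     (\<exists>R>0. \<exists>h g.
        homeomorphism (- ball (0 :: complex \<times> real) R) (- ball (0 :: complex \<times> real) 1) h g \<and>
        h ` (heis_chart ` K - ball 0 R) = {(0, t) | t. t \<ge> 1} \<union> {(0, t) | t. t \<le> -1})"

definition of_bounded_type ::
  "(complex \<times> complex) set set \<Rightarrow> (complex \<times> complex) set \<Rightarrow> bool" where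
  "of_bounded_type \<tau> K \<longleftrightarrow> bounded_knot K \<and> phi ` K \<in> \<tau>"

definition of_unbounded_type ::
  "(complex \<times> complex) set set \<Rightarrow> (complex \<times> complex) set \<Rightarrow> bool" where
  "of_unbounded_type \<tau> K \<longleftrightarrow> unbounded_knot K \<and> phi ` K \<union> {(0, 1)} \<in> \<tau>"

definition complex_polynomial :: "(complex \<times> complex \<Rightarrow> complex) \<Rightarrow> bool" where
  "complex_polynomial p \<longleftrightarrow>
     (\<exists>(c :: nat \<Rightarrow> nat \<Rightarrow> nat \<Rightarrow> nat \<Rightarrow> complex) N. \<forall>z w.
        p (z, w) = (\<Sum>i\<le>N. \<Sum>j\<le>N. \<Sum>k\<le>N. \<Sum>l\<le>N. c i j k l * z ^ i * cnj z ^ j * w ^ k * cnj w ^ l))"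

definition algebraic_in_heis :: "(complex \<times> complex) set \<Rightarrow> bool" where
  "algebraic_in_heis K \<longleftrightarrow> (\<exists>p. complex_polynomial p \<and> K = {x. p x = 0} \<inter> heis)"


section \<open>Embeddings of the Heisenberg group and complex tangents\<close>

text \<open>
  A smooth embedding: a smooth immersion (in the global coordinates) that is a homeomorphism onto
  its image. Only the values of \<open>F\<close> on \<^const>\<open>heis\<close> are relevant.
\<close>

definition heis_embedding :: "(complex \<times> complex \<Rightarrow> complex \<times> complex \<times> complex) \<Rightarrow> bool" where
  "heis_embedding F \<longleftrightarrow>
     smooth_map_on UNIV (F \<circ> heis_param) \<and>
     (\<forall>a. inj (frechet_derivative (F \<circ> heis_param) (at a))) \<and>
     (\<exists>G. homeomorphism heis (F ` heis) F G)"

definition polynomial_embedding :: "(complex \<times> complex \<Rightarrow> complex \<times> complex \<times> complex) \<Rightarrow> bool" where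
  "polynomial_embedding F \<longleftrightarrow> heis_embedding F \<and>
     (\<exists>f. complex_polynomial f \<and> (\<forall>(z, w)\<in>heis. F (z, w) = (z, w, f (z, w))))"

text \<open>
  The velocities at \<open>y\<close> of curves in \<open>M\<close>; for an embedded submanifold \<open>M\<close> and \<open>y \<in> M\<close> this is the
  usual tangent space.
\<close>

definition tangent_space :: "'a::real_normed_vector set \<Rightarrow> 'a \<Rightarrow> 'a set" where
  "tangent_space M y =
     {v. \<exists>\<gamma>. (\<forall>t. \<gamma> t \<in> M) \<and> \<gamma> 0 = y \<and> (\<gamma> has_vector_derivative v) (at 0)}"

definition mult_i :: "complex \<times> complex \<times> complex \<Rightarrow> complex \<times> complex \<times> complex" where
  "mult_i = (\<lambda>(a, b, c). (\<i> * a, \<i> * b, \<i> * c))"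

definition complex_tangents ::
  "(complex \<times> complex \<Rightarrow> complex \<times> complex \<times> complex) \<Rightarrow> (complex \<times> complex) set" where
  "complex_tangents F =
     {x \<in> heis. tangent_space (F ` heis) (F x) \<inter> mult_i ` tangent_space (F ` heis) (F x) \<noteq> {0}}"

end

theory Submission
  imports
    Defs
    "Jordan_Normal_Form.Determinant"
    "HOL-Computational_Algebra.Fundamental_Theorem_Algebra"
begin

text \<open>
  The graph of \<open>f\<close> over \<^const>\<open>heis\<close> has a complex tangent exactly where the tangential
  Cauchy--Riemann derivative of \<open>f\<close> vanishes, and every polynomial on \<^const>\<open>heis\<close> is such a
  derivative. So it suffices to make the knot algebraic. In the chart, approximate the knot in $C^1$
  by a curve with trigonometric coordinates \<open>Re (q\<^sub>j u)\<close>, \<open>|u| = 1\<close>. Eliminating \<open>u\<close> from the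
  equations \<open>x\<^sub>j = (q\<^sub>j u + cnj (q\<^sub>j (1 / cnj u))) / 2\<close> gives a polynomial; its real zeros are the
  curve together with the values taken at \<open>|u| \<noteq> 1\<close> that happen to be real, and these disappear
  under a generic small perturbation of the \<open>q\<^sub>j\<close>. A curve that is $C^1$-close to a knot is the
  image of the knot under an ambient diffeomorphism near the identity.

  An unbounded knot of finite count is first moved by a homeomorphism of space to a $C^1$ curve that
  equals \<open>(0, t)\<close> for large \<open>|t|\<close>. Adding \<open>tan (\<theta> / 2)\<close> to the third trigonometric coordinate gives
  an algebraic curve close to this one; the difference extends to a Lipschitz map with small
  constant, and the identity plus this map is the required homeomorphism.
\<close>

section \<open>Maps of class $C^k$\<close>

text \<open>The perturbation adds multiples of one power u^d with d above all degrees. Its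
  coefficient fixes the degree of the first polynomial in the elimination, so that a resultant
  cannot vanish through a drop of degree, and it keeps u = 0 from being a solution.

  The two cases need different regularity. A bounded type may be a smooth type, so the ambient map
  has to be a diffeomorphism; it is the identity far out and therefore extends smoothly over the
  pole of the sphere. It is built from three shears, one for each coordinate, and the bound on their
  derivatives must be settled before the approximating curve is known.

  For unbounded knots the homeomorphism supplied by finite count has no smoothness at all.
  Straightening the ends with it leaves corners where the arc leaves the ball, and these obstruct
  C^1 approximation. Each ray is therefore bent into the tangent of the arc by a shear with a square
  root profile: a homeomorphism that is not Lipschitz, yet produces a C^1 curve after
  reparametrization. Smallness is then measured against a lower bound for the distance of two points
  of the curve in terms of their parameters.\<close>

lemma Ck_cong:
  assumes "open S" "\<And>x. x \<in> S \<Longrightarrow> f x = g x"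
  shows "Ck k S f \<longleftrightarrow> Ck k S g"
  using assms(2)
proof (induction k arbitrary: f g)
  case 0
  then show ?case by (simp cong: continuous_on_cong)
next
  case (Suc k)
  have ev: "eventually (\<lambda>y. f y = g y) (nhds x)" if "x \<in> S" for x
    using Suc.prems assms(1) that eventually_nhds by blast
  have d: "(f has_derivative f') (at x) \<longleftrightarrow> (g has_derivative f') (at x)" if "x \<in> S" for x f'
  proof -
    have "f x = g x" using Suc.prems that by blast
    moreover have "eventually (\<lambda>y. f y = g y) (at x)"
      using ev[OF that] eventually_nhds_conv_at by blast
    ultimately show ?thesis
      by (metis (mono_tags, lifting) eventually_mono has_derivative_transform_eventually UNIV_I)
  qed
  have fd: "frechet_derivative f (at x) = frechet_derivative g (at x)" if "x \<in> S" for x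
    unfolding frechet_derivative_def using d[OF that] by simp
  have df: "f differentiable (at x) \<longleftrightarrow> g differentiable (at x)" if "x \<in> S" for x
    unfolding differentiable_def using d[OF that] by simp
  show ?case
    using Suc.IH[of "\<lambda>x. frechet_derivative f (at x) v" "\<lambda>x. frechet_derivative g (at x) v" for v]
      fd df by simp
qed

lemma Ck_continuous_on: "Ck k S f \<Longrightarrow> continuous_on S f"
proof (cases k)
  case (Suc n)
  assume "Ck k S f"
  then have "\<forall>x\<in>S. continuous (at x) f"
    using Suc differentiable_imp_continuous_within by auto
  then show ?thesis by (simp add: continuous_at_imp_continuous_on)
qed simp

lemma Ck_Suc_imp: "Ck (Suc k) S f \<Longrightarrow> Ck k S f"
proof (induction k arbitrary: f)
  case 0
  then show ?case using Ck_continuous_on by (simp del: Ck.simps(2)) blast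
next
  case (Suc k)
  then show ?case by (metis Ck.simps(2))
qed

lemma Ck_subset: "Ck k S f \<Longrightarrow> T \<subseteq> S \<Longrightarrow> Ck k T f"
  by (induction k arbitrary: f) (auto intro: continuous_on_subset)

lemma Ck_local:
  assumes "\<And>x. x \<in> S \<Longrightarrow> \<exists>U. open U \<and> x \<in> U \<and> Ck k U f"
  shows "Ck k S f"
  using assms
proof (induction k arbitrary: f)
  case 0
  have "continuous (at x) f" if "x \<in> S" for x
    using 0[OF that] continuous_on_eq_continuous_at by fastforce
  then show ?case by (simp add: continuous_at_imp_continuous_on)
next
  case (Suc k)
  show ?case
    unfolding Ck.simps
  proof (intro conjI ballI allI)
    fix x assume "x \<in> S"
    then show "f differentiable (at x)" using Suc.prems[of x] by auto
  next
    fix v show "Ck k S (\<lambda>x. frechet_derivative f (at x) v)"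
    proof (rule Suc.IH)
      fix x assume "x \<in> S"
      then show "\<exists>U. open U \<and> x \<in> U \<and> Ck k U (\<lambda>x. frechet_derivative f (at x) v)"
        using Suc.prems[of x] by auto
    qed
  qed
qed

lemma Ck_SucI:
  assumes "open S" "\<And>x. x \<in> S \<Longrightarrow> (f has_derivative f' x) (at x)" "\<And>v. Ck k S (\<lambda>x. f' x v)"
  shows "Ck (Suc k) S f"
proof -
  have "frechet_derivative f (at x) = f' x" if "x \<in> S" for x
    using assms(2)[OF that] frechet_derivative_at by metis
  then have "Ck k S (\<lambda>x. frechet_derivative f (at x) v) = Ck k S (\<lambda>x. f' x v)" for v
    by (intro Ck_cong[OF assms(1)]) simp
  with assms show ?thesis by (auto simp: differentiable_def)
qed

lemma Ck_SucD:
  assumes "Ck (Suc k) S f" "x \<in> S"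
  shows "(f has_derivative frechet_derivative f (at x)) (at x)"
  using assms frechet_derivative_works by auto

lemma Ck_const: "Ck k S (\<lambda>x. c)"
proof (induction k arbitrary: c)
  case (Suc k)
  then show ?case
    using frechet_derivative_const[of c] by (simp add: )
qed simp

lemma Ck_bounded_linear: "bounded_linear f \<Longrightarrow> Ck k S f"
proof (induction k)
  case 0
  then show ?case by (simp add: linear_continuous_on)
next
  case (Suc k)
  have "frechet_derivative f (at x) = f" for x
    using Suc.prems bounded_linear_imp_has_derivative frechet_derivative_at by metis
  with Suc show ?case
    by (auto simp: Ck_const intro: bounded_linear_imp_differentiable)
qed

lemma Ck_add:
  assumes "open S" "Ck k S f" "Ck k S g"
  shows "Ck k S (\<lambda>x. f x + g x)"
  using assms(2,3)
proof (induction k arbitrary: f g)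
  case 0
  then show ?case by (simp add: continuous_on_add)
next
  case (Suc k)
  show ?case
  proof (rule Ck_SucI[OF assms(1)])
    fix x assume "x \<in> S"
    then show "((\<lambda>x. f x + g x) has_derivative
        (\<lambda>v. frechet_derivative f (at x) v + frechet_derivative g (at x) v)) (at x)"
      by (intro has_derivative_add Ck_SucD[OF Suc.prems(1)] Ck_SucD[OF Suc.prems(2)])
  next
    fix v show "Ck k S (\<lambda>x. frechet_derivative f (at x) v + frechet_derivative g (at x) v)"
      using Suc by (intro Suc.IH) auto
  qed
qed

lemma Ck_linear_compose:
  assumes "open S" "bounded_linear L" "Ck k S f"
  shows "Ck k S (\<lambda>x. L (f x))"
  using assms(3)
proof (induction k arbitrary: f)
  case 0
  then show ?case using assms(2) by (simp add: bounded_linear.continuous_on)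
next
  case (Suc k)
  show ?case
  proof (rule Ck_SucI[OF assms(1)])
    fix x assume "x \<in> S"
    then show "((\<lambda>x. L (f x)) has_derivative (\<lambda>v. L (frechet_derivative f (at x) v))) (at x)"
      by (intro bounded_linear.has_derivative[OF assms(2)] Ck_SucD[OF Suc.prems(1)])
  next
    fix v show "Ck k S (\<lambda>x. L (frechet_derivative f (at x) v))"
      using Suc by (intro Suc.IH) auto
  qed
qed

text \<open>The derivative is again a sum of two products of the same kind, so the induction closes
  when it runs over all pairs of factors; multiplication, scaling and the inner product are
  instances.\<close>

lemma (in bounded_bilinear) Ck_bilinear:
  assumes "open S" "Ck k S f" "Ck k S g"
  shows "Ck k S (\<lambda>x. prod (f x) (g x))"
  using assms(2,3)
proof (induction k arbitrary: f g)
  case 0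
  then show ?case by (simp add: continuous_on)
next
  case (Suc k)
  show ?case
  proof (rule Ck_SucI[OF assms(1)])
    fix x assume "x \<in> S"
    then show "((\<lambda>x. prod (f x) (g x)) has_derivative
        (\<lambda>v. prod (f x) (frechet_derivative g (at x) v) + prod (frechet_derivative f (at x) v) (g x))) (at x)"
      by (intro FDERIV Ck_SucD[OF Suc.prems(1)] Ck_SucD[OF Suc.prems(2)])
  next
    fix v
    show "Ck k S (\<lambda>x. prod (f x) (frechet_derivative g (at x) v) + prod (frechet_derivative f (at x) v) (g x))"
      using Suc by (intro Ck_add[OF assms(1)] Suc.IH) (auto intro: Ck_Suc_imp)
  qed
qed

lemmas Ck_mult = bounded_bilinear.Ck_bilinear[OF bounded_bilinear_mult]
lemmas Ck_scaleR = bounded_bilinear.Ck_bilinear[OF bounded_bilinear_scaleR]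
lemmas Ck_inner = bounded_bilinear.Ck_bilinear[OF bounded_bilinear_inner]

lemma Ck_minus: "open S \<Longrightarrow> Ck k S f \<Longrightarrow> Ck k S (\<lambda>x. - f x)"
  by (rule Ck_linear_compose) (auto intro: bounded_linear_minus[OF bounded_linear_ident])

lemma Ck_diff: "open S \<Longrightarrow> Ck k S f \<Longrightarrow> Ck k S g \<Longrightarrow> Ck k S (\<lambda>x. f x - g x)"
  using Ck_add[of S k f "\<lambda>x. - g x"] Ck_minus[of S k g] by simp

lemma Ck_id: "Ck k S (\<lambda>x. x)"
  by (rule Ck_bounded_linear) (rule bounded_linear_ident)

lemma Ck_sum:
  assumes "open S" "\<And>i. i \<in> I \<Longrightarrow> Ck k S (f i)"
  shows "Ck k S (\<lambda>x. \<Sum>i\<in>I. f i x)"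
  using assms(2) by (induction I rule: infinite_finite_induct) (auto intro: Ck_const Ck_add[OF assms(1)])

lemma Ck_prod:
  fixes f :: "'i \<Rightarrow> 'a::real_normed_vector \<Rightarrow> 'b::{real_normed_algebra,comm_ring_1}"
  assumes "open S" "\<And>i. i \<in> I \<Longrightarrow> Ck k S (f i)"
  shows "Ck k S (\<lambda>x. \<Prod>i\<in>I. f i x)"
  using assms(2) by (induction I rule: infinite_finite_induct) (auto intro: Ck_const Ck_mult[OF assms(1)])

lemma Ck_power:
  fixes f :: "'a::real_normed_vector \<Rightarrow> 'b::real_normed_algebra_1"
  assumes "open S" "Ck k S f"
  shows "Ck k S (\<lambda>x. f x ^ n)"
  using assms by (induction n) (auto intro: Ck_const Ck_mult)

lemma Ck_Pair:
  assumes "open S" "Ck k S f" "Ck k S g"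
  shows "Ck k S (\<lambda>x. (f x, g x))"
proof -
  have "Ck k S (\<lambda>x. (f x, 0) + (0, g x))"
    using assms
    by (intro Ck_add Ck_linear_compose[of S "\<lambda>y. (y, 0)"] Ck_linear_compose[of S "\<lambda>y. (0, y)"])
      (auto intro!: bounded_linear_intros)
  then show ?thesis by simp
qed

lemma Ck_fst: "open S \<Longrightarrow> Ck k S f \<Longrightarrow> Ck k S (\<lambda>x. fst (f x))"
  by (rule Ck_linear_compose) (auto intro: bounded_linear_fst)

lemma Ck_snd: "open S \<Longrightarrow> Ck k S f \<Longrightarrow> Ck k S (\<lambda>x. snd (f x))"
  by (rule Ck_linear_compose) (auto intro: bounded_linear_snd)

lemma Ck_cnj: "open S \<Longrightarrow> Ck k S f \<Longrightarrow> Ck k S (\<lambda>x. cnj (f x))"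
  by (rule Ck_linear_compose) (auto intro: bounded_linear_cnj)

lemma Ck_Re: "open S \<Longrightarrow> Ck k S f \<Longrightarrow> Ck k S (\<lambda>x. Re (f x))"
  by (rule Ck_linear_compose) (auto intro: bounded_linear_Re)

lemma Ck_Im: "open S \<Longrightarrow> Ck k S f \<Longrightarrow> Ck k S (\<lambda>x. Im (f x))"
  by (rule Ck_linear_compose) (auto intro: bounded_linear_Im)

lemma Ck_of_real:
  "open S \<Longrightarrow> Ck k S f \<Longrightarrow> Ck k S (\<lambda>x. of_real (f x) :: 'b::{real_normed_algebra_1})"
  by (rule Ck_linear_compose) (auto intro: bounded_linear_of_real)

lemma Ck_Complex:
  assumes "open S" "Ck k S f" "Ck k S g"
  shows "Ck k S (\<lambda>x. Complex (f x) (g x))"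
  unfolding Complex_eq using assms by (intro Ck_add Ck_mult Ck_of_real Ck_const)

text \<open>By the chain rule the derivative of \<open>g\<close> is taken in a direction that moves
  with \<open>x\<close>, whereas the recursion of \<open>Ck\<close> only treats fixed directions.
  Expanding the moving direction in \<open>Basis\<close> reduces it to finitely many fixed ones;
  this is why the intermediate space is Euclidean.\<close>

lemma Ck_compose:
  fixes f :: "'a::real_normed_vector \<Rightarrow> 'b::euclidean_space"
  assumes "open S" "open T" "Ck k S f" "Ck k T g" "f ` S \<subseteq> T"
  shows "Ck k S (\<lambda>x. g (f x))"
  using assms(3-5)
proof (induction k arbitrary: f g)
  case 0
  then show ?case by (auto intro: continuous_on_compose2)
next
  case (Suc k)
  let ?D = "\<lambda>x. frechet_derivative g (at (f x))" and ?d = "\<lambda>x. frechet_derivative f (at x)"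
  have lin: "linear (?D x)" if "x \<in> S" for x
    using Ck_SucD[OF Suc.prems(2), of "f x"] Suc.prems(3) that has_derivative_linear by blast
  have eq: "?D x (?d x v) = (\<Sum>b\<in>Basis. (inner (?d x v) b) *\<^sub>R ?D x b)" if "x \<in> S" for x v
  proof -
    have "?D x (?d x v) = ?D x (\<Sum>b\<in>Basis. (inner (?d x v) b) *\<^sub>R b)"
      by (simp add: euclidean_representation)
    then show ?thesis
      by (simp add: linear_sum[OF lin[OF that]] linear_scale[OF lin[OF that]])
  qed
  show ?case
  proof (rule Ck_SucI[OF assms(1)])
    fix x assume x: "x \<in> S"
    then have "f x \<in> T" using Suc.prems(3) by blast
    then show "((\<lambda>x. g (f x)) has_derivative (\<lambda>v. \<Sum>b\<in>Basis. (inner (?d x v) b) *\<^sub>R ?D x b)) (at x)"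
      using diff_chain_at[OF Ck_SucD[OF Suc.prems(1) x] Ck_SucD[OF Suc.prems(2)]] eq[OF x]
      by (simp add: o_def)
  next
    fix v
    show "Ck k S (\<lambda>x. \<Sum>b\<in>Basis. (inner (?d x v) b) *\<^sub>R ?D x b)"
    proof (intro Ck_sum Ck_scaleR Ck_inner Ck_const assms(1))
      fix b :: 'b
      show "Ck k S (\<lambda>x. ?d x v)" using Suc.prems by simp
      show "Ck k S (\<lambda>x. ?D x b)"
        using Suc.prems(2,3) Ck_Suc_imp[OF Suc.prems(1)] by (intro Suc.IH) auto
    qed
  qed
qed

lemma Ck_inverse:
  fixes f :: "'a::real_normed_vector \<Rightarrow> 'b::real_normed_field"
  assumes "open S" "Ck k S f" "\<And>x. x \<in> S \<Longrightarrow> f x \<noteq> 0"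
  shows "Ck k S (\<lambda>x. inverse (f x))"
  using assms(2,3)
proof (induction k)
  case 0
  then show ?case by (simp add: continuous_on_inverse)
next
  case (Suc k)
  show ?case
  proof (rule Ck_SucI[OF assms(1)])
    fix x assume "x \<in> S"
    then show "((\<lambda>x. inverse (f x)) has_derivative
       (\<lambda>v. - (inverse (f x) * frechet_derivative f (at x) v * inverse (f x)))) (at x)"
      by (intro Deriv.has_derivative_inverse Ck_SucD[OF Suc.prems(1)] Suc.prems(2))
  next
    fix v
    have "Ck k S (\<lambda>x. inverse (f x))" using Suc Ck_Suc_imp by blast
    then show "Ck k S (\<lambda>x. - (inverse (f x) * frechet_derivative f (at x) v * inverse (f x)))"
      using Suc.prems by (intro Ck_minus Ck_mult assms(1)) auto
  qed
qed

lemma Ck_divide: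
  fixes f g :: "'a::real_normed_vector \<Rightarrow> 'b::real_normed_field"
  assumes "open S" "Ck k S f" "Ck k S g" "\<And>x. x \<in> S \<Longrightarrow> g x \<noteq> 0"
  shows "Ck k S (\<lambda>x. f x / g x)"
  using Ck_mult[OF assms(1,2) Ck_inverse[OF assms(1,3,4)]] by (simp add: divide_inverse)

lemma Ck_real_SucI:
  fixes f :: "real \<Rightarrow> 'b::real_normed_vector"
  assumes "open S" "\<And>x. x \<in> S \<Longrightarrow> (f has_vector_derivative f' x) (at x)" "Ck k S f'"
  shows "Ck (Suc k) S f"
  by (rule Ck_SucI[OF assms(1), where f' = "\<lambda>x v. v *\<^sub>R f' x"])
    (use assms in \<open>auto simp: has_vector_derivative_def intro: Ck_scaleR Ck_const\<close>)

lemma Ck_vector_derivative: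
  fixes f :: "real \<Rightarrow> 'b::real_normed_vector"
  assumes "open S" "Ck (Suc k) S f"
  shows "Ck k S (\<lambda>t. vector_derivative f (at t))"
    and "t \<in> S \<Longrightarrow> (f has_vector_derivative vector_derivative f (at t)) (at t)"
proof -
  have d: "f differentiable (at t)" if "t \<in> S" for t using assms(2) that by simp
  then show "t \<in> S \<Longrightarrow> (f has_vector_derivative vector_derivative f (at t)) (at t)"
    using vector_derivative_works by blast
  have "vector_derivative f (at t) = frechet_derivative f (at t) 1" if "t \<in> S" for t
    using d[OF that] frechet_derivative_eq_vector_derivative[of f t] by simp
  then show "Ck k S (\<lambda>t. vector_derivative f (at t))"
    using assms Ck_cong[OF assms(1), of "\<lambda>t. vector_derivative f (at t)" "\<lambda>t. frechet_derivative f (at t) 1"]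
    by simp
qed

lemma Ck_cis: "Ck k S cis"
proof -
  have "Ck k UNIV cis \<and> Ck k UNIV (\<lambda>t. \<i> * cis t)"
  proof (induction k)
    case 0
    then show ?case by (auto intro!: continuous_intros)
  next
    case (Suc k)
    have "Ck (Suc k) UNIV cis"
      by (rule Ck_real_SucI[OF _ _ Suc[THEN conjunct2]])
        (auto intro!: derivative_eq_intros simp: has_vector_derivative_def)
    then show ?case by (auto intro: Ck_mult Ck_const simp del: Ck.simps)
  qed
  then show ?thesis using Ck_subset by blast
qed

lemma Ck_sqrt:
  assumes "\<And>x. x \<in> S \<Longrightarrow> x > 0"
  shows "Ck k S sqrt"
proof -
  have "Ck k {0<..} sqrt"
  proof (induction k)
    case 0
    then show ?case by (auto intro!: continuous_intros)
  next
    case (Suc k)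
    have "Ck k {0<..} (\<lambda>x. inverse (2 * sqrt x))"
      by (intro Ck_inverse Ck_mult Ck_const Suc) auto
    then show ?case
      by (rule Ck_real_SucI[rotated 2])
        (auto intro!: derivative_eq_intros simp: has_real_derivative_iff_has_vector_derivative[symmetric] divide_simps)
  qed
  then show ?thesis using Ck_subset assms by (metis greaterThan_iff subsetI)
qed

section \<open>Flat functions and smooth cutoffs\<close>

text \<open>The factor \<open>x\<close> raised to \<open>-n\<close> makes the family closed under differentiation.\<close>

lemma flat_family_derivative:
  "((\<lambda>x::real. if x > 0 then exp (- inverse x) * inverse x ^ n else 0) has_real_derivative
    (if x > 0 then exp (- inverse x) * inverse x ^ (n+2) else 0)
      - n * (if x > 0 then exp (- inverse x) * inverse x ^ (n+1) else 0)) (at x)"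
  (is "(?f n has_real_derivative _) _")
proof -
  consider "x > 0" | "x < 0" | "x = 0" by linarith
  then show ?thesis
  proof cases
    case 1
    have e: "((\<lambda>y::real. exp (- y) * y ^ n) has_real_derivative
        exp (- y) * (n * y ^ (n - 1)) - exp (- y) * y ^ n) (at y)" for y :: real
      by (auto intro!: derivative_eq_intros)
    have "((\<lambda>x::real. exp (- inverse x) * inverse x ^ n) has_real_derivative
      (exp (- inverse x) * (n * inverse x ^ (n - 1)) - exp (- inverse x) * inverse x ^ n)
        * - (inverse x * inverse x)) (at x)"
      using DERIV_chain2[OF e DERIV_inverse] 1 by (simp add: power2_eq_square)
    also have "(exp (- inverse x) * (n * inverse x ^ (n - 1)) - exp (- inverse x) * inverse x ^ n)
        * - (inverse x * inverse x) =
        exp (- inverse x) * inverse x ^ (n+2) - n * (exp (- inverse x) * inverse x ^ (n+1))"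
      by (cases n) (simp_all add: algebra_simps)
    finally have "(?f n has_real_derivative
        exp (- inverse x) * inverse x ^ (n+2) - n * (exp (- inverse x) * inverse x ^ (n+1))) (at x)"
      by (rule has_field_derivative_transform_within[where d = x])
        (use 1 in \<open>auto simp: dist_real_def\<close>)
    then show ?thesis using 1 by simp
  next
    case 2
    have "(?f n has_real_derivative 0) (at x)"
      by (rule has_field_derivative_transform_within[where d = "-x" and f = "\<lambda>_. 0"])
        (use 2 in \<open>auto simp: dist_real_def\<close>)
    then show ?thesis using 2 by simp
  next
    case 3
    \<comment> \<open>At 0 the substitution t = 1/x turns the right difference quotient into t^(n+1)
      exp(-t) at infinity; the left one is identically 0.\<close>
    have lim: "((\<lambda>t::real. t ^ (n+1) * exp (-t)) \<longlongrightarrow> 0) at_top"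
      using tendsto_power_div_exp_0[of "n+1"] by (simp add: exp_minus field_simps)
    have r: "((\<lambda>x. inverse x ^ (n+1) * exp (- inverse x)) \<longlongrightarrow> 0) (at_right (0::real))"
      using filterlim_compose[OF lim filterlim_inverse_at_top_right] by simp
    have "((\<lambda>y. (?f n y - ?f n 0) / (y - 0)) \<longlongrightarrow> 0) (at 0)"
      unfolding filterlim_split_at
    proof (intro filterlim_split_at)
      show "((\<lambda>y. (?f n y - ?f n 0) / (y - 0)) \<longlongrightarrow> 0) (at_right 0)"
        by (rule Lim_transform_eventually[OF r])
          (auto simp: eventually_at_right_field field_simps intro!: exI[of _ 1])
      show "((\<lambda>y. (?f n y - ?f n 0) / (y - 0)) \<longlongrightarrow> 0) (at_left 0)"
        by (rule Lim_transform_eventually[OF tendsto_const])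
          (auto simp: eventually_at_left_field intro!: exI[of _ "-1"])
    qed
    then show ?thesis using 3 by (simp add: has_field_derivative_iff)
  qed
qed

lemma Ck_flat: "Ck k S (\<lambda>x::real. if x > 0 then exp (- inverse x) else 0)"
proof -
  let ?f = "\<lambda>n x::real. if x > 0 then exp (- inverse x) * inverse x ^ n else 0"
  have "Ck k UNIV (?f n)" for n
  proof (induction k arbitrary: n)
    case 0
    then show ?case
      using flat_family_derivative[of n]
      by (auto intro!: continuous_at_imp_continuous_on DERIV_isCont simp del: inverse_eq_divide)
  next
    case (Suc k)
    have "Ck k UNIV (\<lambda>x. ?f (n+2) x - n * ?f (n+1) x)"
      by (intro Ck_diff Ck_mult Ck_const Suc) auto
    then show ?case
      using flat_family_derivative[of n]
      by (intro Ck_real_SucI[of UNIV "?f n" "\<lambda>x. ?f (n+2) x - n * ?f (n+1) x"])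
        (auto simp: has_real_derivative_iff_has_vector_derivative[symmetric])
  qed
  from Ck_subset[OF this[of 0], of S] show ?thesis
    by (simp del: Ck.simps inverse_eq_divide cong: if_cong)
qed

text \<open>The flat function f gives f(b - x) / (f(b - x) + f(x - a)). Because a < b, one of the
  two arguments is always positive, so the denominator never vanishes.\<close>

lemma smooth_step:
  fixes a b :: real
  assumes "a < b"
  shows "\<exists>s::real\<Rightarrow>real. (\<forall>k. Ck k UNIV s) \<and> (\<forall>x. 0 \<le> s x \<and> s x \<le> 1) \<and>
     (\<forall>x\<le>a. s x = 1) \<and> (\<forall>x\<ge>b. s x = 0)"
proof -
  define f where "f = (\<lambda>x::real. if x > 0 then exp (- inverse x) else 0)"
  have f: "Ck k UNIV f" for k unfolding f_def by (rule Ck_flat)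
  have f0: "f x = 0" if "x \<le> 0" for x using that by (simp add: f_def)
  have f1: "f x > 0" if "x > 0" for x using that by (simp add: f_def)
  have f2: "f x \<ge> 0" for x using f0[of x] f1[of x] by linarith
  have pos: "f (b - x) + f (x - a) > 0" for x
    using assms f1[of "b - x"] f1[of "x - a"] f2[of "b - x"] f2[of "x - a"] by linarith
  define s where "s = (\<lambda>x. f (b - x) / (f (b - x) + f (x - a)))"
  have c: "Ck k UNIV (\<lambda>x. f (b - x))" "Ck k UNIV (\<lambda>x. f (x - a))" for k
    by (rule Ck_compose[where g = f and T = UNIV, OF open_UNIV open_UNIV _ f];
        intro Ck_diff Ck_const Ck_id open_UNIV subset_UNIV)+
  have "Ck k UNIV s" for k
    unfolding s_def
    by (rule Ck_divide[OF open_UNIV c(1) Ck_add[OF open_UNIV c]]) (metis pos less_irrefl)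
  moreover have "0 \<le> s x \<and> s x \<le> 1" for x
    using pos[of x] f2[of "b - x"] f2[of "x - a"] by (simp add: s_def divide_le_eq_1)
  moreover have "s x = 1" if "x \<le> a" for x
    using that assms f0[of "x - a"] f1[of "b - x"] by (simp add: s_def)
  moreover have "s x = 0" if "x \<ge> b" for x
    using that f0[of "b - x"] by (simp add: s_def)
  ultimately show ?thesis by blast
qed

text \<open>The step function is applied to the squared distance, which is smooth also at the
  centre.\<close>

lemma smooth_ball_bump:
  fixes c :: "'a::euclidean_space"
  assumes "r > 0"
  shows "\<exists>b::'a\<Rightarrow>real. (\<forall>k. Ck k UNIV b) \<and> (\<forall>x. 0 \<le> b x \<and> b x \<le> 1) \<and>
     (\<forall>x\<in>cball c r. b x = 1) \<and> (\<forall>x. x \<notin> ball c (2*r) \<longrightarrow> b x = 0)"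
proof -
  obtain s :: "real \<Rightarrow> real" where s: "\<And>k. Ck k UNIV s" "\<And>x. 0 \<le> s x \<and> s x \<le> 1"
    "\<And>x. x \<le> r^2 \<Longrightarrow> s x = 1" "\<And>x. x \<ge> (2*r)^2 \<Longrightarrow> s x = 0"
    using smooth_step[of "r^2" "(2*r)^2"] assms by (auto simp: power_mult_distrib)
  define b where "b = (\<lambda>x. s (inner (x - c) (x - c)))"
  have "Ck k UNIV b" for k
    unfolding b_def
    by (rule Ck_compose[where g = s and T = UNIV, OF open_UNIV open_UNIV _ s(1)];
        intro Ck_inner Ck_diff Ck_const Ck_id open_UNIV subset_UNIV)
  moreover have "b x = 1" if "x \<in> cball c r" for x
  proof -
    have "norm (x - c) \<le> r" using that by (simp add: dist_norm norm_minus_commute)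
    then have "(norm (x - c))\<^sup>2 \<le> r\<^sup>2" by (intro power_mono) auto
    then show ?thesis unfolding b_def by (intro s(3)) (simp add: power2_norm_eq_inner)
  qed
  moreover have "b x = 0" if "x \<notin> ball c (2*r)" for x
  proof -
    have "2 * r \<le> norm (x - c)" using that by (simp add: dist_norm norm_minus_commute)
    then have "(2*r)\<^sup>2 \<le> (norm (x - c))\<^sup>2" using assms by (intro power_mono) auto
    then show ?thesis unfolding b_def by (intro s(4)) (simp add: power2_norm_eq_inner)
  qed
  ultimately show ?thesis using s(2) by (intro exI[of _ b]) (auto simp: b_def)
qed

section \<open>Polynomials and complex tangents\<close>

text \<open>Rule induction gives closure under products and conjugation, which is awkward for a
  fourfold sum. Multiplication by one variable is the primitive operation because on monomials it is
  a mere shift of exponents.\<close>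

inductive cpoly :: "(complex \<times> complex \<Rightarrow> complex) \<Rightarrow> bool" where
  const: "cpoly (\<lambda>x. c)"
| add: "cpoly p \<Longrightarrow> cpoly q \<Longrightarrow> cpoly (\<lambda>x. p x + q x)"
| mul_z: "cpoly p \<Longrightarrow> cpoly (\<lambda>x. fst x * p x)"
| mul_z_cnj: "cpoly p \<Longrightarrow> cpoly (\<lambda>x. cnj (fst x) * p x)"
| mul_w: "cpoly p \<Longrightarrow> cpoly (\<lambda>x. snd x * p x)"
| mul_w_cnj: "cpoly p \<Longrightarrow> cpoly (\<lambda>x. cnj (snd x) * p x)"

lemma cpoly_smult: "cpoly p \<Longrightarrow> cpoly (\<lambda>x. c * p x)"
  by (induction rule: cpoly.induct)
    (auto simp: distrib_left mult.left_commute[of c] intro: cpoly.intros)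

lemma cpoly_mult: "cpoly p \<Longrightarrow> cpoly q \<Longrightarrow> cpoly (\<lambda>x. p x * q x)"
  by (induction rule: cpoly.induct)
    (auto simp: distrib_right mult.assoc intro: cpoly.intros cpoly_smult)

lemma cpoly_minus: "cpoly p \<Longrightarrow> cpoly q \<Longrightarrow> cpoly (\<lambda>x. p x - q x)"
  using cpoly.add[of p "\<lambda>x. -1 * q x"] cpoly_smult[of q "-1"] by simp

lemma cpoly_power: "cpoly p \<Longrightarrow> cpoly (\<lambda>x. p x ^ n)"
  by (induction n) (auto intro: cpoly.const cpoly_mult)

lemma cpoly_sum: "(\<And>i. i \<in> I \<Longrightarrow> cpoly (p i)) \<Longrightarrow> cpoly (\<lambda>x. \<Sum>i\<in>I. p i x)"
  by (induction I rule: infinite_finite_induct) (auto intro: cpoly.const cpoly.add)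

lemma cpoly_prod: "(\<And>i. i \<in> I \<Longrightarrow> cpoly (p i)) \<Longrightarrow> cpoly (\<lambda>x. \<Prod>i\<in>I. p i x)"
  by (induction I rule: infinite_finite_induct) (auto intro: cpoly.const cpoly_mult)

lemma cpoly_vars: "cpoly fst" "cpoly (\<lambda>x. cnj (fst x))" "cpoly snd" "cpoly (\<lambda>x. cnj (snd x))"
  using cpoly.mul_z[OF cpoly.const[of 1]] cpoly.mul_z_cnj[OF cpoly.const[of 1]]
    cpoly.mul_w[OF cpoly.const[of 1]] cpoly.mul_w_cnj[OF cpoly.const[of 1]] by simp_all

lemma cpoly_cnj: "cpoly p \<Longrightarrow> cpoly (\<lambda>x. cnj (p x))"
  by (induction rule: cpoly.induct) (auto intro: cpoly.intros)

lemma cpoly_Re: "cpoly p \<Longrightarrow> cpoly (\<lambda>x. of_real (Re (p x)))"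
proof -
  assume p: "cpoly p"
  have "cpoly (\<lambda>x. (1/2) * (p x + cnj (p x)))"
    by (rule cpoly_smult[OF cpoly.add[OF p cpoly_cnj[OF p]]])
  moreover have "(1/2) * (u + cnj u) = of_real (Re u)" for u
    by (simp add: complex_eq_iff)
  ultimately show ?thesis by simp
qed

lemma cpoly_Im: "cpoly p \<Longrightarrow> cpoly (\<lambda>x. of_real (Im (p x)))"
proof -
  assume p: "cpoly p"
  have "cpoly (\<lambda>x. of_real (Re (- \<i> * p x)))" by (rule cpoly_Re[OF cpoly_smult[OF p]])
  then show ?thesis by simp
qed

definition monomial4 :: "nat \<times> nat \<times> nat \<times> nat \<Rightarrow> complex \<times> complex \<Rightarrow> complex" where
  "monomial4 = (\<lambda>(i,j,k,l) (z,w). z ^ i * cnj z ^ j * w ^ k * cnj w ^ l)"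

lemma sum_quadruple:
  "(\<Sum>i\<in>A. \<Sum>j\<in>B. \<Sum>k\<in>C. \<Sum>l\<in>D. f i j k l) = (\<Sum>(i,j,k,l)\<in>A\<times>B\<times>C\<times>D. f i j k l)"
  by (simp add: sum.cartesian_product)

text \<open>Arbitrary finite sets of exponents in place of a box: addition becomes a union of index
  sets, and multiplication by a variable an injective reindexing.\<close>

lemma complex_polynomial_iff_finite_sum:
  "complex_polynomial p \<longleftrightarrow> (\<exists>A c. finite A \<and> p = (\<lambda>x. \<Sum>a\<in>A. c a * monomial4 a x))"
proof
  assume "complex_polynomial p"
  then obtain c N where "\<forall>z w. p (z, w) = (\<Sum>i\<le>N. \<Sum>j\<le>N. \<Sum>k\<le>N. \<Sum>l\<le>N.
      c i j k l * z ^ i * cnj z ^ j * w ^ k * cnj w ^ l)"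
    unfolding complex_polynomial_def by (elim exE)
  note c = this
  have "p x = (\<Sum>a\<in>{..N}\<times>{..N}\<times>{..N}\<times>{..N}. (case a of (i,j,k,l) \<Rightarrow> c i j k l) * monomial4 a x)" for x
  proof (cases x)
    case (Pair z w)
    have "p x = (\<Sum>i\<le>N. \<Sum>j\<le>N. \<Sum>k\<le>N. \<Sum>l\<le>N. c i j k l * z ^ i * cnj z ^ j * w ^ k * cnj w ^ l)"
      using c Pair by blast
    also note sum_quadruple
    also have "(\<Sum>(i,j,k,l)\<in>{..N}\<times>{..N}\<times>{..N}\<times>{..N}. c i j k l * z ^ i * cnj z ^ j * w ^ k * cnj w ^ l) =
      (\<Sum>a\<in>{..N}\<times>{..N}\<times>{..N}\<times>{..N}. (case a of (i,j,k,l) \<Rightarrow> c i j k l) * monomial4 a x)"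
      unfolding Pair by (rule sum.cong) (auto simp: monomial4_def mult.assoc)
    finally show ?thesis .
  qed
  then show "\<exists>A c. finite A \<and> p = (\<lambda>x. \<Sum>a\<in>A. c a * monomial4 a x)"
    by (intro exI[of _ "{..N}\<times>{..N}\<times>{..N}\<times>{..N}"] exI conjI ext) auto
next
  assume "\<exists>A c. finite A \<and> p = (\<lambda>x. \<Sum>a\<in>A. c a * monomial4 a x)"
  then obtain A c where A: "finite A" "p = (\<lambda>x. \<Sum>a\<in>A. c a * monomial4 a x)" by blast
  obtain N where N: "A \<subseteq> {..N}\<times>{..N}\<times>{..N}\<times>{..N}"
  proof -
    let ?s = "\<lambda>a. case a of (i,j,k,l) \<Rightarrow> i + j + k + l"
    have "finite (?s ` A)" using A(1) by simp
    have N: "i + j + k + l \<le> Max (?s ` A)" if "(i,j,k,l) \<in> A" for i j k l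
      using that A(1) by (intro Max_ge) (auto intro!: image_eqI[of _ _ "(i,j,k,l)"])
    have "A \<subseteq> {..Max (?s ` A)}\<times>{..Max (?s ` A)}\<times>{..Max (?s ` A)}\<times>{..Max (?s ` A)}"
    proof (rule subsetI)
      fix a assume "a \<in> A"
      moreover obtain i j k l where "a = (i,j,k,l)" by (cases a)
      ultimately show "a \<in> {..Max (?s ` A)}\<times>{..Max (?s ` A)}\<times>{..Max (?s ` A)}\<times>{..Max (?s ` A)}"
        using N[of i j k l] by (simp del: Max_ge_iff)
    qed
    then show ?thesis by (rule that)
  qed
  define d where "d a = (if a \<in> A then c a else 0)" for a
  have "p x = (\<Sum>a\<in>{..N}\<times>{..N}\<times>{..N}\<times>{..N}. d a * monomial4 a x)" for x
    unfolding A(2) by (intro sum.mono_neutral_cong_left) (use N in \<open>auto simp: d_def\<close>)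
  note d = this
  have "p (z, w) = (\<Sum>i\<le>N. \<Sum>j\<le>N. \<Sum>k\<le>N. \<Sum>l\<le>N. d (i,j,k,l) * z ^ i * cnj z ^ j * w ^ k * cnj w ^ l)" for z w
    unfolding sum_quadruple d by (rule sum.cong) (auto simp: monomial4_def mult.assoc)
  then show "complex_polynomial p" unfolding complex_polynomial_def
    by (intro exI[of _ "\<lambda>i j k l. d (i,j,k,l)"] exI[of _ N] allI)
qed

lemma complex_polynomial_mul_shift:
  assumes "complex_polynomial p" "inj s" "\<And>a x. m x * monomial4 a x = monomial4 (s a) x"
  shows "complex_polynomial (\<lambda>x. m x * p x)"
proof -
  obtain A c where A: "finite A" "p = (\<lambda>x. \<Sum>a\<in>A. c a * monomial4 a x)"
    using assms(1) complex_polynomial_iff_finite_sum by auto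
  have "m x * p x = (\<Sum>a\<in>s ` A. c (inv_into UNIV s a) * monomial4 a x)" for x
    using assms(2,3) unfolding A(2)
    by (subst sum.reindex) (auto simp: sum_distrib_left mult.left_commute intro: inj_on_subset)
  then show ?thesis unfolding complex_polynomial_iff_finite_sum using A(1)
    by (intro exI[of _ "s ` A"] exI[of _ "\<lambda>a. c (inv_into UNIV s a)"]) auto
qed

lemma complex_polynomial_add:
  assumes "complex_polynomial p" "complex_polynomial q"
  shows "complex_polynomial (\<lambda>x. p x + q x)"
proof -
  obtain A c where A: "finite A" "p = (\<lambda>x. \<Sum>a\<in>A. c a * monomial4 a x)"
    using assms(1) complex_polynomial_iff_finite_sum by auto
  obtain B d where B: "finite B" "q = (\<lambda>x. \<Sum>a\<in>B. d a * monomial4 a x)"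
    using assms(2) complex_polynomial_iff_finite_sum by auto
  let ?e = "\<lambda>a. (if a \<in> A then c a else 0) + (if a \<in> B then d a else 0)"
  have "p x = (\<Sum>a\<in>A \<union> B. (if a \<in> A then c a else 0) * monomial4 a x)" for x
    unfolding A(2) by (intro sum.mono_neutral_cong_left) (use A B in auto)
  moreover have "q x = (\<Sum>a\<in>A \<union> B. (if a \<in> B then d a else 0) * monomial4 a x)" for x
    unfolding B(2) by (intro sum.mono_neutral_cong_left) (use A B in auto)
  ultimately have "p x + q x = (\<Sum>a\<in>A \<union> B. ?e a * monomial4 a x)" for x
    by (simp add: distrib_right sum.distrib)
  then show ?thesis unfolding complex_polynomial_iff_finite_sum using A(1) B(1)
    by (intro exI[of _ "A \<union> B"] exI[of _ ?e]) auto
qed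

lemma cpoly_imp_complex_polynomial: "cpoly p \<Longrightarrow> complex_polynomial p"
proof (induction rule: cpoly.induct)
  case (const c)
  show ?case unfolding complex_polynomial_iff_finite_sum
    by (intro exI[of _ "{(0,0,0,0)}"] exI[of _ "\<lambda>_. c"]) (auto simp: monomial4_def)
next
  case (add p q)
  then show ?case by (intro complex_polynomial_add)
next
  case (mul_z p)
  show ?case
    by (rule complex_polynomial_mul_shift[OF mul_z.IH, where s = "\<lambda>(i,j,k,l). (Suc i,j,k,l)"])
      (auto simp: inj_def monomial4_def)
next
  case (mul_z_cnj p)
  show ?case
    by (rule complex_polynomial_mul_shift[OF mul_z_cnj.IH, where s = "\<lambda>(i,j,k,l). (i,Suc j,k,l)"])
      (auto simp: inj_def monomial4_def)
next
  case (mul_w p)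
  show ?case
    by (rule complex_polynomial_mul_shift[OF mul_w.IH, where s = "\<lambda>(i,j,k,l). (i,j,Suc k,l)"])
      (auto simp: inj_def monomial4_def)
next
  case (mul_w_cnj p)
  show ?case
    by (rule complex_polynomial_mul_shift[OF mul_w_cnj.IH, where s = "\<lambda>(i,j,k,l). (i,j,k,Suc l)"])
      (auto simp: inj_def monomial4_def)
qed

lemma Ck_heis_param: "Ck k UNIV heis_param"
proof -
  have e: "heis_param = (\<lambda>a. (fst a, Complex (snd a) (Re (fst a * cnj (fst a)))))"
    by (auto simp: heis_param_def cmod_power2 power2_eq_square[symmetric])
  show ?thesis
    unfolding e by (intro Ck_Pair Ck_Complex Ck_fst Ck_snd Ck_Re Ck_mult Ck_cnj Ck_id open_UNIV)
qed

lemma Ck_cpoly: "cpoly p \<Longrightarrow> Ck k UNIV p"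
  by (induction rule: cpoly.induct)
    (intro Ck_const Ck_add Ck_mult Ck_cnj Ck_fst Ck_snd Ck_id open_UNIV; assumption)+

lemma heis_param_in_heis: "heis_param a \<in> heis"
  by (auto simp: heis_param_def heis_def split: prod.splits)

lemma heis_param_chart: "x \<in> heis \<Longrightarrow> heis_param (heis_chart x) = x"
  using homeomorphism_heis_chart by (auto simp: homeomorphism_def)

lemma heis_chart_param: "heis_chart (heis_param a) = a"
  using homeomorphism_heis_chart by (metis homeomorphism_apply2 UNIV_I)

section \<open>Inverting the tangential Cauchy-Riemann operator\<close>

text \<open>
  On \<^const>\<open>heis\<close> the function \<open>cnj w\<close> agrees with \<open>w - 2 i z cnj z\<close>, and \<open>w\<close> is annihilated by the
  tangential Cauchy--Riemann operator; so that operator is inverted on polynomials by integrating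
  in \<open>cnj z\<close>.
\<close>

definition cr_derivative :: "(complex \<times> complex \<Rightarrow> complex) \<Rightarrow> complex \<Rightarrow> complex \<times> real \<Rightarrow> bool" where
  "cr_derivative f c a \<longleftrightarrow> (\<exists>\<alpha> \<beta>. ((\<lambda>a. f (heis_param a)) has_derivative
     (\<lambda>v. \<alpha> * fst v + c * cnj (fst v)
        + \<beta> * (of_real (snd v) + 2 * \<i> * of_real (Re (cnj (fst a) * fst v))))) (at a))"

definition cr_solution :: "(complex \<times> complex \<Rightarrow> complex) \<Rightarrow> (complex \<times> complex \<Rightarrow> complex) \<Rightarrow> bool" where
  "cr_solution f p \<longleftrightarrow> cpoly f \<and> (\<forall>a. cr_derivative f (p (heis_param a)) a)"

lemma cr_solution_cong: "cr_solution f p \<Longrightarrow> (\<And>x. x \<in> heis \<Longrightarrow> p x = q x) \<Longrightarrow> cr_solution f q"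
  unfolding cr_solution_def using heis_param_in_heis by simp

lemma cr_derivative_add:
  assumes "cr_derivative f c a" "cr_derivative g d a"
  shows "cr_derivative (\<lambda>x. f x + g x) (c + d) a"
proof -
  let ?W = "\<lambda>v. of_real (snd v) + 2 * \<i> * of_real (Re (cnj (fst a) * fst v)) :: complex"
  obtain \<alpha> \<beta> where f: "((\<lambda>a. f (heis_param a)) has_derivative
      (\<lambda>v. \<alpha> * fst v + c * cnj (fst v) + \<beta> * ?W v)) (at a)"
    using assms(1) unfolding cr_derivative_def by (elim exE)
  obtain \<alpha>' \<beta>' where g: "((\<lambda>a. g (heis_param a)) has_derivative
      (\<lambda>v. \<alpha>' * fst v + d * cnj (fst v) + \<beta>' * ?W v)) (at a)"
    using assms(2) unfolding cr_derivative_def by (elim exE)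
  have "(\<lambda>v. (\<alpha> * fst v + c * cnj (fst v) + \<beta> * ?W v) + (\<alpha>' * fst v + d * cnj (fst v) + \<beta>' * ?W v))
      = (\<lambda>v. (\<alpha> + \<alpha>') * fst v + (c + d) * cnj (fst v) + (\<beta> + \<beta>') * ?W v)"
  proof
    fix v
    have "(\<alpha> * x + c * y + \<beta> * w) + (\<alpha>' * x + d * y + \<beta>' * w)
      = (\<alpha> + \<alpha>') * x + (c + d) * y + (\<beta> + \<beta>') * w" for x y w :: complex
      by (simp add: algebra_simps)
    then show "(\<alpha> * fst v + c * cnj (fst v) + \<beta> * ?W v) + (\<alpha>' * fst v + d * cnj (fst v) + \<beta>' * ?W v)
      = (\<alpha> + \<alpha>') * fst v + (c + d) * cnj (fst v) + (\<beta> + \<beta>') * ?W v" .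
  qed
  then show ?thesis
    using has_derivative_add[OF f g] unfolding cr_derivative_def
    by (intro exI[of _ "\<alpha> + \<alpha>'"] exI[of _ "\<beta> + \<beta>'"]) simp
qed

lemma cr_solution_add:
  "cr_solution f p \<Longrightarrow> cr_solution g q \<Longrightarrow> cr_solution (\<lambda>x. f x + g x) (\<lambda>x. p x + q x)"
  unfolding cr_solution_def by (simp add: cpoly.add cr_derivative_add)

lemma heis_param_components_derivative:
  "((\<lambda>a. fst (heis_param a)) has_derivative fst) (at (z,t))"
  "((\<lambda>a. cnj (fst (heis_param a))) has_derivative (\<lambda>v. cnj (fst v))) (at (z,t))"
  "((\<lambda>a. snd (heis_param a)) has_derivative
     (\<lambda>v. of_real (snd v) + 2 * \<i> * of_real (Re (cnj z * fst v)))) (at (z,t))"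
proof -
  have e: "(\<lambda>a. fst (heis_param a)) = fst" "(\<lambda>a. cnj (fst (heis_param a))) = (\<lambda>a. cnj (fst a))"
    "(\<lambda>a. snd (heis_param a)) = (\<lambda>a. of_real (snd a) + \<i> * (fst a * cnj (fst a)))"
    by (auto simp: heis_param_def fun_eq_iff complex_eq_iff cmod_power2 power2_eq_square[symmetric])
  show "((\<lambda>a. fst (heis_param a)) has_derivative fst) (at (z,t))"
    unfolding e by (auto intro!: derivative_eq_intros)
  show "((\<lambda>a. cnj (fst (heis_param a))) has_derivative (\<lambda>v. cnj (fst v))) (at (z,t))"
    unfolding e by (auto intro!: derivative_eq_intros)
  show "((\<lambda>a. snd (heis_param a)) has_derivative
     (\<lambda>v. of_real (snd v) + 2 * \<i> * of_real (Re (cnj z * fst v)))) (at (z,t))"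
    unfolding e
    by (rule derivative_eq_intros refl)+ (simp add: fun_eq_iff complex_eq_iff)
qed

lemma cr_solution_monomial: "\<exists>f. cr_solution f (\<lambda>x. c * monomial4 (i,j,k,l) x)"
proof (induction l arbitrary: c i j k)
  case 0
  \<comment> \<open>Integrating \<open>cnj z ^ j\<close> with respect to \<open>cnj z\<close>
    divides by j + 1. The powers of \<open>z\<close> and \<open>w\<close> only contribute to the
    coefficients of dz and dw, which \<open>cr_derivative\<close> leaves free.\<close>
  define d where "d = c / (of_nat j + 1)"
  have "(of_nat j + 1 :: complex) \<noteq> 0"
    by (metis of_nat_1 of_nat_add of_nat_eq_0_iff add_is_0 one_neq_zero)
  then have c: "c = d * (of_nat j + 1)" by (simp add: d_def)
  let ?f = "\<lambda>x. d * (fst x ^ i * cnj (fst x) ^ Suc j * snd x ^ k)"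
  have "cr_solution ?f (\<lambda>x. c * monomial4 (i,j,k,0) x)"
    unfolding cr_solution_def
  proof (intro conjI allI)
    show "cpoly ?f" by (intro cpoly_smult cpoly_mult cpoly_power cpoly_vars)
    fix a :: "complex \<times> real"
    obtain z t where a: "a = (z,t)" by (cases a)
    let ?w = "snd (heis_param (z,t))"
    let ?D = "\<lambda>v::complex\<times>real. of_real (snd v) + 2 * \<i> * of_real (Re (cnj z * fst v)) :: complex"
    let ?A = "d * (of_nat i * z ^ (i - 1) * cnj z ^ Suc j * ?w ^ k)"
    let ?B = "d * (z ^ i * cnj z ^ Suc j * (of_nat k * ?w ^ (k - 1)))"
    note D = heis_param_components_derivative[of z t]
    have fz: "fst (heis_param (z,t)) = z" by (simp add: heis_param_def)
    have m: "monomial4 (i,j,k,0) (heis_param (z,t)) = z ^ i * cnj z ^ j * ?w ^ k"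
      by (simp add: monomial4_def heis_param_def)
    have "((\<lambda>a. ?f (heis_param a)) has_derivative
       (\<lambda>v. ?A * fst v + c * (z ^ i * cnj z ^ j * ?w ^ k) * cnj (fst v) + ?B * ?D v)) (at (z,t))"
    proof (rule has_derivative_eq_rhs)
      show "((\<lambda>a. ?f (heis_param a)) has_derivative (\<lambda>v. d * (z ^ i * cnj z ^ Suc j * (of_nat k * ?D v * ?w ^ (k - 1)) +
          (z ^ i * (of_nat (Suc j) * cnj (fst v) * cnj z ^ (Suc j - 1)) +
           of_nat i * fst v * z ^ (i - 1) * cnj z ^ Suc j) * ?w ^ k))) (at (z,t))"
        using has_derivative_mult_right[OF has_derivative_mult[OF has_derivative_mult[OF
            has_derivative_power[OF D(1), of i] has_derivative_power[OF D(2), of "Suc j"]]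
            has_derivative_power[OF D(3), of k]], of d] unfolding fz .
    qed (simp add: fun_eq_iff c algebra_simps)
    then show "cr_derivative ?f (c * monomial4 (i,j,k,0) (heis_param a)) a"
      unfolding cr_derivative_def m a fst_conv by (intro exI)
  qed
  then show ?case by blast
next
  case (Suc l)
  \<comment> \<open>One factor \<open>cnj w\<close> is rewritten as w - 2 i z \<open>cnj z\<close>.
    This lowers \<open>l\<close> and raises other exponents, so the induction keeps
    \<open>i\<close>, \<open>j\<close>, \<open>k\<close> and the coefficient arbitrary.\<close>
  obtain f g where fg: "cr_solution f (\<lambda>x. c * monomial4 (i,j,Suc k,l) x)"
    "cr_solution g (\<lambda>x. (- 2 * \<i> * c) * monomial4 (Suc i,Suc j,k,l) x)"
    using Suc[of c i j "Suc k"] Suc[of "- 2 * \<i> * c" "Suc i" "Suc j" k] by (elim exE)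
  have "cr_solution (\<lambda>x. f x + g x) (\<lambda>x. c * monomial4 (i,j,k,Suc l) x)"
  proof (rule cr_solution_cong[OF cr_solution_add[OF fg]])
    fix x :: "complex \<times> complex" assume "x \<in> heis"
    then obtain z w where x: "x = (z,w)" "Im w = (Re z)\<^sup>2 + (Im z)\<^sup>2"
      by (auto simp: heis_def cmod_power2)
    then have w: "cnj w = w - 2 * \<i> * (z * cnj z)"
      by (simp add: complex_eq_iff power2_eq_square)
    let ?m = "z ^ i * cnj z ^ j * w ^ k * cnj w ^ l"
    have "c * monomial4 (i,j,Suc k,l) x + (- 2 * \<i> * c) * monomial4 (Suc i,Suc j,k,l) x
        = c * ((w - 2 * \<i> * (z * cnj z)) * ?m)"
      by (simp add: x monomial4_def algebra_simps)
    also have "\<dots> = c * (cnj w * ?m)" by (simp only: w)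
    also have "\<dots> = c * monomial4 (i,j,k,Suc l) x"
      by (simp add: x monomial4_def mult_ac)
    finally show "c * monomial4 (i,j,Suc k,l) x + (- 2 * \<i> * c) * monomial4 (Suc i,Suc j,k,l) x
        = c * monomial4 (i,j,k,Suc l) x" .
  qed
  then show ?case by blast
qed

lemma cr_solution_exists:
  assumes "complex_polynomial p"
  shows "\<exists>f. cr_solution f p"
proof -
  obtain A c where A: "finite A" "p = (\<lambda>x. \<Sum>a\<in>A. c a * monomial4 a x)"
    using assms complex_polynomial_iff_finite_sum by auto
  have "\<exists>f. cr_solution f (\<lambda>x. \<Sum>a\<in>A. c a * monomial4 a x)"
    using A(1)
  proof (induction A)
    case empty
    have "cr_solution (\<lambda>x. 0) (\<lambda>x. 0)"
      unfolding cr_solution_def cr_derivative_def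
      by (auto simp: cpoly.const intro!: exI[of _ 0])
    then show ?case by auto
  next
    case (insert a A)
    obtain f g where "cr_solution f (\<lambda>x. c a * monomial4 a x)"
      "cr_solution g (\<lambda>x. \<Sum>a\<in>A. c a * monomial4 a x)"
      using insert.IH cr_solution_monomial[of "c a"] by (cases a) blast
    from cr_solution_add[OF this] show ?case using insert by auto
  qed
  then show ?thesis using A by simp
qed

section \<open>Complex tangents of a graph\<close>

lemma smooth_map_onI:
  assumes "open U" "A \<subseteq> U" "\<And>k. Ck k U f"
  shows "smooth_map_on A f"
  unfolding smooth_map_on_def using assms by blast

text \<open>On tangent vectors the third component is \<alpha> dz + p d(cnj z) + \<beta> dw.
  Multiplication by i is compatible with the outer terms but changes the sign of the middle one, so
  a complex line stays tangent to the graph exactly where \<open>p\<close> vanishes.\<close>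

lemma polynomial_embedding_of_cr_solution:
  assumes "cr_solution f p"
  defines "F \<equiv> \<lambda>x. (fst x, snd x, f x)"
  shows "polynomial_embedding F" "complex_tangents F = {x. p x = 0} \<inter> heis"
proof -
  let ?G = "F \<circ> heis_param"
  let ?W = "\<lambda>z v. of_real (snd v) + 2 * \<i> * of_real (Re (cnj z * fst v)) :: complex"
  have f: "cpoly f" using assms by (simp add: cr_solution_def)
  have Ck: "Ck k UNIV ?G" for k
    unfolding F_def o_def
    by (intro Ck_Pair Ck_fst Ck_snd Ck_heis_param open_UNIV
        Ck_compose[OF open_UNIV open_UNIV Ck_heis_param Ck_cpoly[OF f]]) auto
  have DG: "\<exists>\<alpha> \<beta>. (?G has_derivative (\<lambda>v. (fst v, ?W z v,
      \<alpha> * fst v + p (heis_param (z,t)) * cnj (fst v) + \<beta> * ?W z v))) (at (z,t))" for z t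
  proof -
    have "cr_derivative f (p (heis_param (z,t))) (z,t)"
      using assms(1) by (simp add: cr_solution_def)
    then obtain \<alpha> \<beta> where "((\<lambda>a. f (heis_param a)) has_derivative
     (\<lambda>v. \<alpha> * fst v + p (heis_param (z,t)) * cnj (fst v) + \<beta> * ?W z v)) (at (z,t))"
      unfolding cr_derivative_def fst_conv by (elim exE)
    then have "((\<lambda>a. (fst (heis_param a), snd (heis_param a), f (heis_param a))) has_derivative
      (\<lambda>v. (fst v, ?W z v, \<alpha> * fst v + p (heis_param (z,t)) * cnj (fst v) + \<beta> * ?W z v))) (at (z,t))"
      by (intro has_derivative_Pair heis_param_components_derivative)
    then show ?thesis unfolding F_def o_def by (intro exI)
  qed
  have inj: "inj (frechet_derivative ?G (at a))" for a
  proof -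
    obtain z t where a: "a = (z,t)" by (cases a)
    obtain \<alpha> \<beta> where D: "(?G has_derivative (\<lambda>v. (fst v, ?W z v,
        \<alpha> * fst v + p (heis_param (z,t)) * cnj (fst v) + \<beta> * ?W z v))) (at a)"
      using DG[of z t] unfolding a by (elim exE)
    show ?thesis
      unfolding frechet_derivative_at[OF D, symmetric]
      by (rule injI) (auto simp: prod_eq_iff complex_eq_iff)
  qed
  have "homeomorphism heis (F ` heis) F (\<lambda>y. (fst y, fst (snd y)))"
  proof (rule homeomorphismI)
    have "continuous_on UNIV f" using Ck_cpoly[OF f, of 0] by simp
    then have "continuous_on heis f" by (rule continuous_on_subset) simp
    then show "continuous_on heis F"
      unfolding F_def by (intro continuous_on_Pair continuous_on_fst continuous_on_snd continuous_on_id)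
  qed (auto simp: F_def intro!: continuous_intros)
  then have "heis_embedding F"
    unfolding heis_embedding_def using inj Ck by (auto intro!: smooth_map_onI[of UNIV])
  then show "polynomial_embedding F"
    unfolding polynomial_embedding_def
    using cpoly_imp_complex_polynomial[OF f] by (auto simp: F_def intro!: exI[of _ f])
  have T: "tangent_space (F ` heis) (F (heis_param a)) = range D"
    if D: "(?G has_derivative D) (at a)" for a D
  proof (intro equalityI subsetI)
    fix v assume "v \<in> tangent_space (F ` heis) (F (heis_param a))"
    then obtain \<gamma> where g: "\<And>t::real. \<gamma> t \<in> F ` heis" "\<gamma> 0 = F (heis_param a)"
      "(\<gamma> has_vector_derivative v) (at 0)" unfolding tangent_space_def by blast
    \<comment> \<open>The first two components of a point of the image recover its parameter. Hence
      every curve in the image lifts through \<open>?G\<close>, and the chain rule computes its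
      velocity.\<close>
    define \<delta> where "\<delta> t = heis_chart (fst (\<gamma> t), fst (snd (\<gamma> t)))" for t
    have \<gamma>: "\<gamma> t = ?G (\<delta> t)" for t
      using g(1)[of t] by (auto simp: \<delta>_def F_def heis_param_chart)
    have "\<delta> 0 = a" by (simp add: \<delta>_def g(2) F_def heis_chart_param)
    moreover have "\<delta> = (\<lambda>t. (fst (\<gamma> t), Re (fst (snd (\<gamma> t)))))"
      by (auto simp: \<delta>_def heis_chart_def)
    then have "(\<delta> has_vector_derivative (fst v, Re (fst (snd v)))) (at 0)"
      using g(3) unfolding has_vector_derivative_def
      by (auto intro!: derivative_eq_intros)
    ultimately have 1: "((?G \<circ> \<delta>) has_vector_derivative D (fst v, Re (fst (snd v)))) (at 0)"
      using has_derivative_at_withinI[OF D]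
      by (intro vector_derivative_diff_chain_within) (simp_all only:)
    have 2: "\<gamma> = ?G \<circ> \<delta>" by (rule ext) (simp only: \<gamma>[symmetric] comp_apply[of ?G \<delta>])
    have "v = D (fst v, Re (fst (snd v)))"
      by (rule vector_derivative_unique_at[OF g(3)]) (subst 2, rule 1)
    then show "v \<in> range D" by (rule range_eqI)
  next
    fix v assume "v \<in> range D"
    then obtain e where e: "v = D e" by blast
    let ?\<gamma> = "?G \<circ> (\<lambda>t. a + t *\<^sub>R e)"
    have "((\<lambda>t::real. a + t *\<^sub>R e) has_vector_derivative e) (at 0)"
      by (auto intro!: derivative_eq_intros simp: has_vector_derivative_def)
    then have "(?\<gamma> has_vector_derivative v) (at 0)"
      unfolding e using has_derivative_at_withinI[OF D]
      by (intro vector_derivative_diff_chain_within) (simp_all only: scaleR_zero_left add_0_right)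
    then show "v \<in> tangent_space (F ` heis) (F (heis_param a))"
      unfolding tangent_space_def using heis_param_in_heis
      by (intro CollectI exI[of _ ?\<gamma>]) auto
  qed
  have main: "tangent_space (F ` heis) (F x) \<inter> mult_i ` tangent_space (F ` heis) (F x) \<noteq> {0} \<longleftrightarrow> p x = 0"
    if x: "x \<in> heis" for x
  proof -
    obtain z t where zt: "x = heis_param (z,t)"
      using heis_param_chart[OF x] by (metis surj_pair)
    obtain \<alpha> \<beta> where D: "(?G has_derivative (\<lambda>v. (fst v, ?W z v,
        \<alpha> * fst v + p x * cnj (fst v) + \<beta> * ?W z v))) (at (z,t))"
      using DG[of z t] unfolding zt by (elim exE)
    let ?D = "\<lambda>v. (fst v, ?W z v, \<alpha> * fst v + p x * cnj (fst v) + \<beta> * ?W z v)"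
    have TT: "tangent_space (F ` heis) (F x) = range ?D" using T[OF D] zt by simp
    have z0: "(0::complex\<times>complex\<times>complex) \<in> range ?D \<inter> mult_i ` range ?D"
    proof -
      have "0 = ?D (0,0)" "0 = mult_i (?D (0,0))" by (auto simp: mult_i_def zero_prod_def)
      then show ?thesis by blast
    qed
    show ?thesis
    proof
      assume "p x = 0"
      \<comment> \<open>The real entries are forced by dw = 2 i (cnj z) dz with dz = 1 and dz = i:
        the two vectors span the complex line in the tangent space of \<open>heis\<close>.\<close>
      let ?a = "(1, - 2 * Im (cnj z)) :: complex \<times> real"
      let ?b = "(\<i>, - 2 * Re (cnj z)) :: complex \<times> real"
      have "?W z ?b = \<i> * ?W z ?a" by (simp add: complex_eq_iff)
      then have "?D ?b = mult_i (?D ?a)"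
        using \<open>p x = 0\<close> by (simp add: mult_i_def algebra_simps)
      then have "?D ?b \<in> range ?D \<inter> mult_i ` range ?D" by blast
      moreover have "?D ?b \<noteq> 0" by (simp add: zero_prod_def)
      ultimately show "tangent_space (F ` heis) (F x) \<inter> mult_i ` tangent_space (F ` heis) (F x) \<noteq> {0}"
        unfolding TT by blast
    next
      assume "tangent_space (F ` heis) (F x) \<inter> mult_i ` tangent_space (F ` heis) (F x) \<noteq> {0}"
      then obtain y where y: "y \<noteq> 0" "y \<in> range ?D" "y \<in> mult_i ` range ?D"
        unfolding TT using z0 by blast
      then obtain a b where ab: "y = ?D a" "y = mult_i (?D b)" by blast
      then have 1: "fst a = \<i> * fst b" "?W z a = \<i> * ?W z b"
        "\<alpha> * fst a + p x * cnj (fst a) + \<beta> * ?W z a = \<i> * (\<alpha> * fst b + p x * cnj (fst b) + \<beta> * ?W z b)"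
        by (auto simp: mult_i_def)
      have "\<alpha> * (\<i> * fst b) + p x * cnj (\<i> * fst b) + \<beta> * (\<i> * ?W z b)
          = \<i> * (\<alpha> * fst b + p x * cnj (fst b) + \<beta> * ?W z b)"
        using 1(3) unfolding 1(1)[symmetric] 1(2)[symmetric] .
      then have "p x * cnj (fst b) = 0"
        by (simp add: algebra_simps)
      \<comment> \<open>If dz vanishes, then dw is real on both vectors; one value is i times the
        other, so both are 0.\<close>
      moreover have "fst b \<noteq> 0"
      proof
        assume "fst b = 0"
        then have "fst a = 0" using 1 by simp
        then have "?W z a = of_real (snd a)" "?W z b = of_real (snd b)" using \<open>fst b = 0\<close> by auto
        then have "snd a = 0" using 1(2) by (auto simp: complex_eq_iff)
        then show False using y(1) ab(1) \<open>fst a = 0\<close> by (simp add: zero_prod_def)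
      qed
      ultimately show "p x = 0" by simp
    qed
  qed
  show "complex_tangents F = {x. p x = 0} \<inter> heis"
    unfolding complex_tangents_def using main by auto
qed

lemma algebraic_is_complex_tangents:
  assumes "algebraic_in_heis K"
  shows "\<exists>F. polynomial_embedding F \<and> complex_tangents F = K"
proof -
  obtain p where p: "complex_polynomial p" "K = {x. p x = 0} \<inter> heis"
    using assms algebraic_in_heis_def by auto
  obtain f where "cr_solution f p" using cr_solution_exists[OF p(1)] by blast
  from polynomial_embedding_of_cr_solution[OF this] show ?thesis using p(2) by blast
qed

section \<open>Algebraicity of trigonometric curves\<close>

text \<open>Coprimality over an algebraically closed field: a root of \<open>A\<close> is no root of
  \<open>B\<close>, hence one of \<open>g\<close>, and the linear factor can be cancelled from both
  \<open>A\<close> and \<open>g\<close>.\<close>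

lemma dvd_of_dvd_mult_no_common_root:
  fixes A B g :: "complex poly"
  assumes "A \<noteq> 0" "A dvd g * B" "\<And>u. poly A u = 0 \<Longrightarrow> poly B u \<noteq> 0"
  shows "A dvd g"
  using assms
proof (induction "degree A" arbitrary: A g)
  case 0
  then have "is_unit A" by (simp add: is_unit_iff_degree)
  then show ?case by (rule unit_imp_dvd)
next
  case (Suc n)
  obtain \<alpha> where \<alpha>: "poly A \<alpha> = 0" using Suc.hyps(2) alg_closed_imp_poly_has_root[of A] by auto
  then obtain A' where A': "A = [:- \<alpha>, 1:] * A'" using poly_eq_0_iff_dvd by blast
  have "poly (g * B) \<alpha> = 0" using Suc.prems(2) \<alpha> by (metis dvdE mult_zero_left poly_mult)
  then have "poly g \<alpha> = 0" using Suc.prems(3)[OF \<alpha>] by simp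
  then obtain g' where g': "g = [:- \<alpha>, 1:] * g'" using poly_eq_0_iff_dvd by blast
  have "A' \<noteq> 0" using Suc.prems(1) A' by auto
  moreover from this have "degree A' = n"
    using Suc.hyps(2) unfolding A' by (subst (asm) degree_mult_eq) auto
  moreover have "A' dvd g' * B" using Suc.prems(2) unfolding A' g' mult.assoc
    by (simp only: dvd_mult_cancel_left) auto
  moreover have "poly B u \<noteq> 0" if "poly A' u = 0" for u using Suc.prems(3)[of u] that A' by simp
  ultimately have "A' dvd g'" using Suc.hyps(1) by blast
  then show ?case unfolding A' g' by (rule mult_dvd_mono[OF dvd_refl])
qed

text \<open>
  The matrix of \<open>(f, g) \<mapsto> f A + g B\<close> on coefficient vectors with \<open>deg f < m\<close>, \<open>deg g < n\<close>. The
  degrees are nominal, so that its shape does not change when \<open>B\<close> varies with a parameter.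
\<close>

definition sylv :: "nat \<Rightarrow> nat \<Rightarrow> complex poly \<Rightarrow> complex poly \<Rightarrow> complex mat" where
  "sylv n m A B = mat (n + m) (n + m) (\<lambda>(i, j).
     if j < m then (if j \<le> i then coeff A (i - j) else 0)
     else (if j - m \<le> i then coeff B (i - (j - m)) else 0))"

lemma sylv_mult_vec:
  fixes f g A B :: "complex poly"
  assumes "\<And>k. k \<ge> m \<Longrightarrow> coeff f k = 0" "\<And>k. k \<ge> n \<Longrightarrow> coeff g k = 0" "i < n + m"
  shows "(sylv n m A B *\<^sub>v vec (n + m) (\<lambda>j. if j < m then coeff f j else coeff g (j - m))) $ i
    = coeff (f * A + g * B) i"
proof -
  let ?v = "\<lambda>j. if j < m then coeff f j else coeff g (j - m)"
  let ?S = "\<lambda>j. if j < m then (if j \<le> i then coeff A (i - j) else 0)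
     else (if j - m \<le> i then coeff B (i - (j - m)) else 0)"
  have s: "(\<Sum>j<k. (if j \<le> i then coeff Q (i - j) else 0) * coeff h j) = coeff (h * Q) i"
    if h: "\<And>j. j \<ge> k \<Longrightarrow> coeff h j = 0" for k and h Q :: "complex poly"
  proof -
    have "(\<Sum>j<k. (if j \<le> i then coeff Q (i - j) else 0) * coeff h j)
        = (\<Sum>j\<in>{..<k} \<inter> {..i}. coeff h j * coeff Q (i - j))"
      by (subst sum.inter_restrict) (auto intro!: sum.cong)
    also have "\<dots> = (\<Sum>j\<le>i. coeff h j * coeff Q (i - j))"
      by (rule sum.mono_neutral_left) (use h in \<open>auto simp: not_less[symmetric]\<close>)
    finally show ?thesis by (simp add: coeff_mult)
  qed
  have "(sylv n m A B *\<^sub>v vec (n + m) ?v) $ i = (\<Sum>j\<in>{0..<n+m}. ?S j * ?v j)"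
    using assms(3) by (simp add: sylv_def scalar_prod_def row_def)
  also have "{0..<n+m} = {..<m} \<union> (\<lambda>j. j + m) ` {..<n}"
    by (auto simp: image_def) (metis add.commute less_diff_conv2 linorder_not_less lessThan_iff le_add_diff_inverse2)
  also have "(\<Sum>j\<in>{..<m} \<union> (\<lambda>j. j + m) ` {..<n}. ?S j * ?v j)
    = (\<Sum>j<m. ?S j * ?v j) + (\<Sum>j\<in>(\<lambda>j. j + m) ` {..<n}. ?S j * ?v j)"
    by (rule sum.union_disjoint) auto
  also have "(\<Sum>j<m. ?S j * ?v j) = (\<Sum>j<m. (if j \<le> i then coeff A (i - j) else 0) * coeff f j)"
    by (rule sum.cong) auto
  also have "\<dots> = coeff (f * A) i" by (rule s) (use assms(1) in auto)
  also have "(\<Sum>j\<in>(\<lambda>j. j + m) ` {..<n}. ?S j * ?v j)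
    = (\<Sum>j<n. (if j \<le> i then coeff B (i - j) else 0) * coeff g j)"
    by (subst sum.reindex) (auto intro!: sum.cong)
  also have "\<dots> = coeff (g * B) i" by (rule s) (use assms(2) in auto)
  finally show ?thesis by simp
qed

text \<open>A kernel vector means f A = - g B with g nonzero and deg g < deg A; without a common
  root \<open>A\<close> would divide \<open>g\<close>. Conversely, a common root u with A = (x - u)
  A' and B = (x - u) B' yields the kernel vector (B', - A'). Only the degree of \<open>A\<close> has
  to be exact; that of \<open>B\<close> may drop.\<close>

lemma det_sylv_eq_0_iff:
  assumes A: "degree A = n" "n > 0" and B: "degree B \<le> m"
  shows "det (sylv n m A B) = 0 \<longleftrightarrow> (\<exists>u. poly A u = 0 \<and> poly B u = 0)"
proof -
  have A0: "A \<noteq> 0" using A by auto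
  have car: "sylv n m A B \<in> carrier_mat (n + m) (n + m)" by (simp add: sylv_def)
  show ?thesis unfolding det_0_iff_vec_prod_zero[OF car]
  proof
    assume "\<exists>v. v \<in> carrier_vec (n + m) \<and> v \<noteq> 0\<^sub>v (n + m) \<and> sylv n m A B *\<^sub>v v = 0\<^sub>v (n + m)"
    then obtain v where v: "v \<in> carrier_vec (n + m)" "v \<noteq> 0\<^sub>v (n + m)"
      "sylv n m A B *\<^sub>v v = 0\<^sub>v (n + m)" by blast
    define f where "f = Abs_poly (\<lambda>j. if j < m then v $ j else 0)"
    define g where "g = Abs_poly (\<lambda>j. if j < n then v $ (j + m) else 0)"
    have cf: "coeff f j = (if j < m then v $ j else 0)" for j
      unfolding f_def by (subst coeff_Abs_poly[where n = m]) auto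
    have cg: "coeff g j = (if j < n then v $ (j + m) else 0)" for j
      unfolding g_def by (subst coeff_Abs_poly[where n = n]) auto
    have veq: "v = vec (n + m) (\<lambda>j. if j < m then coeff f j else coeff g (j - m))"
      using v(1) by (intro eq_vecI) (auto simp: cf cg)
    have "coeff (f * A + g * B) i = 0" for i
    proof (cases "i < n + m")
      case True
      then have "coeff (f * A + g * B) i = (sylv n m A B *\<^sub>v v) $ i"
        by (subst veq, subst sylv_mult_vec) (auto simp: cf cg)
      then show ?thesis using v(3) True by simp
    next
      case False
      have df: "f = 0 \<or> degree f < m" using cf by (metis leading_coeff_0_iff)
      have dg: "g = 0 \<or> degree g < n" using cg by (metis leading_coeff_0_iff)
      have "coeff (f * A) i = 0"
        using df degree_mult_le[of f A] A False by (cases "f = 0") (auto intro: coeff_eq_0)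
      moreover have "coeff (g * B) i = 0"
        using dg degree_mult_le[of g B] B False by (cases "g = 0") (auto intro: coeff_eq_0)
      ultimately show ?thesis by simp
    qed
    then have eq: "f * A + g * B = 0" by (simp add: poly_eq_iff)
    have g0: "g \<noteq> 0"
    proof
      assume "g = 0"
      then have "f = 0" using eq A0 by simp
      with \<open>g = 0\<close> have "v = 0\<^sub>v (n + m)" by (subst veq) (auto intro!: eq_vecI)
      then show False using v(2) by blast
    qed
    then have dg: "degree g < n" using cg by (metis leading_coeff_0_iff)
    show "\<exists>u. poly A u = 0 \<and> poly B u = 0"
    proof (rule ccontr)
      assume "\<nexists>u. poly A u = 0 \<and> poly B u = 0"
      moreover have "A dvd g * B"
        using eq by (metis add_eq_0_iff dvd_minus_iff dvd_triv_right)
      ultimately have "A dvd g" using A0 by (intro dvd_of_dvd_mult_no_common_root[of A g B]) auto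
      then have "degree A \<le> degree g" using g0 by (rule dvd_imp_degree_le)
      then show False using dg A by simp
    qed
  next
    assume "\<exists>u. poly A u = 0 \<and> poly B u = 0"
    then obtain u where "poly A u = 0" "poly B u = 0" by blast
    then obtain A' B' where A': "A = [:- u, 1:] * A'" and B': "B = [:- u, 1:] * B'"
      using poly_eq_0_iff_dvd by (metis dvdE)
    have A'0: "A' \<noteq> 0" using A0 A' by auto
    then have dA: "degree A' < n"
      using A(1) unfolding A' by (subst (asm) degree_mult_eq) auto
    have dB: "B' = 0 \<or> degree B' < m"
    proof (cases "B' = 0")
      case False
      then have "degree ([:- u, 1:] * B') = Suc (degree B')" by (subst degree_mult_eq) auto
      then show ?thesis using B unfolding B' by simp
    qed simp
    let ?v = "vec (n + m) (\<lambda>j. if j < m then coeff B' j else coeff (- A') (j - m))"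
    have "sylv n m A B *\<^sub>v ?v = 0\<^sub>v (n + m)"
    proof (rule eq_vecI)
      fix i assume "i < dim_vec (0\<^sub>v (n + m))"
      then have "(sylv n m A B *\<^sub>v ?v) $ i = coeff (B' * A + (- A') * B) i"
        using dA dB by (intro sylv_mult_vec) (auto intro: coeff_eq_0)
      also have "B' * A = A' * B" unfolding A' B' by (simp only: mult_ac)
      also have "A' * B + (- A') * B = 0" by simp
      finally show "(sylv n m A B *\<^sub>v ?v) $ i = 0\<^sub>v (n + m) $ i"
        using \<open>i < dim_vec (0\<^sub>v (n + m))\<close> by simp
    qed (simp add: sylv_def)
    moreover have "?v \<noteq> 0\<^sub>v (n + m)"
    proof
      assume "?v = 0\<^sub>v (n + m)"
      then have "?v $ (degree A' + m) = 0" using dA by simp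
      then show False using dA A'0 by simp
    qed
    ultimately show "\<exists>v. v \<in> carrier_vec (n + m) \<and> v \<noteq> 0\<^sub>v (n + m) \<and> sylv n m A B *\<^sub>v v = 0\<^sub>v (n + m)"
      by (intro exI[of _ ?v]) auto
  qed
qed

lemma cpoly_det:
  assumes "\<And>x. M x \<in> carrier_mat N N" "\<And>i j. i < N \<Longrightarrow> j < N \<Longrightarrow> cpoly (\<lambda>x. M x $$ (i, j))"
  shows "cpoly (\<lambda>x. det (M x))"
proof -
  have "cpoly (\<lambda>x. \<Sum>p\<in>{p. p permutes {0..<N}}. signof p * (\<Prod>i=0..<N. M x $$ (i, p i)))"
    by (intro cpoly_sum cpoly_smult cpoly_prod assms(2)) (auto simp: permutes_def)
  then show ?thesis
    using assms(1) by (subst det_def') auto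
qed

text \<open>
  Three polynomials have a common root iff the first one has one in common with \<open>B + \<lambda> C\<close> for more
  values of \<open>\<lambda>\<close> than it has roots.
\<close>

lemma cpoly_elimination:
  fixes A\<^sub>0 A\<^sub>1 B\<^sub>0 B\<^sub>1 C\<^sub>0 C\<^sub>1 :: "complex poly"
  assumes "degree A\<^sub>1 < degree A\<^sub>0" "cpoly X" "cpoly Y" "cpoly Z"
  shows "\<exists>p. cpoly p \<and> (\<forall>q. p q = 0 \<longleftrightarrow> (\<exists>u. poly A\<^sub>0 u = X q * poly A\<^sub>1 u \<and>
     poly B\<^sub>0 u = Y q * poly B\<^sub>1 u \<and> poly C\<^sub>0 u = Z q * poly C\<^sub>1 u))"
proof -
  define n where "n = degree A\<^sub>0"
  define m where "m = degree B\<^sub>0 + degree B\<^sub>1 + degree C\<^sub>0 + degree C\<^sub>1"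
  define A where "A q = A\<^sub>0 - Polynomial.smult (X q) A\<^sub>1" for q
  define D where "D l q = (B\<^sub>0 - Polynomial.smult (Y q) B\<^sub>1) + Polynomial.smult (of_nat l) (C\<^sub>0 - Polynomial.smult (Z q) C\<^sub>1)" for l q
  have dA: "degree (A q) = n" for q
  proof -
    have "degree (- Polynomial.smult (X q) A\<^sub>1) < degree A\<^sub>0"
      using assms(1) degree_smult_le[of "X q" A\<^sub>1] by simp
    then show ?thesis unfolding A_def n_def
      using degree_add_eq_left[of "- Polynomial.smult (X q) A\<^sub>1" A\<^sub>0] by simp
  qed
  have dD: "degree (D l q) \<le> m" for l q
    unfolding D_def m_def
    by (intro degree_add_le degree_diff_le degree_smult_le[THEN order_trans]) auto
  define d where "d l q = det (sylv n m (A q) (D l q))" for l :: nat and q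
  have d: "d l q = 0 \<longleftrightarrow> (\<exists>u. poly (A q) u = 0 \<and> poly (D l q) u = 0)" for l q
    unfolding d_def using assms(1) by (intro det_sylv_eq_0_iff dA dD) (auto simp: n_def)
  have cd: "cpoly (d l)" for l
    unfolding d_def
  proof (rule cpoly_det[where N = "n + m"])
    fix i j assume ij: "i < n + m" "j < n + m"
    have "cpoly (\<lambda>q. coeff (A q) k)" "cpoly (\<lambda>q. coeff (D l q) k)" for k
      unfolding A_def D_def coeff_diff coeff_add coeff_smult
      by (intro cpoly_minus cpoly.add cpoly_mult cpoly.const assms)+
    then show "cpoly (\<lambda>q. sylv n m (A q) (D l q) $$ (i, j))"
      using ij cpoly.const[of 0]
      by (cases "j < m"; cases "j \<le> i"; cases "j - m \<le> i") (simp_all add: sylv_def)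
  qed (simp add: sylv_def)
  \<comment> \<open>A sum of squared moduli turns finitely many equations into one; conjugates are
    available in \<open>cpoly\<close>.\<close>
  define p where "p q = (\<Sum>l\<le>n. d l q * cnj (d l q))" for q
  have "cpoly p" unfolding p_def by (intro cpoly_sum cpoly_mult cpoly_cnj cd)
  moreover have "p q = 0 \<longleftrightarrow> (\<exists>u. poly A\<^sub>0 u = X q * poly A\<^sub>1 u \<and>
     poly B\<^sub>0 u = Y q * poly B\<^sub>1 u \<and> poly C\<^sub>0 u = Z q * poly C\<^sub>1 u)" (is "_ \<longleftrightarrow> (\<exists>u. ?R u)") for q
  proof -
    have "p q = of_real (\<Sum>l\<le>n. (cmod (d l q))\<^sup>2)"
      unfolding p_def by (simp add: complex_norm_square del: of_real_power)
    then have "p q = 0 \<longleftrightarrow> (\<forall>l\<le>n. d l q = 0)"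
      by (simp only: of_real_eq_0_iff) (auto simp: sum_nonneg_eq_0_iff)
    also have "\<dots> \<longleftrightarrow> (\<exists>u. ?R u)"
    proof
      assume "\<forall>l\<le>n. d l q = 0"
      then have "\<forall>l\<in>{..n}. \<exists>u. poly (A q) u = 0 \<and> poly (D l q) u = 0" using d by simp
      from bchoice[OF this] obtain r
        where r: "\<And>l. l \<le> n \<Longrightarrow> poly (A q) (r l) = 0 \<and> poly (D l q) (r l) = 0" by auto
      have A0: "A q \<noteq> 0" using dA[of q] assms(1) by (auto simp: n_def)
      have "\<not> inj_on r {..n}"
      proof
        assume "inj_on r {..n}"
        then have "card {..n} \<le> card {u. poly (A q) u = 0}"
          using r by (intro card_inj_on_le[of r] poly_roots_finite A0) auto
        also have "\<dots> \<le> n" using card_poly_roots_bound[OF A0] dA by simp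
        finally show False by simp
      qed
      then obtain k l where kl: "k \<le> n" "l \<le> n" "k \<noteq> l" "r k = r l" by (auto simp: inj_on_def)
      let ?u = "r l" and ?b = "poly (B\<^sub>0 - Polynomial.smult (Y q) B\<^sub>1) (r l)" and ?c = "poly (C\<^sub>0 - Polynomial.smult (Z q) C\<^sub>1) (r l)"
      have e: "?b + of_nat l * ?c = 0" "?b + of_nat k * ?c = 0"
        using r[OF kl(1)] r[OF kl(2)] kl(4) by (auto simp: D_def)
      have "(l' - k') * c' = (b' + l' * c') - (b' + k' * c')" for b' c' l' k' :: complex
        by (simp add: algebra_simps)
      from this[of "of_nat l" "of_nat k" ?c ?b] have "(of_nat l - of_nat k) * ?c = 0"
        unfolding e by simp
      then have "?c = 0" using kl(3) by simp
      with e have "?b = 0" by simp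
      then have "?R ?u" using \<open>?c = 0\<close> r[OF kl(2)] by (simp add: A_def)
      then show "\<exists>u. ?R u" by blast
    next
      assume "\<exists>u. ?R u"
      then show "\<forall>l\<le>n. d l q = 0" unfolding d by (auto simp: A_def D_def)
    qed
    finally show ?thesis .
  qed
  ultimately show ?thesis by blast
qed

section \<open>Generic choice of the perturbation\<close>

text \<open>The two powers have reciprocal moduli, which agree only on the unit circle.\<close>

lemma power_minus_inverse_cnj_power_neq_0:
  fixes u :: complex
  assumes "d > 0" "u \<noteq> 0" "cmod u \<noteq> 1"
  shows "u ^ d - inverse (cnj u) ^ d \<noteq> 0"
proof
  assume "u ^ d - inverse (cnj u) ^ d = 0"
  then have "cmod (u ^ d) = cmod (inverse (cnj u) ^ d)" by simp
  then have "cmod u ^ d = inverse (cmod u) ^ d" by (simp add: norm_power norm_inverse)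
  then have "cmod u = inverse (cmod u)"
    using assms(1) by (auto intro: power_eq_imp_eq_base)
  then have "(cmod u)\<^sup>2 = 1\<^sup>2" using assms(2) by (simp add: power2_eq_square field_simps)
  then show False using assms(3) by (metis norm_ge_zero power2_eq_imp_eq zero_le_one)
qed

text \<open>
  Each of the three conditions confines its parameter \<open>c\<^sub>j\<close> to a real line, so the bad parameters
  form the image of a five-dimensional set in a six-dimensional space.
\<close>

lemma generic_perturbation:
  fixes f\<^sub>1 f\<^sub>2 f\<^sub>3 :: "complex \<Rightarrow> real"
  assumes diff: "\<And>u. u \<noteq> 0 \<Longrightarrow> cmod u \<noteq> 1 \<Longrightarrow> f\<^sub>1 differentiable (at u)"
    "\<And>u. u \<noteq> 0 \<Longrightarrow> cmod u \<noteq> 1 \<Longrightarrow> f\<^sub>2 differentiable (at u)"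
    "\<And>u. u \<noteq> 0 \<Longrightarrow> cmod u \<noteq> 1 \<Longrightarrow> f\<^sub>3 differentiable (at u)"
    and "d > 0" "\<epsilon> > 0"
  shows "\<exists>c\<^sub>1 c\<^sub>2 c\<^sub>3. cmod c\<^sub>1 < \<epsilon> \<and> cmod c\<^sub>2 < \<epsilon> \<and> cmod c\<^sub>3 < \<epsilon> \<and> c\<^sub>1 \<noteq> 0 \<and>
    (\<forall>u. u \<noteq> 0 \<and> cmod u \<noteq> 1 \<longrightarrow> \<not> (
      f\<^sub>1 u + Im (c\<^sub>1 * (u ^ d - inverse (cnj u) ^ d)) / 2 = 0 \<and>
      f\<^sub>2 u + Im (c\<^sub>2 * (u ^ d - inverse (cnj u) ^ d)) / 2 = 0 \<and>
      f\<^sub>3 u + Im (c\<^sub>3 * (u ^ d - inverse (cnj u) ^ d)) / 2 = 0))"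
proof -
  define D where "D u = u ^ d - inverse (cnj u) ^ d" for u :: complex
  define U where "U = {u::complex. u \<noteq> 0 \<and> cmod u \<noteq> 1}"
  have D0: "D u \<noteq> 0" if "u \<in> U" for u
    unfolding D_def using that power_minus_inverse_cnj_power_neq_0 assms(4) by (auto simp: U_def)
  have dD: "D differentiable (at u)" if "u \<in> U" for u
  proof -
    have u: "cnj u \<noteq> 0" using that by (simp add: U_def)
    show ?thesis unfolding differentiable_def D_def
      by (rule exI) (rule derivative_intros u)+
  qed
  \<comment> \<open>The condition on one coordinate, solved for the parameter: it prescribes the
    imaginary part - 2 f(u) of c D(u) and leaves the real part free, so c = (r - 2 i f(u)) /
    D(u).\<close>
  define g where "g f v = (of_real (snd v) - 2 * \<i> * of_real (f (fst v))) * inverse (D (fst v))"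
    for f :: "complex \<Rightarrow> real" and v :: "complex \<times> real"
  have dg: "g f differentiable (at v)" if f: "f differentiable (at (fst v))" and v: "fst v \<in> U" for f v
  proof -
    obtain f' where f': "(f has_derivative f') (at (fst v))"
      using f differentiable_def by blast
    obtain D' where D': "(D has_derivative D') (at (fst v))"
      using dD[OF v] differentiable_def by blast
    have f2: "((\<lambda>v. f (fst v)) has_derivative (\<lambda>x. f' (fst x))) (at v)"
      by (rule has_derivative_compose[where f = fst and g = f, OF has_derivative_fst[OF has_derivative_ident] f'])
    have D2: "((\<lambda>v. D (fst v)) has_derivative (\<lambda>x. D' (fst x))) (at v)"
      by (rule has_derivative_compose[where f = fst and g = D, OF has_derivative_fst[OF has_derivative_ident] D'])
    show ?thesis
      unfolding differentiable_def g_def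
      by (rule exI) (rule derivative_intros f2 D2 D0[OF v])+
  qed
  define \<Phi> where "\<Phi> = (\<lambda>(u, r\<^sub>1, r\<^sub>2, r\<^sub>3). (g f\<^sub>1 (u, r\<^sub>1), g f\<^sub>2 (u, r\<^sub>2), g f\<^sub>3 (u, r\<^sub>3)))"
  have "\<Phi> differentiable (at x)" if x: "x \<in> U \<times> UNIV" for x
  proof -
    obtain u r\<^sub>1 r\<^sub>2 r\<^sub>3 where xu: "x = (u, r\<^sub>1, r\<^sub>2, r\<^sub>3)" "u \<in> U" using x by (cases x) auto
    obtain g\<^sub>1 where g1: "(g f\<^sub>1 has_derivative g\<^sub>1) (at (u, r\<^sub>1))"
      using dg[of f\<^sub>1 "(u, r\<^sub>1)"] diff(1)[of u] xu(2) by (auto simp: differentiable_def U_def)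
    obtain g\<^sub>2 where g2: "(g f\<^sub>2 has_derivative g\<^sub>2) (at (u, r\<^sub>2))"
      using dg[of f\<^sub>2 "(u, r\<^sub>2)"] diff(2)[of u] xu(2) by (auto simp: differentiable_def U_def)
    obtain g\<^sub>3 where g3: "(g f\<^sub>3 has_derivative g\<^sub>3) (at (u, r\<^sub>3))"
      using dg[of f\<^sub>3 "(u, r\<^sub>3)"] diff(3)[of u] xu(2) by (auto simp: differentiable_def U_def)
    have "((\<lambda>x. g f\<^sub>1 (fst x, fst (snd x))) has_derivative (\<lambda>h. g\<^sub>1 (fst h, fst (snd h)))) (at x)"
      by (rule has_derivative_compose[of "\<lambda>x. (fst x, fst (snd x))" _ _ _ "g f\<^sub>1"])
        (use g1 in \<open>auto simp: xu intro!: derivative_eq_intros\<close>)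
    moreover have "((\<lambda>x. g f\<^sub>2 (fst x, fst (snd (snd x)))) has_derivative (\<lambda>h. g\<^sub>2 (fst h, fst (snd (snd h))))) (at x)"
      by (rule has_derivative_compose[of "\<lambda>x. (fst x, fst (snd (snd x)))" _ _ _ "g f\<^sub>2"])
        (use g2 in \<open>auto simp: xu intro!: derivative_eq_intros\<close>)
    moreover have "((\<lambda>x. g f\<^sub>3 (fst x, snd (snd (snd x)))) has_derivative (\<lambda>h. g\<^sub>3 (fst h, snd (snd (snd h))))) (at x)"
      by (rule has_derivative_compose[of "\<lambda>x. (fst x, snd (snd (snd x)))" _ _ _ "g f\<^sub>3"])
        (use g3 in \<open>auto simp: xu intro!: derivative_eq_intros\<close>)
    ultimately have "((\<lambda>x. (g f\<^sub>1 (fst x, fst (snd x)), g f\<^sub>2 (fst x, fst (snd (snd x))), g f\<^sub>3 (fst x, snd (snd (snd x)))))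
      has_derivative (\<lambda>h. (g\<^sub>1 (fst h, fst (snd h)), g\<^sub>2 (fst h, fst (snd (snd h))), g\<^sub>3 (fst h, snd (snd (snd h)))))) (at x)"
      by (intro has_derivative_Pair)
    moreover have "\<Phi> = (\<lambda>x. (g f\<^sub>1 (fst x, fst (snd x)), g f\<^sub>2 (fst x, fst (snd (snd x))), g f\<^sub>3 (fst x, snd (snd (snd x)))))"
      by (auto simp: \<Phi>_def)
    ultimately show ?thesis unfolding differentiable_def by (intro exI) simp
  qed
  then have "\<Phi> differentiable_on (U \<times> UNIV)"
    by (intro differentiable_at_imp_differentiable_on) blast
  then have neg: "negligible (\<Phi> ` (U \<times> UNIV))"
    by (rule negligible_differentiable_image_lowdim[rotated]) simp
  \<comment> \<open>Removing 0 from the first factor provides the nonzero \<open>c\<^sub>1\<close>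
    that later becomes a leading coefficient.\<close>
  let ?B = "(ball 0 \<epsilon> - {0}) \<times> ball 0 \<epsilon> \<times> ball 0 \<epsilon> :: (complex \<times> complex \<times> complex) set"
  have "open ?B" by (intro open_Times open_Diff) auto
  moreover have "(complex_of_real (\<epsilon> / 2), 0, 0) \<in> ?B" using assms(5) by auto
  ultimately have "\<not> negligible ?B" using open_not_negligible by blast
  then obtain c where c: "c \<in> ?B" "c \<notin> \<Phi> ` (U \<times> UNIV)"
    using neg negligible_subset by blast
  obtain c\<^sub>1 c\<^sub>2 c\<^sub>3 where cc: "c = (c\<^sub>1, c\<^sub>2, c\<^sub>3)" by (cases c)
  have gi: "c = g f (u, Re (c * D u))" if "f u + Im (c * D u) / 2 = 0" "u \<in> U" for f c u
  proof -
    have "c * D u = of_real (Re (c * D u)) - 2 * \<i> * of_real (f u)"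
    proof (rule complex_eqI)
      have "Im (c * D u) = - 2 * f u" using that(1) by linarith
      then show "Im (c * D u) = Im (of_real (Re (c * D u)) - 2 * \<i> * of_real (f u))"
        by (simp del: times_complex.sel) simp
    qed simp
    then have "c * D u * inverse (D u) = g f (u, Re (c * D u))" by (simp add: g_def)
    moreover have "c * D u * inverse (D u) = c" using D0[OF that(2)] by simp
    ultimately show ?thesis by (simp only:)
  qed
  have "\<not> (f\<^sub>1 u + Im (c\<^sub>1 * D u) / 2 = 0 \<and> f\<^sub>2 u + Im (c\<^sub>2 * D u) / 2 = 0 \<and> f\<^sub>3 u + Im (c\<^sub>3 * D u) / 2 = 0)"
    if "u \<in> U" for u
  proof
    assume a: "f\<^sub>1 u + Im (c\<^sub>1 * D u) / 2 = 0 \<and> f\<^sub>2 u + Im (c\<^sub>2 * D u) / 2 = 0 \<and> f\<^sub>3 u + Im (c\<^sub>3 * D u) / 2 = 0"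
    then have "c = \<Phi> (u, Re (c\<^sub>1 * D u), Re (c\<^sub>2 * D u), Re (c\<^sub>3 * D u))"
      unfolding cc \<Phi>_def prod.case using gi[OF _ that] by blast
    then show False using c(2) that by blast
  qed
  then show ?thesis
    using c(1) unfolding cc U_def D_def
    by (intro exI[of _ c\<^sub>1] exI[of _ c\<^sub>2] exI[of _ c\<^sub>3]) auto
qed

section \<open>Trigonometric polynomials and C^1 approximation\<close>

text \<open>On the circle \<open>cnj u\<close> is 1/u, so the product is a Laurent polynomial, and
  the real part of a negative power equals that of a positive power with conjugate coefficient. The
  induction splits off both constant terms and uses u \<open>cnj u\<close> = 1 for the rest.\<close>

lemma Re_mult_cnj_poly:
  fixes p q :: "complex poly"
  shows "\<exists>r. \<forall>t. Re (poly p (cis t) * cnj (poly q (cis t))) = Re (poly r (cis t))"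
proof (induction p arbitrary: q)
  case 0
  then show ?case by (auto intro!: exI[of _ 0])
next
  case (pCons a p)
  obtain b q' where q: "q = pCons b q'" by (cases q)
  obtain r where r: "\<And>t. Re (poly p (cis t) * cnj (poly q' (cis t))) = Re (poly r (cis t))"
    using pCons.IH by blast
  have "Re (poly (pCons a p) (cis t) * cnj (poly q (cis t)))
      = Re (poly (Polynomial.smult (cnj a) q + pCons 0 (Polynomial.smult (cnj b) p) + r) (cis t))" for t
  proof -
    let ?u = "cis t"
    have u: "?u * cnj ?u = 1" by (simp add: cis_cnj cis_mult)
    have "poly (pCons a p) ?u * cnj (poly q ?u)
        = a * cnj (poly q ?u) + ?u * poly p ?u * cnj b + (?u * cnj ?u) * (poly p ?u * cnj (poly q' ?u))"
      by (simp add: q algebra_simps)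
    then have "Re (poly (pCons a p) ?u * cnj (poly q ?u))
        = Re (a * cnj (poly q ?u)) + Re (?u * poly p ?u * cnj b) + Re (poly r ?u)"
      unfolding u using r[of t] by simp
    also have "Re (a * cnj (poly q ?u)) = Re (cnj a * poly q ?u)" by simp
    finally show ?thesis by (simp add: mult_ac)
  qed
  then show ?case by blast
qed

text \<open>Translates the output of the Stone-Weierstrass theorem into real parts of complex
  polynomials. Products use Re a Re b = (Re (a b) + Re (a cnj b)) / 2.\<close>

lemma real_polynomial_function_on_circle:
  fixes g :: "complex \<Rightarrow> real"
  assumes "real_polynomial_function g"
  shows "\<exists>q. \<forall>t. g (cis t) = Re (poly q (cis t))"
  using assms
proof (induction rule: real_polynomial_function.induct)
  case (linear h)
  then interpret bounded_linear h .
  have "h u = Re ((of_real (h 1) - \<i> * of_real (h \<i>)) * u)" for u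
  proof -
    have "h u = h (Re u *\<^sub>R 1 + Im u *\<^sub>R \<i>)"
      by (rule arg_cong[of _ _ h]) (simp add: complex_eq_iff)
    then show ?thesis by (simp only: add scaleR) simp
  qed
  note h = this
  have p: "poly [:0, c:] u = c * u" for c u :: complex by simp
  show ?case
    by (intro exI[of _ "[:0, of_real (h 1) - \<i> * of_real (h \<i>):]"] allI, subst p) (rule h)
next
  case (const c)
  then show ?case by (intro exI[of _ "[:of_real c:]"]) simp
next
  case (add f g)
  then obtain p q where "\<forall>t. f (cis t) = Re (poly p (cis t))" "\<forall>t. g (cis t) = Re (poly q (cis t))"
    by blast
  then show ?case by (intro exI[of _ "p + q"]) simp
next
  case (mult f g)
  then obtain p q where pq: "\<forall>t. f (cis t) = Re (poly p (cis t))" "\<forall>t. g (cis t) = Re (poly q (cis t))"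
    by blast
  obtain r where r: "\<And>t. Re (poly p (cis t) * cnj (poly q (cis t))) = Re (poly r (cis t))"
    using Re_mult_cnj_poly by blast
  have m: "Re a * Re b = (Re (a * b) + Re (a * cnj b)) / 2" for a b by simp
  have "f (cis t) * g (cis t) = Re (poly (Polynomial.smult (1/2) (p * q + r)) (cis t))" for t
  proof -
    have "f (cis t) * g (cis t)
        = (Re (poly p (cis t) * poly q (cis t)) + Re (poly p (cis t) * cnj (poly q (cis t)))) / 2"
      using pq m[of "poly p (cis t)" "poly q (cis t)"] by (simp only:)
    also have "\<dots> = (Re (poly (p * q) (cis t)) + Re (poly r (cis t))) / 2"
      by (simp only: r poly_mult)
    also have "\<dots> = Re (poly (Polynomial.smult (1/2) (p * q + r)) (cis t))"
      by (simp only: poly_smult poly_add) (simp add: add_divide_distrib)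
    finally show ?thesis .
  qed
  then show ?case by blast
qed

text \<open>Equality of \<open>cis\<close> stands for congruence modulo the period, so functions on
  the circle and periodic functions can be exchanged without angle bookkeeping.\<close>

lemma periodic_cis:
  fixes f :: "real \<Rightarrow> 'a"
  assumes "\<And>t. f (t + 2 * pi) = f t" "cis s = cis t"
  shows "f s = f t"
proof -
  have n: "f (t + 2 * pi * of_nat n) = f t" for t n
  proof (induction n)
    case (Suc n)
    have "t + 2 * pi * of_nat (Suc n) = (t + 2 * pi * of_nat n) + 2 * pi" by (simp add: algebra_simps)
    then show ?case using Suc assms(1) by (simp only:)
  qed simp
  have z: "f (t + 2 * pi * of_int n) = f t" for t n
  proof (cases "n \<ge> 0")
    case True
    then show ?thesis using n[of t "nat n"] by simp
  next
    case False
    then show ?thesis using n[of "t + 2 * pi * of_int n" "nat (- n)"] by simp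
  qed
  obtain n :: int where "s = t + 2 * pi * of_int n"
  proof -
    have "sin s = sin t \<and> cos s = cos t" using assms(2) by (simp add: complex_eq_iff)
    then show ?thesis using that unfolding sin_cos_eq_iff by blast
  qed
  then show ?thesis using z by simp
qed

lemma cis_Arg_unit:
  assumes "cmod v = 1"
  shows "cis (Arg v) = v"
proof -
  have "v \<noteq> 0" using assms by auto
  from cis_Arg[OF this] have "cis (Arg v) = sgn v" .
  also have "\<dots> = v" by (simp add: sgn_div_norm assms)
  finally show ?thesis .
qed

text \<open>The factor is f(Arg u). At u = -1, where \<open>Arg\<close> jumps, the continuous angle
  Arg(-u) + pi gives the same values by periodicity.\<close>

lemma continuous_periodic_factor:
  fixes f :: "real \<Rightarrow> 'a::topological_space"
  assumes per: "\<And>t. f (t + 2 * pi) = f t" and cont: "continuous_on UNIV f"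
  shows "\<exists>g. continuous_on (sphere 0 1) g \<and> (\<forall>t. g (cis t) = f t)"
proof (intro exI conjI allI)
  let ?g = "\<lambda>u. f (Arg u)"
  show "?g (cis t) = f t" for t
    by (rule periodic_cis[of f, OF per]) (simp add: cis_Arg_unit)
  have fc: "isCont f t" for t using cont by (simp add: continuous_on_eq_continuous_at)
  have c: "continuous (at u) ?g" if "Arg u \<noteq> pi" "u \<noteq> 0" for u
  proof -
    have "u \<notin> \<real>\<^sub>\<le>\<^sub>0" using that by (auto simp: complex_nonpos_Reals_iff Arg_eq_pi complex_eq_iff)
    then have "isCont Arg u" by (rule continuous_at_Arg)
    then show ?thesis using isCont_o2[OF _ fc] by blast
  qed
  have "continuous (at u within sphere 0 1) ?g" if u: "u \<in> sphere 0 1" for u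
  proof (cases "Arg u = pi")
    case False
    moreover have "u \<noteq> 0" using u by auto
    ultimately show ?thesis by (rule continuous_at_imp_continuous_at_within[OF c])
  next
    case True
    have un: "cmod u = 1" using u by simp
    have "u = -1" using cis_Arg_unit[OF un] True by simp
    then have "- u = 1" by simp
    then have "isCont Arg (- u)" by (simp only:) (intro continuous_at_Arg, simp)
    then have "isCont (\<lambda>u. Arg (- u) + pi) u"
      by (intro continuous_add continuous_const isCont_o2[of u uminus Arg] continuous_minus continuous_ident)
    from isCont_o2[OF this fc] have "isCont (\<lambda>u. f (Arg (- u) + pi)) u" .
    then have "continuous (at u within sphere 0 1) (\<lambda>u. f (Arg (- u) + pi))"
      by (rule continuous_at_imp_continuous_at_within)
    then show ?thesis
    proof (rule continuous_transform_within[OF _ less_numeral_extra(1) u])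
      fix v :: complex assume "v \<in> sphere 0 1"
      then have "cmod v = 1" by simp
      then have "cis (Arg v) = v" "cis (Arg (- v)) = - v"
        using cis_Arg_unit[of v] cis_Arg_unit[of "- v"] by simp_all
      moreover have "cis (Arg (- v) + pi) = - cis (Arg (- v))" by (simp flip: cis_mult)
      ultimately show "f (Arg (- v) + pi) = f (Arg v)"
        by (intro periodic_cis[of f, OF per]) simp
    qed
  qed
  then show "continuous_on (sphere 0 1) ?g" by (simp add: continuous_on_eq_continuous_within)
qed

text \<open>The left side is the derivative of Q(\<open>cis\<close> t) in t. The constant
  coefficient has no periodic primitive and is therefore subtracted.\<close>

lemma poly_antiderivative_on_circle:
  fixes q :: "complex poly"
  shows "\<exists>Q. \<forall>u. \<i> * u * poly (pderiv Q) u = poly q u - coeff q 0"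
proof (intro exI allI)
  let ?Q = "\<Sum>k=1..degree q. Polynomial.monom (coeff q k / (\<i> * of_nat k)) k"
  fix u
  have "\<i> * u * poly (pderiv ?Q) u
      = (\<Sum>k=1..degree q. \<i> * u * poly (pderiv (Polynomial.monom (coeff q k / (\<i> * of_nat k)) k)) u)"
  proof -
    have "pderiv (\<Sum>k\<in>A. p k) = (\<Sum>k\<in>A. pderiv (p k))" for A :: "nat set" and p :: "nat \<Rightarrow> complex poly"
      by (induction A rule: infinite_finite_induct) (auto simp: pderiv_add)
    then show ?thesis by (simp add: poly_sum sum_distrib_left)
  qed
  also have "\<dots> = (\<Sum>k=1..degree q. coeff q k * u ^ k)"
  proof (rule sum.cong[OF refl])
    fix k assume "k \<in> {1..degree q}"
    then obtain m where "k = Suc m" by (cases k) auto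
    then show "\<i> * u * poly (pderiv (Polynomial.monom (coeff q k / (\<i> * of_nat k)) k)) u = coeff q k * u ^ k"
      by (simp add: pderiv_monom poly_monom mult_ac del: of_nat_Suc)
  qed
  also have "\<dots> = poly q u - coeff q 0"
    unfolding poly_altdef by (simp add: atMost_atLeast0 sum.atLeast_Suc_atMost)
  finally show "\<i> * u * poly (pderiv ?Q) u = poly q u - coeff q 0" .
qed

lemma Re_poly_cis_derivative:
  "((\<lambda>t. Re (poly q (cis t))) has_real_derivative Re (\<i> * cis t * poly (pderiv q) (cis t))) (at t)"
proof -
  have "(cis has_vector_derivative \<i> * cis t) (at t)"
    by (auto intro!: derivative_eq_intros simp: has_vector_derivative_def)
  from field_vector_diff_chain_at[OF this poly_DERIV[of q "cis t"]]
  have "((\<lambda>t. poly q (cis t)) has_vector_derivative \<i> * cis t * poly (pderiv q) (cis t)) (at t)"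
    by (simp add: o_def)
  then show ?thesis
    unfolding has_real_derivative_iff_has_vector_derivative
    by (rule bounded_linear.has_vector_derivative[OF bounded_linear_Re])
qed

text \<open>The derivative is approximated uniformly and then integrated. The primitive is periodic
  only after removal of the constant coefficient, which is small because \<open>f'\<close> is the
  derivative of a periodic function.\<close>

lemma trigonometric_C1_approximation:
  fixes f f' :: "real \<Rightarrow> real"
  assumes der: "\<And>t. (f has_real_derivative f' t) (at t)" and cont: "continuous_on UNIV f'"
    and per: "\<And>t. f (t + 2 * pi) = f t" and "e > 0"
  shows "\<exists>q. \<forall>t. \<bar>Re (poly q (cis t)) - f t\<bar> < e \<and>
    \<bar>Re (\<i> * cis t * poly (pderiv q) (cis t)) - f' t\<bar> < e"
proof -
  \<comment> \<open>The derivative error 2 \<eta>, accumulated over a period shorter than 8, stays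
    below 16 \<eta>.\<close>
  define \<eta> where "\<eta> = e / 20"
  have \<eta>: "\<eta> > 0" using assms(4) by (simp add: \<eta>_def)
  have per': "f' (t + 2 * pi) = f' t" for t
  proof -
    have "((\<lambda>x. f (x + 2 * pi)) has_real_derivative f' (t + 2 * pi)) (at t)"
      using der[of "t + 2 * pi"] by (simp add: DERIV_shift)
    then show ?thesis using DERIV_unique der[of t] per by simp
  qed
  obtain g where g: "continuous_on (sphere 0 1) g" "\<And>t. g (cis t) = f' t"
    using continuous_periodic_factor[OF per' cont] by blast
  obtain h where h: "real_polynomial_function h" "\<And>u. u \<in> sphere 0 1 \<Longrightarrow> \<bar>g u - h u\<bar> < \<eta>"
    using Stone_Weierstrass_real_polynomial_function[OF compact_sphere g(1) \<eta>] by blast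
  obtain q where q: "\<And>t. h (cis t) = Re (poly q (cis t))"
    using real_polynomial_function_on_circle[OF h(1)] by blast
  have close: "\<bar>f' t - Re (poly q (cis t))\<bar> < \<eta>" for t
    using h(2)[of "cis t"] by (simp add: g(2) q)
  obtain Q where Q: "\<And>u. \<i> * u * poly (pderiv Q) u = poly q u - coeff q 0"
    using poly_antiderivative_on_circle by blast
  define r where "r t = f t - Re (poly Q (cis t))" for t
  define r' where "r' t = f' t - Re (poly q (cis t)) + Re (coeff q 0)" for t
  have r: "(r has_real_derivative r' t) (at t)" for t
    unfolding r_def r'_def
    using DERIV_diff[OF der Re_poly_cis_derivative[of Q]] unfolding Q by (simp add: algebra_simps)
  have rper: "r (t + 2 * pi) = r t" for t
    by (simp add: r_def per flip: cis_mult)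
  have mvt: "\<exists>z. a < z \<and> z < b \<and> r b - r a = (b - a) * r' z" if "a < b" for a b
    using MVT2[of a b r r'] that r by blast
  \<comment> \<open>\<open>r\<close> takes the same value at both ends of a period, so
    \<open>r'\<close> has a zero; there the constant coefficient is itself an approximation
    error.\<close>
  obtain z where "r (0 + 2 * pi) - r 0 = (2 * pi) * r' z" using mvt[of 0 "2 * pi"] by auto
  then have "r' z = 0" unfolding rper by simp
  then have c0: "\<bar>Re (coeff q 0)\<bar> < \<eta>" using close[of z] by (simp add: r'_def)
  have r'b: "\<bar>r' t\<bar> < 2 * \<eta>" for t using close[of t] c0 by (simp add: r'_def)
  have rb: "\<bar>r t - r 0\<bar> < e" for t
  proof -
    obtain s where s: "0 < s" "s \<le> 2 * pi" "cis s = cis t"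
    proof -
      have a: "cis (Arg (cis t)) = cis t" by (simp add: cis_Arg_unit)
      show ?thesis
      proof (cases "Arg (cis t) > 0")
        case True
        then show ?thesis using that[of "Arg (cis t)"] Arg_le_pi[of "cis t"] a by auto
      next
        case False
        have "cis (Arg (cis t) + 2 * pi) = cis t" using a by (simp flip: cis_mult)
        then show ?thesis using that[of "Arg (cis t) + 2 * pi"] False mpi_less_Arg[of "cis t"] by auto
      qed
    qed
    obtain z where z: "r s - r 0 = s * r' z" using mvt[of 0 s] s by auto
    have "\<bar>r s - r 0\<bar> = s * \<bar>r' z\<bar>" using s by (simp add: z abs_mult)
    also have "\<dots> \<le> (2 * pi) * (2 * \<eta>)" using s r'b[of z] by (intro mult_mono) auto
    also have "\<dots> < 20 * \<eta>" using pi_less_4 \<eta> by simp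
    finally show ?thesis using periodic_cis[of r s t, OF rper s(3)] by (simp add: \<eta>_def)
  qed
  \<comment> \<open>Integration determines the value only up to a constant; adding r(0) makes the
    error vanish at 0.\<close>
  let ?P = "[:of_real (r 0):] + Q"
  have "Re (poly ?P (cis t)) - f t = - (r t - r 0)" for t by (simp add: r_def)
  then have "\<bar>Re (poly ?P (cis t)) - f t\<bar> < e" for t using rb[of t] by (simp only: abs_minus_cancel)
  moreover have "Re (\<i> * cis t * poly (pderiv ?P) (cis t)) - f' t = - r' t" for t
  proof -
    have "pderiv ?P = pderiv Q" by (simp add: pderiv_add pderiv_pCons)
    then show ?thesis by (simp only: Q r'_def) simp
  qed
  then have "\<bar>Re (\<i> * cis t * poly (pderiv ?P) (cis t)) - f' t\<bar> < e" for t
    using r'b[of t] \<eta> by (simp add: \<eta>_def)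
  ultimately show ?thesis by blast
qed

section \<open>Complexified circle curves and their equation\<close>

text \<open>This is a Laurent polynomial in u: conjugating twice leaves a polynomial in 1/u with
  conjugate coefficients. It extends Re q holomorphically from the circle to all nonzero u.\<close>

definition circle_extension :: "complex poly \<Rightarrow> complex \<Rightarrow> complex" where
  "circle_extension q u = (poly q u + cnj (poly q (inverse (cnj u)))) / 2"

text \<open>The product of u^d with \<open>circle_extension\<close>. The bound d is nominal, so the
  same power clears the denominators of all three coordinates.\<close>

definition circle_extension_numerator :: "nat \<Rightarrow> complex poly \<Rightarrow> complex poly" where
  "circle_extension_numerator d q =
     (\<Sum>k\<le>d. Polynomial.monom (coeff q k / 2) (d + k) + Polynomial.monom (cnj (coeff q k) / 2) (d - k))"

lemma circle_extension_on_circle: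
  assumes "cmod u = 1"
  shows "circle_extension q u = of_real (Re (poly q u))"
proof -
  have "u * cnj u = 1" using assms by (simp add: complex_norm_square[symmetric])
  then have "inverse (cnj u) = u" by (metis inverse_unique mult.commute)
  then show ?thesis by (simp add: circle_extension_def complex_add_cnj)
qed

lemma Im_circle_extension:
  "Im (circle_extension q u) = (Im (poly q u) - Im (poly q (inverse (cnj u)))) / 2"
  by (simp add: circle_extension_def)

lemma poly_circle_extension_numerator:
  assumes "degree q \<le> d" "u \<noteq> 0"
  shows "poly (circle_extension_numerator d q) u = u ^ d * circle_extension q u"
proof -
  have q: "poly q x = (\<Sum>k\<le>d. coeff q k * x ^ k)" for x
    unfolding poly_altdef
    by (rule sum.mono_neutral_left) (use assms in \<open>auto simp: coeff_eq_0\<close>)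
  have "cnj (poly q (inverse (cnj u))) = (\<Sum>k\<le>d. cnj (coeff q k) * inverse u ^ k)"
    unfolding q by simp
  then have "u ^ d * circle_extension q u
      = (\<Sum>k\<le>d. u ^ d * (coeff q k * u ^ k / 2) + u ^ d * (cnj (coeff q k) * inverse u ^ k / 2))"
    unfolding circle_extension_def q
    by (simp add: sum.distrib sum_distrib_left add_divide_distrib sum_divide_distrib distrib_left)
  also have "\<dots> = poly (circle_extension_numerator d q) u"
    unfolding circle_extension_numerator_def poly_sum
  proof (rule sum.cong[OF refl])
    fix k assume "k \<in> {..d}"
    then have "u ^ d = u ^ (d - k) * u ^ k" by (simp flip: power_add)
    then have "u ^ d * inverse u ^ k = u ^ (d - k)" using assms(2)
      by (simp add: power_inverse)
    then show "u ^ d * (coeff q k * u ^ k / 2) + u ^ d * (cnj (coeff q k) * inverse u ^ k / 2)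
      = poly (Polynomial.monom (coeff q k / 2) (d + k) + Polynomial.monom (cnj (coeff q k) / 2) (d - k)) u"
      by (simp add: poly_monom power_add mult_ac)
  qed
  finally show ?thesis by simp
qed

text \<open>Only k = d contributes to the top and to the bottom coefficient. When
  \<open>coeff q d\<close> is nonzero, the first fixes the degree as 2 d and the second excludes the
  root 0.\<close>

lemma circle_extension_numerator_coeffs:
  assumes "d > 0"
  shows "coeff (circle_extension_numerator d q) (2 * d) = coeff q d / 2"
    and "poly (circle_extension_numerator d q) 0 = cnj (coeff q d) / 2"
    and "degree (circle_extension_numerator d q) \<le> 2 * d"
proof -
  have "coeff (circle_extension_numerator d q) (2 * d) =
      (\<Sum>k\<le>d. if k = d then coeff q d / 2 else 0)"
    unfolding circle_extension_numerator_def coeff_sum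
    by (rule sum.cong) (use assms in auto)
  then show "coeff (circle_extension_numerator d q) (2 * d) = coeff q d / 2" by simp
  have "poly (circle_extension_numerator d q) 0 = (\<Sum>k\<le>d. if k = d then cnj (coeff q d) / 2 else 0)"
    unfolding circle_extension_numerator_def poly_sum
    by (rule sum.cong) (use assms in \<open>auto simp: poly_monom zero_power\<close>)
  then show "poly (circle_extension_numerator d q) 0 = cnj (coeff q d) / 2" by simp
  show "degree (circle_extension_numerator d q) \<le> 2 * d"
    unfolding circle_extension_numerator_def
    by (intro degree_sum_le degree_add_le degree_monom_le[THEN order_trans]) auto
qed

text \<open>
  The third coordinate may carry a multiple of \<open>tan (\<theta> / 2)\<close>, whose complexification has its only
  pole at \<open>u = -1\<close>; this is the point that an unbounded curve sends to infinity.
\<close>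

definition circle_curve :: "real \<Rightarrow> complex poly \<Rightarrow> complex poly \<Rightarrow> complex poly \<Rightarrow> complex \<Rightarrow> complex \<times> real" where
  "circle_curve a q\<^sub>1 q\<^sub>2 q\<^sub>3 u = (Complex (Re (poly q\<^sub>1 u)) (Re (poly q\<^sub>2 u)),
     Re (poly q\<^sub>3 u) + a * (Im u / (1 + Re u)))"

definition circle_dom :: "real \<Rightarrow> complex set" where
  "circle_dom a = {u. cmod u = 1 \<and> (a \<noteq> 0 \<longrightarrow> u \<noteq> -1)}"

text \<open>The left side is the Cayley transform, which takes \<open>cis\<close> \<theta> to
  tan(\<theta>/2); it extends the last term of \<open>circle_curve\<close> off the circle.\<close>

lemma tan_half_extension_on_circle:
  assumes "cmod u = 1" "u \<noteq> -1"
  shows "- \<i> * (u - 1) / (u + 1) = of_real (Im u / (1 + Re u))"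
proof -
  have c: "(Re u)\<^sup>2 + (Im u)\<^sup>2 = 1" using assms(1) by (simp add: cmod_def)
  have r: "1 + Re u \<noteq> 0"
  proof
    assume "1 + Re u = 0"
    then have "Re u = -1" by simp
    then have "u = -1" using c by (simp add: complex_eq_iff)
    then show False using assms(2) by simp
  qed
  have "u + 1 \<noteq> 0" using assms(2) by (simp add: eq_neg_iff_add_eq_0[symmetric])
  moreover have "- \<i> * (u - 1) * of_real (1 + Re u) = of_real (Im u) * (u + 1)"
    using c by (simp add: complex_eq_iff power2_eq_square algebra_simps)
  ultimately show ?thesis using r by (simp add: field_simps del: of_real_add)
qed

lemma circle_curve_algebraic_perturbation:
  assumes "\<epsilon> > 0"
  shows "\<exists>q\<^sub>1' q\<^sub>2' q\<^sub>3'. (\<forall>(q, q') \<in> {(q\<^sub>1, q\<^sub>1'), (q\<^sub>2, q\<^sub>2'), (q\<^sub>3, q\<^sub>3')}. \<forall>t.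
      \<bar>Re (poly q' (cis t)) - Re (poly q (cis t))\<bar> < \<epsilon> \<and>
      \<bar>Re (\<i> * cis t * poly (pderiv q') (cis t)) - Re (\<i> * cis t * poly (pderiv q) (cis t))\<bar> < \<epsilon>) \<and>
    algebraic_in_heis (heis_param ` circle_curve a q\<^sub>1' q\<^sub>2' q\<^sub>3' ` circle_dom a)"
proof -
  \<comment> \<open>Larger than all three degrees, so that after adding c u^d the coefficient at d
    is exactly c.\<close>
  define d where "d = Suc (degree q\<^sub>1 + degree q\<^sub>2 + degree q\<^sub>3)"
  define T where "T u = of_real a * (- \<i> * (u - 1) / (u + 1))" for u :: complex
  define f where "f q u = Im (circle_extension q u)" for q u
  have df: "f q differentiable (at u)" if "u \<noteq> 0" for q u
  proof -
    have u: "cnj u \<noteq> 0" using that by simp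
    obtain p' where p: "(poly q has_derivative p') (at (inverse (cnj u)))"
      using poly_DERIV[of q "inverse (cnj u)"] has_field_derivative_imp_has_derivative by blast
    obtain p'' where p2: "(poly q has_derivative p'') (at u)"
      using poly_DERIV[of q u] has_field_derivative_imp_has_derivative by blast
    obtain i' where i: "((\<lambda>u. inverse (cnj u)) has_derivative i') (at u)"
      using Deriv.has_derivative_inverse[where f = cnj and x = u, OF u has_derivative_cnj[OF has_derivative_ident]]
      by (rule that)
    have "((\<lambda>u. poly q (inverse (cnj u))) has_derivative (\<lambda>x. p' (i' x))) (at u)"
      by (rule has_derivative_compose[where g = "poly q", OF i p])
    from has_derivative_mult_right[OF has_derivative_diff[OF has_derivative_Im[OF p2] has_derivative_Im[OF this]], of "1/2"]
    have "(\<lambda>u. 1 / 2 * (Im (poly q u) - Im (poly q (inverse (cnj u))))) differentiable (at u)"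
      unfolding differentiable_def by (intro exI)
    moreover have "f q = (\<lambda>u. 1 / 2 * (Im (poly q u) - Im (poly q (inverse (cnj u)))))"
      unfolding f_def Im_circle_extension by (rule ext) simp
    ultimately show ?thesis by (simp only:)
  qed
  have dT: "(\<lambda>u. Im (T u)) differentiable (at u)" if "cmod u \<noteq> 1" for u
  proof -
    have u: "u + 1 \<noteq> 0" using that by (auto simp: eq_neg_iff_add_eq_0[symmetric])
    show ?thesis unfolding differentiable_def T_def
      by (rule exI) (rule derivative_intros u)+
  qed
  \<comment> \<open>On the circle c u^d has modulus |c| and its derivative along the circle has
    modulus d |c|; both are below \<epsilon> if (d + 1) |c| is.\<close>
  have "\<epsilon> / (real d + 1) > 0" using assms by simp
  from generic_perturbation[of "f q\<^sub>1" "f q\<^sub>2" "\<lambda>u. f q\<^sub>3 u + Im (T u)" d, OF df df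
      differentiable_add[OF df dT] _ this]
  obtain c\<^sub>1 c\<^sub>2 c\<^sub>3 where c: "cmod c\<^sub>1 < \<epsilon> / (real d + 1)" "cmod c\<^sub>2 < \<epsilon> / (real d + 1)"
      "cmod c\<^sub>3 < \<epsilon> / (real d + 1)" "c\<^sub>1 \<noteq> 0"
    and generic: "\<And>u. u \<noteq> 0 \<Longrightarrow> cmod u \<noteq> 1 \<Longrightarrow> \<not> (
      f q\<^sub>1 u + Im (c\<^sub>1 * (u ^ d - inverse (cnj u) ^ d)) / 2 = 0 \<and>
      f q\<^sub>2 u + Im (c\<^sub>2 * (u ^ d - inverse (cnj u) ^ d)) / 2 = 0 \<and>
      f q\<^sub>3 u + Im (T u) + Im (c\<^sub>3 * (u ^ d - inverse (cnj u) ^ d)) / 2 = 0)"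
    unfolding d_def by blast
  define Q where "Q q c = q + monom c d" for q :: "complex poly" and c
  have close: "\<bar>Re (poly (Q q c) (cis t)) - Re (poly q (cis t))\<bar> < \<epsilon> \<and>
      \<bar>Re (\<i> * cis t * poly (pderiv (Q q c)) (cis t)) - Re (\<i> * cis t * poly (pderiv q) (cis t))\<bar> < \<epsilon>"
    if "cmod c < \<epsilon> / (real d + 1)" for q c t
  proof -
    have cd: "(real d + 1) * cmod c < \<epsilon>" using that by (simp add: field_simps)
    have "0 \<le> real d * cmod c" by simp
    then have c1: "cmod c < \<epsilon>" and c2: "real d * cmod c < \<epsilon>"
      using cd norm_ge_zero[of c] unfolding distrib_right by linarith+
    have 1: "Re (poly (Q q c) (cis t)) - Re (poly q (cis t)) = Re (c * cis t ^ d)"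
      by (simp add: Q_def poly_monom)
    have 2: "Re (\<i> * cis t * poly (pderiv (Q q c)) (cis t)) - Re (\<i> * cis t * poly (pderiv q) (cis t))
        = Re (\<i> * cis t * (of_nat d * c * cis t ^ (d - 1)))"
      by (simp only: Q_def pderiv_add pderiv_monom poly_add poly_monom distrib_left plus_complex.sel)
    have "\<bar>Re (c * cis t ^ d)\<bar> \<le> cmod (c * cis t ^ d)" by (rule abs_Re_le_cmod)
    also have "\<dots> = cmod c" by (simp add: norm_mult norm_power)
    finally have 3: "\<bar>Re (c * cis t ^ d)\<bar> < \<epsilon>" using c1 by linarith
    have "\<bar>Re (\<i> * cis t * (of_nat d * c * cis t ^ (d - 1)))\<bar> \<le> cmod (\<i> * cis t * (of_nat d * c * cis t ^ (d - 1)))"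
      by (rule abs_Re_le_cmod)
    also have "\<dots> = real d * cmod c" by (simp add: norm_mult norm_power)
    finally show ?thesis unfolding 1 2 using 3 c2 by linarith
  qed
  have dQ: "degree (Q q c) \<le> d" if "degree q \<le> d" for q c
    unfolding Q_def using that by (intro degree_add_le degree_monom_le)
  have fQ: "Im (circle_extension (Q q c) u) = f q u + Im (c * (u ^ d - inverse (cnj u) ^ d)) / 2" for q c u
    by (simp only: f_def Im_circle_extension Q_def poly_add poly_monom plus_complex.sel right_diff_distrib
        minus_complex.sel) (simp only: add_divide_distrib diff_divide_distrib)
  let ?N = "circle_extension_numerator d"
  let ?q\<^sub>1 = "Q q\<^sub>1 c\<^sub>1" and ?q\<^sub>2 = "Q q\<^sub>2 c\<^sub>2" and ?q\<^sub>3 = "Q q\<^sub>3 c\<^sub>3"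
  have dq: "degree ?q\<^sub>1 \<le> d" "degree ?q\<^sub>2 \<le> d" "degree ?q\<^sub>3 \<le> d"
    by (intro dQ; simp add: d_def)+
  have dpos: "d > 0" by (simp add: d_def)
  have lc: "coeff ?q\<^sub>1 d = c\<^sub>1"
    by (simp add: Q_def d_def coeff_eq_0)
  \<comment> \<open>The denominator of the tangent term, inserted only when that term is present;
    otherwise it would add the spurious root -1.\<close>
  define L :: "complex poly" where "L = (if a = 0 then 1 else [:1, 1:])"
  define C\<^sub>0 where "C\<^sub>0 = L * ?N ?q\<^sub>3 + [:of_real a * (- \<i>):] * ([:-1, 1:] * monom 1 d)"
  define C\<^sub>1 where "C\<^sub>1 = L * monom 1 d"
  \<comment> \<open>The degree hypothesis of the elimination: the numerator has the nonzero
    coefficient \<open>c\<^sub>1\<close> / 2 at 2 d, and 2 d > d.\<close>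
  have "degree (monom 1 d :: complex poly) < degree (?N ?q\<^sub>1)"
  proof -
    have "coeff (?N ?q\<^sub>1) (2 * d) \<noteq> 0"
      unfolding circle_extension_numerator_coeffs(1)[OF dpos] lc using c(4) by simp
    then have "2 * d \<le> degree (?N ?q\<^sub>1)" by (rule le_degree)
    then show ?thesis using dpos by (simp add: degree_monom_eq)
  qed
  from cpoly_elimination[OF this cpoly_Re[OF cpoly_vars(1)] cpoly_Im[OF cpoly_vars(1)] cpoly_Re[OF cpoly_vars(3)],
      of "?N ?q\<^sub>2" "monom 1 d" C\<^sub>0 C\<^sub>1]
  obtain p where p: "cpoly p" "\<And>x. p x = 0 \<longleftrightarrow> (\<exists>u.
      poly (?N ?q\<^sub>1) u = of_real (Re (fst x)) * poly (monom 1 d) u \<and>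
      poly (?N ?q\<^sub>2) u = of_real (Im (fst x)) * poly (monom 1 d) u \<and>
      poly C\<^sub>0 u = of_real (Re (snd x)) * poly C\<^sub>1 u)" by blast
  have C: "poly C\<^sub>0 u = s * poly C\<^sub>1 u \<longleftrightarrow> circle_extension ?q\<^sub>3 u + T u = s"
    if u: "u \<noteq> 0" "a \<noteq> 0 \<longrightarrow> u \<noteq> -1" for u s
  proof -
    have L: "poly L u \<noteq> 0" using u(2) by (auto simp: L_def eq_neg_iff_add_eq_0[symmetric] add.commute[of 1])
    have LT: "of_real a * (- \<i>) * (u - 1) = poly L u * T u"
    proof (cases "a = 0")
      case False
      then have "u + 1 \<noteq> 0" using u(2) by (simp add: eq_neg_iff_add_eq_0[symmetric])
      then show ?thesis using False by (simp add: L_def T_def add.commute)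
    qed (simp add: T_def)
    have "poly C\<^sub>0 u = poly L u * (u ^ d * circle_extension ?q\<^sub>3 u) + (of_real a * (- \<i>) * (u - 1)) * u ^ d"
      unfolding C\<^sub>0_def poly_add poly_mult poly_circle_extension_numerator[OF dq(3) u(1)]
      by (simp add: poly_monom mult_ac)
    also have "\<dots> = u ^ d * poly L u * (circle_extension ?q\<^sub>3 u + T u)"
      unfolding LT by (simp add: algebra_simps)
    finally have "poly C\<^sub>0 u = u ^ d * poly L u * (circle_extension ?q\<^sub>3 u + T u)" .
    moreover have "s * poly C\<^sub>1 u = u ^ d * poly L u * s"
      by (simp add: C\<^sub>1_def poly_monom mult_ac)
    moreover have "u ^ d * poly L u \<noteq> 0" using L u(1) by simp
    ultimately show ?thesis by (simp only: mult_cancel_left) simp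
  qed
  have N: "poly (?N q) u = x * poly (monom 1 d) u \<longleftrightarrow> circle_extension q u = x"
    if "degree q \<le> d" "u \<noteq> 0" for q u x
    unfolding poly_circle_extension_numerator[OF that] using that(2) by (simp add: poly_monom mult.commute[of x])
  have T: "T u = of_real (a * (Im u / (1 + Re u)))" if "u \<in> circle_dom a" for u
  proof (cases "a = 0")
    case False
    then show ?thesis unfolding T_def using that
      by (subst tan_half_extension_on_circle) (simp_all add: circle_dom_def)
  qed (simp add: T_def)
  have key: "p x = 0 \<longleftrightarrow> (\<exists>u\<in>circle_dom a. heis_chart x = circle_curve a ?q\<^sub>1 ?q\<^sub>2 ?q\<^sub>3 u)" for x
  proof
    assume "p x = 0"
    then obtain u where u: "poly (?N ?q\<^sub>1) u = of_real (Re (fst x)) * poly (monom 1 d) u"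
      "poly (?N ?q\<^sub>2) u = of_real (Im (fst x)) * poly (monom 1 d) u"
      "poly C\<^sub>0 u = of_real (Re (snd x)) * poly C\<^sub>1 u" using p(2) by blast
    \<comment> \<open>At 0 the first numerator equals \<open>cnj c\<^sub>1\<close> / 2 while the
      power u^d vanishes.\<close>
    have u0: "u \<noteq> 0"
    proof
      assume "u = 0"
      then have "cnj c\<^sub>1 / 2 = 0"
        using u(1) circle_extension_numerator_coeffs(2)[OF dpos, of ?q\<^sub>1] lc dpos
        by (simp add: poly_monom)
      then show False using c(4) by simp
    qed
    \<comment> \<open>At the pole \<open>L\<close> kills every term of the third equation except the
      numerator of the Cayley transform, which is nonzero there.\<close>
    have u1: "u \<noteq> -1" if "a \<noteq> 0"
    proof
      assume "u = -1"
      then have "of_real a * (- \<i>) * (-2) * (-1::complex) ^ d = 0"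
        using u(3) that by (simp add: C\<^sub>0_def C\<^sub>1_def L_def poly_monom)
      then show False using that by simp
    qed
    have u1': "a \<noteq> 0 \<longrightarrow> u \<noteq> -1" using u1 by blast
    note e = u(1)[unfolded N[OF dq(1) u0]] u(2)[unfolded N[OF dq(2) u0]]
      C[THEN iffD1, OF u0 u1' u(3)]
    \<comment> \<open>The eliminated equations say that the extended coordinates take real values at
      \<open>u\<close>, which genericity forbids off the circle.\<close>
    have "cmod u = 1"
    proof (rule ccontr)
      assume "cmod u \<noteq> 1"
      moreover have "Im (circle_extension ?q\<^sub>1 u) = 0" "Im (circle_extension ?q\<^sub>2 u) = 0"
        "Im (circle_extension ?q\<^sub>3 u) + Im (T u) = 0"
        using arg_cong[OF e(1), of Im] arg_cong[OF e(2), of Im] arg_cong[OF e(3), of Im]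
        by simp_all
      ultimately show False using generic[of u] u0 unfolding fQ by (simp add: ac_simps)
    qed
    then have dom: "u \<in> circle_dom a" using u1 by (simp add: circle_dom_def)
    have "heis_chart x = circle_curve a ?q\<^sub>1 ?q\<^sub>2 ?q\<^sub>3 u"
      using e unfolding circle_extension_on_circle[OF \<open>cmod u = 1\<close>] T[OF dom] of_real_add[symmetric] of_real_eq_iff
      by (simp add: heis_chart_def circle_curve_def split_def)
    then show "\<exists>u\<in>circle_dom a. heis_chart x = circle_curve a ?q\<^sub>1 ?q\<^sub>2 ?q\<^sub>3 u" using dom by blast
  next
    assume "\<exists>u\<in>circle_dom a. heis_chart x = circle_curve a ?q\<^sub>1 ?q\<^sub>2 ?q\<^sub>3 u"
    then obtain u where u: "u \<in> circle_dom a" "heis_chart x = circle_curve a ?q\<^sub>1 ?q\<^sub>2 ?q\<^sub>3 u" by blast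
    have un: "cmod u = 1" and u1: "a \<noteq> 0 \<longrightarrow> u \<noteq> -1" using u(1) by (auto simp: circle_dom_def)
    have u0: "u \<noteq> 0" using un by auto
    have "fst x = Complex (Re (poly ?q\<^sub>1 u)) (Re (poly ?q\<^sub>2 u))"
      "Re (snd x) = Re (poly ?q\<^sub>3 u) + a * (Im u / (1 + Re u))"
      using u(2) by (auto simp: heis_chart_def circle_curve_def split_def)
    then show "p x = 0"
      unfolding p(2) using dq
      by (intro exI[of _ u]) (simp add: N[OF _ u0] C[OF u0 u1] circle_extension_on_circle[OF un] T[OF u(1)])
  qed
  have "heis_param ` circle_curve a ?q\<^sub>1 ?q\<^sub>2 ?q\<^sub>3 ` circle_dom a = {x. p x = 0} \<inter> heis"
    unfolding key
  proof (intro equalityI subsetI)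
    fix x assume "x \<in> heis_param ` circle_curve a ?q\<^sub>1 ?q\<^sub>2 ?q\<^sub>3 ` circle_dom a"
    then obtain u where "u \<in> circle_dom a" "x = heis_param (circle_curve a ?q\<^sub>1 ?q\<^sub>2 ?q\<^sub>3 u)" by blast
    then show "x \<in> {x. \<exists>u\<in>circle_dom a. heis_chart x = circle_curve a ?q\<^sub>1 ?q\<^sub>2 ?q\<^sub>3 u} \<inter> heis"
      using heis_param_in_heis heis_chart_param by blast
  next
    fix x assume "x \<in> {x. \<exists>u\<in>circle_dom a. heis_chart x = circle_curve a ?q\<^sub>1 ?q\<^sub>2 ?q\<^sub>3 u} \<inter> heis"
    then obtain u where "u \<in> circle_dom a" "heis_chart x = circle_curve a ?q\<^sub>1 ?q\<^sub>2 ?q\<^sub>3 u" "x \<in> heis" by blast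
    then show "x \<in> heis_param ` circle_curve a ?q\<^sub>1 ?q\<^sub>2 ?q\<^sub>3 ` circle_dom a"
      using heis_param_chart[of x] by (metis image_eqI)
  qed
  then have "algebraic_in_heis (heis_param ` circle_curve a ?q\<^sub>1 ?q\<^sub>2 ?q\<^sub>3 ` circle_dom a)"
    unfolding algebraic_in_heis_def using cpoly_imp_complex_polynomial[OF p(1)] by blast
  then show ?thesis using close c
    by (intro exI[of _ ?q\<^sub>1] exI[of _ ?q\<^sub>2] exI[of _ ?q\<^sub>3] conjI) auto
qed

section \<open>Ambient diffeomorphisms extending a small perturbation of a curve\<close>

text \<open>The inverse is continuous by invariance of domain; its smoothness is then bootstrapped
  from p' = 1 / (q' o p).\<close>

lemma smooth_inverse_1d:
  fixes q :: "real \<Rightarrow> real"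
  assumes smooth: "\<And>k. Ck k {a<..<b} q"
    and pos: "\<And>t. t \<in> {a<..<b} \<Longrightarrow> vector_derivative q (at t) > 0"
  shows "\<exists>p. open (q ` {a<..<b}) \<and> (\<forall>t\<in>{a<..<b}. p (q t) = t) \<and> (\<forall>k. Ck k (q ` {a<..<b}) p)"
proof -
  let ?I = "{a<..<b}"
  let ?q' = "\<lambda>t. vector_derivative q (at t)"
  have d: "(q has_real_derivative ?q' t) (at t)" if "t \<in> ?I" for t
    using Ck_vector_derivative(2)[OF _ smooth that] by (simp add: has_real_derivative_iff_has_vector_derivative)
  have mono: "q s < q t" if "s \<in> ?I" "t \<in> ?I" "s < t" for s t
  proof (rule DERIV_pos_imp_increasing[OF that(3)])
    fix x assume "s \<le> x" "x \<le> t"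
    then have "x \<in> ?I" using that by auto
    then show "\<exists>y. (q has_real_derivative y) (at x) \<and> 0 < y" using d pos by blast
  qed
  have inj: "inj_on q ?I" using mono by (metis inj_onI linorder_neqE_linordered_idom less_irrefl)
  have cont: "continuous_on ?I q" using smooth[of 0] by simp
  have op: "open (q ` ?I)" by (rule invariance_of_domain[OF cont _ inj]) simp
  obtain p where hom: "homeomorphism ?I (q ` ?I) q p"
    using invariance_of_domain_homeomorphism[OF open_greaterThanLessThan cont _ inj] by auto
  have pq: "p (q t) = t" if "t \<in> ?I" for t using hom that by (rule homeomorphism_apply1)
  have qp: "q (p x) = x" "p x \<in> ?I" if "x \<in> q ` ?I" for x
    using that pq by auto
  have pc: "continuous_on (q ` ?I) p" using hom by (simp add: homeomorphism_def)
  have dp: "(p has_vector_derivative inverse (?q' (p x))) (at x)" if x: "x \<in> q ` ?I" for x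
  proof -
    have "(q has_derivative (\<lambda>h. ?q' (p x) * h)) (at (p x))"
      using d[OF qp(2)[OF x]] by (rule has_field_derivative_imp_has_derivative)
    then have "(p has_derivative (\<lambda>h. inverse (?q' (p x)) * h)) (at x)"
    proof (rule has_derivative_inverse_basic[OF _ _ _ _ op x])
      show "continuous (at x) p" using pc op x continuous_on_eq_continuous_at by blast
      show "(\<lambda>h. inverse (?q' (p x)) * h) \<circ> (\<lambda>h. ?q' (p x) * h) = id"
        using pos[OF qp(2)[OF x]] by (simp add: fun_eq_iff)
      show "bounded_linear (\<lambda>h. inverse (?q' (p x)) * h)" by (rule bounded_linear_mult_right)
    qed (use qp in auto)
    then show ?thesis by (simp add: has_vector_derivative_def mult.commute)
  qed
  have "Ck k (q ` ?I) p" for k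
  proof (induction k)
    case 0
    then show ?case using pc by simp
  next
    case (Suc k)
    have "Ck k ?I ?q'" by (rule Ck_vector_derivative(1)[OF _ smooth]) simp
    then have "Ck k (q ` ?I) (\<lambda>x. ?q' (p x))"
      by (rule Ck_compose[where g = ?q' and T = ?I, OF op open_greaterThanLessThan Suc]) (use qp in auto)
    then have "Ck k (q ` ?I) (\<lambda>x. inverse (?q' (p x)))"
      by (rule Ck_inverse[OF op]) (use pos qp(2) in \<open>force\<close>)
    then show ?case
      by (rule Ck_real_SucI[where f' = "\<lambda>x. inverse (?q' (p x))", OF op dp, rotated])
  qed
  then show ?thesis using op pq by blast
qed

text \<open>On every line parallel to \<open>e\<close> the map is the identity plus a function with
  Lipschitz constant 1/2, hence bijective. The bound 2 on the derivative of the inverse allows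
  further shears to be stacked on top.\<close>

lemma shear_diffeo:
  fixes V :: "'a::euclidean_space \<Rightarrow> real" and e :: 'a
  assumes smooth: "\<And>k. Ck k UNIV V"
    and bound: "\<And>x v. \<bar>frechet_derivative V (at x) v\<bar> \<le> norm v / 2"
    and e: "norm e = 1"
  shows "\<exists>g. (\<forall>k. Ck k UNIV g) \<and> (\<forall>x. g (x + V x *\<^sub>R e) = x) \<and> (\<forall>y. g y + V (g y) *\<^sub>R e = y) \<and>
     (\<forall>y v. norm (frechet_derivative g (at y) v) \<le> 2 * norm v)"
proof -
  let ?D = "\<lambda>x. frechet_derivative V (at x)"
  define h where "h x = x + V x *\<^sub>R e" for x
  have dV: "(V has_derivative ?D x) (at x)" for x
    by (rule Ck_SucD[OF smooth UNIV_I])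
  have lip: "\<bar>V (x + s *\<^sub>R e) - V x\<bar> \<le> \<bar>s\<bar> / 2" for x s
  proof -
    have "norm (V (x + s *\<^sub>R e) - V x) \<le> (1/2) * norm ((x + s *\<^sub>R e) - x)"
    proof (rule differentiable_bound[where S = UNIV and f' = ?D])
      show "onorm (?D y) \<le> 1/2" for y
        by (rule onorm_bound) (use bound[of y] in auto)
    qed (auto intro: dV)
    then show ?thesis using e by simp
  qed
  have "inj h"
  proof (rule injI)
    fix x y assume "h x = h y"
    then have y: "y = x + (V x - V y) *\<^sub>R e" by (simp add: h_def algebra_simps)
    have "\<bar>V x - V y\<bar> \<le> \<bar>V x - V y\<bar> / 2"
      using lip[of x "V x - V y"] unfolding y[symmetric] by (simp only: abs_minus_commute)
    then have "V x = V y" by simp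
    then show "x = y" using y by simp
  qed
  have ch: "continuous_on UNIV h"
    unfolding h_def using smooth[of 0] by (auto intro!: continuous_intros)
  have surj: "\<exists>x. h x = y" for y
  proof -
    \<comment> \<open>A preimage of y has the form y - s e with s = V(y - s e); the Lipschitz bound
      forces a sign change of \<open>?f\<close> between -2 |V y| and 2 |V y|.\<close>
    let ?f = "\<lambda>s. s - V (y + (- s) *\<^sub>R e)"
    let ?m = "2 * \<bar>V y\<bar>"
    have "\<exists>s. - ?m \<le> s \<and> s \<le> ?m \<and> ?f s = 0"
    proof (rule IVT')
      show "?f (- ?m) \<le> 0" using lip[of y ?m] by auto
      show "0 \<le> ?f ?m" using lip[of y "- ?m"] by auto
      show "continuous_on {- ?m..?m} ?f"
      proof -
        have "continuous_on UNIV V" using smooth[of 0] by simp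
        then have "continuous_on {- ?m..?m} (\<lambda>s. V (y + (- s) *\<^sub>R e))"
          by (rule continuous_on_compose2) (auto intro!: continuous_intros)
        then show ?thesis by (intro continuous_on_diff continuous_on_id)
      qed
    qed simp
    then obtain s where "?f s = 0" by blast
    then have "h (y + (- s) *\<^sub>R e) = y" by (simp add: h_def)
    then show ?thesis by blast
  qed
  obtain g where hom: "homeomorphism UNIV (h ` UNIV) h g"
    using invariance_of_domain_homeomorphism[OF open_UNIV ch _ \<open>inj h\<close>] by auto
  have gh: "g (h x) = x" for x using hom by (simp add: homeomorphism_def)
  have hg: "h (g y) = y" for y using surj[of y] gh by metis
  have range: "range h = UNIV" using surj by (metis surj_def)
  have gc: "continuous_on UNIV g" using hom range by (simp add: homeomorphism_def)
  have De: "1 + ?D x e \<ge> 1/2" for x using bound[of x e] e by simp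
  have De0: "1 + ?D x e \<noteq> 0" for x using De[of x] by linarith
  \<comment> \<open>The inverse of the rank-one perturbation v + (DV v) e of the identity.\<close>
  define G where "G y v = v - (?D (g y) v / (1 + ?D (g y) e)) *\<^sub>R e" for y v
  have linD: "bounded_linear (?D x)" for x using dV by (rule has_derivative_bounded_linear)
  have dg: "(g has_derivative G y) (at y)" for y
  proof (rule has_derivative_inverse_basic[where f = h and f' = "\<lambda>v. v + ?D (g y) v *\<^sub>R e" and T = UNIV])
    interpret D: bounded_linear "?D (g y)" by (rule linD)
    show "(h has_derivative (\<lambda>v. v + ?D (g y) v *\<^sub>R e)) (at (g y))"
      unfolding h_def by (intro has_derivative_add has_derivative_ident has_derivative_scaleR_left dV)
    show "bounded_linear (G y)"
      unfolding G_def divide_inverse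
      by (intro bounded_linear_sub bounded_linear_ident bounded_linear_scaleR_const
          bounded_linear_mult_const linD)
    show "G y \<circ> (\<lambda>v. v + ?D (g y) v *\<^sub>R e) = id"
    proof
      fix v
      have "?D (g y) (v + ?D (g y) v *\<^sub>R e) = ?D (g y) v * (1 + ?D (g y) e)"
        by (simp add: D.add D.scaleR algebra_simps)
      then have "?D (g y) (v + ?D (g y) v *\<^sub>R e) / (1 + ?D (g y) e) = ?D (g y) v"
        using De[of "g y"] by simp
      then show "(G y \<circ> (\<lambda>v. v + ?D (g y) v *\<^sub>R e)) v = id v"
        unfolding G_def o_def by simp
    qed
    show "continuous (at y) g" using gc by (simp add: continuous_on_eq_continuous_at)
  qed (auto simp: hg)
  have Gb: "norm (G y v) \<le> 2 * norm v" for y v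
  proof -
    have "norm (G y v) \<le> norm v + \<bar>?D (g y) v\<bar> / (1 + ?D (g y) e)"
      unfolding G_def using norm_triangle_ineq4[of v "(?D (g y) v / (1 + ?D (g y) e)) *\<^sub>R e"] De[of "g y"] e
      by simp
    also have "\<bar>?D (g y) v\<bar> / (1 + ?D (g y) e) \<le> (norm v / 2) / (1/2)"
      using bound De by (intro frac_le) auto
    finally show ?thesis by simp
  qed
  have "Ck k UNIV g" for k
  proof (induction k)
    case 0
    then show ?case using gc by simp
  next
    case (Suc k)
    have c: "Ck k UNIV (\<lambda>y. ?D (g y) v)" for v
      by (rule Ck_compose[where g = "\<lambda>x. ?D x v", OF open_UNIV open_UNIV Suc])
        (use smooth[of "Suc k"] in auto)
    have "Ck k UNIV (\<lambda>y. G y v)" for v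
      unfolding G_def
      by (intro Ck_diff Ck_const Ck_scaleR Ck_divide Ck_add c open_UNIV De0)
    then show ?case by (rule Ck_SucI[where f' = G, OF open_UNIV dg, rotated])
  qed
  moreover have "frechet_derivative g (at y) = G y" for y using frechet_derivative_at[OF dg] by simp
  ultimately show ?thesis using gh hg Gb unfolding h_def by metis
qed

section \<open>Extending functions from a closed curve\<close>

text \<open>\<open>C\<close> depends on the cutoff and the local parameter only, not on
  \<open>u\<close>; this uniformity lets the size of admissible perturbations be fixed in advance.
  The cutoff lives in radius 2 r and \<theta> on radius 3 r, so the product and the zero function
  overlap on an open set.\<close>

lemma smooth_local_extension:
  fixes \<psi> :: "'a::euclidean_space \<Rightarrow> real" and \<theta> :: "'a \<Rightarrow> real"
  assumes r: "r > 0" and \<psi>: "\<And>k. Ck k UNIV \<psi>" "\<And>x. x \<notin> ball c (2*r) \<Longrightarrow> \<psi> x = 0"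
    and \<theta>: "\<And>k. Ck k (ball c (3*r)) \<theta>"
  shows "\<exists>C\<ge>0. \<forall>u M. (\<forall>k. Ck k UNIV u) \<and> (\<forall>t. \<bar>u t\<bar> \<le> M \<and> \<bar>vector_derivative u (at t)\<bar> \<le> M) \<longrightarrow>
    (\<forall>k. Ck k UNIV (\<lambda>x. if x \<in> ball c (3*r) then \<psi> x * u (\<theta> x) else 0)) \<and>
    (\<forall>x v. \<bar>frechet_derivative (\<lambda>x. if x \<in> ball c (3*r) then \<psi> x * u (\<theta> x) else 0) (at x) v\<bar> \<le> C * M * norm v)"
proof -
  let ?B = "ball c (3*r)" and ?K = "cball c (2*r)"
  let ?D\<psi> = "\<lambda>x. frechet_derivative \<psi> (at x)" and ?D\<theta> = "\<lambda>x. frechet_derivative \<theta> (at x)"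
  have KB: "?K \<subseteq> ?B" using r by auto
  have "\<exists>m. \<forall>x\<in>?K. \<bar>?D\<psi> x b\<bar> + \<bar>\<psi> x * ?D\<theta> x b\<bar> \<le> m" for b
  proof -
    have "continuous_on ?K (\<lambda>x. ?D\<psi> x b)" "continuous_on ?K \<psi>"
      using \<psi>(1)[of "Suc 0"] \<psi>(1)[of 0] by (auto intro: continuous_on_subset)
    moreover have "continuous_on ?K (\<lambda>x. ?D\<theta> x b)"
      using \<theta>[of "Suc 0"] KB by (auto intro: continuous_on_subset)
    ultimately have "continuous_on ?K (\<lambda>x. \<bar>?D\<psi> x b\<bar> + \<bar>\<psi> x * ?D\<theta> x b\<bar>)"
      by (intro continuous_on_add continuous_on_rabs continuous_on_mult)
    then have "bounded ((\<lambda>x. \<bar>?D\<psi> x b\<bar> + \<bar>\<psi> x * ?D\<theta> x b\<bar>) ` ?K)"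
      by (intro compact_imp_bounded compact_continuous_image) auto
    then show ?thesis by (force simp: bounded_iff)
  qed
  then obtain m where m: "\<And>b x. x \<in> ?K \<Longrightarrow> \<bar>?D\<psi> x b\<bar> + \<bar>\<psi> x * ?D\<theta> x b\<bar> \<le> m b" by metis
  have m0: "m b \<ge> 0" for b using m[of c b] r by force
  define C where "C = (\<Sum>b\<in>Basis. m b)"
  have "C \<ge> 0" unfolding C_def by (intro sum_nonneg m0)
  moreover have "(\<forall>k. Ck k UNIV P) \<and> (\<forall>x v. \<bar>frechet_derivative P (at x) v\<bar> \<le> C * M * norm v)"
    if u: "\<And>k. Ck k UNIV u" and M: "\<And>t. \<bar>u t\<bar> \<le> M \<and> \<bar>vector_derivative u (at t)\<bar> \<le> M"
      and P: "P = (\<lambda>x. if x \<in> ?B then \<psi> x * u (\<theta> x) else 0)" for u M P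
  proof (intro conjI allI)
    let ?P = P
    have M0: "M \<ge> 0" using M[of 0] by linarith
    have Ck_B: "Ck k ?B ?P" for k
    proof -
      have "Ck k ?B (\<lambda>x. \<psi> x * u (\<theta> x))"
        by (intro Ck_mult Ck_subset[OF \<psi>(1)] Ck_compose[where g = u, OF open_ball open_UNIV \<theta> u] open_ball) auto
      then show ?thesis by (subst Ck_cong[OF open_ball, of _ _ _ "\<lambda>x. \<psi> x * u (\<theta> x)"]) (auto simp: P)
    qed
    have P0: "?P x = 0" if "x \<in> - ?K" for x using \<psi>(2)[of x] that by (auto simp: P)
    have oK: "open (- ?K)" by (simp add: open_Compl)
    have Ck_K: "Ck k (- ?K) ?P" for k
      using Ck_const[of k "- ?K" 0] Ck_cong[OF oK, of ?P "\<lambda>_. 0"] P0 by simp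
    show CkP: "Ck k UNIV ?P" for k
    proof (rule Ck_local)
      fix x :: 'a
      show "\<exists>U. open U \<and> x \<in> U \<and> Ck k U ?P"
      proof (cases "x \<in> ?K")
        case True
        then have "x \<in> ?B" using KB by blast
        then show ?thesis using Ck_B open_ball by blast
      next
        case False
        then show ?thesis using Ck_K oK by blast
      qed
    qed
    fix x v
    have dP: "(?P has_derivative frechet_derivative ?P (at x)) (at x)"
      by (rule Ck_SucD[OF CkP UNIV_I])
    then interpret D: bounded_linear "frechet_derivative ?P (at x)" by (rule has_derivative_bounded_linear)
    have b: "\<bar>frechet_derivative ?P (at x) b\<bar> \<le> M * m b" for b
    proof (cases "x \<in> ?K")
      case True
      then have xB: "x \<in> ?B" using KB by blast
      have d\<theta>: "(\<theta> has_derivative ?D\<theta> x) (at x)" using Ck_SucD[OF \<theta> xB] .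
      have "(u has_vector_derivative vector_derivative u (at (\<theta> x))) (at (\<theta> x))"
        by (rule Ck_vector_derivative(2)[OF open_UNIV u UNIV_I])
      then have du: "((\<lambda>x. u (\<theta> x)) has_derivative (\<lambda>v. ?D\<theta> x v * vector_derivative u (at (\<theta> x)))) (at x)"
        using has_derivative_compose[OF d\<theta>, of u] by (simp add: has_vector_derivative_def)
      have d\<psi>: "(\<psi> has_derivative ?D\<psi> x) (at x)" by (rule Ck_SucD[OF \<psi>(1) UNIV_I])
      have "((\<lambda>x. \<psi> x * u (\<theta> x)) has_derivative
        (\<lambda>v. \<psi> x * (?D\<theta> x v * vector_derivative u (at (\<theta> x))) + ?D\<psi> x v * u (\<theta> x))) (at x)"
        by (rule has_derivative_mult[OF d\<psi> du])
      then have "(?P has_derivative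
        (\<lambda>v. \<psi> x * (?D\<theta> x v * vector_derivative u (at (\<theta> x))) + ?D\<psi> x v * u (\<theta> x))) (at x)"
        by (rule has_derivative_transform_within_open[OF _ open_ball xB]) (simp add: P)
      from frechet_derivative_at[OF this]
      have "frechet_derivative ?P (at x) b
          = (\<psi> x * ?D\<theta> x b) * vector_derivative u (at (\<theta> x)) + ?D\<psi> x b * u (\<theta> x)"
        by (metis mult.assoc)
      also have "\<bar>\<dots>\<bar> \<le> \<bar>\<psi> x * ?D\<theta> x b\<bar> * M + \<bar>?D\<psi> x b\<bar> * M"
        using M[of "\<theta> x"]
        by (intro order_trans[OF abs_triangle_ineq] add_mono)
          (auto simp only: abs_mult[of _ "u (\<theta> x)"] abs_mult[of _ "vector_derivative u (at (\<theta> x))"]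
            intro!: mult_left_mono)
      also have "\<dots> = M * (\<bar>?D\<psi> x b\<bar> + \<bar>\<psi> x * ?D\<theta> x b\<bar>)" by (simp add: algebra_simps)
      also have "\<dots> \<le> M * m b" using m[OF True] M0 by (rule mult_left_mono)
      finally show ?thesis .
    next
      case False
      then have "(?P has_derivative (\<lambda>v. 0)) (at x)"
        by (intro has_derivative_transform_within_open[OF has_derivative_const[of 0] oK]) (use P0 in auto)
      from frechet_derivative_at[OF this] show ?thesis
        using M0 m0 by (metis abs_zero mult_nonneg_nonneg)
    qed
    have "frechet_derivative ?P (at x) v = frechet_derivative ?P (at x) (\<Sum>b\<in>Basis. inner v b *\<^sub>R b)"
      by (simp add: euclidean_representation)
    also have "\<dots> = (\<Sum>b\<in>Basis. inner v b * frechet_derivative ?P (at x) b)"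
      by (simp add: D.sum D.scaleR)
    also have "\<bar>\<dots>\<bar> \<le> (\<Sum>b\<in>Basis. norm v * (M * m b))"
      by (intro order_trans[OF sum_abs] sum_mono)
        (auto simp: abs_mult intro!: mult_mono b Basis_le_norm)
    also have "\<dots> = C * M * norm v" by (simp add: C_def sum_distrib_left sum_distrib_right mult_ac)
    finally show "\<bar>frechet_derivative ?P (at x) v\<bar> \<le> C * M * norm v" .
  qed
  ultimately show ?thesis by (intro exI[of _ C]) blast
qed

lemma cis_shift_into_interval:
  "\<exists>s. a \<le> s \<and> s < a + 2 * pi \<and> cis s = cis t"
proof -
  define n where "n = \<lfloor>(t - a) / (2 * pi)\<rfloor>"
  have "of_int n \<le> (t - a) / (2 * pi)" "(t - a) / (2 * pi) < of_int n + 1"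
    unfolding n_def by linarith+
  then have "2 * pi * of_int n \<le> t - a" "t - a < 2 * pi * of_int n + 2 * pi"
    by (simp_all add: field_simps)
  moreover have "cis (t - 2 * pi * of_int n) = cis t"
    by (simp flip: cis_divide)
  ultimately show ?thesis by (intro exI[of _ "t - 2 * pi * of_int n"]) linarith
qed

text \<open>Projection to the tangent direction at \<open>t\<^sub>0\<close> is strictly increasing
  along a short piece of the curve, and its inverse reads off the parameter. The rest of the curve
  is compact and misses the base point, so a small ball meets only the short piece.\<close>

lemma curve_local_parameter:
  fixes \<Gamma> :: "real \<Rightarrow> 'a::euclidean_space"
  assumes smooth: "\<And>k. Ck k UNIV \<Gamma>" and per: "\<And>t. \<Gamma> (t + 2 * pi) = \<Gamma> t"
    and inj: "\<And>s t. \<Gamma> s = \<Gamma> t \<Longrightarrow> cis s = cis t"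
    and regular: "vector_derivative \<Gamma> (at t\<^sub>0) \<noteq> 0"
  shows "\<exists>r>0. \<exists>\<theta>. (\<forall>k. Ck k (ball (\<Gamma> t\<^sub>0) (3 * r)) \<theta>) \<and>
    (\<forall>t. \<Gamma> t \<in> ball (\<Gamma> t\<^sub>0) (3 * r) \<longrightarrow> cis (\<theta> (\<Gamma> t)) = cis t)"
proof -
  let ?\<Gamma>' = "\<lambda>t. vector_derivative \<Gamma> (at t)"
  define a where "a = ?\<Gamma>' t\<^sub>0"
  define q where "q t = inner a (\<Gamma> t)" for t
  have Ckq: "Ck k UNIV q" for k
    unfolding q_def by (intro Ck_inner Ck_const smooth open_UNIV)
  have d\<Gamma>: "(\<Gamma> has_vector_derivative ?\<Gamma>' t) (at t)" for t
    by (rule Ck_vector_derivative(2)[OF open_UNIV smooth UNIV_I])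
  have "(q has_vector_derivative inner a (?\<Gamma>' t)) (at t)" for t
    unfolding q_def by (rule bounded_linear.has_vector_derivative[OF bounded_linear_inner_right d\<Gamma>])
  then have q': "vector_derivative q (at t) = inner a (?\<Gamma>' t)" for t
    by (rule vector_derivative_at)
  have "continuous_on UNIV ?\<Gamma>'"
    using Ck_vector_derivative(1)[OF open_UNIV, of 0 \<Gamma>] smooth[of "Suc 0"] by simp
  then have c: "continuous_on UNIV (\<lambda>t. inner a (?\<Gamma>' t))"
    by (intro continuous_on_inner continuous_on_const)
  have "inner a (?\<Gamma>' t\<^sub>0) > 0" using regular by (simp add: a_def)
  then have t0: "t\<^sub>0 \<in> {t. inner a (?\<Gamma>' t) > 0}" by simp
  have "open {t. inner a (?\<Gamma>' t) > 0}"
    by (intro open_Collect_less continuous_on_const c)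
  then obtain \<delta>\<^sub>0 where \<delta>\<^sub>0: "\<delta>\<^sub>0 > 0" "ball t\<^sub>0 \<delta>\<^sub>0 \<subseteq> {t. inner a (?\<Gamma>' t) > 0}"
    using openE[OF _ t0] by blast
  define \<delta> where "\<delta> = min \<delta>\<^sub>0 1"
  have \<delta>: "\<delta> > 0" "\<delta> \<le> 1" "\<delta> \<le> \<delta>\<^sub>0" using \<delta>\<^sub>0 by (auto simp: \<delta>_def)
  let ?I = "{t\<^sub>0 - \<delta><..<t\<^sub>0 + \<delta>}"
  have pos: "vector_derivative q (at t) > 0" if "t \<in> ?I" for t
  proof -
    have "t \<in> ball t\<^sub>0 \<delta>\<^sub>0" using that \<delta>(3)
      unfolding mem_ball dist_real_def greaterThanLessThan_iff by linarith
    then show ?thesis unfolding q' using \<delta>\<^sub>0(2) by blast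
  qed
  obtain p where p: "open (q ` ?I)" "\<And>t. t \<in> ?I \<Longrightarrow> p (q t) = t" "\<And>k. Ck k (q ` ?I) p"
    using smooth_inverse_1d[of "t\<^sub>0 - \<delta>" "t\<^sub>0 + \<delta>" q, OF Ck_subset[OF Ckq subset_UNIV] pos] by blast
  \<comment> \<open>The remaining arc within one period. With \<delta> at most 1 its parameter
    interval is nonempty.\<close>
  let ?C = "\<Gamma> ` {t\<^sub>0 + \<delta>..t\<^sub>0 + 2 * pi - \<delta>}"
  have c\<Gamma>: "continuous_on UNIV \<Gamma>" using smooth[of 0] by simp
  have "compact ?C"
    by (intro compact_continuous_image continuous_on_subset[OF c\<Gamma>]) auto
  then have clC: "closed ?C" by (rule compact_imp_closed)
  have nC: "\<Gamma> t\<^sub>0 \<notin> ?C"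
  proof
    assume "\<Gamma> t\<^sub>0 \<in> ?C"
    then obtain t where t: "t\<^sub>0 + \<delta> \<le> t" "t \<le> t\<^sub>0 + 2 * pi - \<delta>" "\<Gamma> t\<^sub>0 = \<Gamma> t" by auto
    from inj[OF t(3)] have "sin t = sin t\<^sub>0 \<and> cos t = cos t\<^sub>0" by (simp add: complex_eq_iff)
    then obtain n :: int where n: "t = t\<^sub>0 + 2 * pi * n" unfolding sin_cos_eq_iff by blast
    have "0 < 2 * pi * of_int n" "2 * pi * of_int n < 2 * pi * 1" using t n \<delta> by linarith+
    then have "0 < real_of_int n" "real_of_int n < 1"
      by (simp_all add: zero_less_mult_iff)
    then have "0 < n" "n < 1" by simp_all
    then show False by linarith
  qed
  let ?O = "{x. inner a x \<in> q ` ?I}"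
  have oO: "open (?O - ?C)"
  proof (rule open_Diff[OF _ clC])
    have "open ((\<lambda>x. inner a x) -` (q ` ?I))"
      by (rule open_vimage[OF p(1)]) (intro continuous_on_inner continuous_on_const continuous_on_id)
    then show "open ?O" by (simp add: vimage_def)
  qed
  have "\<Gamma> t\<^sub>0 \<in> ?O - ?C" using nC \<delta>(1) by (auto simp: q_def)
  then obtain R where R: "R > 0" "ball (\<Gamma> t\<^sub>0) R \<subseteq> ?O - ?C" using oO openE by blast
  define r where "r = R / 3"
  have r: "r > 0" "3 * r = R" using R by (simp_all add: r_def)
  define \<theta> where "\<theta> x = p (inner a x)" for x
  have "Ck k (ball (\<Gamma> t\<^sub>0) R) \<theta>" for k
    unfolding \<theta>_def
    by (rule Ck_compose[where g = p and T = "q ` ?I", OF open_ball p(1) _ p(3)])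
      (use R(2) in \<open>auto intro: Ck_inner Ck_const Ck_id\<close>)
  moreover have "cis (\<theta> (\<Gamma> t)) = cis t" if t: "\<Gamma> t \<in> ball (\<Gamma> t\<^sub>0) R" for t
  proof -
    obtain s where s: "t\<^sub>0 - \<delta> \<le> s" "s < t\<^sub>0 - \<delta> + 2 * pi" "cis s = cis t"
      using cis_shift_into_interval by blast
    have gs: "\<Gamma> s = \<Gamma> t" by (rule periodic_cis[of \<Gamma>, OF per s(3)])
    then have nc: "\<Gamma> s \<notin> ?C" using t R(2) by auto
    have "s < t\<^sub>0 + \<delta>"
    proof (rule ccontr)
      assume "\<not> s < t\<^sub>0 + \<delta>"
      then have "s \<in> {t\<^sub>0 + \<delta>..t\<^sub>0 + 2 * pi - \<delta>}" using s by auto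
      then show False using nc by blast
    qed
    \<comment> \<open>The left end of the half-open interval is congruent to the last parameter of
      the excluded arc.\<close>
    moreover have "s \<noteq> t\<^sub>0 - \<delta>"
    proof
      assume "s = t\<^sub>0 - \<delta>"
      then have "t\<^sub>0 + 2 * pi - \<delta> = s + 2 * pi" by simp
      then have "\<Gamma> (t\<^sub>0 + 2 * pi - \<delta>) = \<Gamma> s" using per[of s] by (simp only:)
      moreover have "t\<^sub>0 + 2 * pi - \<delta> \<in> {t\<^sub>0 + \<delta>..t\<^sub>0 + 2 * pi - \<delta>}" using \<delta> pi_gt3 by auto
      ultimately show False using nc by (metis image_eqI)
    qed
    ultimately have "s \<in> ?I" using s(1) by auto
    then have "p (q s) = s" by (rule p(2))
    then have "\<theta> (\<Gamma> t) = s" by (simp add: \<theta>_def q_def gs)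
    then show ?thesis using s(3) by simp
  qed
  ultimately show ?thesis using r by (intro exI[of _ r] conjI exI[of _ \<theta>] allI impI) auto
qed

text \<open>A partition of unity without division: the weights add up to 1 wherever one of the bumps
  equals 1, in particular on the curve they cover.\<close>

lemma sum_telescoping_bumps:
  fixes b :: "nat \<Rightarrow> real"
  shows "(\<Sum>i<n. b i * (\<Prod>j<i. 1 - b j)) = 1 - (\<Prod>j<n. 1 - b j)"
  by (induction n) (simp_all add: algebra_simps)

text \<open>Finitely many local extensions, weighted by the telescoping partition, depend linearly
  on \<open>u\<close>. The derivative bound is the sum of the local constants and \<open>R\<close>
  encloses all supports, so neither depends on \<open>u\<close>.\<close>

lemma smooth_curve_extension:
  fixes \<Gamma> :: "real \<Rightarrow> 'a::euclidean_space"
  assumes smooth: "\<And>k. Ck k UNIV \<Gamma>" and per: "\<And>t. \<Gamma> (t + 2 * pi) = \<Gamma> t"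
    and inj: "\<And>s t. \<Gamma> s = \<Gamma> t \<Longrightarrow> cis s = cis t"
    and regular: "\<And>t. vector_derivative \<Gamma> (at t) \<noteq> 0"
  shows "\<exists>C\<ge>0. \<exists>R. \<forall>u M. (\<forall>k. Ck k UNIV u) \<and> (\<forall>t. u (t + 2 * pi) = u t) \<and>
      (\<forall>t. \<bar>u t\<bar> \<le> M \<and> \<bar>vector_derivative u (at t)\<bar> \<le> M) \<longrightarrow>
    (\<exists>V. (\<forall>k. Ck k UNIV V) \<and> (\<forall>t. V (\<Gamma> t) = u t) \<and>
      (\<forall>x v. \<bar>frechet_derivative V (at x) v\<bar> \<le> C * M * norm v) \<and> (\<forall>x. norm x \<ge> R \<longrightarrow> V x = 0))"
proof -
  have "\<exists>r \<theta>. r > 0 \<and> (\<forall>k. Ck k (ball (\<Gamma> t\<^sub>0) (3 * r)) \<theta>) \<and>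
      (\<forall>t. \<Gamma> t \<in> ball (\<Gamma> t\<^sub>0) (3 * r) \<longrightarrow> cis (\<theta> (\<Gamma> t)) = cis t)" for t\<^sub>0
    using curve_local_parameter[of \<Gamma>, OF smooth per inj regular] by blast
  then obtain r \<theta> where r: "\<And>t\<^sub>0. r t\<^sub>0 > 0"
    and \<theta>: "\<And>t\<^sub>0 k. Ck k (ball (\<Gamma> t\<^sub>0) (3 * r t\<^sub>0)) (\<theta> t\<^sub>0)"
      "\<And>t\<^sub>0 t. \<Gamma> t \<in> ball (\<Gamma> t\<^sub>0) (3 * r t\<^sub>0) \<Longrightarrow> cis (\<theta> t\<^sub>0 (\<Gamma> t)) = cis t"
    by metis
  have "\<exists>b::'a\<Rightarrow>real. (\<forall>k. Ck k UNIV b) \<and> (\<forall>x. 0 \<le> b x \<and> b x \<le> 1) \<and>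
     (\<forall>x\<in>cball (\<Gamma> t) (r t). b x = 1) \<and> (\<forall>x. x \<notin> ball (\<Gamma> t) (2 * r t) \<longrightarrow> b x = 0)" for t
    by (rule smooth_ball_bump[OF r])
  then obtain b :: "real \<Rightarrow> 'a \<Rightarrow> real" where b: "\<And>t k. Ck k UNIV (b t)"
    "\<And>t x. x \<in> cball (\<Gamma> t) (r t) \<Longrightarrow> b t x = 1"
    "\<And>t x. x \<notin> ball (\<Gamma> t) (2 * r t) \<Longrightarrow> b t x = 0"
    by metis
  have "continuous_on {0..2*pi} \<Gamma>" using smooth[of 0] by (auto intro: continuous_on_subset)
  then have cK: "compact (\<Gamma> ` {0..2*pi})" by (intro compact_continuous_image) auto
  have "\<Gamma> ` {0..2*pi} \<subseteq> (\<Union>t\<in>UNIV. ball (\<Gamma> t) (r t))"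
    using r centre_in_ball by blast
  from compactE_image[OF cK _ this] obtain T where T: "finite T" "\<Gamma> ` {0..2*pi} \<subseteq> (\<Union>t\<in>T. ball (\<Gamma> t) (r t))"
    by auto
  obtain f n where f: "bij_betw f {0..<n::nat} T"
    using ex_bij_betw_nat_finite[OF T(1)] by blast
  define \<psi> where "\<psi> i x = b (f i) x * (\<Prod>j<i. 1 - b (f j) x)" for i x
  have \<psi>: "Ck k UNIV (\<psi> i)" for k i
    unfolding \<psi>_def by (intro Ck_mult Ck_prod Ck_diff Ck_const b(1) open_UNIV)
  have \<psi>0: "\<psi> i x = 0" if "x \<notin> ball (\<Gamma> (f i)) (2 * r (f i))" for i x
    using b(3)[OF that] by (simp add: \<psi>_def)
  define P where "P u i = (\<lambda>x. if x \<in> ball (\<Gamma> (f i)) (3 * r (f i)) then \<psi> i x * u (\<theta> (f i) x) else 0)"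
    for u :: "real \<Rightarrow> real" and i
  have "\<exists>C\<ge>0. \<forall>u M. (\<forall>k. Ck k UNIV u) \<and> (\<forall>t. \<bar>u t\<bar> \<le> M \<and> \<bar>vector_derivative u (at t)\<bar> \<le> M) \<longrightarrow>
    (\<forall>k. Ck k UNIV (P u i)) \<and> (\<forall>x v. \<bar>frechet_derivative (P u i) (at x) v\<bar> \<le> C * M * norm v)" for i
    unfolding P_def by (rule smooth_local_extension[OF r \<psi> \<psi>0 \<theta>(1)])
  then obtain C where C: "\<And>i. C i \<ge> 0"
    "\<And>i u M. (\<And>k. Ck k UNIV u) \<Longrightarrow> (\<And>t. \<bar>u t\<bar> \<le> M \<and> \<bar>vector_derivative u (at t)\<bar> \<le> M) \<Longrightarrow>
      (\<forall>k. Ck k UNIV (P u i)) \<and> (\<forall>x v. \<bar>frechet_derivative (P u i) (at x) v\<bar> \<le> C i * M * norm v)"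
    by metis
  have "bounded (\<Union>t\<in>T. ball (\<Gamma> t) (2 * r t))" using T(1) by (intro bounded_UN) auto
  then obtain R where R: "\<And>x. x \<in> (\<Union>t\<in>T. ball (\<Gamma> t) (2 * r t)) \<Longrightarrow> norm x < R"
    unfolding bounded_pos_less by blast
  have fT: "f i \<in> T" if "i < n" for i using f that by (auto simp: bij_betw_def)
  have "\<exists>V. (\<forall>k. Ck k UNIV V) \<and> (\<forall>t. V (\<Gamma> t) = u t) \<and>
      (\<forall>x v. \<bar>frechet_derivative V (at x) v\<bar> \<le> (\<Sum>i<n. C i) * M * norm v) \<and> (\<forall>x. norm x \<ge> R \<longrightarrow> V x = 0)"
    if u: "\<And>k. Ck k UNIV u" "\<And>t. u (t + 2 * pi) = u t"
      "\<And>t. \<bar>u t\<bar> \<le> M \<and> \<bar>vector_derivative u (at t)\<bar> \<le> M" for u M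
  proof (intro exI conjI allI impI)
    let ?V = "\<lambda>x. \<Sum>i<n. P u i x"
    have CP: "Ck k UNIV (P u i)" for k i using C(2)[OF u(1,3)] by blast
    show "Ck k UNIV ?V" for k by (intro Ck_sum CP open_UNIV)
    show "?V (\<Gamma> t) = u t" for t
    proof -
      have "P u i (\<Gamma> t) = \<psi> i (\<Gamma> t) * u t" for i
      proof (cases "\<Gamma> t \<in> ball (\<Gamma> (f i)) (3 * r (f i))")
        case True
        then have "u (\<theta> (f i) (\<Gamma> t)) = u t" by (intro periodic_cis[of u, OF u(2)] \<theta>(2))
        then show ?thesis using True by (simp add: P_def)
      next
        case False
        then have "\<psi> i (\<Gamma> t) = 0" using r[of "f i"] by (intro \<psi>0) auto
        then show ?thesis by (simp add: P_def)
      qed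
      then have "?V (\<Gamma> t) = (\<Sum>i<n. \<psi> i (\<Gamma> t)) * u t" by (simp add: sum_distrib_right)
      also have "(\<Sum>i<n. \<psi> i (\<Gamma> t)) = 1 - (\<Prod>j<n. 1 - b (f j) (\<Gamma> t))"
        unfolding \<psi>_def by (rule sum_telescoping_bumps)
      also have "(\<Prod>j<n. 1 - b (f j) (\<Gamma> t)) = 0"
      proof -
        obtain s where s: "0 \<le> s" "s < 0 + 2 * pi" "cis s = cis t" using cis_shift_into_interval by blast
        have "\<Gamma> t = \<Gamma> s" using periodic_cis[of \<Gamma>, OF per s(3)] by simp
        then have "\<Gamma> t \<in> \<Gamma> ` {0..2*pi}" using s by auto
        then obtain t' where t': "t' \<in> T" "\<Gamma> t \<in> ball (\<Gamma> t') (r t')" using T(2) by blast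
        obtain j where j: "j < n" "f j = t'" using f t'(1) by (auto simp: bij_betw_def)
        have "b (f j) (\<Gamma> t) = 1" using t'(2) j(2) by (intro b(2)) auto
        then show ?thesis using j(1) by (intro prod_zero) auto
      qed
      finally show ?thesis by simp
    qed
    show "?V x = 0" if "norm x \<ge> R" for x
    proof (rule sum.neutral, intro ballI)
      fix i assume "i \<in> {..<n}"
      then have "x \<notin> ball (\<Gamma> (f i)) (2 * r (f i))" using R[of x] fT[of i] that by force
      then show "P u i x = 0" using \<psi>0 by (simp add: P_def)
    qed
    fix x v
    have dP: "(P u i has_derivative frechet_derivative (P u i) (at x)) (at x)" for i
      by (rule Ck_SucD[OF CP UNIV_I])
    have "(?V has_derivative (\<lambda>v. \<Sum>i<n. frechet_derivative (P u i) (at x) v)) (at x)"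
      by (intro has_derivative_sum dP)
    from frechet_derivative_at[OF this]
    have "frechet_derivative ?V (at x) v = (\<Sum>i<n. frechet_derivative (P u i) (at x) v)" by metis
    also have "\<bar>\<dots>\<bar> \<le> (\<Sum>i<n. C i * M * norm v)"
      using C(2)[OF u(1,3)] by (intro order_trans[OF sum_abs] sum_mono) blast
    also have "\<dots> = (\<Sum>i<n. C i) * M * norm v" by (simp add: sum_distrib_right)
    finally show "\<bar>frechet_derivative ?V (at x) v\<bar> \<le> (\<Sum>i<n. C i) * M * norm v" .
  qed
  moreover have "(\<Sum>i<n. C i) \<ge> 0" by (intro sum_nonneg C)
  ultimately show ?thesis by blast
qed

text \<open>The displacement is performed one coordinate at a time by shears. Each later shear
  function is precomposed with the inverses of the earlier shears, so that it is evaluated at the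
  original point of the curve.\<close>

lemma smooth_curve_perturbation:
  fixes \<Gamma> :: "real \<Rightarrow> complex \<times> real"
  assumes smooth: "\<And>k. Ck k UNIV \<Gamma>" and per: "\<And>t. \<Gamma> (t + 2 * pi) = \<Gamma> t"
    and inj: "\<And>s t. \<Gamma> s = \<Gamma> t \<Longrightarrow> cis s = cis t"
    and regular: "\<And>t. vector_derivative \<Gamma> (at t) \<noteq> 0"
  shows "\<exists>\<delta>>0. \<exists>R. \<forall>u\<^sub>1 u\<^sub>2 u\<^sub>3. (\<forall>u\<in>{u\<^sub>1, u\<^sub>2, u\<^sub>3}. (\<forall>k. Ck k UNIV u) \<and> (\<forall>t. u (t + 2 * pi) = u t) \<and>
      (\<forall>t. \<bar>u t\<bar> < \<delta> \<and> \<bar>vector_derivative u (at t)\<bar> < \<delta>)) \<longrightarrow>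
    (\<exists>h g. (\<forall>k. Ck k UNIV h) \<and> (\<forall>k. Ck k UNIV g) \<and> (\<forall>x. g (h x) = x) \<and> (\<forall>y. h (g y) = y) \<and>
      (\<forall>x. norm x \<ge> R \<longrightarrow> h x = x) \<and> (\<forall>t. h (\<Gamma> t) = \<Gamma> t + (Complex (u\<^sub>1 t) (u\<^sub>2 t), u\<^sub>3 t)))"
proof -
  obtain C R where C: "C \<ge> 0" and ext: "\<And>u M. (\<And>k. Ck k UNIV u) \<Longrightarrow> (\<And>t. u (t + 2 * pi) = u t) \<Longrightarrow>
      (\<And>t. \<bar>u t\<bar> \<le> M \<and> \<bar>vector_derivative u (at t)\<bar> \<le> M) \<Longrightarrow>
    (\<exists>V. (\<forall>k. Ck k UNIV V) \<and> (\<forall>t. V (\<Gamma> t) = u t) \<and>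
      (\<forall>x v. \<bar>frechet_derivative V (at x) v\<bar> \<le> C * M * norm v) \<and> (\<forall>x. norm x \<ge> R \<longrightarrow> V x = 0))"
    using smooth_curve_extension[of \<Gamma>, OF smooth per inj regular] by metis
  \<comment> \<open>Each extension then has derivative at most 1/8. Every precomposition with an
    inverse shear doubles the bound, so the third one still meets the limit 1/2.\<close>
  define \<delta> where "\<delta> = 1 / (8 * (C + 1))"
  have \<delta>: "\<delta> > 0" using C by (simp add: \<delta>_def)
  have C\<delta>: "C * \<delta> \<le> 1/8" using C by (simp add: \<delta>_def field_simps)
  have "\<exists>h g. (\<forall>k. Ck k UNIV h) \<and> (\<forall>k. Ck k UNIV g) \<and> (\<forall>x. g (h x) = x) \<and> (\<forall>y. h (g y) = y) \<and>
      (\<forall>x. norm x \<ge> R \<longrightarrow> h x = x) \<and> (\<forall>t. h (\<Gamma> t) = \<Gamma> t + (Complex (u\<^sub>1 t) (u\<^sub>2 t), u\<^sub>3 t))"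
    if u: "\<And>u. u \<in> {u\<^sub>1, u\<^sub>2, u\<^sub>3} \<Longrightarrow> (\<forall>k. Ck k UNIV u) \<and> (\<forall>t. u (t + 2 * pi) = u t) \<and>
      (\<forall>t. \<bar>u t\<bar> < \<delta> \<and> \<bar>vector_derivative u (at t)\<bar> < \<delta>)" for u\<^sub>1 u\<^sub>2 u\<^sub>3
  proof -
    have V: "\<exists>V. (\<forall>k. Ck k UNIV V) \<and> (\<forall>t. V (\<Gamma> t) = u t) \<and>
      (\<forall>x v. \<bar>frechet_derivative V (at x) v\<bar> \<le> norm v / 8) \<and> (\<forall>x. norm x \<ge> R \<longrightarrow> V x = 0)"
      if "u \<in> {u\<^sub>1, u\<^sub>2, u\<^sub>3}" for u
    proof -
      have "\<exists>V. (\<forall>k. Ck k UNIV V) \<and> (\<forall>t. V (\<Gamma> t) = u t) \<and>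
        (\<forall>x v. \<bar>frechet_derivative V (at x) v\<bar> \<le> C * \<delta> * norm v) \<and> (\<forall>x. norm x \<ge> R \<longrightarrow> V x = 0)"
        using u[OF that] by (intro ext) (auto intro: less_imp_le)
      moreover have "C * \<delta> * norm v \<le> norm v / 8" for v :: "complex \<times> real"
        using mult_right_mono[OF C\<delta>, of "norm v"] by simp
      ultimately show ?thesis by (meson order_trans)
    qed
    obtain V\<^sub>1 where V1: "\<And>k. Ck k UNIV V\<^sub>1" "\<And>t. V\<^sub>1 (\<Gamma> t) = u\<^sub>1 t"
      "\<And>x v. \<bar>frechet_derivative V\<^sub>1 (at x) v\<bar> \<le> norm v / 8" "\<And>x. norm x \<ge> R \<Longrightarrow> V\<^sub>1 x = 0"
      using V[of u\<^sub>1] by auto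
    obtain V\<^sub>2 where V2: "\<And>k. Ck k UNIV V\<^sub>2" "\<And>t. V\<^sub>2 (\<Gamma> t) = u\<^sub>2 t"
      "\<And>x v. \<bar>frechet_derivative V\<^sub>2 (at x) v\<bar> \<le> norm v / 8" "\<And>x. norm x \<ge> R \<Longrightarrow> V\<^sub>2 x = 0"
      using V[of u\<^sub>2] by auto
    obtain V\<^sub>3 where V3: "\<And>k. Ck k UNIV V\<^sub>3" "\<And>t. V\<^sub>3 (\<Gamma> t) = u\<^sub>3 t"
      "\<And>x v. \<bar>frechet_derivative V\<^sub>3 (at x) v\<bar> \<le> norm v / 8" "\<And>x. norm x \<ge> R \<Longrightarrow> V\<^sub>3 x = 0"
      using V[of u\<^sub>3] by auto
    have comp: "(\<forall>k. Ck k UNIV (\<lambda>y. W (g y))) \<and>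
        (\<forall>y v. \<bar>frechet_derivative (\<lambda>y. W (g y)) (at y) v\<bar> \<le> 2 * c * norm v)"
      if W: "\<And>k. Ck k UNIV W" "\<And>x v. \<bar>frechet_derivative W (at x) v\<bar> \<le> c * norm v"
        and g: "\<And>k. Ck k UNIV g" "\<And>y v. norm (frechet_derivative g (at y) v) \<le> 2 * norm v" and "c \<ge> 0"
      for W :: "complex \<times> real \<Rightarrow> real" and g :: "complex \<times> real \<Rightarrow> complex \<times> real" and c
    proof (intro conjI allI)
      show "Ck k UNIV (\<lambda>y. W (g y))" for k
        by (rule Ck_compose[where g = W, OF open_UNIV open_UNIV g(1) W(1) subset_UNIV])
      fix y v
      have "((\<lambda>y. W (g y)) has_derivative (\<lambda>v. frechet_derivative W (at (g y)) (frechet_derivative g (at y) v))) (at y)"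
        by (rule has_derivative_compose[where g = W, OF Ck_SucD[OF g(1) UNIV_I] Ck_SucD[OF W(1) UNIV_I]])
      from frechet_derivative_at[OF this]
      have "frechet_derivative (\<lambda>y. W (g y)) (at y) v = frechet_derivative W (at (g y)) (frechet_derivative g (at y) v)"
        by metis
      also have "\<bar>\<dots>\<bar> \<le> c * norm (frechet_derivative g (at y) v)" by (rule W(2))
      also have "\<dots> \<le> c * (2 * norm v)" using g(2) that(5) by (rule mult_left_mono)
      finally show "\<bar>frechet_derivative (\<lambda>y. W (g y)) (at y) v\<bar> \<le> 2 * c * norm v" by simp
    qed
    let ?e1 = "(1, 0) :: complex \<times> real" and ?e2 = "(\<i>, 0) :: complex \<times> real" and ?e3 = "(0, 1) :: complex \<times> real"
    have n1: "norm ?e1 = 1" and n2: "norm ?e2 = 1" and n3: "norm ?e3 = 1" by simp_all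
    have b1: "\<bar>frechet_derivative V\<^sub>1 (at x) v\<bar> \<le> norm v / 2" for x v
      using V1(3)[of x v] norm_ge_zero[of v] by linarith
    obtain g\<^sub>1 where g1: "\<And>k. Ck k UNIV g\<^sub>1" "\<And>x. g\<^sub>1 (x + V\<^sub>1 x *\<^sub>R ?e1) = x"
      "\<And>y. g\<^sub>1 y + V\<^sub>1 (g\<^sub>1 y) *\<^sub>R ?e1 = y" "\<And>y v. norm (frechet_derivative g\<^sub>1 (at y) v) \<le> 2 * norm v"
      using shear_diffeo[of V\<^sub>1 ?e1, OF V1(1) b1 n1] by blast
    \<comment> \<open>At the image of x under the first shear this takes the value
      \<open>V\<^sub>2\<close> at x.\<close>
    define W\<^sub>2 where "W\<^sub>2 y = V\<^sub>2 (g\<^sub>1 y)" for y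
    have V2b: "\<bar>frechet_derivative V\<^sub>2 (at x) v\<bar> \<le> 1/8 * norm v" for x v using V2(3)[of x v] by simp
    have W2': "(\<forall>k. Ck k UNIV W\<^sub>2) \<and> (\<forall>y v. \<bar>frechet_derivative W\<^sub>2 (at y) v\<bar> \<le> 2 * (1/8) * norm v)"
      unfolding W\<^sub>2_def by (rule comp[of V\<^sub>2 "1/8" g\<^sub>1, OF V2(1) V2b g1(1,4)]) simp
    have W2: "Ck k UNIV W\<^sub>2" "\<bar>frechet_derivative W\<^sub>2 (at y) v\<bar> \<le> norm v / 2" for k y v
    proof -
      show "Ck k UNIV W\<^sub>2" using W2' by blast
      have "\<bar>frechet_derivative W\<^sub>2 (at y) v\<bar> \<le> 2 * (1/8) * norm v" using W2' by blast
      then show "\<bar>frechet_derivative W\<^sub>2 (at y) v\<bar> \<le> norm v / 2" using norm_ge_zero[of v] by linarith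
    qed
    obtain g\<^sub>2 where g2: "\<And>k. Ck k UNIV g\<^sub>2" "\<And>x. g\<^sub>2 (x + W\<^sub>2 x *\<^sub>R ?e2) = x"
      "\<And>y. g\<^sub>2 y + W\<^sub>2 (g\<^sub>2 y) *\<^sub>R ?e2 = y" "\<And>y v. norm (frechet_derivative g\<^sub>2 (at y) v) \<le> 2 * norm v"
      using shear_diffeo[of W\<^sub>2 ?e2, OF W2 n2] by blast
    have V3b: "\<bar>frechet_derivative V\<^sub>3 (at x) v\<bar> \<le> 1/8 * norm v" for x v using V3(3)[of x v] by simp
    define W\<^sub>3 where "W\<^sub>3 y = V\<^sub>3 (g\<^sub>1 (g\<^sub>2 y))" for y
    have c1: "(\<forall>k. Ck k UNIV (\<lambda>y. V\<^sub>3 (g\<^sub>1 y))) \<and>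
        (\<forall>y v. \<bar>frechet_derivative (\<lambda>y. V\<^sub>3 (g\<^sub>1 y)) (at y) v\<bar> \<le> 2 * (1/8) * norm v)"
      by (rule comp[of V\<^sub>3 "1/8" g\<^sub>1, OF V3(1) V3b g1(1,4)]) simp
    have c2: "(\<forall>k. Ck k UNIV W\<^sub>3) \<and> (\<forall>y v. \<bar>frechet_derivative W\<^sub>3 (at y) v\<bar> \<le> 2 * (2 * (1/8)) * norm v)"
      unfolding W\<^sub>3_def
      by (rule comp[of "\<lambda>y. V\<^sub>3 (g\<^sub>1 y)" "2 * (1/8)" g\<^sub>2]) (use c1 g2(1,4) in \<open>blast+, simp\<close>)
    have W3: "Ck k UNIV W\<^sub>3" "\<bar>frechet_derivative W\<^sub>3 (at y) v\<bar> \<le> norm v / 2" for k y v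
    proof -
      show "Ck k UNIV W\<^sub>3" using c2 by blast
      have "\<bar>frechet_derivative W\<^sub>3 (at y) v\<bar> \<le> 2 * (2 * (1/8)) * norm v" using c2 by blast
      then show "\<bar>frechet_derivative W\<^sub>3 (at y) v\<bar> \<le> norm v / 2" by simp
    qed
    obtain g\<^sub>3 where g3: "\<And>k. Ck k UNIV g\<^sub>3" "\<And>x. g\<^sub>3 (x + W\<^sub>3 x *\<^sub>R ?e3) = x"
      "\<And>y. g\<^sub>3 y + W\<^sub>3 (g\<^sub>3 y) *\<^sub>R ?e3 = y"
      using shear_diffeo[of W\<^sub>3 ?e3, OF W3 n3] by blast
    define h\<^sub>1 where "h\<^sub>1 x = x + V\<^sub>1 x *\<^sub>R ?e1" for x
    define h\<^sub>2 where "h\<^sub>2 x = x + W\<^sub>2 x *\<^sub>R ?e2" for x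
    define h\<^sub>3 where "h\<^sub>3 x = x + W\<^sub>3 x *\<^sub>R ?e3" for x
    have Ckh: "Ck k UNIV h\<^sub>1" "Ck k UNIV h\<^sub>2" "Ck k UNIV h\<^sub>3" for k
      unfolding h\<^sub>1_def h\<^sub>2_def h\<^sub>3_def
      by (intro Ck_add Ck_id Ck_scaleR Ck_const V1(1) W2(1) W3(1) open_UNIV)+
    have Ckc: "Ck k UNIV (\<lambda>x. p (q x))" if "\<And>k. Ck k UNIV p" "\<And>k. Ck k UNIV q"
      for p q :: "complex \<times> real \<Rightarrow> complex \<times> real" and k
      by (rule Ck_compose[where g = p, OF open_UNIV open_UNIV that(2) that(1) subset_UNIV])
    have f1: "h\<^sub>1 x = x" "g\<^sub>1 x = x" if "norm x \<ge> R" for x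
      using g1(2)[of x] V1(4)[OF that] by (simp_all add: h\<^sub>1_def zero_prod_def[symmetric])
    have f2: "h\<^sub>2 x = x" "g\<^sub>2 x = x" if "norm x \<ge> R" for x
      using g2(2)[of x] V2(4)[OF that] f1(2)[OF that] by (simp_all add: h\<^sub>2_def W\<^sub>2_def zero_prod_def[symmetric])
    have f3: "h\<^sub>3 x = x" if "norm x \<ge> R" for x
      using V3(4)[OF that] f1(2)[OF that] f2(2)[OF that] by (simp add: h\<^sub>3_def W\<^sub>3_def zero_prod_def[symmetric])
    have gh: "g\<^sub>1 (h\<^sub>1 x) = x" "g\<^sub>2 (h\<^sub>2 x) = x" "g\<^sub>3 (h\<^sub>3 x) = x"
      "h\<^sub>1 (g\<^sub>1 x) = x" "h\<^sub>2 (g\<^sub>2 x) = x" "h\<^sub>3 (g\<^sub>3 x) = x" for x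
      unfolding h\<^sub>1_def h\<^sub>2_def h\<^sub>3_def by (rule g1 g2 g3)+
    have "h\<^sub>3 (h\<^sub>2 (h\<^sub>1 (\<Gamma> t))) = \<Gamma> t + (Complex (u\<^sub>1 t) (u\<^sub>2 t), u\<^sub>3 t)" for t
    proof -
      have w2: "W\<^sub>2 (h\<^sub>1 (\<Gamma> t)) = u\<^sub>2 t" by (simp only: W\<^sub>2_def gh V2)
      have w3: "W\<^sub>3 (h\<^sub>2 (h\<^sub>1 (\<Gamma> t))) = u\<^sub>3 t" by (simp only: W\<^sub>3_def gh V3)
      have 1: "h\<^sub>3 (h\<^sub>2 (h\<^sub>1 (\<Gamma> t))) = h\<^sub>2 (h\<^sub>1 (\<Gamma> t)) + u\<^sub>3 t *\<^sub>R ?e3" by (simp only: h\<^sub>3_def[of "h\<^sub>2 (h\<^sub>1 (\<Gamma> t))"] w3)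
      have 2: "h\<^sub>2 (h\<^sub>1 (\<Gamma> t)) = h\<^sub>1 (\<Gamma> t) + u\<^sub>2 t *\<^sub>R ?e2" by (simp only: h\<^sub>2_def[of "h\<^sub>1 (\<Gamma> t)"] w2)
      have 3: "h\<^sub>1 (\<Gamma> t) = \<Gamma> t + u\<^sub>1 t *\<^sub>R ?e1" by (simp only: h\<^sub>1_def V1)
      show ?thesis unfolding 1 unfolding 2 unfolding 3 by (simp add: prod_eq_iff complex_eq_iff)
    qed
    note h\<Gamma> = this
    show ?thesis
    proof (intro exI conjI allI impI)
      show "Ck k UNIV (\<lambda>x. h\<^sub>3 (h\<^sub>2 (h\<^sub>1 x)))" for k by (rule Ckc[OF Ckh(3) Ckc[OF Ckh(2,1)]])
      show "Ck k UNIV (\<lambda>y. g\<^sub>1 (g\<^sub>2 (g\<^sub>3 y)))" for k by (rule Ckc[OF g1(1) Ckc[OF g2(1) g3(1)]])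
      show "g\<^sub>1 (g\<^sub>2 (g\<^sub>3 (h\<^sub>3 (h\<^sub>2 (h\<^sub>1 x))))) = x" for x by (simp only: gh)
      show "h\<^sub>3 (h\<^sub>2 (h\<^sub>1 (g\<^sub>1 (g\<^sub>2 (g\<^sub>3 y))))) = y" for y by (simp only: gh)
      show "h\<^sub>3 (h\<^sub>2 (h\<^sub>1 x)) = x" if "R \<le> norm x" for x by (simp only: f1(1)[OF that] f2(1)[OF that] f3[OF that])
    qed (rule h\<Gamma>)
  qed
  note main = this
  show ?thesis
  proof (rule exI[of _ \<delta>], rule conjI[OF \<delta>], rule exI[of _ R], intro allI impI)
    fix u\<^sub>1 u\<^sub>2 u\<^sub>3 :: "real \<Rightarrow> real"
    assume "\<forall>u\<in>{u\<^sub>1, u\<^sub>2, u\<^sub>3}. (\<forall>k. Ck k UNIV u) \<and> (\<forall>t. u (t + 2 * pi) = u t) \<and>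
      (\<forall>t. \<bar>u t\<bar> < \<delta> \<and> \<bar>vector_derivative u (at t)\<bar> < \<delta>)"
    then show "\<exists>h g. (\<forall>k. Ck k UNIV h) \<and> (\<forall>k. Ck k UNIV g) \<and> (\<forall>x. g (h x) = x) \<and> (\<forall>y. h (g y) = y) \<and>
      (\<forall>x. norm x \<ge> R \<longrightarrow> h x = x) \<and> (\<forall>t. h (\<Gamma> t) = \<Gamma> t + (Complex (u\<^sub>1 t) (u\<^sub>2 t), u\<^sub>3 t))"
      by (intro main) blast
  qed
qed

section \<open>Bounded knots\<close>

lemma algebraic_curve_approximation:
  fixes f\<^sub>1 f\<^sub>2 f\<^sub>3 :: "real \<Rightarrow> real"
  assumes der: "\<And>t. (f\<^sub>1 has_real_derivative f\<^sub>1' t) (at t)" "\<And>t. (f\<^sub>2 has_real_derivative f\<^sub>2' t) (at t)"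
      "\<And>t. (f\<^sub>3 has_real_derivative f\<^sub>3' t) (at t)"
    and cont: "continuous_on UNIV f\<^sub>1'" "continuous_on UNIV f\<^sub>2'" "continuous_on UNIV f\<^sub>3'"
    and per: "\<And>t. f\<^sub>1 (t + 2 * pi) = f\<^sub>1 t" "\<And>t. f\<^sub>2 (t + 2 * pi) = f\<^sub>2 t" "\<And>t. f\<^sub>3 (t + 2 * pi) = f\<^sub>3 t"
    and e: "e > 0"
  shows "\<exists>q\<^sub>1 q\<^sub>2 q\<^sub>3. algebraic_in_heis (heis_param ` circle_curve a q\<^sub>1 q\<^sub>2 q\<^sub>3 ` circle_dom a) \<and>
    (\<forall>t. \<bar>Re (poly q\<^sub>1 (cis t)) - f\<^sub>1 t\<bar> < e \<and> \<bar>Re (\<i> * cis t * poly (pderiv q\<^sub>1) (cis t)) - f\<^sub>1' t\<bar> < e) \<and>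
    (\<forall>t. \<bar>Re (poly q\<^sub>2 (cis t)) - f\<^sub>2 t\<bar> < e \<and> \<bar>Re (\<i> * cis t * poly (pderiv q\<^sub>2) (cis t)) - f\<^sub>2' t\<bar> < e) \<and>
    (\<forall>t. \<bar>Re (poly q\<^sub>3 (cis t)) - f\<^sub>3 t\<bar> < e \<and> \<bar>Re (\<i> * cis t * poly (pderiv q\<^sub>3) (cis t)) - f\<^sub>3' t\<bar> < e)"
proof -
  have e2: "e / 2 > 0" using e by simp
  obtain p\<^sub>1 where p1: "\<And>t. \<bar>Re (poly p\<^sub>1 (cis t)) - f\<^sub>1 t\<bar> < e/2 \<and> \<bar>Re (\<i> * cis t * poly (pderiv p\<^sub>1) (cis t)) - f\<^sub>1' t\<bar> < e/2"
    using trigonometric_C1_approximation[OF der(1) cont(1) per(1) e2] by blast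
  obtain p\<^sub>2 where p2: "\<And>t. \<bar>Re (poly p\<^sub>2 (cis t)) - f\<^sub>2 t\<bar> < e/2 \<and> \<bar>Re (\<i> * cis t * poly (pderiv p\<^sub>2) (cis t)) - f\<^sub>2' t\<bar> < e/2"
    using trigonometric_C1_approximation[OF der(2) cont(2) per(2) e2] by blast
  obtain p\<^sub>3 where p3: "\<And>t. \<bar>Re (poly p\<^sub>3 (cis t)) - f\<^sub>3 t\<bar> < e/2 \<and> \<bar>Re (\<i> * cis t * poly (pderiv p\<^sub>3) (cis t)) - f\<^sub>3' t\<bar> < e/2"
    using trigonometric_C1_approximation[OF der(3) cont(3) per(3) e2] by blast
  obtain q\<^sub>1 q\<^sub>2 q\<^sub>3 where
    q: "\<forall>(q, q') \<in> {(p\<^sub>1, q\<^sub>1), (p\<^sub>2, q\<^sub>2), (p\<^sub>3, q\<^sub>3)}. \<forall>t.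
      \<bar>Re (poly q' (cis t)) - Re (poly q (cis t))\<bar> < e/2 \<and>
      \<bar>Re (\<i> * cis t * poly (pderiv q') (cis t)) - Re (\<i> * cis t * poly (pderiv q) (cis t))\<bar> < e/2"
    and alg: "algebraic_in_heis (heis_param ` circle_curve a q\<^sub>1 q\<^sub>2 q\<^sub>3 ` circle_dom a)"
    using circle_curve_algebraic_perturbation[OF e2, of p\<^sub>1 p\<^sub>2 p\<^sub>3 a] by (elim exE conjE)
  have tri: "\<bar>x - z\<bar> < e" if "\<bar>x - y\<bar> < e/2" "\<bar>y - z\<bar> < e/2" for x y z :: real using that by linarith
  have c: "\<bar>Re (poly q (cis t)) - f t\<bar> < e \<and> \<bar>Re (\<i> * cis t * poly (pderiv q) (cis t)) - f' t\<bar> < e"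
    if p: "\<And>t. \<bar>Re (poly p (cis t)) - f t\<bar> < e/2 \<and> \<bar>Re (\<i> * cis t * poly (pderiv p) (cis t)) - f' t\<bar> < e/2"
      and m: "(p, q) \<in> {(p\<^sub>1, q\<^sub>1), (p\<^sub>2, q\<^sub>2), (p\<^sub>3, q\<^sub>3)}" for p q f f' t
  proof -
    have qt: "\<bar>Re (poly q (cis t)) - Re (poly p (cis t))\<bar> < e/2 \<and>
      \<bar>Re (\<i> * cis t * poly (pderiv q) (cis t)) - Re (\<i> * cis t * poly (pderiv p) (cis t))\<bar> < e/2"
      using bspec[OF q m] unfolding prod.case by blast
    show ?thesis
      by (intro conjI) (rule tri[OF qt[THEN conjunct1] p[THEN conjunct1]], rule tri[OF qt[THEN conjunct2] p[THEN conjunct2]])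
  qed
  have m: "(p\<^sub>1, q\<^sub>1) \<in> {(p\<^sub>1, q\<^sub>1), (p\<^sub>2, q\<^sub>2), (p\<^sub>3, q\<^sub>3)}" "(p\<^sub>2, q\<^sub>2) \<in> {(p\<^sub>1, q\<^sub>1), (p\<^sub>2, q\<^sub>2), (p\<^sub>3, q\<^sub>3)}"
    "(p\<^sub>3, q\<^sub>3) \<in> {(p\<^sub>1, q\<^sub>1), (p\<^sub>2, q\<^sub>2), (p\<^sub>3, q\<^sub>3)}" by blast+
  show ?thesis
    by (rule exI[of _ q\<^sub>1], rule exI[of _ q\<^sub>2], rule exI[of _ q\<^sub>3], intro conjI[OF alg] conjI allI)
      (rule c[OF p1 m(1), THEN conjunct1] c[OF p1 m(1), THEN conjunct2] c[OF p2 m(2), THEN conjunct1]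
        c[OF p2 m(2), THEN conjunct2] c[OF p3 m(3), THEN conjunct1] c[OF p3 m(3), THEN conjunct2])+
qed

lemma smooth_map_on_compose:
  fixes f :: "'a::real_normed_vector \<Rightarrow> 'b::euclidean_space"
  assumes "smooth_map_on A f" "smooth_map_on B g" "f ` A \<subseteq> B"
  shows "smooth_map_on A (\<lambda>x. g (f x))"
proof -
  obtain U F where U: "open U" "A \<subseteq> U" "\<And>k. Ck k U F" "\<And>x. x \<in> A \<Longrightarrow> F x = f x"
    using assms(1) unfolding smooth_map_on_def by blast
  obtain W G where W: "open W" "B \<subseteq> W" "\<And>k. Ck k W G" "\<And>x. x \<in> B \<Longrightarrow> G x = g x"
    using assms(2) unfolding smooth_map_on_def by blast
  let ?U = "U \<inter> F -` W"
  have "continuous_on U F" using U(3)[of 0] by simp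
  then have o: "open ?U" using U(1) W(1) by (rule continuous_open_preimage)
  have "Ck k ?U (\<lambda>x. G (F x))" for k
    by (rule Ck_compose[where g = G and T = W, OF o W(1) Ck_subset[OF U(3)] W(3)]) auto
  moreover have "A \<subseteq> ?U" using U(2,4) W(2) assms(3) by fastforce
  moreover have "G (F x) = g (f x)" if "x \<in> A" for x using that U(4) W(4) assms(3) by auto
  ultimately show ?thesis unfolding smooth_map_on_def using o by blast
qed

lemma smooth_map_on_continuous_on: "smooth_map_on A f \<Longrightarrow> continuous_on A f"
proof -
  assume "smooth_map_on A f"
  then obtain U F where U: "A \<subseteq> U" "Ck 0 U F" "\<And>x. x \<in> A \<Longrightarrow> F x = f x"
    unfolding smooth_map_on_def by blast
  then have "continuous_on A F" using continuous_on_subset[of U F A] by simp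
  then show ?thesis using U(3) by (rule continuous_on_eq)
qed

lemma smooth_map_on_circle_lift:
  fixes \<gamma> :: "complex \<Rightarrow> 'a::real_normed_vector"
  assumes "smooth_map_on (sphere 0 1) \<gamma>"
  shows "Ck k UNIV (\<lambda>t. \<gamma> (cis t))"
proof -
  obtain U F where U: "open U" "sphere 0 1 \<subseteq> U" "\<And>k. Ck k U F" "\<And>x. x \<in> sphere 0 1 \<Longrightarrow> F x = \<gamma> x"
    using assms unfolding smooth_map_on_def by blast
  have "Ck k UNIV (\<lambda>t. F (cis t))"
    by (rule Ck_compose[where g = F and T = U, OF open_UNIV U(1) Ck_cis U(3)]) (use U(2) in auto)
  moreover have "F (cis t) = \<gamma> (cis t)" for t by (rule U(4)) simp
  ultimately show ?thesis by simp
qed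

text \<open>If the velocity of \<open>g\<close> vanished, the chain rule for the left inverse
  \<open>G\<close> would make that of \<open>f\<close> vanish.\<close>

lemma regular_curve_image:
  fixes f :: "real \<Rightarrow> 'a::real_normed_vector" and g :: "real \<Rightarrow> 'b::real_normed_vector"
  assumes "vector_derivative f (at t) \<noteq> 0" "g differentiable (at t)"
    and "\<And>s. G (g s) = f s" "G differentiable (at (g t))"
  shows "vector_derivative g (at t) \<noteq> 0"
proof
  assume z: "vector_derivative g (at t) = 0"
  have g: "(g has_vector_derivative 0) (at t)" using assms(2) vector_derivative_works z by metis
  obtain D where D: "(G has_derivative D) (at (g t))" using assms(4) differentiable_def by blast
  have "((G \<circ> g) has_vector_derivative D 0) (at t)"
    by (rule vector_derivative_diff_chain_within[OF g has_derivative_at_withinI[OF D]])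
  moreover have "D 0 = 0" using D has_derivative_linear linear_0 by blast
  moreover have "G \<circ> g = f" using assms(3) by auto
  ultimately show False using assms(1) vector_derivative_at by metis
qed

lemma smooth_simple_closed_curve_image:
  fixes F G :: "complex \<times> complex \<Rightarrow> complex \<times> complex"
  assumes K: "smooth_simple_closed_curve K" and F: "smooth_map_on K F" and G: "smooth_map_on (F ` K) G"
    and GF: "\<And>x. x \<in> K \<Longrightarrow> G (F x) = x"
  shows "smooth_simple_closed_curve (F ` K)"
proof -
  obtain \<gamma> where \<gamma>: "smooth_map_on (sphere 0 1) \<gamma>" "inj_on \<gamma> (sphere 0 1)"
    "\<And>t. vector_derivative (\<lambda>s. \<gamma> (cis s)) (at t) \<noteq> 0" "K = \<gamma> ` sphere 0 1"
    using K unfolding smooth_simple_closed_curve_def by blast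
  let ?\<delta> = "\<lambda>u. F (\<gamma> u)"
  have sm: "smooth_map_on (sphere 0 1) ?\<delta>"
    by (rule smooth_map_on_compose[OF \<gamma>(1) F]) (simp add: \<gamma>(4))
  have inK: "\<gamma> u \<in> K" if "u \<in> sphere 0 1" for u using that \<gamma>(4) by blast
  have "inj_on ?\<delta> (sphere 0 1)"
  proof (rule inj_onI)
    fix u v assume uv: "u \<in> sphere 0 1" "v \<in> sphere 0 1" "F (\<gamma> u) = F (\<gamma> v)"
    then have "\<gamma> u = \<gamma> v" using GF[OF inK] by metis
    then show "u = v" using \<gamma>(2) uv by (meson inj_onD)
  qed
  moreover have "vector_derivative (\<lambda>s. ?\<delta> (cis s)) (at t) \<noteq> 0" for t
  proof -
    obtain U G' where U: "open U" "F ` K \<subseteq> U" "\<And>k. Ck k U G'" "\<And>x. x \<in> F ` K \<Longrightarrow> G' x = G x"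
      using G unfolding smooth_map_on_def by blast
    have c: "\<gamma> (cis s) \<in> K" for s by (rule inK) simp
    show ?thesis
    proof (rule regular_curve_image[OF \<gamma>(3)])
      show "(\<lambda>s. F (\<gamma> (cis s))) differentiable (at t)"
        using smooth_map_on_circle_lift[OF sm, of "Suc 0"] by simp
      show "G' (F (\<gamma> (cis s))) = \<gamma> (cis s)" for s using U(4) GF c by simp
      have "F (\<gamma> (cis t)) \<in> U" using U(2) c by blast
      then show "G' differentiable at (F (\<gamma> (cis t)))" using U(3)[of "Suc 0"] by simp
    qed
  qed
  moreover have "F ` K = ?\<delta> ` sphere 0 1" using \<gamma>(4) by auto
  ultimately show ?thesis unfolding smooth_simple_closed_curve_def using sm by blast
qed

section \<open>The sphere as the one-point compactification of the chart\<close>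

definition S3_pole :: "complex \<times> complex" where "S3_pole = (0, 1)"

definition S3_param :: "complex \<times> real \<Rightarrow> complex \<times> complex" where
  "S3_param x = phi (heis_param x)"

text \<open>The equations of \<open>phi\<close> solved for z = i a / (1 - b) and w = i (1 + b) / (1
  - b). The formula makes sense on the open set b \<noteq> 1 and not merely on the sphere, which
  gives smoothness.\<close>

definition S3_chart :: "complex \<times> complex \<Rightarrow> complex \<times> real" where
  "S3_chart y = (\<i> * fst y / (1 - snd y), Re (\<i> * (1 + snd y) / (1 - snd y)))"

lemma S3_iff: "y \<in> S3 \<longleftrightarrow> (cmod (fst y))\<^sup>2 + (cmod (snd y))\<^sup>2 = 1"
  by (cases y) (simp add: S3_def)

lemma S3_iff_norm: "y \<in> S3 \<longleftrightarrow> norm y = 1"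
  by (cases y) (simp add: S3_def norm_Pair)

lemma S3_snd_eq_1: "y \<in> S3 \<Longrightarrow> snd y = 1 \<longleftrightarrow> y = S3_pole"
  by (cases y) (auto simp: S3_def S3_pole_def)

lemma S3_pole_in_S3: "S3_pole \<in> S3"
  by (simp add: S3_def S3_pole_def)

lemma compact_S3: "compact S3"
proof -
  have "S3 = sphere 0 1" using S3_iff_norm by auto
  then show ?thesis using compact_sphere by metis
qed

lemma heis_param_snd_plus_ii: "snd (heis_param x) + \<i> \<noteq> 0"
proof
  assume "snd (heis_param x) + \<i> = 0"
  then have "Im (snd (heis_param x) + \<i>) = 0" by simp
  then have "(cmod (fst x))\<^sup>2 + 1 = 0" by (simp add: heis_param_def split_def)
  then show False by (smt (verit) zero_le_power2)
qed

lemma S3_param_eq: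
  "S3_param x = (2 * fst x / (snd (heis_param x) + \<i>), (snd (heis_param x) - \<i>) / (snd (heis_param x) + \<i>))"
  by (simp add: S3_param_def phi_def heis_param_def split_def)

lemma S3_param_in_S3: "S3_param x \<in> S3"
proof -
  define w where "w = snd (heis_param x)"
  have w0: "w + \<i> \<noteq> 0" using heis_param_snd_plus_ii by (simp add: w_def)
  have im: "Im w = (cmod (fst x))\<^sup>2" by (simp add: w_def heis_param_def split_def)
  \<comment> \<open>The difference |w + i|^2 - |w - i|^2 is 4 Im w, that is 4 |z|^2 on
    \<open>heis\<close>.\<close>
  have "(cmod (2 * fst x))\<^sup>2 + (cmod (w - \<i>))\<^sup>2 = (cmod (w + \<i>))\<^sup>2"
    using im by (simp add: cmod_power2 norm_mult power_mult_distrib) (simp add: power2_eq_square algebra_simps)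
  moreover have "(cmod (w + \<i>))\<^sup>2 \<noteq> 0" using w0 by simp
  ultimately show ?thesis
    unfolding S3_iff S3_param_eq w_def[symmetric] fst_conv snd_conv norm_divide power_divide
      add_divide_distrib[symmetric] by simp
qed

lemma S3_param_snd: "1 - snd (S3_param x) = 2 * \<i> / (snd (heis_param x) + \<i>)"
  using heis_param_snd_plus_ii[of x] unfolding S3_param_eq snd_conv by (simp add: divide_simps)

lemma S3_param_snd_neq: "snd (S3_param x) \<noteq> 1"
proof
  assume "snd (S3_param x) = 1"
  then have "2 * \<i> / (snd (heis_param x) + \<i>) = 0" using S3_param_snd[of x] by simp
  then show False using heis_param_snd_plus_ii[of x] by simp
qed

lemma S3_param_neq_pole: "S3_param x \<noteq> S3_pole"
  using S3_param_snd_neq[of x] by (auto simp: S3_pole_def)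

lemma S3_chart_param: "S3_chart (S3_param x) = x"
proof -
  define w where "w = snd (heis_param x)"
  have w0: "w + \<i> \<noteq> 0" using heis_param_snd_plus_ii by (simp add: w_def)
  have f: "fst (S3_param x) = 2 * fst x / (w + \<i>)" by (simp add: S3_param_eq w_def)
  have s: "1 - snd (S3_param x) = 2 * \<i> / (w + \<i>)" by (simp add: S3_param_snd w_def)
  have s2: "1 + snd (S3_param x) = 2 * w / (w + \<i>)"
    using w0 by (simp add: S3_param_eq w_def[symmetric] divide_simps)
  have q: "\<i> * (2 * z / d) / (2 * \<i> / d) = z" if "d \<noteq> 0" for z d :: complex
    using that by (simp add: field_simps)
  have "\<i> * fst (S3_param x) / (1 - snd (S3_param x)) = fst x"
    unfolding f s by (rule q[OF w0])
  moreover have "\<i> * (1 + snd (S3_param x)) / (1 - snd (S3_param x)) = w"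
    unfolding s s2 by (rule q[OF w0])
  moreover have "Re w = snd x" by (simp add: w_def heis_param_def split_def)
  ultimately show ?thesis by (simp add: S3_chart_def prod_eq_iff)
qed

lemma S3_param_chart:
  assumes "y \<in> S3" "y \<noteq> S3_pole"
  shows "S3_param (S3_chart y) = y"
proof -
  obtain a b where y: "y = (a, b)" by (cases y)
  have b1: "1 - b \<noteq> 0" using S3_snd_eq_1[OF assms(1)] assms(2) y by auto
  have ab: "(cmod a)\<^sup>2 + (cmod b)\<^sup>2 = 1" using assms(1) y by (simp add: S3_def)
  define z where "z = \<i> * a / (1 - b)"
  define w where "w = \<i> * (1 + b) / (1 - b)"
  \<comment> \<open>The sphere equation gives Im w = (1 - |b|^2) / |1 - b|^2 = |z|^2, so (z, w) lies
    on \<open>heis\<close>.\<close>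
  have "Im w = Re ((1 + b) / (1 - b))" by (simp add: w_def del: divide_complex_def flip: times_divide_eq_right)
  also have "\<dots> = Re ((1 + b) * cnj (1 - b)) / (cmod (1 - b))\<^sup>2"
    by (simp add: complex_div_cnj[of "1 + b"])
  also have "Re ((1 + b) * cnj (1 - b)) = 1 - (cmod b)\<^sup>2"
    by (simp add: cmod_power2) (simp add: power2_eq_square algebra_simps)
  also have "\<dots> = (cmod a)\<^sup>2" using ab by simp
  also have "(cmod a)\<^sup>2 / (cmod (1 - b))\<^sup>2 = (cmod z)\<^sup>2"
    by (simp add: z_def norm_mult norm_divide power_divide)
  finally have "heis_param (z, Re w) = (z, w)" by (simp add: heis_param_def complex_eq_iff)
  moreover have "S3_chart y = (z, Re w)" by (simp add: S3_chart_def y z_def w_def)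
  ultimately have "S3_param (S3_chart y) = (2 * z / (w + \<i>), (w - \<i>) / (w + \<i>))"
    by (simp add: S3_param_def phi_def)
  also have "w + \<i> = 2 * \<i> / (1 - b)" using b1 by (simp add: w_def field_simps)
  also have "w - \<i> = 2 * \<i> * b / (1 - b)" using b1 by (simp add: w_def field_simps)
  also have "2 * z / (2 * \<i> / (1 - b)) = a" using b1 by (simp add: z_def field_simps)
  also have "2 * \<i> * b / (1 - b) / (2 * \<i> / (1 - b)) = b" using b1 by (simp add: field_simps)
  finally show ?thesis using y by simp
qed

lemma Ck_S3_param: "Ck k UNIV S3_param"
proof -
  have s: "Ck k UNIV (\<lambda>x. snd (heis_param x))" by (intro Ck_snd Ck_heis_param open_UNIV)
  have f: "Ck k UNIV (\<lambda>x::complex\<times>real. fst x)" by (intro Ck_fst Ck_id open_UNIV)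
  have "Ck k UNIV (\<lambda>x. (2 * fst x / (snd (heis_param x) + \<i>), (snd (heis_param x) - \<i>) / (snd (heis_param x) + \<i>)))"
    by (intro Ck_Pair Ck_divide Ck_mult Ck_add Ck_diff Ck_const s f open_UNIV heis_param_snd_plus_ii)
  then show ?thesis unfolding S3_param_eq[abs_def] .
qed

lemma open_snd_neq_1: "open {y::complex\<times>complex. snd y \<noteq> 1}"
  by (intro open_Collect_neq continuous_on_snd continuous_on_id continuous_on_const)

lemma Ck_S3_chart: "Ck k {y. snd y \<noteq> 1} S3_chart"
  unfolding S3_chart_def[abs_def]
  by (intro Ck_Pair Ck_Re Ck_divide Ck_mult Ck_add Ck_diff Ck_const Ck_fst Ck_snd Ck_id open_snd_neq_1) auto

definition S3_extend :: "(complex \<times> real \<Rightarrow> complex \<times> real) \<Rightarrow> complex \<times> complex \<Rightarrow> complex \<times> complex" where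
  "S3_extend H y = (if y = S3_pole then S3_pole else S3_param (H (S3_chart y)))"

lemma S3_extend_param: "S3_extend H (S3_param x) = S3_param (H x)"
  by (simp add: S3_extend_def S3_param_neq_pole S3_chart_param)

lemma S3_extend_image: "S3_extend H ` S3_param ` A = S3_param ` H ` A"
  by (simp add: image_image S3_extend_param)

lemma S3_extend_pole: "S3_extend H S3_pole = S3_pole"
  by (simp add: S3_extend_def)

lemma S3_extend_in_S3: "y \<in> S3 \<Longrightarrow> S3_extend H y \<in> S3"
  by (simp add: S3_extend_def S3_pole_in_S3 S3_param_in_S3)

lemma S3_extend_inverse:
  assumes "\<And>x. G (H x) = x" "y \<in> S3"
  shows "S3_extend G (S3_extend H y) = y"
  using assms
  by (cases "y = S3_pole") (simp_all add: S3_extend_def S3_param_neq_pole S3_chart_param S3_param_chart)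

text \<open>At the pole continuity comes from the inverse: the complement of a neighbourhood of the
  pole is compact, so its preimage, the image under the conjugated \<open>G\<close>, is compact and
  misses the pole.\<close>

lemma S3_extend_continuous:
  assumes H: "continuous_on UNIV H" and G: "continuous_on UNIV G" and GH: "\<And>x. G (H x) = x"
  shows "continuous_on S3 (S3_extend H)"
proof -
  have cp: "continuous_on UNIV S3_param" using Ck_S3_param[of 0] by simp
  have cc: "continuous_on {y. snd y \<noteq> 1} S3_chart" using Ck_S3_chart[of 0] by simp
  have "continuous (at y within S3) (S3_extend H)" if y: "y \<in> S3" for y
  proof (cases "y = S3_pole")
    case False
    let ?W = "{y::complex\<times>complex. snd y \<noteq> 1}"
    have yW: "y \<in> ?W" using S3_snd_eq_1[OF y] False by simp
    have "continuous_on ?W (\<lambda>y. S3_param (H (S3_chart y)))"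
      by (rule continuous_on_compose2[OF cp continuous_on_compose2[OF H cc]]) auto
    then have "continuous_on ?W (S3_extend H)"
      by (rule continuous_on_eq) (auto simp: S3_extend_def S3_pole_def)
    then have "continuous (at y) (S3_extend H)"
      using open_snd_neq_1 yW continuous_on_eq_continuous_at by blast
    then show ?thesis by (rule continuous_at_imp_continuous_at_within)
  next
    case True
    have "\<exists>V. open V \<and> S3_pole \<in> V \<and> (\<forall>z\<in>S3. z \<in> V \<longrightarrow> S3_extend H z \<in> U)" if U: "open U" "S3_pole \<in> U" for U
    proof -
      have 1: "compact (S3 - U)" using compact_S3 U(1) by (rule compact_diff)
      have sub: "S3 - U \<subseteq> {y. snd y \<noteq> 1}" using S3_snd_eq_1 U(2) by blast
      have 2: "compact (S3_chart ` (S3 - U))"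
        by (rule compact_continuous_image[OF continuous_on_subset[OF cc sub] 1])
      have 3: "compact (G ` S3_chart ` (S3 - U))"
        by (rule compact_continuous_image[OF continuous_on_subset[OF G subset_UNIV] 2])
      have "compact (S3_param ` G ` S3_chart ` (S3 - U))"
        by (rule compact_continuous_image[OF continuous_on_subset[OF cp subset_UNIV] 3])
      then have o: "open (- (S3_param ` G ` S3_chart ` (S3 - U)))"
        by (intro open_Compl compact_imp_closed)
      have "S3_extend H z \<in> U" if z: "z \<in> S3" "z \<notin> S3_param ` G ` S3_chart ` (S3 - U)" for z
      proof (cases "z = S3_pole")
        case False
        show ?thesis
        proof (rule ccontr)
          assume n: "S3_extend H z \<notin> U"
          let ?y = "S3_extend H z"
          have "?y \<in> S3 - U" using n S3_extend_in_S3[OF z(1)] by blast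
          then have "S3_param (G (S3_chart ?y)) \<in> S3_param ` G ` S3_chart ` (S3 - U)" by blast
          moreover have "S3_param (G (S3_chart ?y)) = z"
            using False z(1) by (simp add: S3_extend_def S3_chart_param GH S3_param_chart)
          ultimately show False using z(2) by simp
        qed
      qed (simp add: S3_extend_pole U(2))
      moreover have "S3_pole \<in> - (S3_param ` G ` S3_chart ` (S3 - U))"
        using S3_param_neq_pole by (metis ComplI imageE)
      ultimately show ?thesis using o
        by (intro exI[of _ "- (S3_param ` G ` S3_chart ` (S3 - U))"]) blast
    qed
    then show ?thesis
      unfolding True continuous_within_topological S3_extend_pole by blast
  qed
  then show ?thesis by (simp add: continuous_on_eq_continuous_within)
qed

lemma S3_extend_homeomorphism:
  assumes "homeomorphism UNIV UNIV H G"
  shows "homeomorphism S3 S3 (S3_extend H) (S3_extend G)"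
proof -
  have H: "continuous_on UNIV H" "continuous_on UNIV G" "\<And>x. G (H x) = x" "\<And>x. H (G x) = x"
    using assms by (auto simp: homeomorphism_def)
  show ?thesis
    by (rule homeomorphismI)
      (auto intro: S3_extend_continuous[OF H(1,2,3)] S3_extend_continuous[OF H(2,1,4)] S3_extend_in_S3
        S3_extend_inverse[of G H, OF H(3)] S3_extend_inverse[of H G, OF H(4)])
qed

lemma Ck_normalize:
  "Ck k (- {0}) (\<lambda>y::'a::euclidean_space. inverse (norm y) *\<^sub>R y)"
proof -
  have o: "open (- {0::'a})" by (simp add: open_Compl)
  have "Ck k (- {0::'a}) (\<lambda>y. sqrt (inner y y))"
    by (rule Ck_compose[where g = sqrt and T = "{0<..}", OF o open_greaterThan Ck_inner[OF o Ck_id Ck_id] Ck_sqrt])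
      auto
  then have "Ck k (- {0::'a}) norm" by (simp add: norm_eq_sqrt_inner[abs_def])
  then show ?thesis
    by (intro Ck_scaleR Ck_inverse Ck_id o) auto
qed

text \<open>Smoothness on the sphere asks for an extension to an open set; radial projection
  provides it. Near the pole the conjugated map is the identity, since \<open>H\<close> fixes all
  points outside a ball.\<close>

lemma S3_extend_smooth:
  assumes H: "\<And>k. Ck k UNIV H" and R: "\<And>x. norm x \<ge> R \<Longrightarrow> H x = x"
  shows "smooth_map_on S3 (S3_extend H)"
proof -
  define \<nu> where "\<nu> y = inverse (norm y) *\<^sub>R y" for y :: "complex \<times> complex"
  have o: "open (- {0::complex\<times>complex})" by (simp add: open_Compl)
  have \<nu>S: "\<nu> y \<in> S3" if "y \<noteq> 0" for y using that by (simp add: \<nu>_def S3_iff_norm)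
  have \<nu>y: "\<nu> y = y" if "y \<in> S3" for y using that by (simp add: \<nu>_def S3_iff_norm)
  have Ck\<nu>: "Ck k (- {0}) \<nu>" for k unfolding \<nu>_def by (rule Ck_normalize)
  have c\<nu>: "continuous_on (- {0}) \<nu>" using Ck\<nu>[of 0] by simp
  let ?W = "{y::complex\<times>complex. snd y \<noteq> 1}"
  let ?C = "S3_param ` cball 0 R"
  have "continuous_on UNIV S3_param" using Ck_S3_param[of 0] by simp
  then have "compact ?C" by (intro compact_continuous_image) (auto intro: continuous_on_subset)
  then have oC: "open (- ?C)" by (intro open_Compl compact_imp_closed)
  have pC: "S3_pole \<in> - ?C" using S3_param_neq_pole by (metis ComplI imageE)
  have "Ck k (- {0}) (\<lambda>y. S3_extend H (\<nu> y))" for k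
  proof (rule Ck_local)
    fix y :: "complex \<times> complex" assume y: "y \<in> - {0}"
    show "\<exists>U. open U \<and> y \<in> U \<and> Ck k U (\<lambda>y. S3_extend H (\<nu> y))"
    proof (cases "snd (\<nu> y) = 1")
      case False
      let ?U = "(- {0}) \<inter> \<nu> -` ?W"
      have oU: "open ?U" by (rule continuous_open_preimage[OF c\<nu> o open_snd_neq_1])
      have 1: "Ck k ?U \<nu>" by (rule Ck_subset[OF Ck\<nu>]) auto
      have 2: "Ck k ?U (\<lambda>y. S3_chart (\<nu> y))"
        by (rule Ck_compose[where g = S3_chart, OF oU open_snd_neq_1 1 Ck_S3_chart]) auto
      have 3: "Ck k ?U (\<lambda>y. H (S3_chart (\<nu> y)))"
        by (rule Ck_compose[where g = H, OF oU open_UNIV 2 H subset_UNIV])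
      have 4: "Ck k ?U (\<lambda>y. S3_param (H (S3_chart (\<nu> y))))"
        by (rule Ck_compose[where g = S3_param, OF oU open_UNIV 3 Ck_S3_param subset_UNIV])
      have "S3_extend H (\<nu> z) = S3_param (H (S3_chart (\<nu> z)))" if "z \<in> ?U" for z
      proof -
        have "\<nu> z \<noteq> S3_pole" using that unfolding S3_pole_def by fastforce
        then show ?thesis by (simp add: S3_extend_def)
      qed
      then have "Ck k ?U (\<lambda>y. S3_extend H (\<nu> y)) \<longleftrightarrow> Ck k ?U (\<lambda>y. S3_param (H (S3_chart (\<nu> y))))"
        by (rule Ck_cong[OF oU])
      then have "Ck k ?U (\<lambda>y. S3_extend H (\<nu> y))" using 4 by (rule iffD2)
      moreover have "y \<in> ?U" using False y by simp
      ultimately show ?thesis using oU by blast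
    next
      case True
      let ?U = "(- {0}) \<inter> \<nu> -` (- ?C)"
      have oU: "open ?U" by (rule continuous_open_preimage[OF c\<nu> o oC])
      have "S3_extend H (\<nu> z) = \<nu> z" if z: "z \<in> ?U" for z
      proof (cases "\<nu> z = S3_pole")
        case False
        have zS: "\<nu> z \<in> S3" using z by (intro \<nu>S) simp
        have e: "S3_param (S3_chart (\<nu> z)) = \<nu> z" by (rule S3_param_chart[OF zS False])
        have "S3_chart (\<nu> z) \<notin> cball 0 R"
        proof
          assume "S3_chart (\<nu> z) \<in> cball 0 R"
          then have "S3_param (S3_chart (\<nu> z)) \<in> ?C" by blast
          then show False using z e by simp
        qed
        then have "H (S3_chart (\<nu> z)) = S3_chart (\<nu> z)" by (intro R) simp
        then show ?thesis using e False by (simp add: S3_extend_def)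
      qed (simp add: S3_extend_pole)
      then have "Ck k ?U (\<lambda>y. S3_extend H (\<nu> y)) \<longleftrightarrow> Ck k ?U \<nu>"
        by (rule Ck_cong[OF oU])
      then have "Ck k ?U (\<lambda>y. S3_extend H (\<nu> y))"
        by (rule iffD2) (rule Ck_subset[OF Ck\<nu> Int_lower1])
      moreover have "\<nu> y = S3_pole" using True S3_snd_eq_1[OF \<nu>S] y by simp
      then have "y \<in> ?U" using pC y by simp
      ultimately show ?thesis using oU by blast
    qed
  qed
  moreover have "S3 \<subseteq> - {0}" by (auto simp: S3_iff_norm)
  ultimately show ?thesis unfolding smooth_map_on_def
    using o \<nu>y by (intro exI[of _ "- {0}"] exI[of _ "\<lambda>y. S3_extend H (\<nu> y)"]) auto
qed

lemma diffeo_equivalent_trans: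
  assumes "diffeo_equivalent A B" "diffeo_equivalent B C"
  shows "diffeo_equivalent A C"
proof -
  obtain h g where 1: "homeomorphism S3 S3 h g" "smooth_map_on S3 h" "smooth_map_on S3 g" "h ` A = B"
    using assms(1) unfolding diffeo_equivalent_def by blast
  obtain h' g' where 2: "homeomorphism S3 S3 h' g'" "smooth_map_on S3 h'" "smooth_map_on S3 g'" "h' ` B = C"
    using assms(2) unfolding diffeo_equivalent_def by blast
  have "homeomorphism S3 S3 (h' \<circ> h) (g \<circ> g')" by (rule homeomorphism_compose[OF 1(1) 2(1)])
  moreover have "smooth_map_on S3 (h' \<circ> h)"
    unfolding o_def using homeomorphism_image1[OF 1(1)] by (intro smooth_map_on_compose[OF 1(2) 2(2)]) simp
  moreover have "smooth_map_on S3 (g \<circ> g')"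
    unfolding o_def using homeomorphism_image2[OF 2(1)] by (intro smooth_map_on_compose[OF 2(3) 1(3)]) simp
  moreover have "(h' \<circ> h) ` A = C" unfolding image_comp[symmetric] 1(4) 2(4) ..
  ultimately show ?thesis unfolding diffeo_equivalent_def by blast
qed

lemma homeo_equivalent_trans:
  assumes "homeo_equivalent A B" "homeo_equivalent B C"
  shows "homeo_equivalent A C"
proof -
  obtain h g where 1: "homeomorphism S3 S3 h g" "h ` A = B"
    using assms(1) unfolding homeo_equivalent_def by blast
  obtain h' g' where 2: "homeomorphism S3 S3 h' g'" "h' ` B = C"
    using assms(2) unfolding homeo_equivalent_def by blast
  have "homeomorphism S3 S3 (h' \<circ> h) (g \<circ> g')" by (rule homeomorphism_compose[OF 1(1) 2(1)])
  moreover have "(h' \<circ> h) ` A = C" unfolding image_comp[symmetric] 1(2) 2(2) ..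
  ultimately show ?thesis unfolding homeo_equivalent_def by blast
qed

lemma diffeo_imp_homeo_equivalent: "diffeo_equivalent A B \<Longrightarrow> homeo_equivalent A B"
  unfolding diffeo_equivalent_def homeo_equivalent_def by blast

lemma smooth_knot_imp_continuous_knot:
  assumes "smooth_knot K"
  shows "continuous_knot K"
proof -
  obtain \<gamma> :: "complex \<Rightarrow> complex \<times> complex" where "smooth_map_on (sphere 0 1) \<gamma>" "inj_on \<gamma> (sphere 0 1)"
    "K = \<gamma> ` sphere 0 1" "K \<subseteq> S3"
    using assms unfolding smooth_knot_def smooth_simple_closed_curve_def by (elim conjE exE)
  then show ?thesis unfolding continuous_knot_def
    by (intro conjI exI[of _ \<gamma>] smooth_map_on_continuous_on)
qed

lemma phi_image_heis:
  assumes "K \<subseteq> heis"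
  shows "phi ` K = S3_param ` heis_chart ` K"
  unfolding image_image
proof (rule image_cong[OF refl])
  fix x assume "x \<in> K"
  then have "heis_param (heis_chart x) = x" using assms by (intro heis_param_chart) blast
  then show "phi x = S3_param (heis_chart x)" by (simp add: S3_param_def)
qed

lemma Ck_heis_chart: "Ck k UNIV heis_chart"
proof -
  have e: "heis_chart = (\<lambda>x. (fst x, Re (snd x)))" by (auto simp: heis_chart_def)
  show ?thesis
    unfolding e by (intro Ck_Pair Ck_Re Ck_fst Ck_snd Ck_id open_UNIV)
qed

lemma smooth_knot_phi:
  assumes "bounded_knot K"
  shows "smooth_knot (phi ` K)"
proof -
  have K: "K \<subseteq> heis" "smooth_simple_closed_curve K" using assms by (auto simp: bounded_knot_def)
  let ?F = "\<lambda>x. S3_param (heis_chart x)" and ?G = "\<lambda>y. heis_param (S3_chart y)"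
  have F: "phi ` K = ?F ` K" using phi_image_heis[OF K(1)] by (simp add: image_image)
  have "smooth_map_on K ?F"
    by (rule smooth_map_onI[OF open_UNIV subset_UNIV
        Ck_compose[where g = S3_param, OF open_UNIV open_UNIV Ck_heis_chart Ck_S3_param subset_UNIV]])
  moreover have "smooth_map_on (?F ` K) ?G"
  proof (rule smooth_map_onI[OF open_snd_neq_1 _
        Ck_compose[where g = heis_param, OF open_snd_neq_1 open_UNIV Ck_S3_chart Ck_heis_param subset_UNIV]])
    show "?F ` K \<subseteq> {y. snd y \<noteq> 1}" using S3_param_snd_neq by blast
  qed
  moreover have "?G (?F x) = x" if "x \<in> K" for x
  proof -
    have "x \<in> heis" using that K(1) by blast
    then show ?thesis by (simp only: S3_chart_param heis_param_chart)
  qed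
  ultimately have "smooth_simple_closed_curve (?F ` K)"
    by (rule smooth_simple_closed_curve_image[OF K(2)])
  then show ?thesis unfolding smooth_knot_def F using S3_param_in_S3 by blast
qed

section \<open>Algebraic representatives of bounded types\<close>

text \<open>The trigonometric curve is the image of the knot under an ambient diffeomorphism of the
  chart, so simplicity, regularity and the type are all inherited from \<open>K\<close>.\<close>

theorem bounded_knot_algebraic:
  assumes "bounded_knot K"
  shows "\<exists>K'. bounded_knot K' \<and> algebraic_in_heis K' \<and> diffeo_equivalent (phi ` K) (phi ` K')"
proof -
  have K: "K \<subseteq> heis" "smooth_simple_closed_curve K" using assms by (auto simp: bounded_knot_def)
  obtain \<gamma> where \<gamma>: "smooth_map_on (sphere 0 1) \<gamma>" "inj_on \<gamma> (sphere 0 1)"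
    "\<And>t. vector_derivative (\<lambda>s. \<gamma> (cis s)) (at t) \<noteq> 0" "K = \<gamma> ` sphere 0 1"
    using K(2) unfolding smooth_simple_closed_curve_def by blast
  define \<Gamma> where "\<Gamma> t = heis_chart (\<gamma> (cis t))" for t
  have inK: "\<gamma> (cis t) \<in> heis" for t using K(1) \<gamma>(4) by auto
  have p\<Gamma>: "heis_param (\<Gamma> t) = \<gamma> (cis t)" for t unfolding \<Gamma>_def by (rule heis_param_chart[OF inK])
  have Ck\<Gamma>: "Ck k UNIV \<Gamma>" for k
    unfolding \<Gamma>_def
    by (rule Ck_compose[where g = heis_chart, OF open_UNIV open_UNIV smooth_map_on_circle_lift[OF \<gamma>(1)]
        Ck_heis_chart subset_UNIV])
  have cper: "cis (t + 2 * pi) = cis t" for t by (simp flip: cis_mult)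
  have per: "\<Gamma> (t + 2 * pi) = \<Gamma> t" for t by (simp only: \<Gamma>_def cper)
  have inj: "cis s = cis t" if "\<Gamma> s = \<Gamma> t" for s t
  proof -
    have "\<gamma> (cis s) = \<gamma> (cis t)" using p\<Gamma> that by metis
    then show ?thesis using \<gamma>(2) by (auto dest: inj_onD)
  qed
  have reg: "vector_derivative \<Gamma> (at t) \<noteq> 0" for t
  proof (rule regular_curve_image[where G = heis_param, OF \<gamma>(3)])
    show "\<Gamma> differentiable (at t)" using Ck\<Gamma>[of "Suc 0"] by simp
    show "heis_param (\<Gamma> s) = \<gamma> (cis s)" for s by (rule p\<Gamma>)
    have "\<forall>x. heis_param differentiable (at x)" using Ck_heis_param[of "Suc 0"] unfolding Ck.simps by blast
    then show "heis_param differentiable (at (\<Gamma> t))" by blast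
  qed
  obtain \<delta> R where \<delta>: "\<delta> > 0" and pert: "\<And>u\<^sub>1 u\<^sub>2 u\<^sub>3. (\<forall>u\<in>{u\<^sub>1, u\<^sub>2, u\<^sub>3}. (\<forall>k. Ck k UNIV u) \<and> (\<forall>t. u (t + 2 * pi) = u t) \<and>
      (\<forall>t. \<bar>u t\<bar> < \<delta> \<and> \<bar>vector_derivative u (at t)\<bar> < \<delta>)) \<Longrightarrow>
    (\<exists>h g. (\<forall>k. Ck k UNIV h) \<and> (\<forall>k. Ck k UNIV g) \<and> (\<forall>x. g (h x) = x) \<and> (\<forall>y. h (g y) = y) \<and>
      (\<forall>x. norm x \<ge> R \<longrightarrow> h x = x) \<and> (\<forall>t. h (\<Gamma> t) = \<Gamma> t + (Complex (u\<^sub>1 t) (u\<^sub>2 t), u\<^sub>3 t)))"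
    using smooth_curve_perturbation[of \<Gamma>, OF Ck\<Gamma> per inj reg] by blast
  let ?f\<^sub>1 = "\<lambda>t. Re (fst (\<Gamma> t))" and ?f\<^sub>2 = "\<lambda>t. Im (fst (\<Gamma> t))" and ?f\<^sub>3 = "\<lambda>t. snd (\<Gamma> t)"
  have Ckf: "Ck k UNIV ?f\<^sub>1" "Ck k UNIV ?f\<^sub>2" "Ck k UNIV ?f\<^sub>3" for k
    by (intro Ck_Re Ck_Im Ck_fst Ck_snd Ck\<Gamma> open_UNIV)+
  have der: "(f has_real_derivative vector_derivative f (at t)) (at t)" "continuous_on UNIV (\<lambda>t. vector_derivative f (at t))"
    if "\<And>k. Ck k UNIV f" for f :: "real \<Rightarrow> real" and t
    using Ck_vector_derivative(2)[OF open_UNIV that UNIV_I] Ck_vector_derivative(1)[OF open_UNIV that[of "Suc 0"]]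
    by (simp_all add: has_real_derivative_iff_has_vector_derivative)
  obtain q\<^sub>1 q\<^sub>2 q\<^sub>3 where alg: "algebraic_in_heis (heis_param ` circle_curve 0 q\<^sub>1 q\<^sub>2 q\<^sub>3 ` circle_dom 0)"
    and q1: "\<forall>t. \<bar>Re (poly q\<^sub>1 (cis t)) - ?f\<^sub>1 t\<bar> < \<delta> \<and> \<bar>Re (\<i> * cis t * poly (pderiv q\<^sub>1) (cis t)) - vector_derivative ?f\<^sub>1 (at t)\<bar> < \<delta>"
    and q2: "\<forall>t. \<bar>Re (poly q\<^sub>2 (cis t)) - ?f\<^sub>2 t\<bar> < \<delta> \<and> \<bar>Re (\<i> * cis t * poly (pderiv q\<^sub>2) (cis t)) - vector_derivative ?f\<^sub>2 (at t)\<bar> < \<delta>"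
    and q3: "\<forall>t. \<bar>Re (poly q\<^sub>3 (cis t)) - ?f\<^sub>3 t\<bar> < \<delta> \<and> \<bar>Re (\<i> * cis t * poly (pderiv q\<^sub>3) (cis t)) - vector_derivative ?f\<^sub>3 (at t)\<bar> < \<delta>"
    using algebraic_curve_approximation[of ?f\<^sub>1 _ ?f\<^sub>2 _ ?f\<^sub>3 _ \<delta> 0, OF der(1)[OF Ckf(1)] der(1)[OF Ckf(2)] der(1)[OF Ckf(3)]
      der(2)[OF Ckf(1)] der(2)[OF Ckf(2)] der(2)[OF Ckf(3)] _ _ _ \<delta>]
    unfolding per by blast
  define u where "u q f t = Re (poly q (cis t)) - f t" for q f and t :: real
  have Ckq: "Ck k UNIV (\<lambda>t. Re (poly q (cis t)))" for q k
  proof -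
    show ?thesis
      unfolding poly_altdef by (intro Ck_Re Ck_sum Ck_mult Ck_const Ck_power Ck_cis open_UNIV)
  qed
  have u: "(\<forall>k. Ck k UNIV (u q f)) \<and> (\<forall>t. u q f (t + 2 * pi) = u q f t) \<and>
      (\<forall>t. \<bar>u q f t\<bar> < \<delta> \<and> \<bar>vector_derivative (u q f) (at t)\<bar> < \<delta>)"
    if f: "\<And>k. Ck k UNIV f" "\<And>t. f (t + 2 * pi) = f t" and
      q: "\<forall>t. \<bar>Re (poly q (cis t)) - f t\<bar> < \<delta> \<and> \<bar>Re (\<i> * cis t * poly (pderiv q) (cis t)) - vector_derivative f (at t)\<bar> < \<delta>" for q f
  proof -
    have "Ck k UNIV (u q f)" for k unfolding u_def by (intro Ck_diff Ckq f open_UNIV)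
    moreover have "u q f (t + 2 * pi) = u q f t" for t by (simp only: u_def cper f(2))
    moreover have "vector_derivative (u q f) (at t) = Re (\<i> * cis t * poly (pderiv q) (cis t)) - vector_derivative f (at t)" for t
    proof (rule vector_derivative_at)
      show "(u q f has_vector_derivative Re (\<i> * cis t * poly (pderiv q) (cis t)) - vector_derivative f (at t)) (at t)"
        unfolding u_def has_real_derivative_iff_has_vector_derivative[symmetric]
        by (intro DERIV_diff Re_poly_cis_derivative der(1)[OF f(1)])
    qed
    moreover have "\<bar>u q f t\<bar> < \<delta>" for t using q unfolding u_def by blast
    ultimately show ?thesis using q by simp
  qed
  have "\<forall>v\<in>{u q\<^sub>1 ?f\<^sub>1, u q\<^sub>2 ?f\<^sub>2, u q\<^sub>3 ?f\<^sub>3}. (\<forall>k. Ck k UNIV v) \<and> (\<forall>t. v (t + 2 * pi) = v t) \<and>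
      (\<forall>t. \<bar>v t\<bar> < \<delta> \<and> \<bar>vector_derivative v (at t)\<bar> < \<delta>)"
    using u[OF Ckf(1) _ q1] u[OF Ckf(2) _ q2] u[OF Ckf(3) _ q3] unfolding per by blast
  from pert[OF this] obtain h g where hg: "\<And>k. Ck k UNIV h" "\<And>k. Ck k UNIV g" "\<And>x. g (h x) = x" "\<And>y. h (g y) = y"
    "\<And>x. norm x \<ge> R \<Longrightarrow> h x = x"
    and h\<Gamma>: "\<And>t. h (\<Gamma> t) = \<Gamma> t + (Complex (u q\<^sub>1 ?f\<^sub>1 t) (u q\<^sub>2 ?f\<^sub>2 t), u q\<^sub>3 ?f\<^sub>3 t)"
    by blast
  \<comment> \<open>The displacement was taken to be trigonometric curve minus knot, so adding it to
    the knot gives the algebraic curve with the same parameter.\<close>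
  have curve: "h (\<Gamma> t) = circle_curve 0 q\<^sub>1 q\<^sub>2 q\<^sub>3 (cis t)" for t
    unfolding h\<Gamma> by (simp add: u_def circle_curve_def prod_eq_iff complex_eq_iff)
  have sph: "sphere 0 1 = range cis" using cis_Arg_unit by (auto simp: image_iff) metis
  have dom: "circle_dom 0 = range cis" unfolding sph[symmetric] by (auto simp: circle_dom_def)
  have K\<Gamma>: "heis_chart ` K = range \<Gamma>" unfolding \<gamma>(4) sph \<Gamma>_def by auto
  define K' where "K' = heis_param ` h ` heis_chart ` K"
  have K'eq: "K' = heis_param ` circle_curve 0 q\<^sub>1 q\<^sub>2 q\<^sub>3 ` circle_dom 0"
    unfolding K'_def K\<Gamma> dom image_image curve ..
  let ?F = "\<lambda>x. heis_param (h (heis_chart x))" and ?G = "\<lambda>x. heis_param (g (heis_chart x))"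
  have CkFG: "Ck k UNIV (\<lambda>x. heis_param (f (heis_chart x)))" if "\<And>k. Ck k UNIV f" for k f
    by (rule Ck_compose[where g = heis_param, OF open_UNIV open_UNIV _ Ck_heis_param subset_UNIV],
        rule Ck_compose[where g = f, OF open_UNIV open_UNIV Ck_heis_chart that subset_UNIV])
  have K'F: "K' = ?F ` K" by (simp add: K'_def image_image)
  have "smooth_simple_closed_curve K'"
    unfolding K'F
  proof (rule smooth_simple_closed_curve_image[OF K(2)])
    show "smooth_map_on K ?F" by (rule smooth_map_onI[OF open_UNIV subset_UNIV CkFG[OF hg(1)]])
    show "smooth_map_on (?F ` K) ?G" by (rule smooth_map_onI[OF open_UNIV subset_UNIV CkFG[OF hg(2)]])
    show "?G (?F x) = x" if "x \<in> K" for x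
    proof -
      have "x \<in> heis" using that K(1) by blast
      then show ?thesis by (simp add: heis_chart_param hg(3) heis_param_chart)
    qed
  qed
  then have bK': "bounded_knot K'" unfolding bounded_knot_def K'F using heis_param_in_heis by blast
  have g_out: "g x = x" if "norm x \<ge> R" for x using hg(3)[of x] hg(5)[OF that] by simp
  have hom: "homeomorphism UNIV UNIV h g"
    using hg(1)[of 0] hg(2)[of 0] hg(3,4) by (intro homeomorphismI) auto
  have "phi ` K' = S3_param ` heis_chart ` K'" by (rule phi_image_heis) (use bK' in \<open>simp add: bounded_knot_def\<close>)
  also have "heis_chart ` K' = h ` heis_chart ` K" by (simp add: K'_def image_image heis_chart_param)
  finally have "S3_extend h ` phi ` K = phi ` K'"
    unfolding phi_image_heis[OF K(1)] S3_extend_image by simp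
  then have "diffeo_equivalent (phi ` K) (phi ` K')"
    unfolding diffeo_equivalent_def
    using S3_extend_homeomorphism[OF hom] S3_extend_smooth[of h R, OF hg(1,5)] S3_extend_smooth[of g R, OF hg(2) g_out]
    by blast
  then show ?thesis using bK' alg K'eq by blast
qed

text \<open>A diffeomorphism is in particular a homeomorphism, so the same knot serves smooth and
  continuous types.\<close>

theorem bounded_type_algebraic:
  assumes \<tau>: "smooth_knot_type \<tau> \<or> continuous_knot_type \<tau>" and K: "of_bounded_type \<tau> K"
  shows "\<exists>K'. of_bounded_type \<tau> K' \<and> algebraic_in_heis K'"
proof -
  have bK: "bounded_knot K" and KT: "phi ` K \<in> \<tau>" using K by (auto simp: of_bounded_type_def)
  obtain K' where K': "bounded_knot K'" "algebraic_in_heis K'" "diffeo_equivalent (phi ` K) (phi ` K')"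
    using bounded_knot_algebraic[OF bK] by blast
  have sm: "smooth_knot (phi ` K')" by (rule smooth_knot_phi[OF K'(1)])
  have "phi ` K' \<in> \<tau>"
    using \<tau>
  proof
    assume "smooth_knot_type \<tau>"
    then obtain J where "\<tau> = {L. smooth_knot L \<and> diffeo_equivalent J L}" unfolding smooth_knot_type_def by blast
    then show ?thesis using KT K'(3) sm diffeo_equivalent_trans by blast
  next
    assume "continuous_knot_type \<tau>"
    then obtain J where "\<tau> = {L. continuous_knot L \<and> homeo_equivalent J L}" unfolding continuous_knot_type_def by blast
    then show ?thesis using KT smooth_knot_imp_continuous_knot[OF sm]
      homeo_equivalent_trans[OF _ diffeo_imp_homeo_equivalent[OF K'(3)]] by blast
  qed
  then show ?thesis using K' by (auto simp: of_bounded_type_def)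
qed

section \<open>Unbounded knots\<close>

text \<open>Solving x + V x = y is a fixed point problem for the contraction x |-> y - V x;
  continuity of the inverse comes from invariance of domain.\<close>

lemma lipschitz_perturbation_homeomorphism:
  fixes V :: "'a::euclidean_space \<Rightarrow> 'a"
  assumes c: "0 \<le> c" "c < 1" and V: "\<And>x y. norm (V x - V y) \<le> c * norm (x - y)"
  shows "\<exists>g. homeomorphism UNIV UNIV (\<lambda>x. x + V x) g"
proof -
  have inj: "x = y" if "x + V x = y + V y" for x y
  proof -
    have "x - y = (x + V x) - (y + V y) + (V y - V x)" by simp
    then have "norm (x - y) = norm (V y - V x)" using that by simp
    also have "\<dots> \<le> c * norm (x - y)" using V[of y x] by (simp add: norm_minus_commute)
    finally have "(1 - c) * norm (x - y) \<le> 0" by (simp add: algebra_simps)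
    then have "norm (x - y) \<le> 0" using c by (simp add: mult_le_0_iff)
    then show ?thesis by simp
  qed
  have contV: "continuous_on UNIV V"
  proof (rule continuous_on_iff[THEN iffD2], intro ballI allI impI)
    fix x :: 'a and e :: real assume "e > 0"
    have "dist (V y) (V x) < e" if "dist y x < e" for y
    proof -
      have "dist (V y) (V x) \<le> c * dist y x" using V[of y x] by (simp add: dist_norm)
      also have "\<dots> \<le> 1 * dist y x" using c by (intro mult_right_mono) auto
      finally show ?thesis using that by simp
    qed
    then show "\<exists>d>0. \<forall>y\<in>UNIV. dist y x < d \<longrightarrow> dist (V y) (V x) < e" using \<open>e > 0\<close> by blast
  qed
  have surj: "\<exists>x. x + V x = y" for y
  proof -
    have "\<exists>!x. y - V x = x"
    proof (rule banach_fix_type[OF c])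
      show "\<forall>x z. dist (y - V x) (y - V z) \<le> c * dist x z"
      proof (intro allI)
        fix x z
        show "dist (y - V x) (y - V z) \<le> c * dist x z"
          using V[of z x] by (simp add: dist_norm norm_minus_commute)
      qed
    qed
    then obtain x where "y - V x = x" by blast
    then have "x + V x = y" by (metis diff_add_cancel)
    then show ?thesis by blast
  qed
  have ch: "continuous_on UNIV (\<lambda>x. x + V x)" by (intro continuous_on_add continuous_on_id contV)
  have "inj (\<lambda>x. x + V x)" by (rule injI) (rule inj)
  then obtain g where "homeomorphism UNIV (range (\<lambda>x. x + V x)) (\<lambda>x. x + V x) g"
    using invariance_of_domain_homeomorphism[OF open_UNIV ch order_refl] by blast
  moreover have "range (\<lambda>x. x + V x) = UNIV" using surj by (metis surj_def)
  ultimately show ?thesis by metis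
qed

text \<open>McShane's extension, truncated so as not to exceed the bound of the given function.\<close>

lemma mcshane_extension:
  fixes \<gamma> :: "'i \<Rightarrow> 'a::real_normed_vector" and u :: "'i \<Rightarrow> real"
  assumes L: "L \<ge> 0" and u: "\<And>s t. \<bar>u s - u t\<bar> \<le> L * norm (\<gamma> s - \<gamma> t)" and M: "\<And>t. \<bar>u t\<bar> \<le> M"
  shows "\<exists>V. (\<forall>t. V (\<gamma> t) = u t) \<and> (\<forall>x y. \<bar>V x - V y\<bar> \<le> L * norm (x - y)) \<and> (\<forall>x. \<bar>V x\<bar> \<le> M)"
proof -
  define W where "W x = (INF t. u t + L * norm (x - \<gamma> t))" for x
  have low: "- M \<le> u t + L * norm (x - \<gamma> t)" for x t
  proof -
    have "0 \<le> L * norm (x - \<gamma> t)" using L by simp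
    then show ?thesis using M[of t] by linarith
  qed
  have bdd: "bdd_below (range (\<lambda>t. u t + L * norm (x - \<gamma> t)))" for x
    using low by (intro bdd_belowI2)
  have Wle: "W x \<le> u t + L * norm (x - \<gamma> t)" for x t
    unfolding W_def by (intro cINF_lower bdd UNIV_I)
  have Wge: "- M \<le> W x" for x
    unfolding W_def by (intro cINF_greatest low UNIV_not_empty)
  have Wlip: "W x \<le> W y + L * norm (x - y)" for x y
  proof -
    have "W x - L * norm (x - y) \<le> u t + L * norm (y - \<gamma> t)" for t
    proof -
      have "norm (x - \<gamma> t) \<le> norm (x - y) + norm (y - \<gamma> t)" using norm_triangle_ineq[of "x - y" "y - \<gamma> t"] by simp
      then have "L * norm (x - \<gamma> t) \<le> L * norm (x - y) + L * norm (y - \<gamma> t)"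
        using L by (metis distrib_left mult_left_mono)
      then show ?thesis using Wle[of x t] by linarith
    qed
    then have "W x - L * norm (x - y) \<le> W y"
      unfolding W_def[of y] by (intro cINF_greatest UNIV_not_empty)
    then show ?thesis by linarith
  qed
  have Wg: "W (\<gamma> t) = u t" for t
  proof (rule antisym)
    show "W (\<gamma> t) \<le> u t" using Wle[of "\<gamma> t" t] by simp
    have "u t \<le> u s + L * norm (\<gamma> t - \<gamma> s)" for s using u[of t s] by linarith
    then show "u t \<le> W (\<gamma> t)" unfolding W_def by (intro cINF_greatest UNIV_not_empty)
  qed
  have "min M (W (\<gamma> t)) = u t" for t using M[of t] unfolding Wg by linarith
  moreover have "\<bar>min M (W x) - min M (W y)\<bar> \<le> L * norm (x - y)" for x y
  proof -
    have "L * norm (x - y) \<ge> 0" using L by simp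
    then show ?thesis using Wlip[of x y] Wlip[of y x] by (simp add: norm_minus_commute)
  qed
  moreover have "\<bar>min M (W x)\<bar> \<le> M" for x
    using Wge[of x] M[of undefined] by linarith
  ultimately show ?thesis by (intro exI[of _ "\<lambda>x. min M (W x)"]) blast
qed

lemma closed_bounded_slices:
  fixes S :: "'a::real_normed_vector set"
  assumes "\<And>r. closed (S \<inter> cball 0 r)"
  shows "closed S"
  unfolding closed_sequential_limits
proof (intro allI impI, elim conjE)
  fix x l assume x: "\<forall>n. x n \<in> S" "x \<longlonglongrightarrow> l"
  have "bounded (range x)" using x(2) by (intro convergent_imp_bounded) (simp add: convergent_def)
  then obtain r where r: "\<And>n. norm (x n) \<le> r" unfolding bounded_iff by blast
  have "l \<in> S \<inter> cball 0 r"
    by (rule closed_sequentially[OF assms _ x(2)]) (use x(1) r in auto)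
  then show "l \<in> S" by blast
qed

text \<open>Within a bounded part of the target only a bounded part of the source matters, so images
  of closed sets are locally images of compact sets. Thus \<open>f\<close> is a closed map, and its
  inverse is continuous.\<close>

lemma proper_homeomorphism:
  fixes f :: "'a::euclidean_space \<Rightarrow> 'b::euclidean_space"
  assumes S: "closed S" and f: "continuous_on S f" "inj_on f S"
    and proper: "\<And>r. \<exists>\<rho>. \<forall>x\<in>S. norm (f x) \<le> r \<longrightarrow> norm x \<le> \<rho>"
  shows "\<exists>g. homeomorphism S (f ` S) f g" and "closed (f ` S)"
proof -
  have cl: "closed (f ` C)" if C: "closed C" "C \<subseteq> S" for C
  proof (rule closed_bounded_slices)
    fix r
    obtain \<rho> where \<rho>: "\<And>x. x \<in> S \<Longrightarrow> norm (f x) \<le> r \<Longrightarrow> norm x \<le> \<rho>" using proper[of r] by blast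
    have "f ` C \<inter> cball 0 r = f ` (C \<inter> cball 0 \<rho>) \<inter> cball 0 r" using \<rho> C(2) by auto
    moreover have "compact (f ` (C \<inter> cball 0 \<rho>))"
      using C by (intro compact_continuous_image continuous_on_subset[OF f(1)] closed_Int_compact) auto
    ultimately show "closed (f ` C \<inter> cball 0 r)" by (metis closed_Int closed_cball compact_imp_closed)
  qed
  show "closed (f ` S)" by (rule cl[OF S order_refl])
  have inv: "inv_into S f (f x) = x" if "x \<in> S" for x using f(2) that by (rule inv_into_f_f)
  have "continuous_on (f ` S) (inv_into S f)"
  proof (rule continuous_on_inverse_closed_map[OF f(1) refl inv])
    fix U assume "closedin (top_of_set S) U"
    then have "closed U" "U \<subseteq> S" using S closedin_closed_trans closedin_imp_subset by blast+
    then have "closed (f ` U)" "f ` U \<subseteq> f ` S" using cl by blast+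
    then show "closedin (top_of_set (f ` S)) (f ` U)" by (rule closed_subset[rotated])
  qed
  then have "homeomorphism S (f ` S) f (inv_into S f)"
    using f inv by (intro homeomorphismI) (auto intro: inv_into_into)
  then show "\<exists>g. homeomorphism S (f ` S) f g" by blast
qed

section \<open>The ends of a knot of finite count\<close>

text \<open>By invariance of domain the open exterior has an open image. An image point of norm
  exactly r would have points of smaller norm nearby in the image, which lies outside the ball of
  radius r.\<close>

lemma exterior_homeomorphism_interior:
  fixes h :: "'a::euclidean_space \<Rightarrow> 'a"
  assumes h: "homeomorphism (- ball 0 R) (- ball 0 r) h g" and r: "r > 0" and x: "norm x > R"
  shows "norm (h x) > r"
proof (rule ccontr)
  assume "\<not> norm (h x) > r"
  let ?O = "- cball (0::'a) R"
  have sub: "?O \<subseteq> - ball 0 R" by auto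
  have hc: "continuous_on ?O h" using h sub by (auto simp: homeomorphism_def intro: continuous_on_subset)
  have inj: "inj_on h ?O" using h sub unfolding homeomorphism_def by (metis inj_on_inverseI subsetD)
  have op: "open (h ` ?O)" by (rule invariance_of_domain[OF hc _ inj]) (simp add: open_Compl)
  have hO: "h ` ?O \<subseteq> - ball 0 r" using h sub unfolding homeomorphism_def by blast
  have xO: "h x \<in> h ` ?O" using x by auto
  then have "norm (h x) \<ge> r" using hO by auto
  then have n: "norm (h x) = r" using \<open>\<not> norm (h x) > r\<close> by linarith
  obtain e where e: "e > 0" "ball (h x) e \<subseteq> h ` ?O" using op xO openE by blast
  define d where "d = min (e / (2 * r)) 1"
  have d: "0 < d" "d \<le> 1" "d * r \<le> e / 2" using e r by (auto simp: d_def min_def field_simps)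
  let ?y = "(1 - d) *\<^sub>R h x"
  have "dist (h x) ?y = d * r" using d n by (simp add: dist_norm algebra_simps)
  then have "?y \<in> ball (h x) e" using d e by simp
  then have "norm ?y \<ge> r" using e(2) hO by fastforce
  moreover have "norm ?y = (1 - d) * r" using d n by simp
  moreover have "(1 - d) * r = r - d * r" by (simp add: left_diff_distrib)
  moreover have "d * r > 0" using d r by simp
  ultimately show False by linarith
qed

lemma exterior_homeomorphism_sphere:
  fixes h :: "'a::euclidean_space \<Rightarrow> 'a"
  assumes h: "homeomorphism (- ball 0 R) (- ball 0 r) h g" and R: "R > 0" "r > 0" and x: "norm x = R"
  shows "norm (h x) = r"
proof -
  have xE: "x \<in> - ball 0 R" using x by simp
  then have hx: "h x \<in> - ball 0 r" "g (h x) = x" using h unfolding homeomorphism_def by blast+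
  show ?thesis
  proof (rule ccontr)
    assume "norm (h x) \<noteq> r"
    then have "norm (h x) > r" using hx(1) by simp
    from exterior_homeomorphism_interior[OF homeomorphism_symD[OF h] R(1) this] show False
      using hx(2) x by simp
  qed
qed

lemma closed_connected_real_upper:
  fixes A :: "real set"
  assumes "closed A" "connected A" "A \<noteq> {}" "bdd_below A" "\<not> bdd_above A"
  shows "A = {Inf A..}"
proof
  show "A \<subseteq> {Inf A..}" using assms(4) by (auto intro: cInf_lower)
  show "{Inf A..} \<subseteq> A"
  proof
    fix t assume t: "t \<in> {Inf A..}"
    have i: "Inf A \<in> A" by (rule closed_contains_Inf[OF assms(3,4,1)])
    obtain u where u: "u \<in> A" "t < u" using assms(5) unfolding bdd_above_def by (meson not_le)
    show "t \<in> A" using connectedD_interval[OF assms(2) i u(1), of t] t u(2) by simp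
  qed
qed

lemma closed_connected_real_lower:
  fixes A :: "real set"
  assumes "closed A" "connected A" "A \<noteq> {}" "\<not> bdd_below A" "bdd_above A"
  shows "A = {..Sup A}"
proof
  show "A \<subseteq> {..Sup A}" using assms(5) by (auto intro: cSup_upper)
  show "{..Sup A} \<subseteq> A"
  proof
    fix t assume t: "t \<in> {..Sup A}"
    have i: "Sup A \<in> A" by (rule closed_contains_Sup[OF assms(3,5,1)])
    obtain u where u: "u \<in> A" "u < t" using assms(4) unfolding bdd_below_def by (meson not_le)
    show "t \<in> A" using connectedD_interval[OF assms(2) u(1) i, of t] t u(2) by simp
  qed
qed

lemma bdd_bounded: "bdd_below A \<Longrightarrow> bdd_above A \<Longrightarrow> bounded A" for A :: "real set"
  unfolding bdd_below_def bdd_above_def by (meson bounded_closed_interval bounded_subset atLeastAtMost_iff subsetI)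

text \<open>The sets are unbounded intervals. If both were unbounded on the same side, or one on
  both sides, they would meet. Which of them is the upper half-line is unknown, hence the conclusion
  about the union.\<close>

lemma two_ends:
  fixes A B :: "real set"
  assumes A: "closed A" "connected A" "\<not> bounded A" and B: "closed B" "connected B" "\<not> bounded B"
    and AB: "A \<inter> B = {}"
  shows "\<exists>a b. b < a \<and> A \<union> B = {..b} \<union> {a..}"
proof -
  have gen: "\<exists>a b. b < a \<and> A \<union> B = {..b} \<union> {a..}"
    if A: "closed A" "connected A" "\<not> bounded A" and B: "closed B" "connected B" "\<not> bounded B"
      and AB: "A \<inter> B = {}" and up: "\<not> bdd_above A" for A B :: "real set"
  proof -
    have ne: "A \<noteq> {}" "B \<noteq> {}" using A(3) B(3) by auto
    obtain b\<^sub>0 where b0: "b\<^sub>0 \<in> B" using ne by blast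
    obtain a\<^sub>0 where a0: "a\<^sub>0 \<in> A" using ne by blast
    have bB: "bdd_above B"
    proof (rule ccontr)
      assume nb: "\<not> bdd_above B"
      obtain u where u: "u \<in> B" "a\<^sub>0 < u" using nb unfolding bdd_above_def by (meson not_le)
      obtain v where v: "v \<in> A" "u < v" using up unfolding bdd_above_def by (meson not_le)
      have "u \<in> A" using connectedD_interval[OF A(2) a0 v(1), of u] u(2) v(2) by simp
      then show False using u(1) AB by blast
    qed
    have nB: "\<not> bdd_below B" using B(3) bB bdd_bounded by blast
    have bA: "bdd_below A"
    proof (rule ccontr)
      assume na: "\<not> bdd_below A"
      obtain u where u: "u \<in> A" "u < b\<^sub>0" using na unfolding bdd_below_def by (meson not_le)
      obtain v where v: "v \<in> A" "b\<^sub>0 < v" using up unfolding bdd_above_def by (meson not_le)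
      have "b\<^sub>0 \<in> A" using connectedD_interval[OF A(2) u(1) v(1), of b\<^sub>0] u(2) v(2) by simp
      then show False using b0 AB by blast
    qed
    have eA: "A = {Inf A..}" by (rule closed_connected_real_upper[OF A(1,2) ne(1) bA up])
    have eB: "B = {..Sup B}" by (rule closed_connected_real_lower[OF B(1,2) ne(2) nB bB])
    have "Sup B < Inf A"
    proof (rule ccontr)
      assume "\<not> Sup B < Inf A"
      then have "Inf A \<in> B" using eB by (metis atMost_iff not_le)
      moreover have "Inf A \<in> A" using eA by (metis atLeast_iff order_refl)
      ultimately show False using AB by blast
    qed
    moreover have "A \<union> B = {..Sup B} \<union> {Inf A..}" using eA eB by blast
    ultimately show ?thesis by blast
  qed
  show ?thesis
  proof (cases "bdd_above A")
    case False
    then show ?thesis by (rule gen[OF A B AB])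
  next
    case True
    then have nA: "\<not> bdd_below A" using A(3) bdd_bounded by blast
    have "\<not> bdd_above B"
    proof
      assume bB: "bdd_above B"
      then have nB: "\<not> bdd_below B" using B(3) bdd_bounded by blast
      have "A \<noteq> {}" using A(3) by auto
      then obtain a\<^sub>0 where a0: "a\<^sub>0 \<in> A" by blast
      obtain u where u: "u \<in> B" "u < a\<^sub>0" using nB unfolding bdd_below_def by (meson not_le)
      obtain v where v: "v \<in> A" "v < u" using nA unfolding bdd_below_def by (meson not_le)
      have "u \<in> A" using connectedD_interval[OF A(2) v(1) a0, of u] u(2) v(2) by simp
      then show False using u(1) AB by blast
    qed
    moreover have "B \<inter> A = {}" using AB by blast
    ultimately have "\<exists>a b. b < a \<and> B \<union> A = {..b} \<union> {a..}" by (intro gen[OF B A])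
    then show ?thesis by (simp only: Un_commute)
  qed
qed

definition vertical_rays :: "(complex \<times> real) set" where
  "vertical_rays = {(0, t) | t. t \<ge> 1} \<union> {(0, t) | t. t \<le> -1}"

lemma proper_of_filterlim:
  fixes \<Gamma> :: "real \<Rightarrow> 'a::real_normed_vector"
  assumes "filterlim \<Gamma> at_infinity at_top" "filterlim \<Gamma> at_infinity at_bot"
  shows "\<exists>\<rho>. \<forall>t\<in>UNIV. norm (\<Gamma> t) \<le> r \<longrightarrow> norm t \<le> \<rho>"
proof -
  have m: "max 0 r + 1 > 0" by linarith
  have "eventually (\<lambda>t. max 0 r + 1 \<le> norm (\<Gamma> t)) at_top" "eventually (\<lambda>t. max 0 r + 1 \<le> norm (\<Gamma> t)) at_bot"
    using assms m unfolding filterlim_at_infinity[OF order_refl] by blast+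
  then obtain p q where p: "\<And>t. t \<ge> p \<Longrightarrow> max 0 r + 1 \<le> norm (\<Gamma> t)" and q: "\<And>t. t \<le> q \<Longrightarrow> max 0 r + 1 \<le> norm (\<Gamma> t)"
    unfolding eventually_at_top_linorder eventually_at_bot_linorder by blast
  have "norm t \<le> \<bar>p\<bar> + \<bar>q\<bar>" if "norm (\<Gamma> t) \<le> r" for t
  proof -
    have "\<not> t \<ge> p" using p[of t] that by linarith
    moreover have "\<not> t \<le> q" using q[of t] that by linarith
    ultimately show ?thesis by simp
  qed
  then show ?thesis by blast
qed

text \<open>The parameters of the part of the curve carried to \<open>U\<close>. They are connected
  because a proper injective curve is a homeomorphism onto its image, and unbounded because
  otherwise \<open>U\<close> would lie in a compact set.\<close>

lemma exterior_curve_component: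
  fixes \<Gamma> :: "real \<Rightarrow> 'a::euclidean_space"
  assumes cont: "continuous_on UNIV \<Gamma>" and inj: "inj \<Gamma>"
    and lim: "filterlim \<Gamma> at_infinity at_top" "filterlim \<Gamma> at_infinity at_bot"
    and hom: "homeomorphism (- ball 0 R) (- ball 0 1) h g"
    and U: "closed U" "connected U" "\<not> bounded U" "U \<subseteq> h ` (range \<Gamma> - ball 0 R)"
  defines "A \<equiv> {t. \<Gamma> t \<in> - ball 0 R \<and> h (\<Gamma> t) \<in> U}"
  shows "closed A" "connected A" "\<not> bounded A"
proof -
  let ?E = "- ball (0::'a) R"
  obtain G where G: "homeomorphism UNIV (range \<Gamma>) \<Gamma> G"
    using proper_homeomorphism(1)[OF closed_UNIV cont inj] proper_of_filterlim[OF lim] by blast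
  have hc: "continuous_on ?E h" and gc: "continuous_on (- ball 0 1) g" and gh: "\<And>x. x \<in> ?E \<Longrightarrow> g (h x) = x"
    using hom by (auto simp: homeomorphism_def)
  have Gc: "continuous_on (range \<Gamma>) G" and G\<Gamma>: "\<And>t. G (\<Gamma> t) = t"
    using G by (auto simp: homeomorphism_def)
  let ?O = "\<Gamma> -` ?E"
  have clO: "closed ?O" by (rule closed_vimage[OF _ cont]) (simp add: closed_Compl)
  have hG: "continuous_on ?O (\<lambda>t. h (\<Gamma> t))"
    by (rule continuous_on_compose2[OF hc continuous_on_subset[OF cont subset_UNIV]]) auto
  have "closed (?O \<inter> (\<lambda>t. h (\<Gamma> t)) -` U)" by (rule continuous_closed_preimage[OF hG clO U(1)])
  moreover have "A = ?O \<inter> (\<lambda>t. h (\<Gamma> t)) -` U" unfolding A_def by blast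
  ultimately show clA: "closed A" by simp
  have hU: "\<exists>t. \<Gamma> t \<in> ?E \<and> y = h (\<Gamma> t)" if "y \<in> U" for y using U(4) that by blast
  have AU: "A = G ` g ` U"
  proof (intro equalityI subsetI)
    fix t assume t: "t \<in> A"
    then have "t = G (g (h (\<Gamma> t)))" by (simp add: A_def gh G\<Gamma>)
    then show "t \<in> G ` g ` U" using t unfolding A_def by blast
  next
    fix t assume "t \<in> G ` g ` U"
    then obtain y where y: "y \<in> U" "t = G (g y)" by blast
    obtain s where s: "\<Gamma> s \<in> ?E" "y = h (\<Gamma> s)" using hU[OF y(1)] by blast
    have "t = s" using y(2) s by (simp only: gh G\<Gamma>)
    then show "t \<in> A" using s y(1) by (simp add: A_def)
  qed
  have gU: "g ` U \<subseteq> range \<Gamma>"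
  proof
    fix x assume "x \<in> g ` U"
    then obtain y where y: "y \<in> U" "x = g y" by blast
    obtain s where s: "\<Gamma> s \<in> ?E" "y = h (\<Gamma> s)" using hU[OF y(1)] by blast
    have "x = \<Gamma> s" using y(2) s by (simp only: gh)
    then show "x \<in> range \<Gamma>" by blast
  qed
  have "U \<subseteq> - ball 0 1" using U(4) homeomorphism_image1[OF hom] by blast
  then have "connected (g ` U)"
    by (intro connected_continuous_image U(2) continuous_on_subset[OF gc])
  then show "connected A" unfolding AU
    by (rule connected_continuous_image[OF continuous_on_subset[OF Gc gU]])
  show "\<not> bounded A"
  proof
    assume "bounded A"
    then have "compact A" using clA compact_eq_bounded_closed by blast
    then have "compact ((\<lambda>t. h (\<Gamma> t)) ` A)"
      by (intro compact_continuous_image continuous_on_subset[OF hG]) (auto simp: A_def)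
    moreover have "U \<subseteq> (\<lambda>t. h (\<Gamma> t)) ` A" using hU unfolding A_def by blast
    ultimately show False using U(3) compact_imp_bounded bounded_subset by blast
  qed
qed

lemma vertical_ray_properties:
  "closed {(0::complex, t) | t::real. t \<ge> 1}" "connected {(0::complex, t) | t::real. t \<ge> 1}"
  "\<not> bounded {(0::complex, t) | t::real. t \<ge> 1}"
  "closed {(0::complex, t) | t::real. t \<le> -1}" "connected {(0::complex, t) | t::real. t \<le> -1}"
  "\<not> bounded {(0::complex, t) | t::real. t \<le> -1}"
proof -
  have e: "{(0::complex, t) | t::real. t \<ge> 1} = {0} \<times> {1..}" "{(0::complex, t) | t::real. t \<le> -1} = {0} \<times> {..-1}"
    by auto
  show "closed {(0::complex, t) | t::real. t \<ge> 1}" "connected {(0::complex, t) | t::real. t \<ge> 1}"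
    "closed {(0::complex, t) | t::real. t \<le> -1}" "connected {(0::complex, t) | t::real. t \<le> -1}"
    unfolding e by (auto intro!: closed_Times connected_Times)
  show "\<not> bounded {(0::complex, t) | t::real. t \<ge> 1}"
  proof
    assume "bounded {(0::complex, t) | t::real. t \<ge> 1}"
    then obtain B where B: "\<And>x. x \<in> {(0::complex, t) | t::real. t \<ge> 1} \<Longrightarrow> norm x \<le> B" unfolding bounded_iff by blast
    have "norm (0::complex, \<bar>B\<bar> + 1) \<le> B" by (rule B) simp
    then show False by (simp add: norm_Pair)
  qed
  show "\<not> bounded {(0::complex, t) | t::real. t \<le> -1}"
  proof
    assume "bounded {(0::complex, t) | t::real. t \<le> -1}"
    then obtain B where B: "\<And>x. x \<in> {(0::complex, t) | t::real. t \<le> -1} \<Longrightarrow> norm x \<le> B" unfolding bounded_iff by blast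
    have "norm (0::complex, - (\<bar>B\<bar> + 1)) \<le> B" by (rule B) simp
    then show False by (simp add: norm_Pair)
  qed
qed

text \<open>The two rays pull back to two disjoint closed half-lines of parameters, so what remains
  in the open ball is a single arc. Boundary points go to the unit sphere, where the rays have only
  the points (0, 1) and (0, -1).\<close>

lemma finite_count_arc:
  fixes \<Gamma> :: "real \<Rightarrow> complex \<times> real"
  assumes cont: "continuous_on UNIV \<Gamma>" and inj: "inj \<Gamma>"
    and lim: "filterlim \<Gamma> at_infinity at_top" "filterlim \<Gamma> at_infinity at_bot"
    and R: "R > 0" and hom: "homeomorphism (- ball 0 R) (- ball 0 1) h g"
    and rays: "h ` (range \<Gamma> - ball 0 R) = vertical_rays"
  shows "\<exists>a b. b < a \<and> (\<forall>t. norm (\<Gamma> t) \<ge> R \<longleftrightarrow> t \<le> b \<or> a \<le> t) \<and> norm (\<Gamma> a) = R \<and> norm (\<Gamma> b) = R \<and>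
    {h (\<Gamma> a), h (\<Gamma> b)} = {(0, 1), (0, -1)}"
proof -
  let ?U = "{(0::complex, t) | t::real. t \<ge> 1}" and ?D = "{(0::complex, t) | t::real. t \<le> -1}"
  let ?A = "{t. \<Gamma> t \<in> - ball 0 R \<and> h (\<Gamma> t) \<in> ?U}" and ?B = "{t. \<Gamma> t \<in> - ball 0 R \<and> h (\<Gamma> t) \<in> ?D}"
  have sub: "?U \<subseteq> h ` (range \<Gamma> - ball 0 R)" "?D \<subseteq> h ` (range \<Gamma> - ball 0 R)"
    unfolding rays vertical_rays_def by blast+
  note A = exterior_curve_component[OF cont inj lim hom vertical_ray_properties(1-3) sub(1)]
  note B = exterior_curve_component[OF cont inj lim hom vertical_ray_properties(4-6) sub(2)]
  have "?A \<inter> ?B = {}" by auto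
  from two_ends[OF A B this] obtain a b where ab: "b < a" "?A \<union> ?B = {..b} \<union> {a..}" by blast
  have O: "norm (\<Gamma> t) \<ge> R \<longleftrightarrow> t \<le> b \<or> a \<le> t" for t
  proof -
    have "norm (\<Gamma> t) \<ge> R \<longleftrightarrow> t \<in> ?A \<union> ?B"
    proof
      assume "norm (\<Gamma> t) \<ge> R"
      then have 1: "\<Gamma> t \<in> - ball 0 R" by simp
      then have "h (\<Gamma> t) \<in> vertical_rays" unfolding rays[symmetric] by blast
      then show "t \<in> ?A \<union> ?B" using 1 unfolding vertical_rays_def by blast
    qed auto
    then show ?thesis unfolding ab(2) by auto
  qed
  have cn: "continuous_on UNIV (\<lambda>t. norm (\<Gamma> t))" by (intro continuous_on_norm cont)
  \<comment> \<open>Strictly between b and a the norm is below \<open>R\<close>; passing to the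
    closure covers the end points.\<close>
  have lt: "norm (\<Gamma> t) \<le> R" if "t \<in> {b..a}" for t
  proof -
    have "closed ((\<lambda>t. norm (\<Gamma> t)) -` {..R})" by (rule closed_vimage[OF closed_atMost cn])
    moreover have "{b<..<a} \<subseteq> (\<lambda>t. norm (\<Gamma> t)) -` {..R}"
    proof
      fix t assume "t \<in> {b<..<a}"
      then show "t \<in> (\<lambda>t. norm (\<Gamma> t)) -` {..R}" using O[of t] by auto
    qed
    ultimately have "closure {b<..<a} \<subseteq> (\<lambda>t. norm (\<Gamma> t)) -` {..R}" by (intro closure_minimal)
    then show ?thesis using that ab(1) by auto
  qed
  have na: "norm (\<Gamma> a) = R" using O[of a] lt[of a] ab(1) by auto
  have nb: "norm (\<Gamma> b) = R" using O[of b] lt[of b] ab(1) by auto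
  have pole: "h x \<in> {(0, 1), (0, -1)}" if "norm x = R" "x \<in> range \<Gamma>" for x :: "complex \<times> real"
  proof -
    have "norm (h x) = 1" using exterior_homeomorphism_sphere[OF hom R _ that(1)] by simp
    moreover have "h x \<in> vertical_rays" using that unfolding rays[symmetric] by auto
    ultimately show ?thesis unfolding vertical_rays_def by (auto simp: norm_Pair)
  qed
  have "h (\<Gamma> a) \<noteq> h (\<Gamma> b)"
  proof
    assume e: "h (\<Gamma> a) = h (\<Gamma> b)"
    have "g (h (\<Gamma> a)) = \<Gamma> a" "g (h (\<Gamma> b)) = \<Gamma> b"
      using na nb by (auto intro!: homeomorphism_apply1[OF hom])
    then have "\<Gamma> a = \<Gamma> b" using e by metis
    then show False using inj ab(1) by (metis injD less_irrefl)
  qed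
  then have "{h (\<Gamma> a), h (\<Gamma> b)} = {(0, 1), (0, -1)}"
    using pole[OF na rangeI] pole[OF nb rangeI] unfolding doubleton_eq_iff insert_iff empty_iff
    by (elim disjE) simp_all
  then show ?thesis using ab(1) O na nb by blast
qed

text \<open>
  The exterior of a round ball with two rays through \<open>p\<^sub>1, p\<^sub>2\<close> on its boundary is glued back by
  coning the boundary homeomorphism. Coning from the midpoint of \<open>p\<^sub>1\<close> and \<open>p\<^sub>2\<close> puts both rays on
  one line.
\<close>

lemma finite_count_straighten_ends:
  fixes \<Gamma> :: "real \<Rightarrow> complex \<times> real"
  assumes R: "R > 0" and hom: "homeomorphism (- ball 0 R) (- ball 0 1) h g"
    and rays: "h ` (range \<Gamma> - ball 0 R) = vertical_rays"
    and ab: "b < a" and O: "\<And>t. norm (\<Gamma> t) \<ge> R \<longleftrightarrow> t \<le> b \<or> a \<le> t"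
    and na: "norm (\<Gamma> a) = R" and nb: "norm (\<Gamma> b) = R" and neq: "\<Gamma> a \<noteq> \<Gamma> b"
    and poles: "{h (\<Gamma> a), h (\<Gamma> b)} = {(0, 1), (0, -1)}"
  defines "e \<equiv> (1/2) *\<^sub>R (\<Gamma> a - \<Gamma> b)"
  shows "\<exists>\<Phi> \<Psi>. homeomorphism UNIV UNIV \<Phi> \<Psi> \<and>
    \<Phi> ` range \<Gamma> = \<Gamma> ` {b..a} \<union> {\<Gamma> a + s *\<^sub>R e | s. s \<ge> 0} \<union> {\<Gamma> b - s *\<^sub>R e | s. s \<ge> 0}"
proof -
  let ?E = "- ball (0::complex\<times>real) R" and ?E1 = "- ball (0::complex\<times>real) 1"
  have hc: "continuous_on ?E h" and gc: "continuous_on ?E1 g" and gh: "\<And>x. x \<in> ?E \<Longrightarrow> g (h x) = x"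
    and hg: "\<And>y. y \<in> ?E1 \<Longrightarrow> h (g y) = y" and hE: "\<And>x. x \<in> ?E \<Longrightarrow> h x \<in> ?E1" and gE: "\<And>y. y \<in> ?E1 \<Longrightarrow> g y \<in> ?E"
    using homeomorphism_cont1[OF hom] homeomorphism_cont2[OF hom] homeomorphism_apply1[OF hom]
      homeomorphism_apply2[OF hom] homeomorphism_image1[OF hom] homeomorphism_image2[OF hom] by blast+
  have hs: "norm (h x) = 1" if "norm x = R" for x :: "complex \<times> real"
    using exterior_homeomorphism_sphere[OF hom R _ that] by simp
  have gs: "norm (g y) = R" if "norm y = 1" for y :: "complex \<times> real"
    using exterior_homeomorphism_sphere[OF homeomorphism_symD[OF hom] _ R that] by simp
  define c where "c = (1/2) *\<^sub>R (\<Gamma> a + \<Gamma> b)"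
  \<comment> \<open>By the parallelogram law, because the two end points differ.\<close>
  have cR: "norm c < R"
  proof -
    have "(norm (\<Gamma> a + \<Gamma> b))\<^sup>2 + (norm (\<Gamma> a - \<Gamma> b))\<^sup>2 = 4 * R\<^sup>2"
    proof -
      have "((norm (\<Gamma> a + \<Gamma> b))\<^sup>2 - R\<^sup>2 - R\<^sup>2) / 2 = (R\<^sup>2 + R\<^sup>2 - (norm (\<Gamma> a - \<Gamma> b))\<^sup>2) / 2"
        using dot_norm[of "\<Gamma> a" "\<Gamma> b"] dot_norm_neg[of "\<Gamma> a" "\<Gamma> b"] unfolding na nb by metis
      then show ?thesis by (simp add: field_simps)
    qed
    moreover have "(norm (\<Gamma> a - \<Gamma> b))\<^sup>2 > 0" using neq by simp
    ultimately have "(norm (\<Gamma> a + \<Gamma> b))\<^sup>2 < 4 * R\<^sup>2" by linarith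
    then have "(norm (\<Gamma> a + \<Gamma> b))\<^sup>2 < (2 * R)\<^sup>2" by (simp add: power_mult_distrib)
    then have "norm (\<Gamma> a + \<Gamma> b) < 2 * R" by (rule power2_less_imp_less) (use R in simp)
    then show ?thesis by (simp add: c_def)
  qed
  \<comment> \<open>Fixes the sphere of radius \<open>R\<close> pointwise and moves the vertex 0 to
    \<open>c\<close>; its displacement has Lipschitz constant |c| / R < 1.\<close>
  define M where "M x = x + ((R - norm x) / R) *\<^sub>R c" for x :: "complex \<times> real"
  have "\<exists>g. homeomorphism UNIV UNIV (\<lambda>x. x + ((R - norm x) / R) *\<^sub>R c) g"
  proof (rule lipschitz_perturbation_homeomorphism[of "norm c / R"])
    show "0 \<le> norm c / R" "norm c / R < 1" using R cR by simp_all
    fix x y :: "complex \<times> real"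
    have "((R - norm x) / R) *\<^sub>R c - ((R - norm y) / R) *\<^sub>R c = ((norm y - norm x) / R) *\<^sub>R c"
      unfolding scaleR_diff_left[symmetric] diff_divide_distrib[symmetric] by simp
    then have "norm (((R - norm x) / R) *\<^sub>R c - ((R - norm y) / R) *\<^sub>R c) = \<bar>norm y - norm x\<bar> * (norm c / R)"
      using R by simp
    also have "\<dots> \<le> norm (x - y) * (norm c / R)"
      using R norm_triangle_ineq3[of y x] by (intro mult_right_mono) (simp_all add: norm_minus_commute)
    finally show "norm (((R - norm x) / R) *\<^sub>R c - ((R - norm y) / R) *\<^sub>R c) \<le> norm c / R * norm (x - y)"
      by (simp add: mult.commute)
  qed
  then obtain M' where M': "homeomorphism UNIV UNIV M M'" unfolding M_def by blast
  have MM': "M (M' y) = y" "M' (M x) = x" for x y using homeomorphism_apply1[OF M'] homeomorphism_apply2[OF M'] by blast+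
  have Mc: "continuous_on UNIV M" "continuous_on UNIV M'" using homeomorphism_cont1[OF M'] homeomorphism_cont2[OF M'] by blast+
  have Ms: "M x = x" if "norm x = R" for x using that by (simp add: M_def)
  have Min: "norm (M x) < R" if "norm x < R" for x
  proof -
    have "norm (M x) \<le> norm x + (R - norm x) / R * norm c"
      unfolding M_def using norm_triangle_ineq[of x "((R - norm x) / R) *\<^sub>R c"] that R by simp
    also have "(R - norm x) / R * norm c < (R - norm x) / R * R"
      using that R cR by (intro mult_strict_left_mono) auto
    finally show ?thesis using R by simp
  qed
  have Mout: "norm (M x) \<ge> R" if "norm x \<ge> R" for x
  proof -
    have "norm x - norm (((R - norm x) / R) *\<^sub>R c) \<le> norm (M x)"
      unfolding M_def using norm_triangle_ineq4[of "x + ((R - norm x) / R) *\<^sub>R c" "((R - norm x) / R) *\<^sub>R c"] by simp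
    moreover have "norm (((R - norm x) / R) *\<^sub>R c) = (norm x - R) / R * norm c"
      using that R by simp
    moreover have "(norm x - R) / R * norm c \<le> (norm x - R) / R * R"
      using that R cR by (intro mult_left_mono) auto
    moreover have "(norm x - R) / R * R = norm x - R" using R by simp
    ultimately show ?thesis by linarith
  qed
  have M'out: "norm (M' y) \<ge> R" if "norm y \<ge> R" for y
  proof (rule ccontr)
    assume "\<not> norm (M' y) \<ge> R"
    then have "norm (M (M' y)) < R" by (intro Min) simp
    then show False using that unfolding MM' by simp
  qed
  have M's: "M' y = y" if "norm y = R" for y using MM'(2)[of y] Ms[OF that] by simp
  \<comment> \<open>The cone over the boundary homeomorphism: \<open>k\<close> extends
    \<open>g\<close> radially from the unit sphere and \<open>k'\<close> extends \<open>h\<close>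
    from the sphere of radius \<open>R\<close>. Hence k(h x) = x on that sphere.\<close>
  define k where "k y = norm y *\<^sub>R g ((1 / norm y) *\<^sub>R y)" for y :: "complex \<times> real"
  define k' where "k' x = (norm x / R) *\<^sub>R h ((R / norm x) *\<^sub>R x)" for x :: "complex \<times> real"
  have unit: "norm ((r / norm x) *\<^sub>R x) = r" if "norm x > 0" "r \<ge> 0" for r and x :: "complex \<times> real"
    using that by simp
  have nk: "norm (k y) = R * norm y" if "norm y \<ge> 1" for y
  proof -
    have "norm ((1 / norm y) *\<^sub>R y) = 1" by (rule unit) (use that in linarith)+
    from gs[OF this] show ?thesis by (simp add: k_def)
  qed
  have nk': "norm (k' x) = norm x / R" if "norm x \<ge> R" for x
  proof -
    have "norm ((R / norm x) *\<^sub>R x) = R" by (rule unit) (use that R in linarith)+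
    from hs[OF this] show ?thesis using R by (simp add: k'_def)
  qed
  have k'k: "k' (k y) = y" if "norm y \<ge> 1" for y
  proof -
    let ?u = "(1 / norm y) *\<^sub>R y"
    have y0: "norm y > 0" using that by linarith
    have u: "norm ?u = 1" by (rule unit[OF y0]) simp
    have "(R / norm (k y)) *\<^sub>R k y = g ?u"
      unfolding nk[OF that] using R y0 by (simp add: k_def)
    moreover have "h (g ?u) = ?u" by (rule hg) (use u in simp)
    ultimately have "k' (k y) = (norm (k y) / R) *\<^sub>R ?u" unfolding k'_def by simp
    then show ?thesis unfolding nk[OF that] using R y0 by simp
  qed
  have kk': "k (k' x) = x" if "norm x \<ge> R" for x
  proof -
    let ?u = "(R / norm x) *\<^sub>R x"
    have x0: "norm x > 0" using that R by linarith
    have u: "norm ?u = R" by (rule unit[OF x0]) (use R in simp)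
    have "(1 / norm (k' x)) *\<^sub>R k' x = h ?u"
      unfolding nk'[OF that] using R x0 by (simp add: k'_def)
    moreover have "g (h ?u) = ?u" by (rule gh) (use u in simp)
    ultimately have "k (k' x) = norm (k' x) *\<^sub>R ?u" unfolding k_def by simp
    then show ?thesis unfolding nk'[OF that] using R x0 by simp
  qed
  have kc: "continuous_on ?E1 k"
    unfolding k_def
  proof (intro continuous_on_scaleR continuous_on_norm continuous_on_id continuous_on_compose2[OF gc]
      continuous_on_divide continuous_on_const)
    show "\<forall>y\<in>?E1. norm y \<noteq> 0" by auto
    show "(\<lambda>y. (1 / norm y) *\<^sub>R y) ` ?E1 \<subseteq> ?E1"
    proof (rule image_subsetI)
      fix y assume "y \<in> ?E1"
      then have "norm y \<ge> 1" by simp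
      then have "norm y > 0" by linarith
      from unit[OF this, of 1] show "(1 / norm y) *\<^sub>R y \<in> ?E1" by simp
    qed
  qed
  have k'c: "continuous_on ?E k'"
    unfolding k'_def
  proof (intro continuous_on_scaleR continuous_on_norm continuous_on_id continuous_on_compose2[OF hc]
      continuous_on_divide continuous_on_const)
    show "\<forall>x\<in>?E. R \<noteq> 0" using R by auto
    show "\<forall>x\<in>?E. norm x \<noteq> 0" using R by auto
    show "(\<lambda>x. (R / norm x) *\<^sub>R x) ` ?E \<subseteq> ?E"
    proof (rule image_subsetI)
      fix x assume "x \<in> ?E"
      then have "norm x > 0" using R by auto
      from unit[OF this, of R] show "(R / norm x) *\<^sub>R x \<in> ?E" using R by simp
    qed
  qed
  \<comment> \<open>Identity inside; outside \<open>h\<close> straightens the knot, \<open>k\<close>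
    carries the rays to radial ones through the end points, and \<open>M\<close> shifts their vertex
    to \<open>c\<close>. On the sphere both definitions agree.\<close>
  define \<Phi> where "\<Phi> x = (if norm x \<le> R then x else M (k (h x)))" for x
  define \<Psi> where "\<Psi> y = (if norm y \<le> R then y else g (k' (M' y)))" for y
  have \<Phi>out: "\<Phi> x = M (k (h x))" if "norm x \<ge> R" for x
  proof (cases "norm x = R")
    case True
    have "k (h x) = g (h x)" using hs[OF True] by (simp add: k_def)
    also have "\<dots> = x" by (rule gh) (use True in simp)
    finally show ?thesis using True by (simp add: \<Phi>_def Ms)
  qed (use that in \<open>simp add: \<Phi>_def\<close>)
  have \<Psi>out: "\<Psi> y = g (k' (M' y))" if "norm y \<ge> R" for y
  proof (cases "norm y = R")
    case True
    have "k' y = h y" using True R by (simp add: k'_def)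
    moreover have "g (h y) = y" by (rule gh) (use True in simp)
    ultimately show ?thesis using True by (simp add: \<Psi>_def M's)
  qed (use that in \<open>simp add: \<Psi>_def\<close>)
  have cover: "cball 0 R \<union> ?E = UNIV" by auto
  have "homeomorphism UNIV UNIV \<Phi> \<Psi>"
  proof (rule homeomorphismI)
    have 1: "continuous_on ?E (\<lambda>x. M (k (h x)))"
      by (rule continuous_on_compose2[OF Mc(1) continuous_on_compose2[OF kc hc]]) (use hE in auto)
    have "continuous_on (cball 0 R \<union> ?E) \<Phi>"
      unfolding \<Phi>_def
    proof (rule continuous_on_cases[OF closed_cball _ continuous_on_id 1], goal_cases)
      case 2
      show ?case
      proof (intro allI impI)
        fix x assume "x \<in> cball 0 R \<and> \<not> norm x \<le> R \<or> x \<in> ?E \<and> norm x \<le> R"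
        then have "norm x = R" by auto
        then show "x = M (k (h x))" using \<Phi>out[of x] by (simp add: \<Phi>_def)
      qed
    qed (simp add: closed_Compl)
    then show "continuous_on UNIV \<Phi>" unfolding cover .
    have 2: "continuous_on ?E (\<lambda>y. g (k' (M' y)))"
    proof (rule continuous_on_compose2[OF gc continuous_on_compose2[OF k'c continuous_on_subset[OF Mc(2) subset_UNIV]]])
      show "M' ` ?E \<subseteq> ?E"
      proof (rule image_subsetI)
        fix y assume "y \<in> ?E"
        then have "norm (M' y) \<ge> R" by (intro M'out) simp
        then show "M' y \<in> ?E" by simp
      qed
      show "(\<lambda>y. k' (M' y)) ` ?E \<subseteq> ?E1"
      proof (rule image_subsetI)
        fix y assume "y \<in> ?E"
        then have "norm (M' y) \<ge> R" by (intro M'out) simp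
        then show "k' (M' y) \<in> ?E1" using nk' R by simp
      qed
    qed
    have "continuous_on (cball 0 R \<union> ?E) \<Psi>"
      unfolding \<Psi>_def
    proof (rule continuous_on_cases[OF closed_cball _ continuous_on_id 2], goal_cases)
      case 2
      show ?case
      proof (intro allI impI)
        fix y assume "y \<in> cball 0 R \<and> \<not> norm y \<le> R \<or> y \<in> ?E \<and> norm y \<le> R"
        then have "norm y = R" by auto
        then show "y = g (k' (M' y))" using \<Psi>out[of y] by (simp add: \<Psi>_def)
      qed
    qed (simp add: closed_Compl)
    then show "continuous_on UNIV \<Psi>" unfolding cover .
    show "\<Psi> (\<Phi> x) = x" for x
    proof (cases "norm x \<le> R")
      case False
      then have x: "norm x \<ge> R" by simp
      then have hx: "norm (h x) \<ge> 1" using hE[of x] by simp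
      then have "norm (k (h x)) \<ge> R" using nk R by simp
      then have "norm (\<Phi> x) \<ge> R" unfolding \<Phi>out[OF x] by (rule Mout)
      then have "\<Psi> (\<Phi> x) = g (k' (M' (M (k (h x)))))" using \<Psi>out \<Phi>out[OF x] by simp
      also have "\<dots> = x" unfolding MM' k'k[OF hx] by (rule gh) (use x in simp)
      finally show ?thesis .
    qed (simp add: \<Phi>_def \<Psi>_def)
    show "\<Phi> (\<Psi> y) = y" for y
    proof (cases "norm y \<le> R")
      case False
      then have y: "norm y \<ge> R" by simp
      have my: "norm (M' y) \<ge> R" by (rule M'out[OF y])
      then have k1: "k' (M' y) \<in> ?E1" using nk' R by simp
      have "norm (\<Psi> y) \<ge> R" unfolding \<Psi>out[OF y] using gE[OF k1] by simp
      then have "\<Phi> (\<Psi> y) = M (k (h (g (k' (M' y)))))" using \<Phi>out \<Psi>out[OF y] by simp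
      also have "\<dots> = y" unfolding hg[OF k1] kk'[OF my] MM' ..
      finally show ?thesis .
    qed (simp add: \<Phi>_def \<Psi>_def)
  qed auto
  moreover have "\<Phi> ` range \<Gamma> = \<Gamma> ` {b..a} \<union> {\<Gamma> a + s *\<^sub>R e | s. s \<ge> 0} \<union> {\<Gamma> b - s *\<^sub>R e | s. s \<ge> 0}"
  proof -
    have split: "range \<Gamma> = \<Gamma> ` {b..a} \<union> (range \<Gamma> - ball 0 R)"
    proof -
      have "\<Gamma> t \<in> \<Gamma> ` {b..a} \<union> (range \<Gamma> - ball 0 R)" for t
        using O[of t] by (cases "norm (\<Gamma> t) \<ge> R") auto
      then show ?thesis by blast
    qed
    have inner: "\<Phi> (\<Gamma> t) = \<Gamma> t" if "t \<in> {b..a}" for t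
    proof (cases "t = a \<or> t = b")
      case True
      then show ?thesis using na nb by (auto simp: \<Phi>_def)
    next
      case False
      then have "\<not> (t \<le> b \<or> a \<le> t)" using that by auto
      then have "norm (\<Gamma> t) \<le> R" using O[of t] by linarith
      then show ?thesis by (simp add: \<Phi>_def)
    qed
    have "\<Phi> ` (range \<Gamma> - ball 0 R) = (\<lambda>y. M (k y)) ` h ` (range \<Gamma> - ball 0 R)"
      unfolding image_image
    proof (rule image_cong[OF refl])
      fix x assume "x \<in> range \<Gamma> - ball 0 R"
      then show "\<Phi> x = M (k (h x))" by (intro \<Phi>out) simp
    qed
    also have "\<dots> = (\<lambda>y. M (k y)) ` vertical_rays" by (simp only: rays)
    also have "vertical_rays = {s *\<^sub>R y | s y. s \<ge> 1 \<and> y \<in> {(0, 1), (0, -1)}}"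
    proof (intro equalityI subsetI)
      fix x assume "x \<in> vertical_rays"
      then obtain t where t: "x = (0, t)" "t \<ge> 1 \<or> t \<le> -1" unfolding vertical_rays_def by blast
      then have "x = \<bar>t\<bar> *\<^sub>R (0, sgn t)" "\<bar>t\<bar> \<ge> 1" "(0::complex, sgn t) \<in> {(0, 1), (0, -1)}"
        by (auto simp: abs_mult_sgn mult.commute)
      then show "x \<in> {s *\<^sub>R y | s y. s \<ge> 1 \<and> y \<in> {(0, 1), (0, -1)}}" by blast
    qed (auto simp: vertical_rays_def)
    also have "\<dots> = {s *\<^sub>R h (\<Gamma> a) | s. s \<ge> 1} \<union> {s *\<^sub>R h (\<Gamma> b) | s. s \<ge> 1}"
      unfolding poles[symmetric] by blast
    also have "(\<lambda>y. M (k y)) ` ({s *\<^sub>R h (\<Gamma> a) | s. s \<ge> 1} \<union> {s *\<^sub>R h (\<Gamma> b) | s. s \<ge> 1})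
      = {M (k (s *\<^sub>R h (\<Gamma> a))) | s. s \<ge> 1} \<union> {M (k (s *\<^sub>R h (\<Gamma> b))) | s. s \<ge> 1}"
      by blast
    finally have outer: "\<Phi> ` (range \<Gamma> - ball 0 R)
      = {M (k (s *\<^sub>R h (\<Gamma> a))) | s. s \<ge> 1} \<union> {M (k (s *\<^sub>R h (\<Gamma> b))) | s. s \<ge> 1}" .
    \<comment> \<open>The point s p + (1 - s) c runs along the ray from \<open>c\<close> through p.
      As the end points are c + e and c - e, both rays are parallel to \<open>e\<close>.\<close>
    have Mk: "M (k (s *\<^sub>R h p)) = s *\<^sub>R p + (1 - s) *\<^sub>R c" if "norm p = R" "s \<ge> 1" for s p
    proof -
      have "k (s *\<^sub>R h p) = s *\<^sub>R g (h p)" using hs[OF that(1)] that(2) by (simp add: k_def)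
      also have "g (h p) = p" by (rule gh) (use that(1) in simp)
      finally have "M (k (s *\<^sub>R h p)) = s *\<^sub>R p + ((R - s * R) / R) *\<^sub>R c" using that by (simp add: M_def)
      also have "(R - s * R) / R = 1 - s" using R by (simp add: field_simps)
      finally show ?thesis .
    qed
    have ea: "s *\<^sub>R \<Gamma> a + (1 - s) *\<^sub>R c = \<Gamma> a + (s - 1) *\<^sub>R e" for s
    proof -
      have ce: "c = \<Gamma> a - e" unfolding c_def e_def by (simp add: algebra_simps scaleR_2[symmetric])
      show ?thesis unfolding ce by (simp add: algebra_simps)
    qed
    have eb: "s *\<^sub>R \<Gamma> b + (1 - s) *\<^sub>R c = \<Gamma> b - (s - 1) *\<^sub>R e" for s
    proof -
      have ce: "c = \<Gamma> b + e" unfolding c_def e_def by (simp add: algebra_simps scaleR_2[symmetric])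
      show ?thesis unfolding ce by (simp add: algebra_simps)
    qed
    have shift: "{f (s - 1) | s::real. s \<ge> 1} = {f s | s. s \<ge> 0}" for f :: "real \<Rightarrow> complex \<times> real"
    proof (intro equalityI subsetI)
      fix x assume "x \<in> {f s | s. s \<ge> 0}"
      then obtain s where "x = f ((s + 1) - 1)" "s + 1 \<ge> 1" by auto
      then show "x \<in> {f (s - 1) | s::real. s \<ge> 1}" by blast
    qed auto
    have cong: "{f s | s::real. s \<ge> 1} = {f' s | s. s \<ge> 1}" if "\<And>s. s \<ge> 1 \<Longrightarrow> f s = f' s"
      for f f' :: "real \<Rightarrow> complex \<times> real"
      by (rule Collect_cong) (use that in metis)
    have "{M (k (s *\<^sub>R h (\<Gamma> a))) | s. s \<ge> 1} = {\<Gamma> a + (s - 1) *\<^sub>R e | s. s \<ge> 1}"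
      by (rule cong) (use Mk[OF na] ea in simp)
    moreover have "{M (k (s *\<^sub>R h (\<Gamma> b))) | s. s \<ge> 1} = {\<Gamma> b - (s - 1) *\<^sub>R e | s. s \<ge> 1}"
      by (rule cong) (use Mk[OF nb] eb in simp)
    ultimately have "\<Phi> ` (range \<Gamma> - ball 0 R) = {\<Gamma> a + s *\<^sub>R e | s. s \<ge> 0} \<union> {\<Gamma> b - s *\<^sub>R e | s. s \<ge> 0}"
      unfolding outer using shift[of "\<lambda>s. \<Gamma> a + s *\<^sub>R e"] shift[of "\<lambda>s. \<Gamma> b - s *\<^sub>R e"] by simp
    moreover have "\<Phi> ` \<Gamma> ` {b..a} = \<Gamma> ` {b..a}" unfolding image_image by (rule image_cong[OF refl inner])
    ultimately show ?thesis by (subst split) (simp only: image_Un Un_assoc)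
  qed
  ultimately show ?thesis by blast
qed

section \<open>Bending the ends to a C^1 curve\<close>

text \<open>Along each line in direction \<open>v\<close> the map s |-> s + F increases with slope
  at least 1/2, which gives injectivity, and boundedness of \<open>F\<close> gives surjectivity. The
  condition is one-sided since the square root profile rises with infinite slope.\<close>

lemma monotone_shear_homeomorphism:
  fixes F :: "'a::euclidean_space \<Rightarrow> real" and v :: 'a
  assumes F: "continuous_on UNIV F" "\<And>x. \<bar>F x\<bar> \<le> B"
    and mono: "\<And>x s. s \<ge> 0 \<Longrightarrow> F (x + s *\<^sub>R v) - F x \<ge> - (s / 2)"
  shows "\<exists>g. homeomorphism UNIV UNIV (\<lambda>x. x + F x *\<^sub>R v) g"
proof -
  let ?h = "\<lambda>x. x + F x *\<^sub>R v"
  have inj1: "x = y" if "?h x = ?h y" "F y \<le> F x" for x y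
  proof -
    have y: "y = x + (F x - F y) *\<^sub>R v" using that(1) by (simp add: algebra_simps)
    have "F (x + (F x - F y) *\<^sub>R v) - F x \<ge> - ((F x - F y) / 2)" using that(2) by (intro mono) simp
    then have "F y - F x \<ge> - ((F x - F y) / 2)" unfolding y[symmetric] .
    then have "F x - F y \<le> 0" by (simp add: field_simps)
    then have "F x = F y" using that(2) by linarith
    then show ?thesis using y by simp
  qed
  have "inj ?h"
  proof (rule injI)
    fix x y assume e: "?h x = ?h y"
    show "x = y"
    proof (cases "F y \<le> F x")
      case True
      show ?thesis by (rule inj1[OF e True])
    next
      case False
      then have "F x \<le> F y" by linarith
      from inj1[OF e[symmetric] this] show ?thesis by simp
    qed
  qed
  have c: "continuous_on UNIV ?h"
    by (intro continuous_on_add continuous_on_id continuous_on_scaleR F(1) continuous_on_const)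
  have surj: "\<exists>x. ?h x = y" for y
  proof -
    let ?f = "\<lambda>s. s + F (y + s *\<^sub>R v)"
    have "\<exists>s. - B \<le> s \<and> s \<le> B \<and> ?f s = 0"
    proof (rule IVT')
      show "?f (- B) \<le> 0" using F(2)[of "y + (- B) *\<^sub>R v"] by linarith
      show "0 \<le> ?f B" using F(2)[of "y + B *\<^sub>R v"] by linarith
      show "- B \<le> B" using F(2)[of y] by linarith
      have "continuous_on {- B..B} (\<lambda>s. F (y + s *\<^sub>R v))"
        by (rule continuous_on_compose2[OF F(1)])
          (intro continuous_on_add continuous_on_const continuous_on_scaleR continuous_on_id, simp)
      then show "continuous_on {- B..B} ?f" by (intro continuous_on_add continuous_on_id)
    qed
    then obtain s where s: "?f s = 0" by blast
    have "?h (y + s *\<^sub>R v) = y + ?f s *\<^sub>R v" by (simp only: scaleR_add_left add.assoc)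
    then have "?h (y + s *\<^sub>R v) = y" unfolding s by simp
    then show ?thesis by blast
  qed
  obtain g where "homeomorphism UNIV (range ?h) ?h g"
    using invariance_of_domain_homeomorphism[OF open_UNIV c order_refl \<open>inj ?h\<close>] by blast
  moreover have "range ?h = UNIV" using surj by (metis surj_def)
  ultimately show ?thesis by metis
qed

text \<open>
  A curve meeting a straight ray at an angle is made $C^1$ by pushing the ray by a multiple of this
  function in the direction of the curve. The square root becomes smooth once the distance along
  the ray is taken as the square of the parameter.
\<close>

definition corner_profile :: "real \<Rightarrow> real" where
  "corner_profile s = sqrt (max 0 s) * (max 0 (1 - s))\<^sup>2"

lemma corner_profile_nonneg: "corner_profile s \<ge> 0"
  by (simp add: corner_profile_def)

lemma corner_profile_nonpos: "s \<le> 0 \<Longrightarrow> corner_profile s = 0"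
  by (simp add: corner_profile_def max_def)

lemma corner_profile_le_1: "corner_profile s \<le> 1"
proof (cases "0 < s \<and> s < 1")
  case True
  then have "sqrt s \<le> 1" "(1 - s)\<^sup>2 \<le> 1" by (simp_all add: power_le_one)
  then have "sqrt s * (1 - s)\<^sup>2 \<le> 1 * 1" using True by (intro mult_mono) auto
  then show ?thesis using True by (simp add: corner_profile_def max_def)
next
  case False
  then have "s \<le> 0 \<or> 1 \<le> s" by linarith
  then show ?thesis by (auto simp: corner_profile_def max_def)
qed

lemma continuous_on_corner_profile: "continuous_on A corner_profile"
  unfolding corner_profile_def
  by (intro continuous_on_mult continuous_on_real_sqrt continuous_on_max continuous_on_power
      continuous_on_diff continuous_on_const continuous_on_id)

text \<open>The square root only increases, so a decrease can come only from the factor (1 - s)^2,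
  whose slope is at least -2.\<close>

lemma corner_profile_slope:
  assumes "s \<le> s'"
  shows "corner_profile s' - corner_profile s \<ge> - 2 * (s' - s)"
proof (cases "0 < s \<and> s < 1")
  case True
  define u where "u = 1 - s"
  define u' where "u' = max 0 (1 - s')"
  have u: "0 < u" "u < 1" "0 \<le> u'" "u' \<le> u" "u - u' \<le> s' - s" using True assms by (auto simp: u_def u'_def)
  have "sqrt s * u'\<^sup>2 \<le> corner_profile s'"
    using True assms by (auto simp: corner_profile_def u'_def intro!: mult_right_mono)
  moreover have "corner_profile s = sqrt s * u\<^sup>2"
    using True by (simp add: corner_profile_def u_def)
  moreover have "sqrt s * u\<^sup>2 - sqrt s * u'\<^sup>2 \<le> 2 * (s' - s)"
  proof -
    have "sqrt s * u\<^sup>2 - sqrt s * u'\<^sup>2 = sqrt s * ((u - u') * (u + u'))"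
      by (simp add: power2_eq_square algebra_simps)
    also have "\<dots> \<le> 1 * ((u - u') * (u + u'))"
      using True u by (intro mult_right_mono mult_nonneg_nonneg) auto
    also have "\<dots> \<le> 1 * ((s' - s) * 2)" using u by (intro mult_left_mono mult_mono) auto
    finally show ?thesis by simp
  qed
  ultimately show ?thesis by linarith
next
  case False
  then have "s \<le> 0 \<or> 1 \<le> s" by linarith
  then have "corner_profile s = 0" by (auto simp: corner_profile_def max_def)
  moreover have "- 2 * (s' - s) \<le> 0" using assms by simp
  ultimately show ?thesis using order_trans[OF _ corner_profile_nonneg[of s']] by simp
qed

text \<open>One shear for each ray, each acting only beyond the tangent plane of the ball at the
  corresponding end point. The ball lies on the other side of both planes, and so does each ray with
  respect to the plane of the other.\<close>

lemma bend_ends_homeomorphism: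
  fixes p\<^sub>1 p\<^sub>2 v\<^sub>1 v\<^sub>2 :: "'a::euclidean_space"
  assumes R: "norm p\<^sub>1 = R" "norm p\<^sub>2 = R" and c0: "c\<^sub>0 = (R\<^sup>2 - inner p\<^sub>1 p\<^sub>2) / 2" "c\<^sub>0 > 0"
    and e: "e = (1/2) *\<^sub>R (p\<^sub>1 - p\<^sub>2)" and v: "inner p\<^sub>1 v\<^sub>1 \<ge> 0" "inner p\<^sub>2 v\<^sub>2 \<ge> 0"
    and \<epsilon>: "\<epsilon> > 0" "4 * \<epsilon> * inner p\<^sub>1 v\<^sub>1 \<le> c\<^sub>0" "4 * \<epsilon> * inner p\<^sub>2 v\<^sub>2 \<le> c\<^sub>0" "\<epsilon> * \<bar>inner p\<^sub>2 v\<^sub>1\<bar> \<le> c\<^sub>0"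
  shows "\<exists>\<Psi> \<Psi>'. homeomorphism UNIV UNIV \<Psi> \<Psi>' \<and> (\<forall>x. norm x \<le> R \<longrightarrow> \<Psi> x = x) \<and>
    (\<forall>s\<ge>0. \<Psi> (p\<^sub>1 + s *\<^sub>R e) = p\<^sub>1 + s *\<^sub>R e + (\<epsilon> * corner_profile s) *\<^sub>R v\<^sub>1) \<and>
    (\<forall>s\<ge>0. \<Psi> (p\<^sub>2 - s *\<^sub>R e) = p\<^sub>2 - s *\<^sub>R e + (\<epsilon> * corner_profile s) *\<^sub>R v\<^sub>2)"
proof -
  \<comment> \<open>Height above the tangent plane at \<open>p\<close>, scaled so that it equals s
    at the point of the ray with parameter s; \<open>c\<^sub>0\<close> is the inner product of
    \<open>p\<^sub>1\<close> with \<open>e\<close>.\<close>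
  define l where "l p x = (inner p x - R\<^sup>2) / c\<^sub>0" for p x :: 'a
  define F where "F p x = \<epsilon> * corner_profile (l p x)" for p x
  have shear: "\<exists>g. homeomorphism UNIV UNIV (\<lambda>x. x + F p x *\<^sub>R v) g"
    if pv: "inner p v \<ge> 0" "4 * \<epsilon> * inner p v \<le> c\<^sub>0" for p v
  proof (rule monotone_shear_homeomorphism)
    show "continuous_on UNIV (F p)"
      unfolding F_def l_def using c0(2)
      by (intro continuous_on_mult continuous_on_const continuous_on_compose2[OF continuous_on_corner_profile[of UNIV]]
          continuous_on_divide continuous_on_diff continuous_on_inner continuous_on_id) auto
    show "\<bar>F p x\<bar> \<le> \<epsilon>" for x
    proof -
      have "\<epsilon> * corner_profile (l p x) \<le> \<epsilon> * 1" using corner_profile_le_1 \<epsilon>(1) by (intro mult_left_mono) auto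
      moreover have "\<epsilon> * corner_profile (l p x) \<ge> 0" using corner_profile_nonneg \<epsilon>(1) by simp
      ultimately show ?thesis unfolding F_def by linarith
    qed
    fix x and s :: real assume s: "s \<ge> 0"
    have lx: "l p (x + s *\<^sub>R v) = l p x + s * inner p v / c\<^sub>0"
      unfolding l_def inner_add_right inner_scaleR_right
      by (simp add: add_divide_distrib diff_divide_distrib)
    have "s * inner p v / c\<^sub>0 \<ge> 0" using s pv(1) c0(2) by simp
    then have "corner_profile (l p (x + s *\<^sub>R v)) - corner_profile (l p x) \<ge> - 2 * (s * inner p v / c\<^sub>0)"
      using corner_profile_slope[of "l p x" "l p (x + s *\<^sub>R v)"] unfolding lx by simp
    then have "\<epsilon> * (corner_profile (l p (x + s *\<^sub>R v)) - corner_profile (l p x)) \<ge> \<epsilon> * (- 2 * (s * inner p v / c\<^sub>0))"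
      using \<epsilon>(1) by (intro mult_left_mono) auto
    moreover have "\<epsilon> * (- 2 * (s * inner p v / c\<^sub>0)) \<ge> - (s / 2)"
    proof -
      have "s * (4 * \<epsilon> * inner p v) \<le> s * c\<^sub>0" using s pv(2) by (rule mult_left_mono[rotated])
      then have "s * (4 * \<epsilon> * inner p v) / c\<^sub>0 \<le> s" using c0(2) by (simp add: pos_divide_le_eq)
      then show ?thesis by (simp add: mult_ac)
    qed
    ultimately show "F p (x + s *\<^sub>R v) - F p x \<ge> - (s / 2)"
      unfolding F_def right_diff_distrib[symmetric] by linarith
  qed
  obtain g\<^sub>1 where h1: "homeomorphism UNIV UNIV (\<lambda>x. x + F p\<^sub>1 x *\<^sub>R v\<^sub>1) g\<^sub>1" using shear[OF v(1) \<epsilon>(2)] by blast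
  obtain g\<^sub>2 where h2: "homeomorphism UNIV UNIV (\<lambda>x. x + F p\<^sub>2 x *\<^sub>R v\<^sub>2) g\<^sub>2" using shear[OF v(2) \<epsilon>(3)] by blast
  define \<sigma>\<^sub>1 where "\<sigma>\<^sub>1 x = x + F p\<^sub>1 x *\<^sub>R v\<^sub>1" for x
  define \<sigma>\<^sub>2 where "\<sigma>\<^sub>2 x = x + F p\<^sub>2 x *\<^sub>R v\<^sub>2" for x
  have hom: "homeomorphism UNIV UNIV (\<sigma>\<^sub>2 \<circ> \<sigma>\<^sub>1) (g\<^sub>1 \<circ> g\<^sub>2)"
    unfolding \<sigma>\<^sub>1_def \<sigma>\<^sub>2_def by (rule homeomorphism_compose[OF h1 h2])
  have F0: "F p x = 0" if "l p x \<le> 0" for p x using corner_profile_nonpos[OF that] by (simp add: F_def)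
  have lin: "l p x \<le> 0" if "norm x \<le> R" "norm p = R" for p x
  proof -
    have "inner p x \<le> norm p * norm x" by (rule norm_cauchy_schwarz)
    also have "\<dots> \<le> R * R" using that norm_ge_zero[of p] by (intro mult_mono) auto
    finally show ?thesis using c0(2) by (simp add: l_def divide_nonpos_pos power2_eq_square)
  qed
  have pp: "inner p\<^sub>1 p\<^sub>1 = R\<^sup>2" "inner p\<^sub>2 p\<^sub>2 = R\<^sup>2" using R by (simp_all flip: power2_norm_eq_inner)
  have p12: "inner p\<^sub>1 p\<^sub>2 = R\<^sup>2 - 2 * c\<^sub>0" "inner p\<^sub>2 p\<^sub>1 = R\<^sup>2 - 2 * c\<^sub>0" using c0(1) by (simp_all add: inner_commute)
  have pe: "inner p\<^sub>1 e = c\<^sub>0" "inner p\<^sub>2 e = - c\<^sub>0"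
    unfolding e inner_scaleR_right inner_diff_right pp p12 by simp_all
  have l11: "l p\<^sub>1 (p\<^sub>1 + s *\<^sub>R e) = s" for s
    unfolding l_def inner_add_right inner_scaleR_right pp pe using c0(2) by simp
  have l12: "l p\<^sub>1 (p\<^sub>2 - s *\<^sub>R e) = - 2 - s" for s
    unfolding l_def inner_diff_right inner_scaleR_right p12 pe using c0(2) by (simp add: field_simps)
  have l22: "l p\<^sub>2 (p\<^sub>2 - s *\<^sub>R e) = s" for s
    unfolding l_def inner_diff_right inner_scaleR_right pp pe using c0(2) by simp
  have l21: "l p\<^sub>2 (p\<^sub>1 + s *\<^sub>R e + t *\<^sub>R v\<^sub>1) = - 2 - s + t * inner p\<^sub>2 v\<^sub>1 / c\<^sub>0" for s t
    unfolding l_def inner_add_right inner_scaleR_right p12 pe using c0(2) by (simp add: field_simps)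
  show ?thesis
  proof (intro exI conjI allI impI)
    show "homeomorphism UNIV UNIV (\<sigma>\<^sub>2 \<circ> \<sigma>\<^sub>1) (g\<^sub>1 \<circ> g\<^sub>2)" by (rule hom)
    show "(\<sigma>\<^sub>2 \<circ> \<sigma>\<^sub>1) x = x" if "norm x \<le> R" for x
      using F0[OF lin[OF that R(1)]] F0[OF lin[OF that R(2)]] by (simp add: \<sigma>\<^sub>1_def \<sigma>\<^sub>2_def)
    fix s :: real assume s: "s \<ge> 0"
    let ?x = "p\<^sub>1 + s *\<^sub>R e + (\<epsilon> * corner_profile s) *\<^sub>R v\<^sub>1"
    have 1: "\<sigma>\<^sub>1 (p\<^sub>1 + s *\<^sub>R e) = ?x" by (simp add: \<sigma>\<^sub>1_def F_def l11)
    \<comment> \<open>The straight ray has height - 2 - s here, and the last bound on \<epsilon>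
      lets the bending raise it by at most 1.\<close>
    have "l p\<^sub>2 ?x \<le> 0"
    proof -
      have "\<epsilon> * corner_profile s * inner p\<^sub>2 v\<^sub>1 \<le> \<bar>\<epsilon> * corner_profile s * inner p\<^sub>2 v\<^sub>1\<bar>" by (rule abs_ge_self)
      also have "\<dots> = corner_profile s * (\<epsilon> * \<bar>inner p\<^sub>2 v\<^sub>1\<bar>)"
        using \<epsilon>(1) corner_profile_nonneg[of s] by (simp add: abs_mult)
      also have "\<dots> \<le> 1 * c\<^sub>0"
        using corner_profile_nonneg[of s] corner_profile_le_1[of s] \<epsilon>(1,4) by (intro mult_mono) auto
      finally have "\<epsilon> * corner_profile s * inner p\<^sub>2 v\<^sub>1 / c\<^sub>0 \<le> 1" using c0(2) by simp
      then show ?thesis unfolding l21 using s by linarith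
    qed
    then have "\<sigma>\<^sub>2 ?x = ?x" using F0 by (simp add: \<sigma>\<^sub>2_def)
    then show "(\<sigma>\<^sub>2 \<circ> \<sigma>\<^sub>1) (p\<^sub>1 + s *\<^sub>R e) = ?x" using 1 by simp
    have "l p\<^sub>1 (p\<^sub>2 - s *\<^sub>R e) \<le> 0" unfolding l12 using s by linarith
    then have "\<sigma>\<^sub>1 (p\<^sub>2 - s *\<^sub>R e) = p\<^sub>2 - s *\<^sub>R e" using F0 by (simp add: \<sigma>\<^sub>1_def)
    moreover have "\<sigma>\<^sub>2 (p\<^sub>2 - s *\<^sub>R e) = p\<^sub>2 - s *\<^sub>R e + (\<epsilon> * corner_profile s) *\<^sub>R v\<^sub>2"
      by (simp add: \<sigma>\<^sub>2_def F_def l22)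
    ultimately show "(\<sigma>\<^sub>2 \<circ> \<sigma>\<^sub>1) (p\<^sub>2 - s *\<^sub>R e) = p\<^sub>2 - s *\<^sub>R e + (\<epsilon> * corner_profile s) *\<^sub>R v\<^sub>2" by simp
  qed
qed

lemma has_vector_derivative_glue:
  fixes f\<^sub>1 f\<^sub>2 :: "real \<Rightarrow> 'a::real_normed_vector"
  assumes f1: "\<And>t. t \<le> c \<Longrightarrow> (f\<^sub>1 has_vector_derivative f\<^sub>1' t) (at t)"
    and f2: "\<And>t. t \<ge> c \<Longrightarrow> (f\<^sub>2 has_vector_derivative f\<^sub>2' t) (at t)"
    and eq: "f\<^sub>1 c = f\<^sub>2 c" "f\<^sub>1' c = f\<^sub>2' c"
  shows "((\<lambda>t. if t \<le> c then f\<^sub>1 t else f\<^sub>2 t) has_vector_derivative (if t \<le> c then f\<^sub>1' t else f\<^sub>2' t)) (at t)"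
proof -
  have "((\<lambda>t. if t \<in> {..c} then f\<^sub>1 t else f\<^sub>2 t) has_vector_derivative (if t \<in> {..c} then f\<^sub>1' t else f\<^sub>2' t)) (at t within UNIV)"
  proof (rule has_vector_derivative_If_within_closures[where T = "{c<..}"])
    show "t \<in> {..c} \<union> {c<..}" "UNIV = {..c} \<union> {c<..}" by auto
    show "(f\<^sub>1 has_vector_derivative f\<^sub>1' t) (at t within {..c} \<union> closure {..c} \<inter> closure {c<..})"
      if "t \<in> {..c} \<union> closure {..c} \<inter> closure {c<..}"
      by (rule has_vector_derivative_at_within[OF f1]) (use that in auto)
    show "(f\<^sub>2 has_vector_derivative f\<^sub>2' t) (at t within {c<..} \<union> closure {..c} \<inter> closure {c<..})"
      if "t \<in> {c<..} \<union> closure {..c} \<inter> closure {c<..}"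
      by (rule has_vector_derivative_at_within[OF f2]) (use that in auto)
    assume "t \<in> closure {..c}" "t \<in> closure {c<..}"
    then have "t = c" by auto
    then show "f\<^sub>1 t = f\<^sub>2 t" "f\<^sub>1' t = f\<^sub>2' t" using eq by auto
  qed
  then show ?thesis by simp
qed

lemma continuous_on_glue:
  fixes f\<^sub>1 f\<^sub>2 :: "real \<Rightarrow> 'a::topological_space"
  assumes "continuous_on {..c} f\<^sub>1" "continuous_on {c..} f\<^sub>2" "f\<^sub>1 c = f\<^sub>2 c"
  shows "continuous_on UNIV (\<lambda>t. if t \<le> c then f\<^sub>1 t else f\<^sub>2 t)"
proof -
  have "continuous_on ({..c} \<union> {c..}) (\<lambda>t. if t \<le> c then f\<^sub>1 t else f\<^sub>2 t)"
    by (rule continuous_on_cases[OF closed_atMost closed_atLeast assms(1,2)]) (use assms(3) in \<open>auto simp: order.order_iff_strict\<close>)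
  moreover have "{..c} \<union> {c..} = (UNIV :: real set)" by auto
  ultimately show ?thesis by simp
qed

text \<open>
  The square root of the distance travelled along the ray: the slope \<open>\<mu>\<close> at \<open>0\<close> is large, so that a
  small push suffices, and the distance finally grows with unit speed.
\<close>

definition end_parameter :: "real \<Rightarrow> real \<Rightarrow> real" where
  "end_parameter \<mu> \<tau> = (if \<tau> \<le> 1 / (2 * \<mu>\<^sup>2) then \<mu> * \<tau> else sqrt (\<tau> - 1 / (4 * \<mu>\<^sup>2)))"

definition end_parameter' :: "real \<Rightarrow> real \<Rightarrow> real" where
  "end_parameter' \<mu> \<tau> = (if \<tau> \<le> 1 / (2 * \<mu>\<^sup>2) then \<mu> else inverse (sqrt (\<tau> - 1 / (4 * \<mu>\<^sup>2))) / 2)"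

context
  fixes \<mu> :: real
  assumes \<mu>: "\<mu> \<ge> 1"
begin

private lemma \<rho>: "1 / (2 * \<mu>\<^sup>2) - 1 / (4 * \<mu>\<^sup>2) = (1 / (2 * \<mu>))\<^sup>2" "1 / (4 * \<mu>\<^sup>2) > 0" "1 / (4 * \<mu>\<^sup>2) < 1 / (2 * \<mu>\<^sup>2)"
  "1 / (2 * \<mu>\<^sup>2) \<le> 1 / 2" "1 / (4 * \<mu>\<^sup>2) \<le> 1 / 4"
proof -
  have m: "\<mu>\<^sup>2 \<ge> 1" using \<mu> by (simp add: one_le_power)
  then have p: "\<mu>\<^sup>2 > 0" by linarith
  show "1 / (2 * \<mu>\<^sup>2) - 1 / (4 * \<mu>\<^sup>2) = (1 / (2 * \<mu>))\<^sup>2" using p by (simp add: field_simps power2_eq_square)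
  show "1 / (4 * \<mu>\<^sup>2) > 0" using p by simp
  show "1 / (4 * \<mu>\<^sup>2) < 1 / (2 * \<mu>\<^sup>2)" using p by (simp add: field_simps)
  show "1 / (2 * \<mu>\<^sup>2) \<le> 1 / 2" "1 / (4 * \<mu>\<^sup>2) \<le> 1 / 4" using m p by (simp_all add: divide_le_eq)
qed

text \<open>The common value of both branches of \<open>end_parameter\<close> at the junction. The
  shift 1/(4 \<mu>^2) is the one for which the slopes agree there too, both being \<mu>.\<close>

private lemma sqrt_\<rho>: "sqrt (1 / (2 * \<mu>\<^sup>2) - 1 / (4 * \<mu>\<^sup>2)) = 1 / (2 * \<mu>)"
  unfolding \<rho>(1) real_sqrt_abs using \<mu> by simp

lemma end_parameter_deriv: "(end_parameter \<mu> has_real_derivative end_parameter' \<mu> \<tau>) (at \<tau>)"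
  unfolding has_real_derivative_iff_has_vector_derivative end_parameter_def[abs_def] end_parameter'_def
proof (rule has_vector_derivative_glue)
  show "((\<lambda>x. \<mu> * x) has_vector_derivative \<mu>) (at t)" for t
    unfolding has_real_derivative_iff_has_vector_derivative[symmetric] by (auto intro!: derivative_eq_intros)
  fix t :: real assume t: "1 / (2 * \<mu>\<^sup>2) \<le> t"
  then have p: "t - 1 / (4 * \<mu>\<^sup>2) > 0" using \<rho>(3) by linarith
  have d: "((\<lambda>\<tau>. \<tau> - 1 / (4 * \<mu>\<^sup>2)) has_real_derivative 1) (at t)" by (auto intro!: derivative_eq_intros)
  have "((\<lambda>\<tau>. sqrt (\<tau> - 1 / (4 * \<mu>\<^sup>2))) has_real_derivative inverse (sqrt (t - 1 / (4 * \<mu>\<^sup>2))) / 2 * 1) (at t)"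
    by (rule DERIV_chain2[OF DERIV_real_sqrt[OF p] d])
  then show "((\<lambda>\<tau>. sqrt (\<tau> - 1 / (4 * \<mu>\<^sup>2))) has_vector_derivative inverse (sqrt (t - 1 / (4 * \<mu>\<^sup>2))) / 2) (at t)"
    unfolding has_real_derivative_iff_has_vector_derivative by simp
next
  show "\<mu> * (1 / (2 * \<mu>\<^sup>2)) = sqrt (1 / (2 * \<mu>\<^sup>2) - 1 / (4 * \<mu>\<^sup>2))"
    unfolding sqrt_\<rho> using \<mu> by (simp add: power2_eq_square)
  show "\<mu> = inverse (sqrt (1 / (2 * \<mu>\<^sup>2) - 1 / (4 * \<mu>\<^sup>2))) / 2"
    unfolding sqrt_\<rho> using \<mu> by simp
qed

lemma continuous_end_parameter': "continuous_on UNIV (end_parameter' \<mu>)"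
  unfolding end_parameter'_def[abs_def]
proof (rule continuous_on_glue)
  show "continuous_on {1 / (2 * \<mu>\<^sup>2)..} (\<lambda>\<tau>. inverse (sqrt (\<tau> - 1 / (4 * \<mu>\<^sup>2))) / 2)"
    using \<rho>(3) by (intro continuous_intros) auto
  show "\<mu> = inverse (sqrt (1 / (2 * \<mu>\<^sup>2) - 1 / (4 * \<mu>\<^sup>2))) / 2"
    unfolding sqrt_\<rho> using \<mu> by simp
qed simp

lemma end_parameter'_pos: "end_parameter' \<mu> \<tau> > 0"
  unfolding end_parameter'_def using \<mu> \<rho>(3) by auto

lemma end_parameter_0: "end_parameter \<mu> 0 = 0" "end_parameter' \<mu> 0 = \<mu>"
  using \<mu> by (auto simp: end_parameter_def end_parameter'_def)

lemma end_parameter_mono: "s < t \<Longrightarrow> end_parameter \<mu> s < end_parameter \<mu> t"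
  using end_parameter_deriv end_parameter'_pos by (metis DERIV_pos_imp_increasing)

text \<open>Since \<mu> is at least 1, the junction lies at or before 1/2; from there on the ray is
  traversed with constant velocity.\<close>

lemma end_parameter_square: "\<tau> \<ge> 1 / 2 \<Longrightarrow> (end_parameter \<mu> \<tau>)\<^sup>2 = \<tau> - 1 / (4 * \<mu>\<^sup>2)"
proof -
  assume t: "\<tau> \<ge> 1 / 2"
  show ?thesis
  proof (cases "\<tau> \<le> 1 / (2 * \<mu>\<^sup>2)")
    case True
    then have e: "\<tau> = 1 / (2 * \<mu>\<^sup>2)" using t \<rho>(4) by linarith
    show ?thesis using \<mu> unfolding end_parameter_def e by (simp add: power2_eq_square field_simps)
  next
    case False
    then show ?thesis using \<rho>(3) by (simp add: end_parameter_def)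
  qed
qed

lemma end_parameter_onto:
  assumes "r \<ge> 0"
  shows "\<exists>\<tau>\<ge>0. end_parameter \<mu> \<tau> = r"
proof -
  have "end_parameter \<mu> (r\<^sup>2 + 1) \<ge> r"
  proof (rule power2_le_imp_le)
    have "(end_parameter \<mu> (r\<^sup>2 + 1))\<^sup>2 = r\<^sup>2 + 1 - 1 / (4 * \<mu>\<^sup>2)" by (rule end_parameter_square) (simp add: add_increasing)
    then show "r\<^sup>2 \<le> (end_parameter \<mu> (r\<^sup>2 + 1))\<^sup>2" using \<rho>(5) by linarith
    have "0 < r\<^sup>2 + 1" by (simp add: add_nonneg_pos)
    then show "0 \<le> end_parameter \<mu> (r\<^sup>2 + 1)" using end_parameter_mono[of 0 "r\<^sup>2 + 1"] end_parameter_0(1) by simp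
  qed
  moreover have "continuous_on {0..r\<^sup>2 + 1} (end_parameter \<mu>)"
    using end_parameter_deriv by (metis DERIV_continuous_on has_field_derivative_at_within)
  ultimately show ?thesis
    using IVT'[of "end_parameter \<mu>" 0 r "r\<^sup>2 + 1"] end_parameter_0(1) assms by (auto simp: add_increasing)
qed

text \<open>With distance \<sigma>^2 along the ray, the root in the profile becomes \<sigma> and the
  singularity disappears. At 0 the velocity is purely in direction \<open>v\<close>, with a length
  adjustable through \<epsilon> \<mu>, so it can be matched with the arc.\<close>

lemma bent_ray_C1:
  fixes p v e :: "'a::real_inner"
  assumes c0: "inner p e > 0" and v: "v \<noteq> 0" "inner p v \<ge> 0" and \<epsilon>: "\<epsilon> > 0" "4 * \<epsilon> * inner p v \<le> inner p e"
  defines "\<eta> \<equiv> \<lambda>\<tau>. p + (end_parameter \<mu> \<tau>)\<^sup>2 *\<^sub>R e + (\<epsilon> * (end_parameter \<mu> \<tau> * (max 0 (1 - (end_parameter \<mu> \<tau>)\<^sup>2))\<^sup>2)) *\<^sub>R v"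
  shows "\<exists>\<eta>'. (\<forall>\<tau>. (\<eta> has_vector_derivative \<eta>' \<tau>) (at \<tau>)) \<and> continuous_on UNIV \<eta>' \<and> \<eta>' 0 = (\<epsilon> * \<mu>) *\<^sub>R v \<and>
    (\<forall>\<tau>\<ge>0. \<eta>' \<tau> \<noteq> 0)"
proof -
  define \<sigma> where "\<sigma> = end_parameter \<mu>"
  define \<sigma>' where "\<sigma>' = end_parameter' \<mu>"
  note defs = \<sigma>_def[symmetric] \<sigma>'_def[symmetric]
  note \<sigma>d = end_parameter_deriv[unfolded defs] and \<sigma>c = continuous_end_parameter'[unfolded defs]
    and \<sigma>p = end_parameter'_pos[unfolded defs] and \<sigma>0 = end_parameter_0[unfolded defs]
    and \<sigma>m = end_parameter_mono[unfolded defs]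
  have \<eta>: "\<eta> = (\<lambda>\<tau>. p + (\<sigma> \<tau>)\<^sup>2 *\<^sub>R e + (\<epsilon> * (\<sigma> \<tau> * (max 0 (1 - (\<sigma> \<tau>)\<^sup>2))\<^sup>2)) *\<^sub>R v)"
    unfolding \<eta>_def defs ..
  \<comment> \<open>The square makes the positive part differentiable across its zero, so the cutoff
    at \<sigma> = 1 is C^1.\<close>
  have mx: "((\<lambda>s::real. (max 0 s)\<^sup>2) has_real_derivative 2 * max 0 s) (at s)" for s
  proof -
    have "((\<lambda>s::real. if s \<le> 0 then 0 else s\<^sup>2) has_vector_derivative (if s \<le> 0 then 0 else 2 * s)) (at s)"
      by (rule has_vector_derivative_glue)
        (auto simp: has_real_derivative_iff_has_vector_derivative[symmetric] intro!: derivative_eq_intros)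
    moreover have "(\<lambda>s::real. if s \<le> 0 then 0 else s\<^sup>2) = (\<lambda>s. (max 0 s)\<^sup>2)" by (auto simp: max_def)
    moreover have "(if s \<le> 0 then 0 else 2 * s) = 2 * max 0 s" by (simp add: max_def)
    ultimately show ?thesis unfolding has_real_derivative_iff_has_vector_derivative by simp
  qed
  define A where "A \<tau> = 2 * \<sigma> \<tau> * \<sigma>' \<tau>" for \<tau>
  define B where "B \<tau> = \<sigma>' \<tau> * ((max 0 (1 - (\<sigma> \<tau>)\<^sup>2))\<^sup>2 - 4 * (\<sigma> \<tau>)\<^sup>2 * max 0 (1 - (\<sigma> \<tau>)\<^sup>2))" for \<tau>
  have dA: "((\<lambda>\<tau>. (\<sigma> \<tau>)\<^sup>2) has_real_derivative A \<tau>) (at \<tau>)" for \<tau>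
    unfolding A_def by (rule derivative_eq_intros \<sigma>d refl)+ simp
  have "((\<lambda>\<tau>. 1 - (\<sigma> \<tau>)\<^sup>2) has_real_derivative - A \<tau>) (at \<tau>)" for \<tau>
    using DERIV_diff[OF DERIV_const dA] by simp
  from DERIV_chain2[OF mx this]
  have dq: "((\<lambda>\<tau>. (max 0 (1 - (\<sigma> \<tau>)\<^sup>2))\<^sup>2) has_real_derivative 2 * max 0 (1 - (\<sigma> \<tau>)\<^sup>2) * - A \<tau>) (at \<tau>)" for \<tau> .
  have dB: "((\<lambda>\<tau>. \<sigma> \<tau> * (max 0 (1 - (\<sigma> \<tau>)\<^sup>2))\<^sup>2) has_real_derivative B \<tau>) (at \<tau>)" for \<tau>
    using DERIV_mult[OF \<sigma>d dq] by (simp add: B_def A_def power2_eq_square algebra_simps)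
  define \<eta>' where "\<eta>' \<tau> = A \<tau> *\<^sub>R e + (\<epsilon> * B \<tau>) *\<^sub>R v" for \<tau>
  have vd: "((\<lambda>\<tau>. f \<tau> *\<^sub>R x) has_vector_derivative f' *\<^sub>R x) (at \<tau>)"
    if "(f has_real_derivative f') (at \<tau>)" for f f' \<tau> and x :: 'a
    using has_vector_derivative_scaleR[OF that has_vector_derivative_const[of x]] by simp
  have "(\<eta> has_vector_derivative \<eta>' \<tau>) (at \<tau>)" for \<tau>
  proof -
    have "(\<eta> has_vector_derivative (0 + A \<tau> *\<^sub>R e) + (\<epsilon> * B \<tau>) *\<^sub>R v) (at \<tau>)"
      unfolding \<eta>
      by (intro has_vector_derivative_add has_vector_derivative_const vd dA DERIV_cmult dB)
    then show ?thesis by (simp add: \<eta>'_def)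
  qed
  moreover have "continuous_on UNIV \<sigma>" using \<sigma>d by (metis DERIV_continuous_on has_field_derivative_at_within)
  then have "continuous_on UNIV \<eta>'"
    unfolding \<eta>'_def[abs_def] A_def B_def
    by (intro continuous_on_add continuous_on_scaleR continuous_on_mult continuous_on_const continuous_on_diff
        continuous_on_power continuous_on_max \<sigma>c)
  moreover have \<eta>0: "\<eta>' 0 = (\<epsilon> * \<mu>) *\<^sub>R v" by (simp add: \<eta>'_def A_def B_def \<sigma>0)
  moreover have "\<eta>' \<tau> \<noteq> 0" if t: "\<tau> \<ge> 0" for \<tau>
  proof (cases "\<tau> = 0")
    case True
    then show ?thesis using \<eta>0 v(1) \<epsilon>(1) \<mu> by simp
  next
    case False
    then have s: "\<sigma> \<tau> > 0" using \<sigma>m[of 0 \<tau>] \<sigma>0(1) t by simp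
    define u where "u = max 0 (1 - (\<sigma> \<tau>)\<^sup>2)"
    have u: "0 \<le> u" "u\<^sup>2 \<ge> 0" "(\<sigma> \<tau>)\<^sup>2 * u \<le> \<sigma> \<tau>"
    proof -
      show "(\<sigma> \<tau>)\<^sup>2 * u \<le> \<sigma> \<tau>"
      proof (cases "\<sigma> \<tau> \<le> 1")
        case True
        have "u \<le> 1" by (simp add: u_def)
        then have "(\<sigma> \<tau> * \<sigma> \<tau>) * u \<le> (\<sigma> \<tau> * 1) * 1" using True s by (intro mult_mono mult_nonneg_nonneg) (auto simp: u_def)
        then show ?thesis by (simp add: power2_eq_square)
      next
        case False
        then have "1 \<le> (\<sigma> \<tau>)\<^sup>2" by (simp add: one_le_power)
        then show ?thesis using s by (simp add: u_def)
      qed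
    qed (auto simp: u_def)
    \<comment> \<open>For positive \<tau> the velocity has a positive component along
      \<open>p\<close>: the bound on \<epsilon> makes the contribution of \<open>e\<close> exceed
      the only negative term.\<close>
    have "inner p (\<eta>' \<tau>) = \<sigma>' \<tau> * (2 * \<sigma> \<tau> * inner p e + \<epsilon> * inner p v * u\<^sup>2 - 4 * \<epsilon> * inner p v * ((\<sigma> \<tau>)\<^sup>2 * u))"
      by (simp add: \<eta>'_def A_def B_def u_def[symmetric] inner_add_right algebra_simps)
    moreover have "4 * \<epsilon> * inner p v * ((\<sigma> \<tau>)\<^sup>2 * u) \<le> inner p e * \<sigma> \<tau>"
      using \<epsilon> c0 u s by (intro mult_mono) auto
    moreover have "\<epsilon> * inner p v * u\<^sup>2 \<ge> 0" using \<epsilon>(1) v(2) by simp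
    moreover have "inner p e * \<sigma> \<tau> > 0" using c0 s by simp
    moreover have "2 * \<sigma> \<tau> * inner p e + Z - Y > 0" if "Y \<le> inner p e * \<sigma> \<tau>" "Z \<ge> 0" "inner p e * \<sigma> \<tau> > 0" for Y Z
    proof -
      have "2 * \<sigma> \<tau> * inner p e = inner p e * \<sigma> \<tau> + inner p e * \<sigma> \<tau>" by simp
      then show ?thesis using that by linarith
    qed
    ultimately have "inner p (\<eta>' \<tau>) > 0" using mult_pos_pos[OF \<sigma>p[of \<tau>]] by metis
    then show ?thesis by (metis inner_zero_right less_irrefl)
  qed
  ultimately show ?thesis by (intro exI[of _ \<eta>'] conjI allI impI)
qed

end


text \<open>The arc in the ball is joined to the two bent rays with matching velocities. Time is
  arranged so that the far ends lie exactly on the line c + t e with unit parameter speed.\<close>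

lemma C1_straight_ends:
  fixes \<Gamma> :: "real \<Rightarrow> 'a::euclidean_space"
  assumes \<Gamma>: "\<And>t. (\<Gamma> has_vector_derivative \<Gamma>' t) (at t)" "continuous_on UNIV \<Gamma>'" "\<And>t. \<Gamma>' t \<noteq> 0" "inj \<Gamma>"
    and ab: "b < a" and R: "\<And>t. t \<in> {b..a} \<Longrightarrow> norm (\<Gamma> t) \<le> R" "norm (\<Gamma> a) = R" "norm (\<Gamma> b) = R"
  defines "c \<equiv> (1/2) *\<^sub>R (\<Gamma> a + \<Gamma> b)" and "e \<equiv> (1/2) *\<^sub>R (\<Gamma> a - \<Gamma> b)"
  shows "\<exists>\<Psi> \<Psi>' \<gamma> \<gamma>'. homeomorphism UNIV UNIV \<Psi> \<Psi>' \<and>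
    range \<gamma> = \<Psi> ` (\<Gamma> ` {b..a} \<union> {\<Gamma> a + s *\<^sub>R e | s. s \<ge> 0} \<union> {\<Gamma> b - s *\<^sub>R e | s. s \<ge> 0}) \<and>
    inj \<gamma> \<and> (\<forall>t. (\<gamma> has_vector_derivative \<gamma>' t) (at t)) \<and> continuous_on UNIV \<gamma>' \<and> (\<forall>t. \<gamma>' t \<noteq> 0) \<and>
    (\<forall>t. \<bar>t\<bar> \<ge> 3 \<longrightarrow> \<gamma> t = c + t *\<^sub>R e)"
proof -
  define p\<^sub>1 p\<^sub>2 where "p\<^sub>1 = \<Gamma> a" and "p\<^sub>2 = \<Gamma> b"
  define v\<^sub>1 v\<^sub>2 where "v\<^sub>1 = \<Gamma>' a" and "v\<^sub>2 = - \<Gamma>' b"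
  have nn: "norm p\<^sub>1 = R" "norm p\<^sub>2 = R" using R by (auto simp: p\<^sub>1_def p\<^sub>2_def)
  have neq: "p\<^sub>1 \<noteq> p\<^sub>2" using \<Gamma>(4) ab unfolding p\<^sub>1_def p\<^sub>2_def by (metis injD less_irrefl)
  have e: "e = (1/2) *\<^sub>R (p\<^sub>1 - p\<^sub>2)" and c: "c = (1/2) *\<^sub>R (p\<^sub>1 + p\<^sub>2)" by (simp_all add: e_def c_def p\<^sub>1_def p\<^sub>2_def)
  have sq: "inner p\<^sub>1 p\<^sub>1 = R\<^sup>2" "inner p\<^sub>2 p\<^sub>2 = R\<^sup>2" using nn by (simp_all add: dot_square_norm)
  define c\<^sub>0 where "c\<^sub>0 = (R\<^sup>2 - inner p\<^sub>1 p\<^sub>2) / 2"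
  have c0e: "inner p\<^sub>1 e = c\<^sub>0" "inner p\<^sub>2 (- e) = c\<^sub>0"
    unfolding e c\<^sub>0_def using sq by (simp_all add: inner_diff_right inner_commute field_simps)
  have c0: "c\<^sub>0 > 0"
  proof -
    have "inner (p\<^sub>1 - p\<^sub>2) (p\<^sub>1 - p\<^sub>2) > 0" using neq by simp
    moreover have "inner (p\<^sub>1 - p\<^sub>2) (p\<^sub>1 - p\<^sub>2) = 4 * c\<^sub>0"
      using sq by (simp add: inner_diff_left inner_diff_right inner_commute c\<^sub>0_def)
    ultimately show ?thesis by simp
  qed
  have e0: "e \<noteq> 0" using c0 c0e by auto
  have dn: "((\<lambda>t. inner (\<Gamma> t) (\<Gamma> t)) has_real_derivative 2 * inner (\<Gamma> t) (\<Gamma>' t)) (at t)" for t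
  proof -
    have "((\<lambda>t. inner (\<Gamma> t) (\<Gamma> t)) has_vector_derivative (inner (\<Gamma> t) (\<Gamma>' t) + inner (\<Gamma>' t) (\<Gamma> t))) (at t)"
      by (rule bounded_bilinear.has_vector_derivative[OF bounded_bilinear_inner \<Gamma>(1) \<Gamma>(1)])
    then show ?thesis unfolding has_real_derivative_iff_has_vector_derivative by (simp add: inner_commute)
  qed
  have n2: "inner (\<Gamma> t) (\<Gamma> t) \<le> R\<^sup>2" if "t \<in> {b..a}" for t
    using R(1)[OF that] by (simp add: dot_square_norm power_mono)
  \<comment> \<open>The arc stays in the ball up to its end point on the sphere, so its velocity
    there cannot point inwards.\<close>
  have v1: "inner p\<^sub>1 v\<^sub>1 \<ge> 0"
  proof (rule ccontr)
    assume "\<not> ?thesis"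
    then have "2 * inner (\<Gamma> a) (\<Gamma>' a) < 0" by (simp add: p\<^sub>1_def v\<^sub>1_def)
    from DERIV_neg_dec_left[OF dn this] obtain d where d: "d > 0"
      "\<And>h. h > 0 \<Longrightarrow> h < d \<Longrightarrow> inner (\<Gamma> a) (\<Gamma> a) < inner (\<Gamma> (a - h)) (\<Gamma> (a - h))" by blast
    define h where "h = min (d/2) (a - b)"
    have "h > 0" "h < d" "a - h \<in> {b..a}" using d(1) ab by (auto simp: h_def)
    from d(2)[OF this(1,2)] n2[OF this(3)] show False using sq(1) by (simp add: p\<^sub>1_def)
  qed
  have v2: "inner p\<^sub>2 v\<^sub>2 \<ge> 0"
  proof (rule ccontr)
    assume "\<not> ?thesis"
    then have "2 * inner (\<Gamma> b) (\<Gamma>' b) > 0" by (simp add: p\<^sub>2_def v\<^sub>2_def)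
    from DERIV_pos_inc_right[OF dn this] obtain d where d: "d > 0"
      "\<And>h. h > 0 \<Longrightarrow> h < d \<Longrightarrow> inner (\<Gamma> b) (\<Gamma> b) < inner (\<Gamma> (b + h)) (\<Gamma> (b + h))" by blast
    define h where "h = min (d/2) (a - b)"
    have "h > 0" "h < d" "b + h \<in> {b..a}" using d(1) ab by (auto simp: h_def)
    from d(2)[OF this(1,2)] n2[OF this(3)] show False using sq(2) by (simp add: p\<^sub>2_def)
  qed
  \<comment> \<open>\<open>X\<close> dominates all inner products that have to be small against
    \<open>c\<^sub>0\<close> after multiplication by \<epsilon>. The steep slope \<mu> makes
    \<epsilon> = k / \<mu> small enough while the end speed \<epsilon> \<mu> stays k.\<close>
  define X where "X = 4 * inner p\<^sub>1 v\<^sub>1 + 4 * inner p\<^sub>2 v\<^sub>2 + \<bar>inner p\<^sub>2 v\<^sub>1\<bar>"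
  define \<mu> where "\<mu> = 1 + (a - b) * X / c\<^sub>0"
  have X: "4 * inner p\<^sub>1 v\<^sub>1 \<le> X" "4 * inner p\<^sub>2 v\<^sub>2 \<le> X" "\<bar>inner p\<^sub>2 v\<^sub>1\<bar> \<le> X" "X \<ge> 0" using v1 v2 by (auto simp: X_def)
  have \<mu>: "\<mu> \<ge> 1" using X(4) ab c0 by (simp add: \<mu>_def)
  \<comment> \<open>The time at which the arc ends: the constant in
    \<open>end_parameter_square\<close> then turns \<sigma>(t - T)^2 into t - 1.\<close>
  define T where "T = 1 - 1 / (4 * \<mu>\<^sup>2)"
  have "\<mu>\<^sup>2 \<ge> 1" using \<mu> by (simp add: one_le_power)
  then have "1 / (4 * \<mu>\<^sup>2) \<le> 1 / 4" "1 / (4 * \<mu>\<^sup>2) > 0" using \<mu> by (simp_all add: divide_le_eq zero_less_divide_iff)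
  then have T: "T \<ge> 3/4" "T < 1" by (simp_all add: T_def)
  \<comment> \<open>The speed with which t from - \<open>T\<close> to \<open>T\<close> traverses the
    interval from \<open>b\<close> to \<open>a\<close>.\<close>
  define k where "k = (a - b) / (2 * T)"
  define m where "m = (a + b) / 2"
  have k: "k > 0" "k \<le> a - b" "k * T = (a - b) / 2"
  proof -
    show "k > 0" "k * T = (a - b) / 2" using ab T by (auto simp: k_def)
    have "(a - b) * 1 \<le> (a - b) * (2 * T)" using ab T by (intro mult_left_mono) auto
    then show "k \<le> a - b" unfolding k_def using T by (simp add: divide_le_eq)
  qed
  define \<epsilon> where "\<epsilon> = k / \<mu>"
  have \<epsilon>0: "\<epsilon> > 0" and \<epsilon>\<mu>: "\<epsilon> * \<mu> = k" using k \<mu> by (auto simp: \<epsilon>_def)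
  have "\<epsilon> * X \<le> c\<^sub>0"
  proof -
    have "k * X \<le> (a - b) * X" using k X by (intro mult_right_mono) auto
    also have "\<dots> \<le> c\<^sub>0 * \<mu>" using c0 by (simp add: \<mu>_def distrib_left)
    finally show ?thesis unfolding \<epsilon>_def using \<mu> by (simp add: divide_le_eq)
  qed
  then have \<epsilon>X: "\<epsilon> * x \<le> c\<^sub>0" if "x \<le> X" for x
    using mult_left_mono[OF that, of \<epsilon>] \<epsilon>0 by linarith
  have \<epsilon>1: "4 * \<epsilon> * inner p\<^sub>1 v\<^sub>1 \<le> c\<^sub>0" "4 * \<epsilon> * inner p\<^sub>2 v\<^sub>2 \<le> c\<^sub>0" "\<epsilon> * \<bar>inner p\<^sub>2 v\<^sub>1\<bar> \<le> c\<^sub>0"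
    using \<epsilon>X[OF X(1)] \<epsilon>X[OF X(2)] \<epsilon>X[OF X(3)] by (simp_all add: algebra_simps)
  obtain \<Psi> \<Psi>' where \<Psi>: "homeomorphism UNIV UNIV \<Psi> \<Psi>'" "\<And>x. norm x \<le> R \<Longrightarrow> \<Psi> x = x"
    "\<And>s. s \<ge> 0 \<Longrightarrow> \<Psi> (p\<^sub>1 + s *\<^sub>R e) = p\<^sub>1 + s *\<^sub>R e + (\<epsilon> * corner_profile s) *\<^sub>R v\<^sub>1"
    "\<And>s. s \<ge> 0 \<Longrightarrow> \<Psi> (p\<^sub>2 - s *\<^sub>R e) = p\<^sub>2 - s *\<^sub>R e + (\<epsilon> * corner_profile s) *\<^sub>R v\<^sub>2"
    using bend_ends_homeomorphism[OF nn c\<^sub>0_def c0 e v1 v2 \<epsilon>0 \<epsilon>1] by blast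
  define \<sigma> where "\<sigma> = end_parameter \<mu>"
  define \<eta> where "\<eta> p e v \<tau> = p + (\<sigma> \<tau>)\<^sup>2 *\<^sub>R e + (\<epsilon> * (\<sigma> \<tau> * (max 0 (1 - (\<sigma> \<tau>)\<^sup>2))\<^sup>2)) *\<^sub>R v" for p e v :: 'a and \<tau>
  have \<sigma>m: "\<sigma> s < \<sigma> t" if "s < t" for s t
    using end_parameter_mono[OF \<mu> that] by (simp add: \<sigma>_def)
  have \<sigma>0: "\<sigma> 0 = 0" using end_parameter_0(1)[OF \<mu>] by (simp add: \<sigma>_def)
  have \<sigma>pos: "\<sigma> t \<ge> 0" if "t \<ge> 0" for t using \<sigma>m[of 0 t] \<sigma>0 that by (cases "t = 0") auto
  have \<sigma>cp: "\<sigma> t * (max 0 (1 - (\<sigma> t)\<^sup>2))\<^sup>2 = corner_profile ((\<sigma> t)\<^sup>2)" if "t \<ge> 0" for t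
    using \<sigma>pos[OF that] by (simp add: corner_profile_def max_def)
  have vn: "v\<^sub>1 \<noteq> 0" "v\<^sub>2 \<noteq> 0" using \<Gamma>(3) by (simp_all add: v\<^sub>1_def v\<^sub>2_def)
  obtain \<eta>\<^sub>1' where \<eta>1: "\<And>\<tau>. (\<eta> p\<^sub>1 e v\<^sub>1 has_vector_derivative \<eta>\<^sub>1' \<tau>) (at \<tau>)" "continuous_on UNIV \<eta>\<^sub>1'"
      "\<eta>\<^sub>1' 0 = (\<epsilon> * \<mu>) *\<^sub>R v\<^sub>1" "\<And>\<tau>. \<tau> \<ge> 0 \<Longrightarrow> \<eta>\<^sub>1' \<tau> \<noteq> 0"
    using bent_ray_C1[OF \<mu> _ vn(1) v1 \<epsilon>0, of e] c0 \<epsilon>1(1) unfolding c0e \<eta>_def[abs_def] \<sigma>_def by blast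
  obtain \<eta>\<^sub>2' where \<eta>2: "\<And>\<tau>. (\<eta> p\<^sub>2 (- e) v\<^sub>2 has_vector_derivative \<eta>\<^sub>2' \<tau>) (at \<tau>)" "continuous_on UNIV \<eta>\<^sub>2'"
      "\<eta>\<^sub>2' 0 = (\<epsilon> * \<mu>) *\<^sub>R v\<^sub>2" "\<And>\<tau>. \<tau> \<ge> 0 \<Longrightarrow> \<eta>\<^sub>2' \<tau> \<noteq> 0"
    using bent_ray_C1[OF \<mu> _ vn(2) v2 \<epsilon>0, of "- e"] c0 \<epsilon>1(2) unfolding c0e \<eta>_def[abs_def] \<sigma>_def by blast
  have mT: "m + k * T = a" "m + k * - T = b" using k(3) by (simp_all add: m_def field_simps)
  define \<zeta> where "\<zeta> t = (if t \<le> T then \<Gamma> (m + k * t) else \<eta> p\<^sub>1 e v\<^sub>1 (t - T))" for t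
  define \<zeta>' where "\<zeta>' t = (if t \<le> T then k *\<^sub>R \<Gamma>' (m + k * t) else \<eta>\<^sub>1' (t - T))" for t
  define \<gamma> where "\<gamma> t = (if t \<le> - T then \<eta> p\<^sub>2 (- e) v\<^sub>2 (- t - T) else \<zeta> t)" for t
  define \<gamma>' where "\<gamma>' t = (if t \<le> - T then - \<eta>\<^sub>2' (- t - T) else \<zeta>' t)" for t
  have ch: "((\<lambda>t. f (l + x * t)) has_vector_derivative x *\<^sub>R f') (at t)"
    if "(f has_vector_derivative f') (at (l + x * t))" for f :: "real \<Rightarrow> 'a" and f' l x t
  proof -
    have "((\<lambda>t. l + x * t) has_vector_derivative x) (at t)"
      unfolding has_real_derivative_iff_has_vector_derivative[symmetric] by (auto intro!: derivative_eq_intros)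
    from vector_diff_chain_at[OF this that] show ?thesis by (simp add: o_def)
  qed
  have cc: "continuous_on S (\<lambda>t. f (l + x * t))" if "continuous_on UNIV f" for f :: "real \<Rightarrow> 'a" and l x S
    by (rule continuous_on_compose2[OF that]) (intro continuous_intros, simp)
  have \<zeta>d: "(\<zeta> has_vector_derivative \<zeta>' t) (at t)" for t
    unfolding \<zeta>_def[abs_def] \<zeta>'_def
  proof (rule has_vector_derivative_glue)
    show "((\<lambda>t. \<Gamma> (m + k * t)) has_vector_derivative k *\<^sub>R \<Gamma>' (m + k * t)) (at t)" for t by (rule ch[OF \<Gamma>(1)])
    show "((\<lambda>t. \<eta> p\<^sub>1 e v\<^sub>1 (t - T)) has_vector_derivative \<eta>\<^sub>1' (t - T)) (at t)" for t
      using ch[OF \<eta>1(1), of "- T" 1 t] by simp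
    show "\<Gamma> (m + k * T) = \<eta> p\<^sub>1 e v\<^sub>1 (T - T)" unfolding mT by (simp add: \<eta>_def \<sigma>0 p\<^sub>1_def)
    show "k *\<^sub>R \<Gamma>' (m + k * T) = \<eta>\<^sub>1' (T - T)" unfolding mT by (simp add: \<eta>1(3) \<epsilon>\<mu> v\<^sub>1_def)
  qed
  have \<zeta>c: "continuous_on UNIV \<zeta>'"
    unfolding \<zeta>'_def[abs_def]
  proof (rule continuous_on_glue)
    show "continuous_on {..T} (\<lambda>t. k *\<^sub>R \<Gamma>' (m + k * t))" by (intro continuous_on_scaleR continuous_on_const cc \<Gamma>(2))
    show "continuous_on {T..} (\<lambda>t. \<eta>\<^sub>1' (t - T))" using cc[OF \<eta>1(2), of "{T..}" "- T" 1] by simp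
    show "k *\<^sub>R \<Gamma>' (m + k * T) = \<eta>\<^sub>1' (T - T)" unfolding mT by (simp add: \<eta>1(3) \<epsilon>\<mu> v\<^sub>1_def)
  qed
  have nt: "- t - T = - T + (- 1) * t" for t by simp
  have \<gamma>d: "(\<gamma> has_vector_derivative \<gamma>' t) (at t)" for t
    unfolding \<gamma>_def[abs_def] \<gamma>'_def
  proof (rule has_vector_derivative_glue)
    show "((\<lambda>t. \<eta> p\<^sub>2 (- e) v\<^sub>2 (- t - T)) has_vector_derivative - \<eta>\<^sub>2' (- t - T)) (at t)" for t
      unfolding nt using ch[OF \<eta>2(1), of "- T" "- 1" t] by simp
    show "\<eta> p\<^sub>2 (- e) v\<^sub>2 (- (- T) - T) = \<zeta> (- T)" using T mT by (simp add: \<eta>_def \<sigma>0 p\<^sub>2_def \<zeta>_def)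
    show "- \<eta>\<^sub>2' (- (- T) - T) = \<zeta>' (- T)" using T mT by (simp add: \<eta>2(3) \<epsilon>\<mu> v\<^sub>2_def \<zeta>'_def)
  qed (rule \<zeta>d)
  have \<gamma>c: "continuous_on UNIV \<gamma>'"
    unfolding \<gamma>'_def[abs_def]
  proof (rule continuous_on_glue)
    show "continuous_on {..- T} (\<lambda>t. - \<eta>\<^sub>2' (- t - T))"
      unfolding nt using continuous_on_minus[OF cc[OF \<eta>2(2), of "{..- T}" "- T" "- 1"]] by simp
    show "continuous_on {- T..} \<zeta>'" by (rule continuous_on_subset[OF \<zeta>c subset_UNIV])
    show "- \<eta>\<^sub>2' (- (- T) - T) = \<zeta>' (- T)" using T mT by (simp add: \<eta>2(3) \<epsilon>\<mu> v\<^sub>2_def \<zeta>'_def)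
  qed
  have \<gamma>0: "\<gamma>' t \<noteq> 0" for t
    using \<eta>2(4)[of "- t - T"] \<eta>1(4)[of "t - T"] \<Gamma>(3) k(1) by (auto simp: \<gamma>'_def \<zeta>'_def)
  \<comment> \<open>The same curve before bending, so that \<gamma> is \<Psi> composed with it.
    Injectivity and range are read off here, where the ends are straight.\<close>
  define \<delta> where "\<delta> t = (if t \<le> - T then p\<^sub>2 - (\<sigma> (- t - T))\<^sup>2 *\<^sub>R e else if t \<le> T then \<Gamma> (m + k * t)
    else p\<^sub>1 + (\<sigma> (t - T))\<^sup>2 *\<^sub>R e)" for t
  have mid: "m + k * t \<in> {b..a}" if "- T \<le> t" "t \<le> T" for t
  proof -
    have "k * - T \<le> k * t" "k * t \<le> k * T" using that k(1) by (intro mult_left_mono; simp)+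
    then show ?thesis unfolding atLeastAtMost_iff using mT by linarith
  qed
  have \<gamma>\<delta>: "\<gamma> t = \<Psi> (\<delta> t)" for t
  proof -
    consider "t \<le> - T" | "- T < t" "t \<le> T" | "T < t" "\<not> t \<le> - T" using T by linarith
    then show ?thesis
    proof cases
      case 1
      then show ?thesis using \<Psi>(4)[of "(\<sigma> (- t - T))\<^sup>2"] \<sigma>cp[of "- t - T"] by (simp add: \<gamma>_def \<delta>_def \<eta>_def)
    next
      case 2
      then show ?thesis using \<Psi>(2)[OF R(1)[OF mid[of t]]] by (simp add: \<gamma>_def \<delta>_def \<zeta>_def)
    next
      case 3
      then show ?thesis using \<Psi>(3)[of "(\<sigma> (t - T))\<^sup>2"] \<sigma>cp[of "t - T"] by (simp add: \<gamma>_def \<zeta>_def \<delta>_def \<eta>_def)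
    qed
  qed
  \<comment> \<open>Beyond the end points the straight rays lie outside the ball, since their inner
    product with the end point exceeds R^2; so they cannot meet the arc.\<close>
  have nl: "norm (p + s *\<^sub>R u) > R" if "s > 0" "inner p u = c\<^sub>0" "norm p = R" for p s u
  proof (rule ccontr)
    assume n: "\<not> ?thesis"
    have "R \<ge> 0" using that(3) by auto
    have "inner p (p + s *\<^sub>R u) = R\<^sup>2 + s * c\<^sub>0" using that by (simp add: inner_add_right dot_square_norm)
    moreover have "s * c\<^sub>0 > 0" using that(1) c0 by simp
    moreover have "norm p * norm (p + s *\<^sub>R u) \<le> R\<^sup>2"
      unfolding that(3) power2_eq_square using n \<open>R \<ge> 0\<close> by (intro mult_left_mono) auto
    ultimately show False using norm_cauchy_schwarz[of p "p + s *\<^sub>R u"] by linarith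
  qed
  have nl1: "norm (\<delta> t) > R" if "t > T" for t
    using nl[of "(\<sigma> (t - T))\<^sup>2", OF _ c0e(1) nn(1)] \<sigma>m[of 0 "t - T"] \<sigma>0 that T by (simp add: \<delta>_def)
  have nl2: "norm (\<delta> t) > R" if "t < - T" for t
    using nl[of "(\<sigma> (- t - T))\<^sup>2", OF _ c0e(2) nn(2)] \<sigma>m[of 0 "- t - T"] \<sigma>0 that T by (simp add: \<delta>_def)
  have \<delta>m: "\<delta> t = \<Gamma> (m + k * t)" if "- T \<le> t" "t \<le> T" for t
    using that T mT by (cases "t = - T") (auto simp: \<delta>_def \<sigma>0 p\<^sub>2_def)
  have nlm: "norm (\<delta> t) \<le> R" if "- T \<le> t" "t \<le> T" for t
    unfolding \<delta>m[OF that] by (rule R(1)[OF mid[OF that]])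
  have \<sigma>eq: "s = t" if "(\<sigma> s)\<^sup>2 *\<^sub>R e = (\<sigma> t)\<^sup>2 *\<^sub>R e" "s \<ge> 0" "t \<ge> 0" for s t
  proof -
    have "(\<sigma> s)\<^sup>2 = (\<sigma> t)\<^sup>2" using that(1) e0 by simp
    then have "\<sigma> s = \<sigma> t" using \<sigma>pos that by simp
    then show ?thesis using \<sigma>m[of s t] \<sigma>m[of t s] by (cases s t rule: linorder_cases) auto
  qed
  have inj: "inj \<delta>"
  proof (rule linorder_injI)
    fix s t :: real assume st: "s < t"
    consider "s < - T" "t < - T" | "s < - T" "- T \<le> t" "t \<le> T" | "s < - T" "t > T"
      | "- T \<le> s" "s \<le> T" "- T \<le> t" "t \<le> T" | "- T \<le> s" "s \<le> T" "t > T" | "s > T" "t > T" using st by linarith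
    then show "\<delta> s \<noteq> \<delta> t"
    proof cases
      case 1
      then show ?thesis using \<sigma>eq[of "- s - T" "- t - T"] st by (auto simp: \<delta>_def)
    next
      case 2
      then show ?thesis using nl2[of s] nlm[of t] by auto
    next
      case 3
      show ?thesis
      proof
        assume "\<delta> s = \<delta> t"
        \<comment> \<open>The end points differ by 2 e and the rays run in opposite directions, so
          coincidence would make a positive multiple of \<open>e\<close> vanish.\<close>
        then have "p\<^sub>1 - p\<^sub>2 + ((\<sigma> (t - T))\<^sup>2 + (\<sigma> (- s - T))\<^sup>2) *\<^sub>R e = 0" using 3 T by (simp add: \<delta>_def algebra_simps)
        moreover have "p\<^sub>1 - p\<^sub>2 = 2 *\<^sub>R e" by (simp add: e)
        ultimately have "(2 + ((\<sigma> (t - T))\<^sup>2 + (\<sigma> (- s - T))\<^sup>2)) *\<^sub>R e = 0" by (simp only: scaleR_add_left)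
        moreover have "2 + ((\<sigma> (t - T))\<^sup>2 + (\<sigma> (- s - T))\<^sup>2) > 0" by (simp add: add_pos_nonneg)
        ultimately show False using e0 by simp
      qed
    next
      case 4
      then have "m + k * s \<noteq> m + k * t" using st k(1) by simp
      then show ?thesis unfolding \<delta>m[OF 4(1,2)] \<delta>m[OF 4(3,4)] using \<Gamma>(4) by (metis injD)
    next
      case 5
      then show ?thesis using nl1[of t] nlm[of s] by auto
    next
      case 6
      then show ?thesis using \<sigma>eq[of "s - T" "t - T"] st T by (auto simp: \<delta>_def)
    qed
  qed
  have "inj \<Psi>" by (rule inj_on_inverseI[of UNIV \<Psi>']) (use homeomorphism_apply1[OF \<Psi>(1)] in auto)
  then have "inj \<gamma>" using inj unfolding \<gamma>\<delta>[abs_def] by (simp add: inj_def)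
  have onto: "\<exists>t\<ge>0. (\<sigma> t)\<^sup>2 = s" if "s \<ge> 0" for s
    using end_parameter_onto[OF \<mu>, of "sqrt s"] that unfolding \<sigma>_def by auto
  have rd: "range \<delta> = \<Gamma> ` {b..a} \<union> {\<Gamma> a + s *\<^sub>R e | s. s \<ge> 0} \<union> {\<Gamma> b - s *\<^sub>R e | s. s \<ge> 0}" (is "_ = ?M \<union> ?A \<union> ?B")
  proof (intro equalityI subsetI)
    fix x assume "x \<in> range \<delta>"
    then obtain t where t: "x = \<delta> t" by blast
    consider "t \<le> - T" | "- T \<le> t" "t \<le> T" | "T < t" by linarith
    then show "x \<in> ?M \<union> ?A \<union> ?B"
    proof cases
      case 1
      then have "x = \<Gamma> b - (\<sigma> (- t - T))\<^sup>2 *\<^sub>R e" "(\<sigma> (- t - T))\<^sup>2 \<ge> 0" by (simp_all add: t \<delta>_def p\<^sub>2_def)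
      then show ?thesis by blast
    next
      case 2
      then show ?thesis using mid[OF 2] unfolding t \<delta>m[OF 2] by blast
    next
      case 3
      then have "x = \<Gamma> a + (\<sigma> (t - T))\<^sup>2 *\<^sub>R e" "(\<sigma> (t - T))\<^sup>2 \<ge> 0" using T by (simp_all add: t \<delta>_def p\<^sub>1_def)
      then show ?thesis by blast
    qed
  next
    fix x assume "x \<in> ?M \<union> ?A \<union> ?B"
    then consider u where "u \<in> {b..a}" "x = \<Gamma> u" | s where "s \<ge> 0" "x = \<Gamma> a + s *\<^sub>R e"
      | s where "s \<ge> 0" "x = \<Gamma> b - s *\<^sub>R e" by blast
    then show "x \<in> range \<delta>"
    proof cases
      case (1 u)
      define t where "t = (u - m) / k"
      have "u = m + k * t" using k(1) by (simp add: t_def)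
      moreover have "- T \<le> t" "t \<le> T"
        using 1(1) k mT by (auto simp: t_def le_divide_eq divide_le_eq algebra_simps)
      ultimately show ?thesis unfolding 1(2) using \<delta>m[of t] by (metis rangeI)
    next
      case (2 s)
      obtain t where t: "t \<ge> 0" "(\<sigma> t)\<^sup>2 = s" using onto[OF 2(1)] by blast
      have "\<delta> (t + T) = x"
      proof (cases "t = 0")
        case True
        then show ?thesis using \<delta>m[of T] T t mT 2(2) \<sigma>0 by simp
      next
        case False
        then show ?thesis using T t 2(2) by (simp add: \<delta>_def p\<^sub>1_def)
      qed
      then show ?thesis by blast
    next
      case (3 s)
      obtain t where t: "t \<ge> 0" "(\<sigma> t)\<^sup>2 = s" using onto[OF 3(1)] by blast
      then have "\<delta> (- t - T) = x" using 3(2) by (simp add: \<delta>_def p\<^sub>2_def)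
      then show ?thesis by blast
    qed
  qed
  have "range \<gamma> = \<Psi> ` range \<delta>" unfolding \<gamma>\<delta>[abs_def] by blast
  moreover have "\<gamma> t = c + t *\<^sub>R e" if t: "\<bar>t\<bar> \<ge> 3" for t
  proof -
    have far: "\<eta> p u v (\<bar>t\<bar> - T) = p + (\<bar>t\<bar> - 1) *\<^sub>R u" for p u v
    proof -
      have g: "\<bar>t\<bar> - T \<ge> 1 / 2" using t T by linarith
      have "(\<sigma> (\<bar>t\<bar> - T))\<^sup>2 = \<bar>t\<bar> - 1"
        unfolding \<sigma>_def end_parameter_square[OF \<mu> g] by (simp add: T_def)
      moreover have "max 0 (1 - (\<bar>t\<bar> - 1)) = 0" using t by (simp add: max_def)
      ultimately show ?thesis by (simp add: \<eta>_def)
    qed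
    have pc: "p\<^sub>1 = c + e" "p\<^sub>2 = c - e" by (simp_all add: c e scaleR_add_right scaleR_diff_right algebra_simps flip: scaleR_add_left)
    show ?thesis
    proof (cases "t \<ge> 0")
      case True
      then have "\<gamma> t = \<eta> p\<^sub>1 e v\<^sub>1 (\<bar>t\<bar> - T)" using t T by (simp add: \<gamma>_def \<zeta>_def)
      then show ?thesis unfolding far pc using True by (simp add: algebra_simps)
    next
      case False
      then have "\<gamma> t = \<eta> p\<^sub>2 (- e) v\<^sub>2 (\<bar>t\<bar> - T)" using t T by (simp add: \<gamma>_def)
      then show ?thesis unfolding far pc using False by (simp add: algebra_simps)
    qed
  qed
  ultimately show ?thesis
    using \<Psi>(1) \<open>inj \<gamma>\<close> \<gamma>d \<gamma>c \<gamma>0 unfolding rd by (intro exI[of _ \<Psi>] exI[of _ \<Psi>'] exI[of _ \<gamma>] exI[of _ \<gamma>'] conjI allI impI)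
qed

section \<open>Algebraic curves near a straightened curve\<close>

text \<open>A rank-one perturbation of the identity, x + <u, x> (y - e). It sends \<open>e\<close>
  to \<open>y\<close> when <u, e> = 1 and is invertible when <u, y> is nonzero; the case split finds
  such a u.\<close>

lemma linear_bijection_moving:
  fixes e y :: "'a::real_inner"
  assumes "e \<noteq> 0" "y \<noteq> 0"
  shows "\<exists>L L'. bounded_linear L \<and> bounded_linear L' \<and> (\<forall>x. L' (L x) = x) \<and> (\<forall>x. L (L' x) = x) \<and> L e = y"
proof -
  obtain u where u: "inner u e = 1" "inner u y \<noteq> 0"
  proof (cases "inner e y = 0")
    case True
    show ?thesis
    proof
      show "inner (inverse (inner e e) *\<^sub>R e + y) e = 1" "inner (inverse (inner e e) *\<^sub>R e + y) y \<noteq> 0"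
        using True assms by (simp_all add: inner_add_left inner_commute[of y e])
    qed
  next
    case False
    show ?thesis
    proof
      show "inner (inverse (inner e e) *\<^sub>R e) e = 1" "inner (inverse (inner e e) *\<^sub>R e) y \<noteq> 0"
        using False assms by simp_all
    qed
  qed
  define L where "L x = x + inner u x *\<^sub>R (y - e)" for x
  define L' where "L' x = x - (inner u x / inner u y) *\<^sub>R (y - e)" for x
  have bl: "bounded_linear (\<lambda>x. inner u x *\<^sub>R z)" for z :: 'a
    by (rule bounded_linear_scaleR_left[THEN bounded_linear_compose, OF bounded_linear_inner_right])
  have "bounded_linear L" unfolding L_def[abs_def] by (intro bounded_linear_add bounded_linear_ident bl)
  moreover have "bounded_linear (\<lambda>x. x - inner u x *\<^sub>R (inverse (inner u y) *\<^sub>R (y - e)))"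
    by (intro bounded_linear_sub bounded_linear_ident bl)
  then have "bounded_linear L'" unfolding L'_def[abs_def] by (simp add: divide_inverse)
  moreover have "inner u (L x) = inner u x * inner u y" for x
    using u by (simp add: L_def inner_add_right inner_diff_right algebra_simps)
  then have "L' (L x) = x" for x using u by (simp add: L'_def) (simp add: L_def)
  moreover have "inner u (L' x) = inner u x / inner u y" for x
  proof -
    have "inner u (L' x) = inner u x - (inner u x / inner u y) * (inner u y - 1)"
      by (simp add: L'_def inner_diff_right u(1))
    then show ?thesis using u(2) by (simp add: right_diff_distrib)
  qed
  then have "L (L' x) = x" for x by (simp add: L_def) (simp add: L'_def)
  moreover have "L e = y" using u by (simp add: L_def)
  ultimately show ?thesis by blast
qed

lemma eventually_linear_deviation:
  fixes \<beta> :: "real \<Rightarrow> 'a::real_normed_vector"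
  assumes c\<beta>: "continuous_on UNIV \<beta>" and line: "\<And>t. \<bar>t\<bar> \<ge> T \<Longrightarrow> \<beta> t = t *\<^sub>R e"
  shows "\<exists>M>0. \<forall>t. norm (\<beta> t - t *\<^sub>R e) \<le> M"
proof -
  have "compact ((\<lambda>t. \<beta> t - t *\<^sub>R e) ` {- \<bar>T\<bar>..\<bar>T\<bar>})"
    by (intro compact_continuous_image continuous_on_diff continuous_on_subset[OF c\<beta> subset_UNIV] continuous_on_scaleR continuous_on_const continuous_on_id compact_Icc)
  then have "bounded ((\<lambda>t. \<beta> t - t *\<^sub>R e) ` {- \<bar>T\<bar>..\<bar>T\<bar>})" by (rule compact_imp_bounded)
  then obtain M where M: "M > 0" "\<And>t. t \<in> {- \<bar>T\<bar>..\<bar>T\<bar>} \<Longrightarrow> norm (\<beta> t - t *\<^sub>R e) \<le> M"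
    unfolding bounded_pos by blast
  have "norm (\<beta> t - t *\<^sub>R e) \<le> M" for t
  proof (cases "t \<in> {- \<bar>T\<bar>..\<bar>T\<bar>}")
    case False
    then show ?thesis using line[of t] M(1) by (auto simp: abs_real_def split: if_splits)
  qed (rule M(2))
  then show ?thesis using M(1) by blast
qed

text \<open>Far apart parameters are controlled by the bounded deviation from the line, close ones
  outside a compact interval by exact linearity, very close ones inside it by uniform continuity of
  the velocity, and the remaining compact set of pairs by injectivity.\<close>

lemma C1_embedding_lower_bound:
  fixes \<beta> :: "real \<Rightarrow> 'a::real_normed_vector"
  assumes \<beta>: "\<And>t. (\<beta> has_vector_derivative \<beta>' t) (at t)" "continuous_on UNIV \<beta>'" "\<And>t. \<beta>' t \<noteq> 0" "inj \<beta>"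
    and line: "\<And>t. \<bar>t\<bar> \<ge> T \<Longrightarrow> \<beta> t = t *\<^sub>R e" and e: "norm e = 1"
  shows "\<exists>\<kappa>>0. \<forall>s t. norm (\<beta> s - \<beta> t) \<ge> \<kappa> * \<bar>s - t\<bar>"
proof -
  have c\<beta>: "continuous_on S \<beta>" for S
    by (rule continuous_on_vector_derivative) (rule has_vector_derivative_at_within[OF \<beta>(1)])
  obtain M where M: "M > 0" and M': "\<And>t. norm (\<beta> t - t *\<^sub>R e) \<le> M"
    using eventually_linear_deviation[OF c\<beta> line] by blast
  have far: "norm (\<beta> s - \<beta> t) \<ge> (1/2) * \<bar>s - t\<bar>" if "\<bar>s - t\<bar> \<ge> 4 * M" for s t
  proof -
    have "\<bar>s - t\<bar> = norm ((s - t) *\<^sub>R e)" using e by simp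
    also have "(s - t) *\<^sub>R e = (\<beta> s - \<beta> t) - ((\<beta> s - s *\<^sub>R e) - (\<beta> t - t *\<^sub>R e))" by (simp add: algebra_simps)
    finally have "\<bar>s - t\<bar> \<le> norm (\<beta> s - \<beta> t) + norm ((\<beta> s - s *\<^sub>R e) - (\<beta> t - t *\<^sub>R e))"
      using norm_triangle_ineq4 by metis
    moreover have "norm ((\<beta> s - s *\<^sub>R e) - (\<beta> t - t *\<^sub>R e)) \<le> M + M"
      using norm_triangle_ineq4[of "\<beta> s - s *\<^sub>R e" "\<beta> t - t *\<^sub>R e"] M'[of s] M'[of t] by linarith
    moreover have "(1/2) * D \<le> n" if "D \<le> n + w" "w \<le> M + M" "4 * M \<le> D" for D n w :: real
      using that by linarith
    ultimately show ?thesis using that by metis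
  qed
  \<comment> \<open>If two parameters differ by less than 4 M and one leaves [-N, N], both have
    absolute value at least \<open>T\<close>.\<close>
  define N where "N = \<bar>T\<bar> + 4 * M"
  have Np: "N > 0" using M by (simp add: N_def add_nonneg_pos)
  have out: "norm (\<beta> s - \<beta> t) = \<bar>s - t\<bar>" if "\<bar>s - t\<bar> < 4 * M" "\<not> (\<bar>s\<bar> \<le> N \<and> \<bar>t\<bar> \<le> N)" for s t
  proof -
    have "T \<le> \<bar>s\<bar>" "T \<le> \<bar>t\<bar>" using that unfolding N_def by linarith+
    then have "\<beta> s - \<beta> t = (s - t) *\<^sub>R e" by (simp add: line algebra_simps)
    then show ?thesis using e by simp
  qed
  have "\<exists>x\<in>{- N..N}. \<forall>y\<in>{- N..N}. norm (\<beta>' x) \<le> norm (\<beta>' y)"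
    using Np by (intro continuous_attains_inf continuous_on_norm continuous_on_subset[OF \<beta>(2)]) auto
  then obtain x0 where x0: "\<And>y. y \<in> {- N..N} \<Longrightarrow> norm (\<beta>' x0) \<le> norm (\<beta>' y)" by blast
  define m where "m = norm (\<beta>' x0)"
  have m: "m > 0" using \<beta>(3) by (simp add: m_def)
  have "uniformly_continuous_on {- N..N} \<beta>'"
    by (intro compact_uniformly_continuous continuous_on_subset[OF \<beta>(2)]) auto
  moreover have "m / 2 > 0" using m by simp
  ultimately obtain \<delta> where \<delta>: "\<delta> > 0" "\<And>x y. x \<in> {- N..N} \<Longrightarrow> y \<in> {- N..N} \<Longrightarrow> dist y x < \<delta> \<Longrightarrow> dist (\<beta>' y) (\<beta>' x) < m / 2"
    unfolding uniformly_continuous_on_def by metis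
  have near: "norm (\<beta> s - \<beta> t) \<ge> (m/2) * \<bar>s - t\<bar>" if "\<bar>s\<bar> \<le> N" "\<bar>t\<bar> \<le> N" "\<bar>s - t\<bar> < \<delta>" for s t
  proof -
    let ?S = "closed_segment t s"
    have S: "x \<in> {- N..N} \<and> \<bar>x - t\<bar> < \<delta>" if "x \<in> ?S" for x
      using that \<open>\<bar>s\<bar> \<le> N\<close> \<open>\<bar>t\<bar> \<le> N\<close> \<open>\<bar>s - t\<bar> < \<delta>\<close> unfolding closed_segment_eq_real_ivl by (auto split: if_splits)
    have "norm (\<beta> s - \<beta> t - (s - t) *\<^sub>R \<beta>' t) \<le> norm (s - t) * (m / 2)"
    proof (rule vector_differentiable_bound_linearization[where S = ?S])
      show "(\<beta> has_vector_derivative \<beta>' x) (at x within ?S)" for x by (rule has_vector_derivative_at_within[OF \<beta>(1)])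
      show "norm (\<beta>' x - \<beta>' t) \<le> m / 2" if "x \<in> ?S" for x
        using \<delta>(2)[of t x] S[OF that] S[of t] by (simp add: dist_norm)
    qed auto
    moreover have "m \<le> norm (\<beta>' t)" unfolding m_def using that(2) by (intro x0) (simp add: abs_le_iff)
    then have "norm ((s - t) *\<^sub>R \<beta>' t) \<ge> \<bar>s - t\<bar> * m" by (simp add: mult_left_mono)
    moreover have "norm ((s - t) *\<^sub>R \<beta>' t) \<le> norm (\<beta> s - \<beta> t) + norm (\<beta> s - \<beta> t - (s - t) *\<^sub>R \<beta>' t)"
      by (metis norm_triangle_sub norm_minus_commute)
    ultimately show ?thesis by (simp add: algebra_simps)
  qed
  let ?P = "{z :: real \<times> real. \<bar>fst z\<bar> \<le> N \<and> \<bar>snd z\<bar> \<le> N \<and> \<delta> \<le> \<bar>fst z - snd z\<bar>}"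
  have "\<exists>m'>0. \<forall>z\<in>?P. norm (\<beta> (fst z) - \<beta> (snd z)) \<ge> m'"
  proof (cases "?P = {}")
    case True
    then have "\<forall>z\<in>?P. norm (\<beta> (fst z) - \<beta> (snd z)) \<ge> 1" by blast
    moreover have "(0::real) < 1" by simp
    ultimately show ?thesis by (intro exI[of _ "1::real"] conjI)
  next
    case False
    have "?P = ({- N..N} \<times> {- N..N}) \<inter> {z. \<delta> \<le> \<bar>fst z - snd z\<bar>}" by auto
    moreover have "closed {z :: real \<times> real. \<delta> \<le> \<bar>fst z - snd z\<bar>}" by (intro closed_Collect_le continuous_intros)
    ultimately have cP: "compact ?P" by (simp add: compact_Times compact_Int_closed)
    have "continuous_on ?P (\<lambda>z. norm (\<beta> (fst z) - \<beta> (snd z)))"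
      by (intro continuous_on_norm continuous_on_diff continuous_on_compose2[OF c\<beta>[of UNIV]] continuous_on_fst continuous_on_snd continuous_on_id) auto
    from continuous_attains_inf[OF cP False this] obtain z where z: "z \<in> ?P"
      "\<And>y. y \<in> ?P \<Longrightarrow> norm (\<beta> (fst z) - \<beta> (snd z)) \<le> norm (\<beta> (fst y) - \<beta> (snd y))" by blast
    have "fst z \<noteq> snd z" using z(1) \<delta>(1) by auto
    then have "\<beta> (fst z) \<noteq> \<beta> (snd z)" using \<beta>(4) by (metis injD)
    then have "norm (\<beta> (fst z) - \<beta> (snd z)) > 0" by simp
    then show ?thesis using z(2) by blast
  qed
  then obtain m' where m'0: "m' > 0" "\<forall>z\<in>?P. norm (\<beta> (fst z) - \<beta> (snd z)) \<ge> m'" by blast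
  have m': "norm (\<beta> s - \<beta> t) \<ge> m'" if "\<bar>s\<bar> \<le> N" "\<bar>t\<bar> \<le> N" "\<delta> \<le> \<bar>s - t\<bar>" for s t
    using bspec[OF m'0(2), of "(s, t)"] that by simp
  define \<kappa> where "\<kappa> = min (1/2) (min (m/2) (m' / (4 * M)))"
  have k: "\<kappa> > 0" "\<kappa> \<le> 1/2" "\<kappa> \<le> m/2" "\<kappa> \<le> m' / (4 * M)" using m m'0(1) M by (auto simp: \<kappa>_def)
  have "norm (\<beta> s - \<beta> t) \<ge> \<kappa> * \<bar>s - t\<bar>" for s t
  proof -
    have mono: "\<kappa> * \<bar>s - t\<bar> \<le> x * \<bar>s - t\<bar>" if "\<kappa> \<le> x" for x using that by (intro mult_right_mono) auto
    consider "\<bar>s - t\<bar> \<ge> 4 * M" | "\<bar>s - t\<bar> < 4 * M" "\<not> (\<bar>s\<bar> \<le> N \<and> \<bar>t\<bar> \<le> N)"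
      | "\<bar>s\<bar> \<le> N" "\<bar>t\<bar> \<le> N" "\<bar>s - t\<bar> < \<delta>" | "\<bar>s\<bar> \<le> N" "\<bar>t\<bar> \<le> N" "\<bar>s - t\<bar> \<ge> \<delta>" "\<bar>s - t\<bar> < 4 * M" by linarith
    then show ?thesis
    proof cases
      case 1
      then show ?thesis using far[OF 1] mono[OF k(2)] by linarith
    next
      case 2
      then show ?thesis using out[OF 2] mono[of 1] k(2) by simp
    next
      case 3
      then show ?thesis using near[OF 3] mono[OF k(3)] by linarith
    next
      case 4
      have "m' / (4 * M) * \<bar>s - t\<bar> \<le> m' / (4 * M) * (4 * M)" using 4(4) m'0(1) M by (intro mult_left_mono) auto
      also have "\<dots> = m'" using M by simp
      finally show ?thesis using m'[OF 4(1-3)] mono[OF k(4)] by linarith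
    qed
  qed
  then show ?thesis using k(1) by blast
qed

text \<open>Moves a function of bounded support from the line to the circle by \<theta> = 2 arctan
  t. The function vanishes near infinity, so extension by 0 at odd multiples of pi is C^1.\<close>

lemma tan_half_periodic_C1:
  fixes b :: "real \<Rightarrow> real"
  assumes b: "\<And>t. (b has_real_derivative b' t) (at t)" "continuous_on UNIV b'" and supp: "\<And>t. \<bar>t\<bar> \<ge> T \<Longrightarrow> b t = 0"
  shows "\<exists>f f'. (\<forall>\<theta>. (f has_real_derivative f' \<theta>) (at \<theta>)) \<and> continuous_on UNIV f' \<and> (\<forall>\<theta>. f (\<theta> + 2 * pi) = f \<theta>) \<and>
    (\<forall>t. f (2 * arctan t) = b t)"
proof -
  define f where "f \<theta> = (if cos (\<theta> / 2) = 0 then 0 else b (tan (\<theta> / 2)))" for \<theta>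
  define f' where "f' \<theta> = (if cos (\<theta> / 2) = 0 then 0 else b' (tan (\<theta> / 2)) * (inverse ((cos (\<theta> / 2))\<^sup>2) * (1 / 2)))" for \<theta>
  let ?W = "{\<theta>::real. cos (\<theta> / 2) \<noteq> 0}"
  \<comment> \<open>The condition |tan(\<theta>/2)| > max 0 T without division: an open set that
    contains the zeros of the cosine, on which the transported function is 0.\<close>
  let ?U = "{\<theta>::real. max 0 T * \<bar>cos (\<theta> / 2)\<bar> < \<bar>sin (\<theta> / 2)\<bar>}"
  have oW: "open ?W" by (intro open_Collect_neq continuous_intros) auto
  have oU: "open ?U" by (intro open_Collect_less continuous_intros) auto
  have cov: "?W \<union> ?U = UNIV"
  proof -
    have "\<theta> \<in> ?U" if "cos (\<theta> / 2) = 0" for \<theta>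
      using that sin_cos_squared_add[of "\<theta>/2"] by auto
    then show ?thesis by blast
  qed
  have b'0: "b' t = 0" if "\<bar>t\<bar> > T" for t
  proof -
    have "((\<lambda>t. 0) has_real_derivative b' t) (at t)"
    proof (rule has_field_derivative_transform_within_open[OF b(1)])
      show "open {t. T < \<bar>t\<bar>}" by (intro open_Collect_less continuous_intros)
    qed (use that supp in auto)
    then show ?thesis by (metis DERIV_const DERIV_unique)
  qed
  have U0: "f \<theta> = 0 \<and> f' \<theta> = 0" if "\<theta> \<in> ?U" for \<theta>
  proof (cases "cos (\<theta> / 2) = 0")
    case False
    then have "max 0 T < \<bar>tan (\<theta> / 2)\<bar>" using that by (simp add: tan_def less_divide_eq)
    then have "T < \<bar>tan (\<theta> / 2)\<bar>" by simp
    then show ?thesis using supp b'0 by (simp add: f_def f'_def)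
  qed (simp add: f_def f'_def)
  have d: "(f has_real_derivative f' \<theta>) (at \<theta>)" for \<theta>
  proof (cases "\<theta> \<in> ?U")
    case True
    have "((\<lambda>_. 0) has_real_derivative 0) (at \<theta>)" by simp
    then have "(f has_real_derivative 0) (at \<theta>)"
      by (rule has_field_derivative_transform_within_open[OF _ oU True]) (use U0 in auto)
    then show ?thesis using U0[OF True] by simp
  next
    case False
    then have W: "\<theta> \<in> ?W" using cov by blast
    have "((\<lambda>\<theta>. tan (\<theta> / 2)) has_real_derivative inverse ((cos (\<theta> / 2))\<^sup>2) * (1 / 2)) (at \<theta>)"
      by (rule DERIV_chain2[OF DERIV_tan]) (use W in \<open>auto intro!: derivative_eq_intros\<close>)
    from DERIV_chain2[OF b(1) this]
    have "(f has_real_derivative b' (tan (\<theta> / 2)) * (inverse ((cos (\<theta> / 2))\<^sup>2) * (1 / 2))) (at \<theta>)"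
      by (rule has_field_derivative_transform_within_open[OF _ oW W]) (auto simp: f_def)
    then show ?thesis using W by (simp add: f'_def)
  qed
  have cW: "continuous_on ?W f'"
  proof (rule continuous_on_eq)
    show "continuous_on ?W (\<lambda>\<theta>. b' (tan (\<theta> / 2)) * (inverse ((cos (\<theta> / 2))\<^sup>2) * (1 / 2)))"
      by (intro continuous_on_mult continuous_on_compose2[OF b(2)] continuous_intros) auto
  qed (auto simp: f'_def)
  have cU: "continuous_on ?U f'"
    by (rule continuous_on_eq[of _ "\<lambda>_. 0"]) (use U0 in auto)
  have "continuous_on UNIV f'" unfolding cov[symmetric] by (rule continuous_on_open_Un[OF oW oU cW cU])
  moreover have "f (\<theta> + 2 * pi) = f \<theta>" for \<theta>
  proof -
    have "cos ((\<theta> + 2 * pi) / 2) = - cos (\<theta> / 2)" "sin ((\<theta> + 2 * pi) / 2) = - sin (\<theta> / 2)"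
      by (simp_all add: add_divide_distrib)
    then show ?thesis unfolding f_def tan_def by simp
  qed
  moreover have "f (2 * arctan t) = b t" for t by (simp add: f_def tan_arctan)
  ultimately show ?thesis using d by blast
qed

lemma Ck_arctan: "Ck k UNIV arctan"
proof (cases k)
  case 0
  then show ?thesis by (simp add: continuous_on_arctan)
next
  case (Suc j)
  have "Ck j UNIV (\<lambda>x::real. inverse (1 + x\<^sup>2))"
    by (intro Ck_inverse Ck_add Ck_const Ck_power Ck_id open_UNIV) (metis add_cancel_left_right power_one zero_eq_power2 sum_power2_eq_zero_iff zero_neq_one)
  then show ?thesis unfolding Suc
    by (intro Ck_real_SucI[where f' = "\<lambda>x. inverse (1 + x\<^sup>2)"] open_UNIV)
      (auto intro: DERIV_arctan simp: has_real_derivative_iff_has_vector_derivative[symmetric])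
qed

lemma punctured_circle_arctan: "circle_dom 1 = range (\<lambda>t. cis (2 * arctan t))"
proof (intro equalityI subsetI)
  fix u assume "u \<in> circle_dom 1"
  then have u: "cmod u = 1" "u \<noteq> -1" by (auto simp: circle_dom_def)
  have c: "cis (Arg u) = u" using u(1) cis_Arg_unit by auto
  have A: "- pi < Arg u" "Arg u \<le> pi" using Arg_bounded by auto
  have "Arg u \<noteq> pi" using c u(2) by auto
  then have "arctan (tan (Arg u / 2)) = Arg u / 2" using A by (intro arctan_tan) auto
  then have "2 * arctan (tan (Arg u / 2)) = Arg u" by simp
  then have "u = cis (2 * arctan (tan (Arg u / 2)))" using c by simp
  then show "u \<in> range (\<lambda>t. cis (2 * arctan t))" by blast
next
  fix u assume "u \<in> range (\<lambda>t. cis (2 * arctan t))"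
  then obtain t where t: "u = cis (2 * arctan t)" by blast
  have "cos (2 * arctan t) \<noteq> -1"
  proof
    assume "cos (2 * arctan t) = -1"
    then have "2 * (cos (arctan t))\<^sup>2 = 0" by (simp add: cos_double_cos)
    then show False by simp
  qed
  then have "Re u \<noteq> -1" by (simp add: t)
  then have "u \<noteq> -1" by (metis complex_Re_numeral one_complex.sel(1) uminus_complex.sel(1))
  moreover have "cmod u = 1" by (simp add: t)
  ultimately show "u \<in> circle_dom 1" by (simp add: circle_dom_def)
qed

text \<open>Subtracting t from the third coordinate leaves functions of bounded support, which are
  approximated on the circle. The subtracted t is tan(\<theta>/2) and comes back through the term of
  \<open>circle_curve\<close> with coefficient 1.\<close>

lemma straight_curve_algebraic_approximation:
  fixes \<beta> :: "real \<Rightarrow> complex \<times> real"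
  assumes \<beta>: "\<And>t. (\<beta> has_vector_derivative \<beta>' t) (at t)" "continuous_on UNIV \<beta>'"
    and line: "\<And>t. \<bar>t\<bar> \<ge> T \<Longrightarrow> \<beta> t = (0, t)" and e: "e > 0"
  shows "\<exists>\<gamma>. algebraic_in_heis (heis_param ` range \<gamma>) \<and> (\<forall>k. Ck k UNIV \<gamma>) \<and> (\<forall>t. norm (\<gamma> t - \<beta> t) \<le> e) \<and>
    (\<forall>s t. norm ((\<gamma> s - \<beta> s) - (\<gamma> t - \<beta> t)) \<le> e * \<bar>s - t\<bar>)"
proof -
  define b\<^sub>1 b\<^sub>2 b\<^sub>3 where "b\<^sub>1 t = Re (fst (\<beta> t))" and "b\<^sub>2 t = Im (fst (\<beta> t))" and "b\<^sub>3 t = snd (\<beta> t) - t" for t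
  define b\<^sub>1' b\<^sub>2' b\<^sub>3' where "b\<^sub>1' t = Re (fst (\<beta>' t))" and "b\<^sub>2' t = Im (fst (\<beta>' t))" and "b\<^sub>3' t = snd (\<beta>' t) - 1" for t
  have l1: "bounded_linear (\<lambda>x::complex\<times>real. Re (fst x))" and l2: "bounded_linear (\<lambda>x::complex\<times>real. Im (fst x))"
    by (intro bounded_linear_Re[THEN bounded_linear_compose] bounded_linear_Im[THEN bounded_linear_compose] bounded_linear_fst)+
  have d1: "(b\<^sub>1 has_real_derivative b\<^sub>1' t) (at t)" and d2: "(b\<^sub>2 has_real_derivative b\<^sub>2' t) (at t)" for t
    unfolding has_real_derivative_iff_has_vector_derivative b\<^sub>1_def[abs_def] b\<^sub>1'_def b\<^sub>2_def[abs_def] b\<^sub>2'_def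
    by (rule bounded_linear.has_vector_derivative[OF l1 \<beta>(1)], rule bounded_linear.has_vector_derivative[OF l2 \<beta>(1)])
  have "((\<lambda>t. snd (\<beta> t)) has_real_derivative snd (\<beta>' t)) (at t)" for t
    unfolding has_real_derivative_iff_has_vector_derivative
    by (rule bounded_linear.has_vector_derivative[OF bounded_linear_snd \<beta>(1)])
  from DERIV_diff[OF this DERIV_ident]
  have d3: "(b\<^sub>3 has_real_derivative b\<^sub>3' t) (at t)" for t unfolding b\<^sub>3_def[abs_def] b\<^sub>3'_def .
  have c: "continuous_on UNIV b\<^sub>1'" "continuous_on UNIV b\<^sub>2'" "continuous_on UNIV b\<^sub>3'"
    unfolding b\<^sub>1'_def[abs_def] b\<^sub>2'_def[abs_def] b\<^sub>3'_def[abs_def] by (intro continuous_intros \<beta>(2))+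
  have s: "b\<^sub>1 t = 0" "b\<^sub>2 t = 0" "b\<^sub>3 t = 0" if "\<bar>t\<bar> \<ge> T" for t
    using line[OF that] by (simp_all add: b\<^sub>1_def b\<^sub>2_def b\<^sub>3_def)
  obtain f\<^sub>1 f\<^sub>1' where f1: "\<And>t. (f\<^sub>1 has_real_derivative f\<^sub>1' t) (at t)" "continuous_on UNIV f\<^sub>1'"
    "\<And>t. f\<^sub>1 (t + 2 * pi) = f\<^sub>1 t" "\<And>t. f\<^sub>1 (2 * arctan t) = b\<^sub>1 t" using tan_half_periodic_C1[OF d1 c(1) s(1)] by blast
  obtain f\<^sub>2 f\<^sub>2' where f2: "\<And>t. (f\<^sub>2 has_real_derivative f\<^sub>2' t) (at t)" "continuous_on UNIV f\<^sub>2'"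
    "\<And>t. f\<^sub>2 (t + 2 * pi) = f\<^sub>2 t" "\<And>t. f\<^sub>2 (2 * arctan t) = b\<^sub>2 t" using tan_half_periodic_C1[OF d2 c(2) s(2)] by blast
  obtain f\<^sub>3 f\<^sub>3' where f3: "\<And>t. (f\<^sub>3 has_real_derivative f\<^sub>3' t) (at t)" "continuous_on UNIV f\<^sub>3'"
    "\<And>t. f\<^sub>3 (t + 2 * pi) = f\<^sub>3 t" "\<And>t. f\<^sub>3 (2 * arctan t) = b\<^sub>3 t" using tan_half_periodic_C1[OF d3 c(3) s(3)] by blast
  \<comment> \<open>The Lipschitz error of one coordinate is 2 \<eta>, as the angle is 2
    \<open>arctan\<close> and \<open>arctan\<close> has Lipschitz constant 1; there are three
    coordinates.\<close>
  define \<eta> where "\<eta> = e / 6"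
  have \<eta>: "\<eta> > 0" using e by (simp add: \<eta>_def)
  obtain q\<^sub>1 q\<^sub>2 q\<^sub>3 where alg: "algebraic_in_heis (heis_param ` circle_curve 1 q\<^sub>1 q\<^sub>2 q\<^sub>3 ` circle_dom 1)"
    and q1: "\<And>t. \<bar>Re (poly q\<^sub>1 (cis t)) - f\<^sub>1 t\<bar> < \<eta> \<and> \<bar>Re (\<i> * cis t * poly (pderiv q\<^sub>1) (cis t)) - f\<^sub>1' t\<bar> < \<eta>"
    and q2: "\<And>t. \<bar>Re (poly q\<^sub>2 (cis t)) - f\<^sub>2 t\<bar> < \<eta> \<and> \<bar>Re (\<i> * cis t * poly (pderiv q\<^sub>2) (cis t)) - f\<^sub>2' t\<bar> < \<eta>"
    and q3: "\<And>t. \<bar>Re (poly q\<^sub>3 (cis t)) - f\<^sub>3 t\<bar> < \<eta> \<and> \<bar>Re (\<i> * cis t * poly (pderiv q\<^sub>3) (cis t)) - f\<^sub>3' t\<bar> < \<eta>"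
    using algebraic_curve_approximation[OF f1(1) f2(1) f3(1) f1(2) f2(2) f3(2) f1(3) f2(3) f3(3) \<eta>, of 1] by blast
  define g where "g q t = Re (poly q (cis (2 * arctan t)))" for q t
  have gL: "\<bar>(g q s - b s) - (g q t - b t)\<bar> \<le> 2 * \<eta> * \<bar>s - t\<bar>"
    if f: "\<And>t. (f has_real_derivative f' t) (at t)" "\<And>t. f (2 * arctan t) = b t"
      and q: "\<And>t. \<bar>Re (poly q (cis t)) - f t\<bar> < \<eta> \<and> \<bar>Re (\<i> * cis t * poly (pderiv q) (cis t)) - f' t\<bar> < \<eta>"
    for q f f' b s t
  proof -
    have "norm ((Re (poly q (cis x)) - f x) - (Re (poly q (cis y)) - f y)) \<le> \<eta> * norm (x - y)" for x y
    proof (rule field_differentiable_bound[where S = UNIV])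
      show "((\<lambda>x. Re (poly q (cis x)) - f x) has_field_derivative (Re (\<i> * cis z * poly (pderiv q) (cis z)) - f' z)) (at z within UNIV)" for z
        by (intro DERIV_diff Re_poly_cis_derivative f(1))
      show "norm (Re (\<i> * cis z * poly (pderiv q) (cis z)) - f' z) \<le> \<eta>" for z using q[of z] by simp
    qed auto
    from this[of "2 * arctan s" "2 * arctan t"]
    have "\<bar>(g q s - b s) - (g q t - b t)\<bar> \<le> \<eta> * \<bar>2 * arctan s - 2 * arctan t\<bar>" by (simp add: g_def f(2))
    moreover have "norm (arctan s - arctan t) \<le> 1 * norm (s - t)"
    proof (rule field_differentiable_bound[where S = UNIV])
      show "(arctan has_field_derivative inverse (1 + z\<^sup>2)) (at z within UNIV)" for z using DERIV_arctan[of z] by simp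
      show "norm (inverse (1 + z\<^sup>2)) \<le> 1" for z :: real by (simp add: inverse_le_1_iff)
    qed auto
    then have "\<bar>2 * arctan s - 2 * arctan t\<bar> \<le> 2 * \<bar>s - t\<bar>" unfolding real_norm_def by linarith
    then have "\<eta> * \<bar>2 * arctan s - 2 * arctan t\<bar> \<le> \<eta> * (2 * \<bar>s - t\<bar>)" using \<eta> by (intro mult_left_mono) auto
    ultimately show ?thesis by (simp add: mult.commute mult.left_commute)
  qed
  define \<gamma> where "\<gamma> t = (Complex (g q\<^sub>1 t) (g q\<^sub>2 t), g q\<^sub>3 t + t)" for t
  have cc: "circle_curve 1 q\<^sub>1 q\<^sub>2 q\<^sub>3 (cis (2 * arctan t)) = \<gamma> t" for t
  proof -
    have "sin (2 * arctan t) / (1 + cos (2 * arctan t)) = t"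
      using tan_half[of "arctan t"] by (simp add: tan_arctan add.commute)
    then show ?thesis by (simp add: circle_curve_def \<gamma>_def g_def)
  qed
  have "circle_curve 1 q\<^sub>1 q\<^sub>2 q\<^sub>3 ` circle_dom 1 = range \<gamma>"
    unfolding punctured_circle_arctan image_image cc ..
  then have "algebraic_in_heis (heis_param ` range \<gamma>)" using alg by simp
  moreover have "Ck k UNIV \<gamma>" for k
  proof -
    have a: "Ck k UNIV (\<lambda>t. cis (2 * arctan t))"
      by (rule Ck_compose[where g = cis and T = UNIV, OF open_UNIV open_UNIV Ck_mult[OF open_UNIV Ck_const Ck_arctan] Ck_cis])
        simp
    have "Ck k UNIV (g q)" for q
      unfolding g_def[abs_def] poly_altdef by (intro Ck_Re Ck_sum Ck_mult Ck_const Ck_power a open_UNIV)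
    then show ?thesis unfolding \<gamma>_def[abs_def] by (intro Ck_Pair Ck_Complex Ck_add Ck_id open_UNIV)
  qed
  moreover have \<gamma>\<beta>: "\<gamma> t - \<beta> t = (Complex (g q\<^sub>1 t - b\<^sub>1 t) (g q\<^sub>2 t - b\<^sub>2 t), g q\<^sub>3 t - b\<^sub>3 t)" for t
    by (simp add: \<gamma>_def b\<^sub>1_def b\<^sub>2_def b\<^sub>3_def prod_eq_iff complex_eq_iff)
  have nle: "norm (Complex x y, z) \<le> \<bar>x\<bar> + \<bar>y\<bar> + \<bar>z\<bar>" for x y z
    using norm_Pair_le[of "Complex x y" z] cmod_le[of "Complex x y"] by simp
  have "norm (\<gamma> t - \<beta> t) \<le> e" for t
  proof -
    have "\<bar>g q\<^sub>1 t - b\<^sub>1 t\<bar> < \<eta>" "\<bar>g q\<^sub>2 t - b\<^sub>2 t\<bar> < \<eta>" "\<bar>g q\<^sub>3 t - b\<^sub>3 t\<bar> < \<eta>"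
      using q1[of "2 * arctan t"] q2[of "2 * arctan t"] q3[of "2 * arctan t"] by (simp_all add: g_def f1(4) f2(4) f3(4))
    then show ?thesis using nle[of "g q\<^sub>1 t - b\<^sub>1 t" "g q\<^sub>2 t - b\<^sub>2 t" "g q\<^sub>3 t - b\<^sub>3 t"] e unfolding \<gamma>\<beta> \<eta>_def by linarith
  qed
  moreover have "norm ((\<gamma> s - \<beta> s) - (\<gamma> t - \<beta> t)) \<le> e * \<bar>s - t\<bar>" for s t
  proof -
    have eq: "(\<gamma> s - \<beta> s) - (\<gamma> t - \<beta> t) = (Complex ((g q\<^sub>1 s - b\<^sub>1 s) - (g q\<^sub>1 t - b\<^sub>1 t)) ((g q\<^sub>2 s - b\<^sub>2 s) - (g q\<^sub>2 t - b\<^sub>2 t)),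
        (g q\<^sub>3 s - b\<^sub>3 s) - (g q\<^sub>3 t - b\<^sub>3 t))"
      unfolding \<gamma>\<beta> by (simp add: prod_eq_iff complex_eq_iff)
    note gL[OF f1(1,4) q1, of s t] gL[OF f2(1,4) q2, of s t] gL[OF f3(1,4) q3, of s t]
      nle[of "(g q\<^sub>1 s - b\<^sub>1 s) - (g q\<^sub>1 t - b\<^sub>1 t)" "(g q\<^sub>2 s - b\<^sub>2 s) - (g q\<^sub>2 t - b\<^sub>2 t)" "(g q\<^sub>3 s - b\<^sub>3 s) - (g q\<^sub>3 t - b\<^sub>3 t)"]
    moreover have "e * \<bar>s - t\<bar> = 2 * \<eta> * \<bar>s - t\<bar> + 2 * \<eta> * \<bar>s - t\<bar> + 2 * \<eta> * \<bar>s - t\<bar>" by (simp add: \<eta>_def)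
    ultimately show ?thesis unfolding eq by linarith
  qed
  ultimately show ?thesis by blast
qed

text \<open>Coordinatewise extension; summing over the basis costs the factor \<open>DIM('b)\<close>
  in both bounds.\<close>

lemma mcshane_extension_euclidean:
  fixes \<gamma> :: "'i \<Rightarrow> 'a::real_normed_vector" and u :: "'i \<Rightarrow> 'b::euclidean_space"
  assumes L: "L \<ge> 0" and u: "\<And>s t. norm (u s - u t) \<le> L * norm (\<gamma> s - \<gamma> t)" and M: "\<And>t. norm (u t) \<le> M"
  shows "\<exists>V. (\<forall>t. V (\<gamma> t) = u t) \<and> (\<forall>x y. norm (V x - V y) \<le> real DIM('b) * L * norm (x - y)) \<and> (\<forall>x. norm (V x) \<le> real DIM('b) * M)"
proof -
  have "\<exists>W. (\<forall>t. W (\<gamma> t) = inner (u t) b) \<and> (\<forall>x y. \<bar>W x - W y\<bar> \<le> L * norm (x - y)) \<and> (\<forall>x. \<bar>W x\<bar> \<le> M)"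
    if "b \<in> Basis" for b
  proof (rule mcshane_extension[OF L])
    show "\<bar>inner (u s) b - inner (u t) b\<bar> \<le> L * norm (\<gamma> s - \<gamma> t)" for s t
      using Basis_le_norm[OF that, of "u s - u t"] u[of s t] by (simp add: inner_diff_left)
    show "\<bar>inner (u t) b\<bar> \<le> M" for t using Basis_le_norm[OF that, of "u t"] M[of t] by simp
  qed
  then have "\<forall>b\<in>Basis. \<exists>W. (\<forall>t. W (\<gamma> t) = inner (u t) b) \<and> (\<forall>x y. \<bar>W x - W y\<bar> \<le> L * norm (x - y)) \<and> (\<forall>x. \<bar>W x\<bar> \<le> M)"
    by blast
  from bchoice[OF this] obtain W where W: "\<And>b t. b \<in> Basis \<Longrightarrow> W b (\<gamma> t) = inner (u t) b"
    "\<And>b x y. b \<in> Basis \<Longrightarrow> \<bar>W b x - W b y\<bar> \<le> L * norm (x - y)" "\<And>b x. b \<in> Basis \<Longrightarrow> \<bar>W b x\<bar> \<le> M" by blast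
  define V where "V x = (\<Sum>b\<in>Basis. W b x *\<^sub>R b)" for x
  have i: "inner (V x) b = W b x" if "b \<in> Basis" for x b using that by (simp add: V_def)
  have "V (\<gamma> t) = u t" for t by (rule euclidean_eqI) (simp add: i W(1))
  moreover have "norm (V x - V y) \<le> real DIM('b) * L * norm (x - y)" for x y
  proof -
    have "norm (V x - V y) \<le> (\<Sum>b\<in>Basis. \<bar>inner (V x - V y) b\<bar>)" by (rule norm_le_l1)
    also have "\<dots> \<le> (\<Sum>b\<in>(Basis :: 'b set). L * norm (x - y))"
      by (intro sum_mono) (simp add: inner_diff_left i W(2))
    finally show ?thesis by (simp add: mult.assoc)
  qed
  moreover have "norm (V x) \<le> real DIM('b) * M" for x
  proof -
    have "norm (V x) \<le> (\<Sum>b\<in>Basis. \<bar>inner (V x) b\<bar>)" by (rule norm_le_l1)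
    also have "\<dots> \<le> (\<Sum>b\<in>(Basis :: 'b set). M)" by (intro sum_mono) (simp add: i W(3))
    finally show ?thesis by simp
  qed
  ultimately show ?thesis by blast
qed

section \<open>Finite count of the perturbed line\<close>

text \<open>The inverse perturbation \<open>G\<close> straightens the curve but does not preserve
  round spheres. So \<open>h\<close> keeps only the direction of G x and takes its radius from x,
  which maps the exteriors of balls onto each other.\<close>

lemma radial_straightening:
  fixes V :: "'a::euclidean_space \<Rightarrow> 'a"
  assumes V: "\<And>x y. norm (V x - V y) \<le> (1/4) * norm (x - y)" "\<And>x. norm (V x) \<le> M"
    and G: "homeomorphism UNIV UNIV (\<lambda>x. x + V x) G" and R: "R > 4 * M" "R > 0"
  defines "h \<equiv> \<lambda>x. (norm x / R) *\<^sub>R ((1 / norm (G x)) *\<^sub>R G x)"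
  shows "\<exists>g. homeomorphism (- ball 0 R) (- ball 0 1) h g"
proof -
  have M: "M \<ge> 0" using V(2)[of 0] norm_ge_zero order_trans by blast
  have Gc: "continuous_on UNIV G" and \<Theta>G: "\<And>x. G x + V (G x) = x" and G\<Theta>: "\<And>x. G (x + V x) = x"
    and \<Theta>c: "continuous_on UNIV (\<lambda>x. x + V x)"
    using G by (auto simp: homeomorphism_def)
  have Gn: "norm (G x) \<ge> norm x - M" for x
    using norm_triangle_ineq[of "G x" "V (G x)"] V(2)[of "G x"] unfolding \<Theta>G by linarith
  have Gp: "norm (G x) > 3 * M" "norm (G x) > 0" if "x \<in> - ball 0 R" for x
  proof -
    have "norm x \<ge> R" using that by simp
    then show "norm (G x) > 3 * M" using Gn[of x] R by linarith
    then show "norm (G x) > 0" using M by linarith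
  qed
  have nh: "norm (h x) = norm x / R" if "x \<in> - ball 0 R" for x
    using Gp(2)[OF that] R by (simp add: h_def)
  \<comment> \<open>A ray from the origin, after the perturbation, still crosses each large sphere
    only once: for s > 3 M the radial growth 3/4 outweighs the effect of the bounded displacement.
    This makes \<open>h\<close> injective.\<close>
  have mono: "norm (s *\<^sub>R \<omega> + V (s *\<^sub>R \<omega>)) < norm (t *\<^sub>R \<omega> + V (t *\<^sub>R \<omega>))"
    if "s < t" "s > 3 * M" and w: "norm \<omega> = 1" for s t \<omega>
  proof -
    define P where "P = s *\<^sub>R \<omega> + V (s *\<^sub>R \<omega>)"
    define E where "E = V (t *\<^sub>R \<omega>) - V (s *\<^sub>R \<omega>)"
    define d where "d = t - s"
    have d: "d > 0" using that by (simp add: d_def)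
    have Q: "t *\<^sub>R \<omega> + V (t *\<^sub>R \<omega>) = P + (d *\<^sub>R \<omega> + E)" by (simp add: P_def E_def d_def algebra_simps)
    have "t *\<^sub>R \<omega> - s *\<^sub>R \<omega> = d *\<^sub>R \<omega>" by (simp add: d_def scaleR_diff_left)
    then have E: "norm E \<le> d / 4" using V(1)[of "t *\<^sub>R \<omega>" "s *\<^sub>R \<omega>"] d w by (simp add: E_def)
    have ww: "inner \<omega> \<omega> = 1" using w by (simp add: dot_square_norm)
    have nD: "norm (d *\<^sub>R \<omega> + E) \<le> d + d / 4" using norm_triangle_ineq[of "d *\<^sub>R \<omega>" E] E d w by simp
    have "inner \<omega> E \<ge> - (d / 4)" using Cauchy_Schwarz_ineq2[of \<omega> E] E w by simp
    then have "inner \<omega> (d *\<^sub>R \<omega> + E) \<ge> 3 / 4 * d" by (simp add: inner_add_right ww)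
    then have "s * inner \<omega> (d *\<^sub>R \<omega> + E) \<ge> s * (3 / 4 * d)" using that M by (intro mult_left_mono) auto
    moreover have "\<bar>inner (V (s *\<^sub>R \<omega>)) (d *\<^sub>R \<omega> + E)\<bar> \<le> M * (d + d / 4)"
      using Cauchy_Schwarz_ineq2[of "V (s *\<^sub>R \<omega>)" "d *\<^sub>R \<omega> + E"]
        mult_mono[OF V(2)[of "s *\<^sub>R \<omega>"] nD M norm_ge_zero] by linarith
    moreover have "M * (d + d / 4) < s * (3 / 4 * d)"
    proof -
      have "M * (5 / 4) < s * (3 / 4)" using that M by linarith
      then have "M * (5 / 4) * d < s * (3 / 4) * d" using d by (rule mult_strict_right_mono)
      then show ?thesis by (simp add: algebra_simps)
    qed
    ultimately have "inner P (d *\<^sub>R \<omega> + E) > 0" unfolding P_def inner_add_left inner_scaleR_left by linarith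
    moreover have "(norm (P + D))\<^sup>2 = (norm P)\<^sup>2 + 2 * inner P D + (norm D)\<^sup>2" for D
      by (simp add: power2_norm_eq_inner inner_add_left inner_add_right inner_commute[of D P])
    note this[of "d *\<^sub>R \<omega> + E"]
    moreover have "(norm (d *\<^sub>R \<omega> + E))\<^sup>2 \<ge> 0" by simp
    ultimately have "(norm P)\<^sup>2 < (norm (P + (d *\<^sub>R \<omega> + E)))\<^sup>2" by linarith
    then show ?thesis unfolding Q P_def[symmetric] by (rule power2_less_imp_less) simp
  qed
  have polar: "norm (G x) *\<^sub>R ((1 / norm (G x)) *\<^sub>R G x) = G x" "norm ((1 / norm (G x)) *\<^sub>R G x) = 1"
    if "x \<in> - ball 0 R" for x
    using Gp(2)[OF that] by simp_all
  have "inj_on h (- ball 0 R)"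
  proof (rule inj_onI)
    fix x y assume x: "x \<in> - ball 0 R" and y: "y \<in> - ball 0 R" and e: "h x = h y"
    have n: "norm x = norm y" using nh[OF x] nh[OF y] e R by simp
    define \<omega> where "\<omega> = (1 / norm (G x)) *\<^sub>R G x"
    have "norm y \<ge> R" using y by simp
    then have "norm y > 0" using R by linarith
    then have "norm y / R \<noteq> 0" using R by simp
    moreover have "(norm y / R) *\<^sub>R ((1 / norm (G y)) *\<^sub>R G y) = (norm y / R) *\<^sub>R \<omega>"
      using e unfolding h_def \<omega>_def n by (rule sym)
    ultimately have w: "(1 / norm (G y)) *\<^sub>R G y = \<omega>" by (rule scaleR_left_imp_eq)
    have "norm (norm (G x) *\<^sub>R \<omega> + V (norm (G x) *\<^sub>R \<omega>)) = norm (norm (G y) *\<^sub>R \<omega> + V (norm (G y) *\<^sub>R \<omega>))"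
      using n polar(1)[OF x, folded \<omega>_def] polar(1)[OF y, unfolded w] by (simp add: \<Theta>G)
    then have "norm (G x) = norm (G y)"
      using mono[OF _ _ polar(2)[OF x, folded \<omega>_def], of "norm (G x)" "norm (G y)"]
        mono[OF _ _ polar(2)[OF x, folded \<omega>_def], of "norm (G y)" "norm (G x)"] Gp(1)[OF x] Gp(1)[OF y]
      by (cases "norm (G x)" "norm (G y)" rule: linorder_cases) auto
    then have "norm (G x) *\<^sub>R \<omega> = norm (G y) *\<^sub>R \<omega>" by (rule arg_cong)
    then have "G x = G y" unfolding polar(1)[OF x, folded \<omega>_def] polar(1)[OF y, unfolded w] .
    then have "G x + V (G x) = G y + V (G y)" by (rule arg_cong)
    then show "x = y" unfolding \<Theta>G .
  qed
  moreover have ch: "continuous_on (- ball 0 R) h"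
    unfolding h_def using Gp(2) R
    by (intro continuous_on_scaleR continuous_on_divide continuous_on_norm continuous_on_const continuous_on_id
        continuous_on_subset[OF Gc]) auto
  moreover have im: "h ` (- ball 0 R) = - ball 0 1"
  proof (intro equalityI subsetI)
    fix z assume "z \<in> h ` (- ball 0 R)"
    then obtain x where x: "x \<in> - ball 0 R" "z = h x" by blast
    then have "norm z = norm x / R" "norm x \<ge> R" using nh by auto
    then show "z \<in> - ball 0 1" using R by (simp add: le_divide_eq)
  next
    fix z :: 'a assume "z \<in> - ball 0 1"
    then have z: "norm z \<ge> 1" by simp
    define \<omega> where "\<omega> = (1 / norm z) *\<^sub>R z"
    have "norm z > 0" using z by linarith
    then have w: "norm \<omega> = 1" "norm z *\<^sub>R \<omega> = z" by (simp_all add: \<omega>_def)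
    define r where "r = R * norm z"
    have "R * 1 \<le> R * norm z" using z R by (intro mult_left_mono) auto
    then have r: "r \<ge> R" by (simp add: r_def)
    have n: "norm (s *\<^sub>R \<omega>) = s" if "s \<ge> 0" for s using that w by simp
    \<comment> \<open>Surjectivity: the perturbation changes norms by at most \<open>M\<close>, so
      the perturbed ray in direction \<omega> passes through radius r between parameters r - M and r
      + M.\<close>
    have "\<exists>s\<ge>r - M. s \<le> r + M \<and> norm (s *\<^sub>R \<omega> + V (s *\<^sub>R \<omega>)) = r"
    proof (rule IVT')
      have "r - M \<ge> 0" using r R M by linarith
      then show "norm ((r - M) *\<^sub>R \<omega> + V ((r - M) *\<^sub>R \<omega>)) \<le> r"
        using norm_triangle_ineq[of "(r - M) *\<^sub>R \<omega>" "V ((r - M) *\<^sub>R \<omega>)"] n[of "r - M"] V(2)[of "(r - M) *\<^sub>R \<omega>"] by linarith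
      have "r + M \<ge> 0" using r R M by linarith
      then show "r \<le> norm ((r + M) *\<^sub>R \<omega> + V ((r + M) *\<^sub>R \<omega>))"
        using norm_diff_ineq[of "(r + M) *\<^sub>R \<omega>" "V ((r + M) *\<^sub>R \<omega>)"] n[of "r + M"] V(2)[of "(r + M) *\<^sub>R \<omega>"] by linarith
      show "r - M \<le> r + M" using M by simp
      show "continuous_on {r - M..r + M} (\<lambda>s. norm (s *\<^sub>R \<omega> + V (s *\<^sub>R \<omega>)))"
        by (rule continuous_on_norm, rule continuous_on_compose2[OF \<Theta>c])
          (intro continuous_on_scaleR continuous_on_id continuous_on_const, simp)
    qed
    then obtain s where s: "s \<ge> r - M" "norm (s *\<^sub>R \<omega> + V (s *\<^sub>R \<omega>)) = r" by blast
    have sp: "s > 0" using s(1) r R M by linarith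
    let ?x = "s *\<^sub>R \<omega> + V (s *\<^sub>R \<omega>)"
    have "?x \<in> - ball 0 R" using s(2) r by simp
    moreover have "h ?x = z"
      using sp R w by (simp add: h_def G\<Theta> s(2)) (simp add: r_def)
    ultimately show "z \<in> h ` (- ball 0 R)" by (metis imageI)
  qed
  moreover have "\<exists>\<rho>. \<forall>x\<in>- ball 0 R. norm (h x) \<le> r \<longrightarrow> norm x \<le> \<rho>" for r
    by (intro exI[of _ "r * R"] ballI impI) (use nh R in \<open>simp add: divide_le_eq\<close>)
  ultimately show ?thesis
    using proper_homeomorphism(1)[of "- ball 0 R" h] by (simp add: closed_Compl)
qed

text \<open>\<open>G\<close> takes the perturbed curve back to \<beta>, which is vertical far out;
  hence \<open>h\<close>, having the direction of \<open>G\<close>, puts the exterior part on the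
  vertical rays.\<close>

lemma near_line_finite_count:
  fixes \<beta> :: "real \<Rightarrow> complex \<times> real"
  assumes V: "\<And>x y. norm (V x - V y) \<le> (1/4) * norm (x - y)" "\<And>x. norm (V x) \<le> M"
    and G: "homeomorphism UNIV UNIV (\<lambda>x. x + V x) G"
    and line: "\<And>t. \<bar>t\<bar> \<ge> T \<Longrightarrow> \<beta> t = (0, t)" and B: "\<And>t. norm (\<beta> t - (0, t)) \<le> B"
  shows "\<exists>R>0. \<exists>h g. homeomorphism (- ball (0::complex \<times> real) R) (- ball (0::complex \<times> real) 1) h g \<and>
    h ` (range (\<lambda>t. \<beta> t + V (\<beta> t)) - ball 0 R) = {(0, t) | t. t \<ge> 1} \<union> {(0, t) | t. t \<le> -1}"
proof -
  have M: "M \<ge> 0" using V(2)[of 0] norm_ge_zero order_trans by blast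
  have B0: "B \<ge> 0" using B[of 0] norm_ge_zero order_trans by blast
  \<comment> \<open>Besides R > 4 M, the remaining terms ensure that a curve point of norm at least
    \<open>R\<close> has a nonzero parameter with |t| at least \<open>T\<close>, after losing
    \<open>M\<close> to the perturbation and \<open>B\<close> to the deviation.\<close>
  define R where "R = 4 * M + \<bar>T\<bar> + B + 1"
  have R: "R > 4 * M" "R > 0" using M B0 by (auto simp: R_def)
  have \<Theta>G: "\<And>x. G x + V (G x) = x" and G\<Theta>: "\<And>x. G (x + V x) = x" using G by (auto simp: homeomorphism_def)
  define h where "h x = (norm x / R) *\<^sub>R ((1 / norm (G x)) *\<^sub>R G x)" for x
  obtain g where g: "homeomorphism (- ball 0 R) (- ball 0 1) h g"
    using radial_straightening[OF V G R] unfolding h_def[abs_def] by blast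
  have Gn: "norm (G x) \<ge> norm x - M" for x
    using norm_triangle_ineq[of "G x" "V (G x)"] V(2)[of "G x"] unfolding \<Theta>G by linarith
  have "h ` (range (\<lambda>t. \<beta> t + V (\<beta> t)) - ball 0 R) = {(0, t) | t. t \<ge> 1} \<union> {(0, t) | t. t \<le> -1}" (is "_ = ?rays")
  proof (intro equalityI subsetI)
    fix z assume "z \<in> h ` (range (\<lambda>t. \<beta> t + V (\<beta> t)) - ball 0 R)"
    then obtain x t where xt: "z = h x" "x = \<beta> t + V (\<beta> t)" "x \<notin> ball 0 R" by blast
    then have nx: "norm x \<ge> R" by simp
    have Gx: "G x = \<beta> t" unfolding xt(2) by (rule G\<Theta>)
    have "norm (0::complex, t) \<ge> norm (\<beta> t) - norm (\<beta> t - (0, t))"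
      using norm_triangle_ineq2[of "\<beta> t" "\<beta> t - (0, t)"] by simp
    moreover have "norm (0::complex, t) = \<bar>t\<bar>" by (simp add: norm_Pair)
    ultimately have t: "\<bar>t\<bar> \<ge> T" "\<bar>t\<bar> > 0" using Gn[of x] nx B[of t] M unfolding Gx R_def by linarith+
    have z: "z = (0, (norm x / R) * (t / \<bar>t\<bar>))"
      by (simp add: xt(1) h_def Gx line[OF t(1)] norm_Pair)
    have sg: "t / \<bar>t\<bar> = 1 \<or> t / \<bar>t\<bar> = -1" using t(2) by (auto simp: abs_real_def)
    have "norm x / R \<ge> 1" using nx R by (simp add: le_divide_eq)
    then have "(norm x / R) * u \<ge> 1 \<or> (norm x / R) * u \<le> -1" if "u = 1 \<or> u = -1" for u using that by auto
    from this[OF sg] have "(norm x / R) * (t / \<bar>t\<bar>) \<ge> 1 \<or> (norm x / R) * (t / \<bar>t\<bar>) \<le> -1" .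
    then show "z \<in> ?rays" unfolding z by blast
  next
    fix z assume "z \<in> ?rays"
    then obtain r :: real where r: "z = (0, r)" "\<bar>r\<bar> \<ge> 1" by auto
    then have "z \<in> - ball 0 1" by (simp add: norm_Pair)
    then have "z \<in> h ` (- ball 0 R)" unfolding homeomorphism_image1[OF g] .
    then obtain x where x': "z = h x" and x1: "x \<in> - ball 0 R" by (rule imageE)
    note x = x1 x'[symmetric]
    have nx: "norm x \<ge> R" using x(1) by simp
    have nG: "norm (G x) \<ge> T" "norm (G x) > 0" using Gn[of x] nx M B0 unfolding R_def by linarith+
    define k where "k = norm x / R * (1 / norm (G x))"
    have "norm x > 0" using nx R by linarith
    then have k: "k > 0" unfolding k_def using R nG(2) by (intro mult_pos_pos divide_pos_pos) simp_all
    have "k *\<^sub>R G x = (0, r)" using x(2) r(1) by (simp add: h_def k_def)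
    moreover have "G x = (1 / k) *\<^sub>R (k *\<^sub>R G x)" using k by simp
    ultimately have Gx: "G x = (0, r / k)" by simp
    then have "norm (G x) = \<bar>r / k\<bar>" by (simp add: norm_Pair)
    then have "G x = \<beta> (r / k)" using line[of "r / k"] nG(1) Gx by simp
    then have "x = \<beta> (r / k) + V (\<beta> (r / k))" using \<Theta>G[of x] by simp
    then have "x \<in> range (\<lambda>t. \<beta> t + V (\<beta> t)) - ball 0 R" using x(1) by blast
    then show "z \<in> h ` (range (\<lambda>t. \<beta> t + V (\<beta> t)) - ball 0 R)" using x(2) by blast
  qed
  with R(2) g show ?thesis by (intro exI[of _ R] exI[of _ h] exI[of _ g] conjI)
qed

lemma vector_derivative_nonzero_if_expanding:
  fixes f :: "real \<Rightarrow> 'a::real_normed_vector"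
  assumes f: "(f has_vector_derivative D) (at t)" and k: "k > 0" "\<And>s. norm (f s - f t) \<ge> k * \<bar>s - t\<bar>"
  shows "D \<noteq> 0"
proof
  assume "D = 0"
  then have "(f has_derivative (\<lambda>h. 0)) (at t)" using f by (simp add: has_vector_derivative_def)
  moreover have "k / 2 > 0" using k by simp
  ultimately obtain d where d: "d > 0" "\<And>s. norm (s - t) < d \<Longrightarrow> norm (f s - f t - 0) \<le> k / 2 * norm (s - t)"
    unfolding has_derivative_at_alt by blast
  have "k * (d / 2) \<le> norm (f (t + d/2) - f t)" using k(2)[of "t + d/2"] d(1) by simp
  also have "\<dots> \<le> k / 2 * (d / 2)" using d(2)[of "t + d/2"] d(1) by simp
  finally show False using k(1) d(1) by simp
qed

lemma continuous_knot_image: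
  assumes "homeomorphism S3 S3 h g" "continuous_knot K"
  shows "continuous_knot (h ` K)"
proof -
  obtain \<gamma> :: "complex \<Rightarrow> complex \<times> complex" where \<gamma>: "K \<subseteq> S3" "continuous_on (sphere 0 1) \<gamma>" "inj_on \<gamma> (sphere 0 1)" "K = \<gamma> ` sphere 0 1"
    using assms(2) unfolding continuous_knot_def by blast
  have sub: "\<gamma> ` sphere 0 1 \<subseteq> S3" using \<gamma>(1,4) by simp
  have "continuous_on (sphere 0 1) (h \<circ> \<gamma>)"
    by (intro continuous_on_compose \<gamma>(2) continuous_on_subset[OF homeomorphism_cont1[OF assms(1)] sub])
  moreover have "inj_on h S3" by (rule inj_on_inverseI[of S3 g]) (rule homeomorphism_apply1[OF assms(1)])
  then have "inj_on (h \<circ> \<gamma>) (sphere 0 1)" using \<gamma>(3) sub by (intro comp_inj_on) (auto intro: inj_on_subset)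
  moreover have "h ` K = (h \<circ> \<gamma>) ` sphere 0 1" unfolding \<gamma>(4) by (simp add: image_comp)
  moreover have "h ` K \<subseteq> S3" using homeomorphism_image1[OF assms(1)] \<gamma>(1) by blast
  ultimately show ?thesis unfolding continuous_knot_def by blast
qed

text \<open>Both bounds together let escape to infinity be tested on \<open>heis\<close> or in the
  chart; the square comes from Im w = |z|^2.\<close>

lemma norm_heis_param: "norm x \<le> norm (heis_param x)" "norm (heis_param x) \<le> norm x + (norm x)\<^sup>2"
proof -
  obtain z t where x: "x = (z, t)" by (cases x)
  have p: "heis_param x = (z, complex_of_real t) + (0, \<i> * complex_of_real ((cmod z)\<^sup>2))"
    by (simp add: heis_param_def x Complex_eq)
  have "norm (heis_param x) \<le> norm (z, complex_of_real t) + norm (0::complex, \<i> * complex_of_real ((cmod z)\<^sup>2))"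
    unfolding p by (rule norm_triangle_ineq)
  moreover have "norm (z, complex_of_real t) = norm x" by (simp add: norm_Pair x)
  moreover have "norm (0::complex, w) = cmod w" for w :: complex by (simp add: norm_Pair)
  then have "norm (0::complex, \<i> * complex_of_real ((cmod z)\<^sup>2)) = (cmod z)\<^sup>2" by (simp add: norm_mult norm_power)
  moreover have "(cmod z)\<^sup>2 \<le> (norm x)\<^sup>2" using norm_fst_le[of z t] by (simp add: x power_mono)
  ultimately show "norm (heis_param x) \<le> norm x + (norm x)\<^sup>2" by linarith
  have "\<bar>t\<bar> \<le> cmod (Complex t ((cmod z)\<^sup>2))" using abs_Re_le_cmod[of "Complex t ((cmod z)\<^sup>2)"] by simp
  then have "t\<^sup>2 \<le> (cmod (Complex t ((cmod z)\<^sup>2)))\<^sup>2" using abs_le_square_iff by fastforce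
  then show "norm x \<le> norm (heis_param x)" by (simp add: norm_Pair heis_param_def x)
qed

lemma homeomorphism_UNIV_trans:
  assumes "homeomorphism UNIV UNIV f f'" "homeomorphism UNIV UNIV g g'"
  shows "homeomorphism UNIV UNIV (\<lambda>x. g (f x)) (\<lambda>x. f' (g' x))"
  using homeomorphism_compose[OF assms] unfolding o_def .

lemma finite_count_normal_form:
  fixes \<Gamma> :: "real \<Rightarrow> complex \<times> real"
  assumes \<Gamma>: "\<And>t. (\<Gamma> has_vector_derivative \<Gamma>' t) (at t)" "continuous_on UNIV \<Gamma>'" "\<And>t. \<Gamma>' t \<noteq> 0" "inj \<Gamma>"
    and lim: "filterlim \<Gamma> at_infinity at_top" "filterlim \<Gamma> at_infinity at_bot"
    and R: "R > 0" and hom: "homeomorphism (- ball 0 R) (- ball 0 1) h g"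
    and rays: "h ` (range \<Gamma> - ball 0 R) = vertical_rays"
  shows "\<exists>(H :: complex \<times> real \<Rightarrow> complex \<times> real) H' \<beta> \<beta>' T. homeomorphism UNIV UNIV H H' \<and> H ` range \<Gamma> = range \<beta> \<and> inj \<beta> \<and>
    (\<forall>t. (\<beta> has_vector_derivative \<beta>' t) (at t)) \<and> continuous_on UNIV \<beta>' \<and> (\<forall>t. \<beta>' t \<noteq> 0) \<and>
    (\<forall>t. \<bar>t\<bar> \<ge> T \<longrightarrow> \<beta> t = (0, t))"
proof -
  have cont: "continuous_on UNIV \<Gamma>"
    by (rule continuous_on_vector_derivative) (rule has_vector_derivative_at_within[OF \<Gamma>(1)])
  obtain a b where ab: "b < a" and O: "\<And>t. norm (\<Gamma> t) \<ge> R \<longleftrightarrow> t \<le> b \<or> a \<le> t"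
    and n: "norm (\<Gamma> a) = R" "norm (\<Gamma> b) = R" and poles: "{h (\<Gamma> a), h (\<Gamma> b)} = {(0, 1), (0, -1)}"
    using finite_count_arc[OF cont \<Gamma>(4) lim R hom rays] by blast
  have neq: "\<Gamma> a \<noteq> \<Gamma> b" using \<Gamma>(4) ab by (metis injD less_irrefl)
  define e where "e = (1/2) *\<^sub>R (\<Gamma> a - \<Gamma> b)"
  define c where "c = (1/2) *\<^sub>R (\<Gamma> a + \<Gamma> b)"
  have e0: "e \<noteq> 0" using neq by (simp add: e_def)
  obtain \<Phi> \<Phi>' where \<Phi>: "homeomorphism UNIV UNIV \<Phi> \<Phi>'"
    "\<Phi> ` range \<Gamma> = \<Gamma> ` {b..a} \<union> {\<Gamma> a + s *\<^sub>R e | s. s \<ge> 0} \<union> {\<Gamma> b - s *\<^sub>R e | s. s \<ge> 0}"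
    using finite_count_straighten_ends[OF R hom rays ab O n neq poles] unfolding e_def[symmetric] by blast
  have inner: "norm (\<Gamma> t) \<le> R" if "t \<in> {b..a}" for t
  proof (cases "t = a \<or> t = b")
    case False
    then have "\<not> (t \<le> b \<or> a \<le> t)" using that by auto
    then show ?thesis using O[of t] by linarith
  qed (use n in auto)
  obtain \<Psi> \<Psi>' \<gamma> \<gamma>' where \<Psi>: "homeomorphism UNIV UNIV \<Psi> \<Psi>'" "range \<gamma> = \<Psi> ` \<Phi> ` range \<Gamma>" "inj \<gamma>"
    and \<gamma>: "\<And>t. (\<gamma> has_vector_derivative \<gamma>' t) (at t)" "continuous_on UNIV \<gamma>'" "\<And>t. \<gamma>' t \<noteq> 0"
      "\<And>t. \<bar>t\<bar> \<ge> 3 \<Longrightarrow> \<gamma> t = c + t *\<^sub>R e"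
    using C1_straight_ends[OF \<Gamma> ab inner n] unfolding e_def[symmetric] c_def[symmetric] \<Phi>(2)[symmetric] by blast
  have y0: "(0::complex, 1::real) \<noteq> 0" by (simp add: zero_prod_def)
  obtain L L' where L: "bounded_linear L" "bounded_linear L'" "\<And>x. L' (L x) = x" "\<And>x. L (L' x) = x" "L e = (0 :: complex, 1 :: real)"
    using linear_bijection_moving[OF e0 y0] by blast
  have A: "homeomorphism UNIV UNIV (\<lambda>x. L (x - c)) (\<lambda>x. L' x + c)"
  proof (rule homeomorphismI)
    show "continuous_on UNIV (\<lambda>x. L (x - c))"
      by (rule bounded_linear.continuous_on[OF L(1)]) (intro continuous_on_diff continuous_on_id continuous_on_const)
    show "continuous_on UNIV (\<lambda>x. L' x + c)"
      by (intro continuous_on_add bounded_linear.continuous_on[OF L(2)] continuous_on_id continuous_on_const)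
  qed (use L in auto)
  define \<beta> where "\<beta> t = L (\<gamma> t - c)" for t
  define \<beta>' where "\<beta>' t = L (\<gamma>' t)" for t
  have H: "homeomorphism UNIV UNIV (\<lambda>x. L (\<Psi> (\<Phi> x) - c)) (\<lambda>x. \<Phi>' (\<Psi>' (L' x + c)))"
    by (rule homeomorphism_UNIV_trans[OF homeomorphism_UNIV_trans[OF \<Phi>(1) \<Psi>(1)] A])
  have "(\<lambda>x. L (\<Psi> (\<Phi> x) - c)) ` range \<Gamma> = (\<lambda>x. L (x - c)) ` \<Psi> ` \<Phi> ` range \<Gamma>" by (simp only: image_image)
  moreover have "range \<beta> = (\<lambda>x. L (x - c)) ` range \<gamma>" by (simp only: image_image \<beta>_def[abs_def])
  ultimately have H\<beta>: "(\<lambda>x. L (\<Psi> (\<Phi> x) - c)) ` range \<Gamma> = range \<beta>" unfolding \<Psi>(2) by (simp only:)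
  have "inj \<beta>"
  proof (rule injI)
    fix s t assume "\<beta> s = \<beta> t"
    then have "L' (L (\<gamma> s - c)) = L' (L (\<gamma> t - c))" unfolding \<beta>_def by (rule arg_cong)
    then have "\<gamma> s = \<gamma> t" unfolding L(3) by simp
    then show "s = t" using \<Psi>(3) by (simp add: inj_eq)
  qed
  moreover have "(\<beta> has_vector_derivative \<beta>' t) (at t)" for t
  proof -
    have "((\<lambda>t. \<gamma> t - c) has_vector_derivative \<gamma>' t - 0) (at t)"
      by (intro has_vector_derivative_diff \<gamma>(1) has_vector_derivative_const)
    then show ?thesis unfolding \<beta>_def[abs_def] \<beta>'_def
      using bounded_linear.has_vector_derivative[OF L(1)] by simp
  qed
  moreover have "continuous_on UNIV \<beta>'"
    unfolding \<beta>'_def[abs_def] by (rule bounded_linear.continuous_on[OF L(1) \<gamma>(2)])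
  moreover have "\<beta>' t \<noteq> 0" for t
  proof
    assume "\<beta>' t = 0"
    then have "L' (L (\<gamma>' t)) = L' 0" unfolding \<beta>'_def by (rule arg_cong)
    then have "\<gamma>' t = 0" unfolding L(3) by (simp add: linear_0[OF bounded_linear.linear[OF L(2)]])
    then show False using \<gamma>(3) by simp
  qed
  moreover have "\<beta> t = (0, t)" if "\<bar>t\<bar> \<ge> 3" for t
    unfolding \<beta>_def \<gamma>(4)[OF that] by (simp add: linear_cmul[OF bounded_linear.linear[OF L(1)]] L(5))
  ultimately show ?thesis using H H\<beta>
    by - (rule exI[of _ "\<lambda>x. L (\<Psi> (\<Phi> x) - c)"], rule exI[of _ "\<lambda>x. \<Phi>' (\<Psi>' (L' x + c))"], rule exI[of _ \<beta>],
        rule exI[of _ \<beta>'], rule exI[of _ 3], intro conjI allI impI)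
qed

text \<open>The difference of the approximating curve and \<beta> is a Lipschitz function of the
  point of \<beta>, by the lower bound for distances. Its extension \<open>V\<close> yields the
  ambient homeomorphism and also keeps the new curve injective and regular.\<close>

lemma straight_curve_algebraic:
  fixes \<beta> :: "real \<Rightarrow> complex \<times> real"
  assumes \<beta>: "\<And>t. (\<beta> has_vector_derivative \<beta>' t) (at t)" "continuous_on UNIV \<beta>'" "\<And>t. \<beta>' t \<noteq> 0" "inj \<beta>"
    and line: "\<forall>t. \<bar>t\<bar> \<ge> T \<longrightarrow> \<beta> t = (0, t)"
  shows "\<exists>\<Theta> G \<gamma> C. homeomorphism UNIV UNIV \<Theta> G \<and> range \<gamma> = \<Theta> ` range \<beta> \<and> algebraic_in_heis (heis_param ` range \<gamma>) \<and>
    (\<forall>k. Ck k UNIV \<gamma>) \<and> inj \<gamma> \<and> (\<forall>t. vector_derivative \<gamma> (at t) \<noteq> 0) \<and> (\<forall>t. \<bar>t\<bar> - C \<le> norm (\<gamma> t)) \<and>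
    (\<exists>R>0. \<exists>h g. homeomorphism (- ball (0::complex \<times> real) R) (- ball (0::complex \<times> real) 1) h g \<and>
      h ` (range \<gamma> - ball 0 R) = {(0, t) | t. t \<ge> 1} \<union> {(0, t) | t. t \<le> -1})"
proof -
  have c\<beta>: "continuous_on S \<beta>" for S
    by (rule continuous_on_vector_derivative) (rule has_vector_derivative_at_within[OF \<beta>(1)])
  have e: "norm (0::complex, 1::real) = 1" by (simp add: norm_Pair)
  have line': "\<beta> t = t *\<^sub>R (0, 1)" if "\<bar>t\<bar> \<ge> T" for t using line that by simp
  obtain \<kappa> where \<kappa>: "\<kappa> > 0" "\<And>s t. norm (\<beta> s - \<beta> t) \<ge> \<kappa> * \<bar>s - t\<bar>"
    using C1_embedding_lower_bound[OF \<beta> line' e] by blast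
  obtain B where B: "\<And>t. norm (\<beta> t - (0, t)) \<le> B"
    using eventually_linear_deviation[OF c\<beta> line'] by auto
  \<comment> \<open>The extension has Lipschitz constant \<open>DIM\<close> times \<eta> / \<kappa>,
    which this choice makes 1/4.\<close>
  define \<eta> where "\<eta> = \<kappa> / (4 * DIM(complex \<times> real))"
  have \<eta>: "\<eta> > 0" using \<kappa>(1) by (simp add: \<eta>_def)
  obtain \<gamma> where alg: "algebraic_in_heis (heis_param ` range \<gamma>)" and Ck\<gamma>: "\<And>k. Ck k UNIV \<gamma>"
    and n: "\<And>t. norm (\<gamma> t - \<beta> t) \<le> \<eta>" and l: "\<And>s t. norm ((\<gamma> s - \<beta> s) - (\<gamma> t - \<beta> t)) \<le> \<eta> * \<bar>s - t\<bar>"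
    using straight_curve_algebraic_approximation[OF \<beta>(1,2) line[rule_format] \<eta>] by blast
  have "norm ((\<gamma> s - \<beta> s) - (\<gamma> t - \<beta> t)) \<le> (\<eta> / \<kappa>) * norm (\<beta> s - \<beta> t)" for s t
  proof -
    have "(\<eta> / \<kappa>) * (\<kappa> * \<bar>s - t\<bar>) \<le> (\<eta> / \<kappa>) * norm (\<beta> s - \<beta> t)"
      using \<kappa> \<eta> by (intro mult_left_mono) auto
    moreover have "(\<eta> / \<kappa>) * (\<kappa> * \<bar>s - t\<bar>) = \<eta> * \<bar>s - t\<bar>" using \<kappa>(1) by simp
    ultimately show ?thesis using l[of s t] by linarith
  qed
  moreover have "\<eta> / \<kappa> \<ge> 0" using \<eta> \<kappa>(1) by simp
  ultimately obtain V where V\<beta>: "\<And>t. V (\<beta> t) = \<gamma> t - \<beta> t"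
    and V0: "\<And>x y. norm (V x - V y) \<le> real DIM(complex \<times> real) * (\<eta> / \<kappa>) * norm (x - y)"
    and VM: "\<And>x. norm (V x) \<le> real DIM(complex \<times> real) * \<eta>"
    using mcshane_extension_euclidean[of "\<eta> / \<kappa>" "\<lambda>t. \<gamma> t - \<beta> t" \<beta> \<eta>] n by blast
  have "real DIM(complex \<times> real) * (\<eta> / \<kappa>) = 1 / 4" using \<kappa>(1) by (simp add: \<eta>_def)
  then have V: "norm (V x - V y) \<le> (1/4) * norm (x - y)" for x y using V0[of x y] by simp
  obtain G where G: "homeomorphism UNIV UNIV (\<lambda>x. x + V x) G"
    using lipschitz_perturbation_homeomorphism[OF _ _ V] by auto
  have \<gamma>: "\<gamma> t = \<beta> t + V (\<beta> t)" for t by (simp add: V\<beta>)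
  have lower: "norm (\<gamma> s - \<gamma> t) \<ge> (3/4 * \<kappa>) * \<bar>s - t\<bar>" for s t
  proof -
    have "norm (\<beta> s - \<beta> t) \<le> norm (\<gamma> s - \<gamma> t) + norm (V (\<beta> s) - V (\<beta> t))"
      using norm_triangle_ineq4[of "\<gamma> s - \<gamma> t" "V (\<beta> s) - V (\<beta> t)"] by (simp add: \<gamma> algebra_simps)
    then show ?thesis using V[of "\<beta> s" "\<beta> t"] \<kappa>(2)[of s t] by (simp add: algebra_simps)
  qed
  have k: "3/4 * \<kappa> > 0" using \<kappa>(1) by simp
  have "inj \<gamma>"
  proof (rule injI)
    fix s t assume "\<gamma> s = \<gamma> t"
    then have "(3/4 * \<kappa>) * \<bar>s - t\<bar> \<le> 0" using lower[of s t] by simp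
    then show "s = t" using k by (simp add: mult_le_0_iff)
  qed
  moreover have "vector_derivative \<gamma> (at t) \<noteq> 0" for t
    using vector_derivative_nonzero_if_expanding[OF Ck_vector_derivative(2)[OF open_UNIV Ck\<gamma> UNIV_I] k lower] .
  moreover have "\<bar>t\<bar> - (B + \<eta>) \<le> norm (\<gamma> t)" for t
  proof -
    have "norm (0::complex, t) = \<bar>t\<bar>" by (simp add: norm_Pair)
    moreover have "norm (0::complex, t) \<le> norm (\<gamma> t) + norm (\<gamma> t - (0, t))"
      by (metis norm_triangle_sub norm_minus_commute)
    moreover have "norm (\<gamma> t - (0, t)) \<le> norm (\<gamma> t - \<beta> t) + norm (\<beta> t - (0, t))"
      by (rule norm_diff_triangle_ineq[of "\<gamma> t" "\<beta> t" "\<beta> t" "(0, t)", simplified]) 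
    ultimately show ?thesis using B[of t] n[of t] by linarith
  qed
  moreover have "range \<gamma> = (\<lambda>x. x + V x) ` range \<beta>" unfolding image_image \<gamma>[symmetric] ..
  moreover have "\<exists>R>0. \<exists>h g. homeomorphism (- ball (0::complex \<times> real) R) (- ball (0::complex \<times> real) 1) h g \<and>
      h ` (range \<gamma> - ball 0 R) = {(0, t) | t. t \<ge> 1} \<union> {(0, t) | t. t \<le> -1}"
    using near_line_finite_count[OF V VM G line[rule_format] B] unfolding \<gamma>[symmetric] by blast
  ultimately show ?thesis using G alg Ck\<gamma>
    by - (rule exI[of _ "\<lambda>x. x + V x"], rule exI[of _ G], rule exI[of _ \<gamma>], rule exI[of _ "B + \<eta>"], intro conjI allI)
qed

lemma unbounded_knot_heis_param:
  assumes Ck\<gamma>: "\<And>k. Ck k UNIV \<gamma>" and inj: "inj \<gamma>" and reg: "\<And>t. vector_derivative \<gamma> (at t) \<noteq> 0"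
    and proper: "\<And>t. \<bar>t\<bar> - C \<le> norm (\<gamma> t)"
  shows "unbounded_knot (heis_param ` range \<gamma>)"
proof -
  define \<delta> where "\<delta> t = heis_param (\<gamma> t)" for t
  have Ck\<delta>: "Ck k UNIV \<delta>" for k
    unfolding \<delta>_def[abs_def]
    by (rule Ck_compose[where g = heis_param, OF open_UNIV open_UNIV Ck\<gamma> Ck_heis_param subset_UNIV])
  have "inj \<delta>"
  proof (rule injI)
    fix s t assume "\<delta> s = \<delta> t"
    then have "heis_chart (heis_param (\<gamma> s)) = heis_chart (heis_param (\<gamma> t))" unfolding \<delta>_def by (rule arg_cong)
    then show "s = t" unfolding heis_chart_param using inj by (simp add: inj_eq)
  qed
  moreover have "vector_derivative \<delta> (at t) \<noteq> 0" for t
  proof (rule regular_curve_image[where f = \<gamma> and G = heis_chart])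
    show "\<delta> differentiable at t" using Ck\<delta>[of 1] by simp
    show "heis_chart differentiable at (\<delta> t)" using Ck_heis_chart[of 1] by (simp del: split_paired_All)
  qed (simp_all add: reg \<delta>_def heis_chart_param)
  moreover have low: "\<bar>t\<bar> - C \<le> norm (\<delta> t)" for t
    using proper[of t] norm_heis_param(1)[of "\<gamma> t"] unfolding \<delta>_def by linarith
  have "filterlim \<delta> at_infinity at_top" "filterlim \<delta> at_infinity at_bot"
  proof -
    have ge: "r \<le> norm (\<delta> t)" if "r + C \<le> \<bar>t\<bar>" for r t using low[of t] that by linarith
    show "filterlim \<delta> at_infinity at_top"
      unfolding filterlim_at_infinity[OF order_refl] eventually_at_top_linorder
      using ge by (metis abs_ge_self order_trans)
    show "filterlim \<delta> at_infinity at_bot"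
      unfolding filterlim_at_infinity[OF order_refl] eventually_at_bot_linorder
    proof (intro allI impI)
      fix r :: real
      show "\<exists>N. \<forall>n\<le>N. r \<le> norm (\<delta> n)" by (intro exI[of _ "- (r + C)"] allI impI ge) linarith
    qed
  qed
  moreover have "heis_param ` range \<gamma> = range \<delta>" unfolding \<delta>_def[abs_def] by (simp add: image_image)
  moreover have "heis_param ` range \<gamma> \<subseteq> heis" using heis_param_in_heis by blast
  moreover have "smooth_map_on UNIV \<delta>" by (rule smooth_map_onI[OF open_UNIV subset_UNIV Ck\<delta>])
  ultimately show ?thesis unfolding unbounded_knot_def by blast
qed

lemma unbounded_knot_chart:
  assumes "unbounded_knot K"
  shows "\<exists>\<Gamma> \<Gamma>'. heis_chart ` K = range \<Gamma> \<and> (\<forall>t. (\<Gamma> has_vector_derivative \<Gamma>' t) (at t)) \<and> continuous_on UNIV \<Gamma>' \<and>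
    (\<forall>t. \<Gamma>' t \<noteq> 0) \<and> inj \<Gamma> \<and> filterlim \<Gamma> at_infinity at_top \<and> filterlim \<Gamma> at_infinity at_bot"
proof -
  obtain \<gamma> :: "real \<Rightarrow> complex \<times> complex" where sm: "smooth_map_on UNIV \<gamma>" and inj: "inj \<gamma>"
    and reg: "\<And>t. vector_derivative \<gamma> (at t) \<noteq> 0"
    and lim: "filterlim \<gamma> at_infinity at_top" "filterlim \<gamma> at_infinity at_bot" and K: "K = range \<gamma>" "K \<subseteq> heis"
    using assms unfolding unbounded_knot_def by blast
  obtain U g where g: "UNIV \<subseteq> U" "\<And>k. Ck k U g" "\<And>x. g x = \<gamma> x"
    using sm unfolding smooth_map_on_def by blast
  have "g = \<gamma>" "U = UNIV" using g(1,3) by auto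
  then have Ck\<gamma>: "Ck k UNIV \<gamma>" for k using g(2) by simp
  define \<Gamma> where "\<Gamma> t = heis_chart (\<gamma> t)" for t
  have pg: "heis_param (\<Gamma> t) = \<gamma> t" for t unfolding \<Gamma>_def using K by (intro heis_param_chart) blast
  have Ck\<Gamma>: "Ck k UNIV \<Gamma>" for k
    unfolding \<Gamma>_def[abs_def]
    by (rule Ck_compose[where g = heis_chart, OF open_UNIV open_UNIV Ck\<gamma> Ck_heis_chart subset_UNIV])
  have "vector_derivative \<Gamma> (at t) \<noteq> 0" for t
  proof (rule regular_curve_image[where f = \<gamma> and G = heis_param])
    show "\<Gamma> differentiable at t" using Ck\<Gamma>[of 1] by simp
    show "heis_param differentiable at (\<Gamma> t)" using Ck_heis_param[of 1] by (simp del: split_paired_All)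
  qed (simp_all add: reg pg)
  moreover have "inj \<Gamma>"
  proof (rule injI)
    fix s t assume "\<Gamma> s = \<Gamma> t"
    then have "heis_param (\<Gamma> s) = heis_param (\<Gamma> t)" by (rule arg_cong)
    then show "s = t" unfolding pg using inj by (simp add: inj_eq)
  qed
  moreover have "filterlim \<Gamma> at_infinity F" if F: "filterlim \<gamma> at_infinity F" for F
    unfolding filterlim_at_infinity[OF order_refl]
  proof (intro allI impI)
    fix r :: real assume r: "r > 0"
    then have "r + r\<^sup>2 > 0" by (simp add: add_pos_pos)
    \<comment> \<open>A chart point of norm below r has norm below r + r^2 on
      \<open>heis\<close>.\<close>
    then have "eventually (\<lambda>t. r + r\<^sup>2 \<le> norm (\<gamma> t)) F" using F unfolding filterlim_at_infinity[OF order_refl] by blast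
    then show "eventually (\<lambda>t. r \<le> norm (\<Gamma> t)) F"
    proof (rule eventually_mono)
      fix t assume t: "r + r\<^sup>2 \<le> norm (\<gamma> t)"
      show "r \<le> norm (\<Gamma> t)"
      proof (rule ccontr)
        assume "\<not> ?thesis"
        then have "norm (\<Gamma> t) < r" by simp
        moreover from this have "(norm (\<Gamma> t))\<^sup>2 < r\<^sup>2" by (intro power_strict_mono) auto
        moreover have "norm (\<gamma> t) \<le> norm (\<Gamma> t) + (norm (\<Gamma> t))\<^sup>2" using norm_heis_param(2)[of "\<Gamma> t"] unfolding pg .
        ultimately show False using t by linarith
      qed
    qed
  qed
  moreover have "heis_chart ` K = range \<Gamma>" unfolding K(1) \<Gamma>_def[abs_def] by (simp add: image_image)
  moreover have "(\<Gamma> has_vector_derivative vector_derivative \<Gamma> (at t)) (at t)" for t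
    by (rule Ck_vector_derivative(2)[OF open_UNIV Ck\<Gamma> UNIV_I])
  moreover have "continuous_on UNIV (\<lambda>t. vector_derivative \<Gamma> (at t))"
    using Ck_vector_derivative(1)[OF open_UNIV Ck\<Gamma>, of 0] by simp
  ultimately show ?thesis using lim by (intro exI[of _ \<Gamma>] exI[of _ "\<lambda>t. vector_derivative \<Gamma> (at t)"] conjI allI)
qed

text \<open>The two homeomorphisms of the chart compose to one that extends over the pole. It
  carries the closed-up knot to the closed-up algebraic curve, and a continuous type is preserved by
  it.\<close>

theorem finite_count_type_algebraic:
  assumes \<tau>: "continuous_knot_type \<tau>" and K: "finite_count_knot K" "of_unbounded_type \<tau> K"
  shows "\<exists>K'. finite_count_knot K' \<and> of_unbounded_type \<tau> K' \<and> algebraic_in_heis K'"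
proof -
  have uK: "unbounded_knot K" and KT: "phi ` K \<union> {(0, 1)} \<in> \<tau>" using K by (auto simp: of_unbounded_type_def)
  obtain \<Gamma> \<Gamma>' where \<Gamma>K: "heis_chart ` K = range \<Gamma>" and \<Gamma>: "\<And>t. (\<Gamma> has_vector_derivative \<Gamma>' t) (at t)"
      "continuous_on UNIV \<Gamma>'" "\<And>t. \<Gamma>' t \<noteq> 0" "inj \<Gamma>"
    and lim: "filterlim \<Gamma> at_infinity at_top" "filterlim \<Gamma> at_infinity at_bot"
    using unbounded_knot_chart[OF uK] by blast
  obtain R h g where R: "R > 0" and hom: "homeomorphism (- ball (0::complex\<times>real) R) (- ball (0::complex\<times>real) 1) h g"
    and rays: "h ` (heis_chart ` K - ball 0 R) = {(0, t) | t. t \<ge> 1} \<union> {(0, t) | t. t \<le> -1}"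
    using K(1) unfolding finite_count_knot_def by blast
  have rays': "h ` (range \<Gamma> - ball 0 R) = vertical_rays" using rays unfolding \<Gamma>K vertical_rays_def .
  obtain H H' \<beta> \<beta>' T where H: "homeomorphism (UNIV :: (complex \<times> real) set) (UNIV :: (complex \<times> real) set) H H'" "H ` range \<Gamma> = range \<beta>"
    and \<beta>: "\<And>t. (\<beta> has_vector_derivative \<beta>' t) (at t)" "continuous_on UNIV \<beta>'" "\<And>t. \<beta>' t \<noteq> 0" "inj \<beta>"
    and line: "\<forall>t. \<bar>t\<bar> \<ge> T \<longrightarrow> \<beta> t = (0, t)"
    using finite_count_normal_form[OF \<Gamma> lim R hom rays'] by blast
  obtain \<Theta> G \<gamma> C where \<Theta>: "homeomorphism UNIV UNIV \<Theta> G" "range \<gamma> = \<Theta> ` range \<beta>"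
    and alg: "algebraic_in_heis (heis_param ` range \<gamma>)"
    and \<gamma>: "\<And>k. Ck k UNIV \<gamma>" "inj \<gamma>" "\<And>t. vector_derivative \<gamma> (at t) \<noteq> 0" "\<And>t. \<bar>t\<bar> - C \<le> norm (\<gamma> t)"
    and fc: "\<exists>R>0. \<exists>h g. homeomorphism (- ball (0::complex \<times> real) R) (- ball (0::complex \<times> real) 1) h g \<and>
      h ` (range \<gamma> - ball 0 R) = {(0, t) | t. t \<ge> 1} \<union> {(0, t) | t. t \<le> -1}"
    using straight_curve_algebraic[OF \<beta> line] by blast
  define K' where "K' = heis_param ` range \<gamma>"
  have uK': "unbounded_knot K'" unfolding K'_def by (rule unbounded_knot_heis_param[OF \<gamma>])
  have chart: "heis_chart ` K' = range \<gamma>" unfolding K'_def by (simp add: image_image heis_chart_param)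
  have fK': "finite_count_knot K'" using uK' fc unfolding finite_count_knot_def chart by (rule conjI)
  define X where "X x = \<Theta> (H x)" for x
  have X: "homeomorphism UNIV UNIV X (\<lambda>x. H' (G x))"
    unfolding X_def[abs_def] by (rule homeomorphism_UNIV_trans[OF H(1) \<Theta>(1)])
  have S: "homeomorphism S3 S3 (S3_extend X) (S3_extend (\<lambda>x. H' (G x)))" by (rule S3_extend_homeomorphism[OF X])
  have sub: "K \<subseteq> heis" "K' \<subseteq> heis" using uK uK' by (auto simp: unbounded_knot_def)
  have "X ` range \<Gamma> = range \<gamma>" unfolding \<Theta>(2) H(2)[symmetric] by (simp add: X_def image_image)
  then have "S3_extend X ` (phi ` K \<union> {S3_pole}) = phi ` K' \<union> {S3_pole}"
    unfolding phi_image_heis[OF sub(1)] phi_image_heis[OF sub(2)] chart \<Gamma>K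
    by (simp add: image_Un S3_extend_image S3_extend_pole)
  then have im: "S3_extend X ` (phi ` K \<union> {(0, 1)}) = phi ` K' \<union> {(0, 1)}" unfolding S3_pole_def .
  obtain J where J: "\<tau> = {L. continuous_knot L \<and> homeo_equivalent J L}"
    using \<tau> unfolding continuous_knot_type_def by blast
  have 1: "continuous_knot (phi ` K \<union> {(0, 1)})" "homeo_equivalent J (phi ` K \<union> {(0, 1)})" using KT unfolding J by blast+
  have "homeo_equivalent (phi ` K \<union> {(0, 1)}) (phi ` K' \<union> {(0, 1)})"
    unfolding homeo_equivalent_def using S im by blast
  then have "phi ` K' \<union> {(0, 1)} \<in> \<tau>"
    unfolding J using continuous_knot_image[OF S 1(1)] homeo_equivalent_trans[OF 1(2)] unfolding im by blast
  then show ?thesis using uK' fK' alg unfolding of_unbounded_type_def K'_def[symmetric] by blast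
qed

theorem theorem12:
  shows "(\<forall>\<tau>. (smooth_knot_type \<tau> \<or> continuous_knot_type \<tau>) \<and> (\<exists>K. of_bounded_type \<tau> K) \<longrightarrow>
            (\<exists>F. polynomial_embedding F \<and>
                 of_bounded_type \<tau> (complex_tangents F) \<and>
                 algebraic_in_heis (complex_tangents F))) \<and>
         (\<forall>\<tau>. continuous_knot_type \<tau> \<and> (\<exists>K. finite_count_knot K \<and> of_unbounded_type \<tau> K) \<longrightarrow>
            (\<exists>F. polynomial_embedding F \<and>
                 finite_count_knot (complex_tangents F) \<and>
                 of_unbounded_type \<tau> (complex_tangents F) \<and>
                 algebraic_in_heis (complex_tangents F)))"
proof (intro conjI allI impI)
  fix \<tau> assume "(smooth_knot_type \<tau> \<or> continuous_knot_type \<tau>) \<and> (\<exists>K. of_bounded_type \<tau> K)"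
  then obtain K' where K': "of_bounded_type \<tau> K'" "algebraic_in_heis K'" using bounded_type_algebraic by blast
  from algebraic_is_complex_tangents[OF K'(2)] obtain F where "polynomial_embedding F" "complex_tangents F = K'" by blast
  then show "\<exists>F. polynomial_embedding F \<and> of_bounded_type \<tau> (complex_tangents F) \<and> algebraic_in_heis (complex_tangents F)"
    using K' by blast
next
  fix \<tau> assume "continuous_knot_type \<tau> \<and> (\<exists>K. finite_count_knot K \<and> of_unbounded_type \<tau> K)"
  then obtain K' where K': "finite_count_knot K'" "of_unbounded_type \<tau> K'" "algebraic_in_heis K'"
    using finite_count_type_algebraic by blast
  from algebraic_is_complex_tangents[OF K'(3)] obtain F where "polynomial_embedding F" "complex_tangents F = K'" by blast
  then show "\<exists>F. polynomial_embedding F \<and> finite_count_knot (complex_tangents F) \<and>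
      of_unbounded_type \<tau> (complex_tangents F) \<and> algebraic_in_heis (complex_tangents F)"
    using K' by blast
qed

end
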